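(* Let $u\in C^\infty(\mathbb{R}^3)$ be a solution (in the sense defined in the context) of $$(-\Delta)^{\frac32}u=2e^{3u}\quad\text{in }\mathbb{R}^3,\qquad V:=\int_{\mathbb{R}^3}e^{3u}\,dx<\infty.$$ Set $$\alpha:=\frac1{\pi^2}\int_{\mathbb{R}^3}e^{3u}\,dx>0,\qquad v(x):=\frac1{\pi^2}\int_{\mathbb{R}^3}\log\left(\frac{|y|}{|x-y|}\right)e^{3u(y)}\,dy .$$ Then $u=v+p$, where $p$ is a polynomial of degree $0$ or $2$ which is bounded from above on $\mathbb{R}^3$. Moreover, $$\lim_{|x|\to\infty}\nabla^\ell v(x)=0\quad\text{for }\ell=1,2,$$ and $$v(x)=-\alpha\log|x|+o(\log|x|)\quad\text{as }|x|\to\infty.$$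
   Context: For $\varphi$ in the Schwartz space $\mathcal{S}(\mathbb{R}^3)$, $(-\Delta)^{\frac12}\varphi$ is the function with Fourier transform $|\xi|\hat\varphi(\xi)$. Let $$L_{1/2}(\mathbb{R}^3)=\Big\{v\in L^1_{\mathrm{loc}}(\mathbb{R}^3):\int_{\mathbb{R}^3}\frac{|v(x)|}{1+|x|^4}\,dx<\infty\Big\}.$$ Given a tempered distribution $f$ on $\mathbb{R}^3$, a function $u$ is a solution of $(-\Delta)^{\frac32}u=f$ if $u\in W^{2,1}_{\mathrm{loc}}(\mathbb{R}^3)$, $\Delta u\in L_{1/2}(\mathbb{R}^3)$ and $$\int_{\mathbb{R}^3}(-\Delta u)\,(-\Delta)^{\frac12}\varphi\,dx=\langle f,\varphi\rangle\quad\text{for every }\varphi\in\mathcal{S}(\mathbb{R}^3).$$ A polynomial of degree $0$ means a constant; $\nabla^\ell$ denotes the tensor of all $\ell$-th order partial derivatives. *)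

theory Defs
  imports "HOL-Analysis.Analysis" "HOL-Library.Landau_Symbols"
begin

section \<open>Partial derivatives and function spaces\<close>

definition partial_deriv :: "3 \<Rightarrow> (real^3 \<Rightarrow> 'b::real_normed_vector) \<Rightarrow> real^3 \<Rightarrow> 'b" where
  "partial_deriv i f x = vector_derivative (\<lambda>t. f (x + t *\<^sub>R axis i 1)) (at 0)"

text \<open>The list \<open>[i\<^sub>1, \<dots>, i\<^sub>l]\<close> stands for the derivative
  \<open>\<partial>\<^bsub>i\<^sub>1\<^esub> \<dots> \<partial>\<^bsub>i\<^sub>l\<^esub>\<close>; the components of the tensor \<open>\<nabla>\<^sup>l f\<close> are the
  \<open>iter_partial is f\<close> with \<open>length is = l\<close>.\<close>

definition iter_partial :: "3 list \<Rightarrow> (real^3 \<Rightarrow> 'b::real_normed_vector) \<Rightarrow> real^3 \<Rightarrow> 'b" where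
  "iter_partial is f = foldr partial_deriv is f"

definition smooth :: "(real^3 \<Rightarrow> 'b::real_normed_vector) \<Rightarrow> bool" where
  "smooth f \<longleftrightarrow> (\<forall>is x. iter_partial is f differentiable (at x))"

definition test_function :: "(real^3 \<Rightarrow> real) \<Rightarrow> bool" where
  "test_function \<phi> \<longleftrightarrow> smooth \<phi> \<and> compact (closure {x. \<phi> x \<noteq> 0})"

definition schwartz :: "(real^3 \<Rightarrow> complex) \<Rightarrow> bool" where
  "schwartz \<phi> \<longleftrightarrow> smooth \<phi> \<and>
     (\<forall>N is. bounded (range (\<lambda>x. (1 + norm x) ^ N *\<^sub>R iter_partial is \<phi> x)))"

definition schwartz_seminorm :: "nat \<Rightarrow> (real^3 \<Rightarrow> complex) \<Rightarrow> real" where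
  "schwartz_seminorm N \<phi> =
     (SUP (is, x) \<in> {is. length is \<le> N} \<times> UNIV. (1 + norm x) ^ N * norm (iter_partial is \<phi> x))"

text \<open>Distributions are functionals on all functions, of which only the values on Schwartz
  functions matter.\<close>

definition tempered_distribution :: "((real^3 \<Rightarrow> complex) \<Rightarrow> complex) \<Rightarrow> bool" where
  "tempered_distribution T \<longleftrightarrow>
     (\<forall>\<phi> \<psi>. schwartz \<phi> \<longrightarrow> schwartz \<psi> \<longrightarrow> T (\<lambda>x. \<phi> x + \<psi> x) = T \<phi> + T \<psi>) \<and>
     (\<forall>c \<phi>. schwartz \<phi> \<longrightarrow> T (\<lambda>x. c * \<phi> x) = c * T \<phi>) \<and>
     (\<exists>C N. \<forall>\<phi>. schwartz \<phi> \<longrightarrow> norm (T \<phi>) \<le> C * schwartz_seminorm N \<phi>)"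

definition distribution_of :: "(real^3 \<Rightarrow> real) \<Rightarrow> (real^3 \<Rightarrow> complex) \<Rightarrow> complex" where
  "distribution_of g \<phi> = (LINT x|lebesgue. complex_of_real (g x) * \<phi> x)"

definition locally_integrable :: "(real^3 \<Rightarrow> real) \<Rightarrow> bool" where
  "locally_integrable f \<longleftrightarrow> (\<forall>K. compact K \<longrightarrow> f absolutely_integrable_on K)"

definition L_half :: "(real^3 \<Rightarrow> real) set" where
  "L_half = {v. locally_integrable v \<and> integrable lebesgue (\<lambda>x. \<bar>v x\<bar> / (1 + norm x ^ 4))}"

definition weak_partial :: "3 \<Rightarrow> (real^3 \<Rightarrow> real) \<Rightarrow> (real^3 \<Rightarrow> real) \<Rightarrow> bool" where
  "weak_partial i f g \<longleftrightarrow> locally_integrable f \<and> locally_integrable g \<and>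
     (\<forall>\<phi>. test_function \<phi> \<longrightarrow>
        (LINT x|lebesgue. f x * partial_deriv i \<phi> x) = - (LINT x|lebesgue. g x * \<phi> x))"

definition W21_loc :: "(real^3 \<Rightarrow> real) set" where
  "W21_loc = {u. locally_integrable u \<and>
     (\<forall>i. \<exists>g. weak_partial i u g \<and> (\<forall>j. \<exists>h. weak_partial j g h))}"

definition weak_laplacian :: "(real^3 \<Rightarrow> real) \<Rightarrow> (real^3 \<Rightarrow> real) \<Rightarrow> bool" where
  "weak_laplacian u w \<longleftrightarrow>
     (\<exists>g h. (\<forall>i. weak_partial i u (g i) \<and> weak_partial i (g i) (h i)) \<and> w = (\<lambda>x. \<Sum>i\<in>UNIV. h i x))"

lemma weak_laplacian_exists:
  assumes "u \<in> W21_loc"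
  shows "\<exists>w. weak_laplacian u w"
proof -
  have "\<forall>i. \<exists>g h. weak_partial i u g \<and> weak_partial i g h"
    using assms unfolding W21_loc_def by blast
  then obtain g h where "\<forall>i. weak_partial i u (g i) \<and> weak_partial i (g i) (h i)"
    by metis
  then show ?thesis
    unfolding weak_laplacian_def by blast
qed

section \<open>The equation \<open>(-\<Delta>)\<^bsup>3/2\<^esup> u = f\<close>\<close>

text \<open>Any normalisation of the Fourier transform with kernel \<open>exp (- \<i> (\<xi> \<bullet> x))\<close> gives the same
  operator \<open>(-\<Delta>)\<^bsup>1/2\<^esup>\<close>.\<close>

definition fourier :: "(real^3 \<Rightarrow> complex) \<Rightarrow> real^3 \<Rightarrow> complex" where
  "fourier \<phi> \<xi> = (LINT x|lborel. cis (- (\<xi> \<bullet> x)) * \<phi> x)"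

text \<open>For a Schwartz function \<open>\<phi>\<close>, the function with Fourier transform \<open>\<bar>\<xi>\<bar> \<phi>^(\<xi>)\<close> is smooth and
  decays like \<open>\<bar>x\<bar>\<^sup>-\<^sup>4\<close>. Continuity singles it out within its almost everywhere class.\<close>

definition half_laplacian :: "(real^3 \<Rightarrow> complex) \<Rightarrow> real^3 \<Rightarrow> complex" where
  "half_laplacian \<phi> = (THE \<psi>. continuous_on UNIV \<psi> \<and> integrable lborel \<psi> \<and>
     (\<forall>\<xi>. fourier \<psi> \<xi> = complex_of_real (norm \<xi>) * fourier \<phi> \<xi>))"

text \<open>Here \<open>w\<close> ranges over the representatives of \<open>\<Delta>u\<close>. One exists by
  \<open>weak_laplacian_exists\<close>, and any two agree almost everywhere.\<close>

definition solution :: "((real^3 \<Rightarrow> complex) \<Rightarrow> complex) \<Rightarrow> (real^3 \<Rightarrow> real) \<Rightarrow> bool" where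
  "solution f u \<longleftrightarrow> tempered_distribution f \<and> u \<in> W21_loc \<and>
     (\<forall>w. weak_laplacian u w \<longrightarrow> w \<in> L_half \<and>
        (\<forall>\<phi>. schwartz \<phi> \<longrightarrow>
           (LINT x|lebesgue. complex_of_real (- w x) * half_laplacian \<phi> x) = f \<phi>))"

section \<open>Polynomials on \<open>\<real>\<^sup>3\<close>\<close>

definition poly_degree_le :: "nat \<Rightarrow> (real^3 \<Rightarrow> real) \<Rightarrow> bool" where
  "poly_degree_le d p \<longleftrightarrow> (\<exists>c :: (3 \<Rightarrow> nat) \<Rightarrow> real. \<forall>x.
     p x = (\<Sum>a\<in>{a. sum a UNIV \<le> d}. c a * (\<Prod>i\<in>UNIV. (x $ i) ^ a i)))"

text \<open>With this convention the zero polynomial has degree 0.\<close>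

definition poly_of_degree :: "nat \<Rightarrow> (real^3 \<Rightarrow> real) \<Rightarrow> bool" where
  "poly_of_degree d p \<longleftrightarrow> poly_degree_le d p \<and> (\<forall>m<d. \<not> poly_degree_le m p)"

lemma finite_multi_indices: "finite {a :: 3 \<Rightarrow> nat. sum a UNIV \<le> d}"
proof (rule finite_subset)
  have "a i \<le> d" if "sum a UNIV \<le> d" for a :: "3 \<Rightarrow> nat" and i
    using member_le_sum[of i UNIV a] that by simp
  then show "{a :: 3 \<Rightarrow> nat. sum a UNIV \<le> d} \<subseteq> PiE UNIV (\<lambda>_. {..d})"
    by (simp add: subset_iff PiE_UNIV_domain)
  show "finite (PiE (UNIV :: 3 set) (\<lambda>_. {..d}))"
    by (rule finite_PiE) simp_all
qed

end

theory Submission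
  imports Defs "HOL-Probability.Probability" "HOL-Real_Asymp.Real_Asymp"
begin

text \<open>Testing the equation with the time derivative of the heat kernel, whose half Laplacian is the
  half derivative in time of that kernel, and then integrating fractionally in time, inverts
  \<open>(-\<Delta>)\<^bsup>1/2\<^esup>\<close> up to a constant: \<open>-\<Delta>u = c + \<pi>\<^sup>-\<^sup>2 \<integral> e\<^bsup>3u(y)\<^esup> \<bar>x - y\<bar>\<^sup>-\<^sup>2 dy\<close>. The integral is
  \<open>-\<Delta>v\<close>, so \<open>p = u - v\<close> has constant Laplacian. Since \<open>v\<close> is bounded below by a logarithm, \<open>p\<close> is at
  most \<open>e\<^bsup>3u\<^esup>\<close> plus a linear function, and the mean value property makes \<open>p\<close> a polynomial of degree
  at most 2. If \<open>p\<close> were unbounded above it would grow linearly along a ray, uniformly on unit balls,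
  contradicting \<open>\<integral> e\<^bsup>3u\<^esup> < \<infinity>\<close>; this also excludes degree 1.

  For the behaviour of \<open>v\<close> at infinity, the logarithmic kernel gives
  \<open>v \<le> -(\<alpha> - \<epsilon>) ln \<bar>x\<bar> + C\<close> apart from the contribution of the points near \<open>x\<close>. The latter is
  controlled by \<open>e\<^bsup>3u\<^esup> \<le> C e\<^bsup>3v\<^esup>\<close> and a maximum argument. Hence \<open>e\<^bsup>3u\<^esup> \<rightarrow> 0\<close>, and the
  derivatives of \<open>v\<close>, being convolutions of \<open>e\<^bsup>3u\<^esup>\<close> with kernels of size \<open>\<bar>z\<bar>\<^sup>-\<^sup>1\<close> and
  \<open>\<bar>z\<bar>\<^sup>-\<^sup>2\<close>, tend to 0.\<close>

section \<open>Integration tools\<close>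

text \<open>Gaussians make it computable, because \<open>1 / |\<xi>|\<close> is
  \<open>1 / sqrt pi\<close> times the integral of \<open>t^(-1/2) * exp (- t * |\<xi>|^2)\<close>
  over \<open>t > 0\<close>. The time derivative of the heat kernel is tested, and not the kernel,
  because \<open>\<Delta>u\<close> is integrable only against the weight
  \<open>1 / (1 + |y|^4)\<close>: the extra factor \<open>1 / s\<close> in
  \<open>heat_half_bound\<close> is what makes the fractional integral over time converge. The price
  is a quantity known only to be constant in time, \<open>defect\<close>; time 0 gives the wanted
  identity, and infinite time shows that it does not depend on the point. The constants fit since
  the Riesz kernel is \<open>1 / (2 * pi^2 * |z|^2)\<close>, the equation contributes the factor 2,
  and \<open>ln |z|\<close> has Laplacian \<open>1 / |z|^2\<close> in three dimensions. The maximum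
  argument closes because the logarithmic singularity costs at most \<open>3 * v\<close>, the 3
  being that of \<open>e^(3u)\<close>, while \<open>v\<close> enters with the factor
  \<open>pi^2 > 3\<close>.\<close>

lemma tendsto_integral_at_within:
  fixes f :: "'t::first_countable_topology \<Rightarrow> 'a \<Rightarrow> 'b::{banach, second_countable_topology}"
  assumes meas: "\<And>t. f t \<in> borel_measurable M" "g \<in> borel_measurable M"
    and w: "integrable M w"
    and bd: "\<forall>\<^sub>F t in at a within S. AE x in M. norm (f t x) \<le> w x"
    and lim: "AE x in M. ((\<lambda>t. f t x) \<longlongrightarrow> g x) (at a within S)"
  shows "((\<lambda>t. \<integral>x. f t x \<partial>M) \<longlongrightarrow> (\<integral>x. g x \<partial>M)) (at a within S)"
  unfolding tendsto_at_iff_sequentially comp_def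
proof (intro allI impI)
  fix X assume X: "\<forall>i. X i \<in> S - {a}" "X \<longlonglongrightarrow> a"
  have fl: "filterlim X (at a within S) sequentially"
    using X by (auto simp: filterlim_at)
  from bd fl have "\<forall>\<^sub>F n in sequentially. AE x in M. norm (f (X n) x) \<le> w x"
    using filterlim_iff[of X "at a within S" sequentially] by blast
  then obtain N where N: "\<And>n. n \<ge> N \<Longrightarrow> AE x in M. norm (f (X n) x) \<le> w x"
    by (auto simp: eventually_sequentially)
  show "(\<lambda>n. \<integral>x. f (X n) x \<partial>M) \<longlonglongrightarrow> (\<integral>x. g x \<partial>M)"
  proof (rule LIMSEQ_offset, rule integral_dominated_convergence)
    show "AE x in M. norm (f (X (n + N)) x) \<le> w x" for n
      by (rule N) auto
    show "AE x in M. (\<lambda>n. f (X (n + N)) x) \<longlonglongrightarrow> g x"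
      using lim
    proof eventually_elim
      case (elim x)
      then show ?case
        by (intro LIMSEQ_ignore_initial_segment filterlim_compose[OF _ fl])
    qed
  qed (use meas w in auto)
qed

text \<open>Dominated convergence for the difference quotients, which the mean value theorem bounds
  by the majorant \<open>g\<close> of \<open>f'\<close>. Measurability of \<open>f' c\<close> is
  obtained along the way, as a limit of quotients.\<close>

lemma has_real_derivative_integral:
  fixes f f' :: "real \<Rightarrow> 'a \<Rightarrow> real"
  assumes e: "e > 0"
    and int: "\<And>t. \<bar>t - c\<bar> < e \<Longrightarrow> integrable M (f t)"
    and der: "\<And>t x. \<bar>t - c\<bar> < e \<Longrightarrow> x \<in> space M \<Longrightarrow>
      ((\<lambda>s. f s x) has_real_derivative f' t x) (at t)"
    and bd: "\<And>t x. \<bar>t - c\<bar> < e \<Longrightarrow> x \<in> space M \<Longrightarrow> \<bar>f' t x\<bar> \<le> g x"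
    and g: "integrable M g"
  shows "integrable M (f' c)"
    and "((\<lambda>t. \<integral>x. f t x \<partial>M) has_real_derivative (\<integral>x. f' c x \<partial>M)) (at c)"
proof -
  \<comment> \<open>Cutting the quotient off at \<open>|h| = e\<close> makes \<open>q h\<close>
    measurable and dominated by \<open>g\<close> for every \<open>h\<close>, also for
    \<open>h = 0\<close>, where division by 0 gives 0.\<close>
  define q where "q = (\<lambda>h x. if \<bar>h\<bar> < e then (f (c + h) x - f c x) / h else 0)"
  have qm: "q h \<in> borel_measurable M" for h
    using int[of "c + h"] int[of c] e unfolding q_def by (cases "\<bar>h\<bar> < e") auto
  have ev: "\<forall>\<^sub>F h in at (0::real). \<bar>h\<bar> < e"
    using e by (auto simp: eventually_at intro!: exI[of _ e])
  have qlim: "((\<lambda>h. q h x) \<longlongrightarrow> f' c x) (at 0)" if "x \<in> space M" for x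
  proof -
    have "((\<lambda>h. (f (c + h) x - f c x) / h) \<longlongrightarrow> f' c x) (at 0)"
      using der[of c x] e that by (simp add: DERIV_def)
    then show ?thesis
      by (rule Lim_transform_eventually) (use ev in eventually_elim, simp add: q_def)
  qed
  have qbd: "\<bar>q h x\<bar> \<le> g x" if x: "x \<in> space M" for h x
  proof -
    have g0: "0 \<le> g x"
      using bd[of c x] e x by (auto intro: order_trans[OF abs_ge_zero])
    consider "h = 0 \<or> \<not> \<bar>h\<bar> < e" | "h > 0" "h < e" | "h < 0" "-h < e"
      by linarith
    then show ?thesis
    proof cases
      case 1
      then show ?thesis using g0 by (auto simp: q_def)
    next
      case 2
      obtain z where "z > c" "z < c + h" "f (c + h) x - f c x = (c + h - c) * f' z x"
        using MVT2[of c "c + h" "\<lambda>s. f s x" "\<lambda>s. f' s x"] der 2 x by force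
      then show ?thesis
        using bd[of z x] 2 x by (auto simp: q_def)
    next
      case 3
      obtain z where "z > c + h" "z < c" "f c x - f (c + h) x = (c - (c + h)) * f' z x"
        using MVT2[of "c + h" c "\<lambda>s. f s x" "\<lambda>s. f' s x"] der 3 x by force
      moreover from this have "(f (c + h) x - f c x) / h = f' z x"
        using 3 by (simp add: field_simps)
      ultimately show ?thesis
        using bd[of z x] 3 x by (auto simp: q_def)
    qed
  qed
  have m: "f' c \<in> borel_measurable M"
  proof (rule borel_measurable_LIMSEQ_real[where u = "\<lambda>n. q (1 / real (Suc n))"])
    have "filterlim (\<lambda>n. 1 / real (Suc n)) (at 0) sequentially"
      using LIMSEQ_Suc[OF lim_1_over_n] by (auto simp: filterlim_at)
    then show "(\<lambda>n. q (1 / real (Suc n)) x) \<longlonglongrightarrow> f' c x" if "x \<in> space M" for x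
      by (rule filterlim_compose[OF qlim[OF that]])
  qed (rule qm)
  show "integrable M (f' c)"
    by (rule Bochner_Integration.integrable_bound[OF g m])
      (use bd[of c] e in \<open>auto intro!: AE_I2 intro: order_trans[OF _ abs_ge_self]\<close>)
  have "((\<lambda>h. \<integral>x. q h x \<partial>M) \<longlongrightarrow> (\<integral>x. f' c x \<partial>M)) (at 0)"
    by (rule tendsto_integral_at_within[OF qm m g]) (use qbd qlim in auto)
  then have "((\<lambda>h. ((\<integral>x. f (c + h) x \<partial>M) - (\<integral>x. f c x \<partial>M)) / h) \<longlongrightarrow> (\<integral>x. f' c x \<partial>M)) (at 0)"
  proof (rule Lim_transform_eventually)
    show "\<forall>\<^sub>F h in at 0. (\<integral>x. q h x \<partial>M) = ((\<integral>x. f (c + h) x \<partial>M) - (\<integral>x. f c x \<partial>M)) / h"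
      using ev by eventually_elim (use int[of c] e in \<open>simp add: q_def int\<close>)
  qed
  then show "((\<lambda>t. \<integral>x. f t x \<partial>M) has_real_derivative (\<integral>x. f' c x \<partial>M)) (at c)"
    by (simp add: DERIV_def)
qed

lemma
  fixes f :: "'a::euclidean_space \<Rightarrow> 'b::{banach, second_countable_topology}"
  assumes f[measurable]: "f \<in> borel_measurable borel" and c: "c \<noteq> 0"
  shows lborel_integral_affine: "(\<integral>x. f x \<partial>lborel) = \<bar>c\<bar> ^ DIM('a) *\<^sub>R (\<integral>x. f (t + c *\<^sub>R x) \<partial>lborel)"
    and lborel_integrable_affine: "integrable lborel (\<lambda>x. f (t + c *\<^sub>R x)) \<longleftrightarrow> integrable lborel f"
proof -
  have "(\<integral>x. f x \<partial>lborel) = (\<integral>x. f x \<partial>density (distr lborel borel (\<lambda>x. t + c *\<^sub>R x)) (\<lambda>_. \<bar>c\<bar>^DIM('a)))"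
    using lborel_affine[OF c, of t] by simp
  also have "\<dots> = \<bar>c\<bar> ^ DIM('a) *\<^sub>R (\<integral>x. f (t + c *\<^sub>R x) \<partial>lborel)"
    by (subst integral_density) (auto simp: integral_distr)
  finally show "(\<integral>x. f x \<partial>lborel) = \<bar>c\<bar> ^ DIM('a) *\<^sub>R (\<integral>x. f (t + c *\<^sub>R x) \<partial>lborel)" .
  have "integrable lborel f \<longleftrightarrow>
    integrable (density (distr lborel borel (\<lambda>x. t + c *\<^sub>R x)) (\<lambda>_. \<bar>c\<bar>^DIM('a))) f"
    using lborel_affine[OF c, of t] by simp
  also have "\<dots> \<longleftrightarrow> integrable lborel (\<lambda>x. f (t + c *\<^sub>R x))"
    using c integrable_scaleR_right[of "1 / \<bar>c\<bar> ^ DIM('a)" lborel "\<lambda>x. \<bar>c\<bar> ^ DIM('a) *\<^sub>R f (t + c *\<^sub>R x)"]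
    by (subst integrable_density) (auto simp: integrable_distr_eq)
  finally show "integrable lborel (\<lambda>x. f (t + c *\<^sub>R x)) \<longleftrightarrow> integrable lborel f" by simp
qed

lemma
  fixes f :: "'a::euclidean_space \<Rightarrow> 'b::{banach, second_countable_topology}"
  assumes f: "f \<in> borel_measurable borel"
  shows lborel_integral_translate: "(\<integral>x. f (x + t) \<partial>lborel) = (\<integral>x. f x \<partial>lborel)"
    and lborel_integral_reflect: "(\<integral>x. f (t - x) \<partial>lborel) = (\<integral>x. f x \<partial>lborel)"
    and lborel_integrable_translate: "integrable lborel (\<lambda>x. f (x + t)) \<longleftrightarrow> integrable lborel f"
    and lborel_integrable_reflect: "integrable lborel (\<lambda>x. f (t - x)) \<longleftrightarrow> integrable lborel f"
  using lborel_integral_affine[OF f, of 1 t] lborel_integral_affine[OF f, of "-1" t]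
    lborel_integrable_affine[OF f, of 1 t] lborel_integrable_affine[OF f, of "-1" t]
  by (simp_all add: add.commute)

text \<open>By translation invariance the integral of \<open>g (x + t *\<^sub>R e)\<close> does not
  depend on \<open>t\<close>, and its derivative at 0 is the integral of \<open>g'\<close>. This
  gives integration by parts in any direction \<open>e\<close> without iterated integrals.\<close>

lemma integral_partial_eq_0:
  fixes g g' :: "'a::euclidean_space \<Rightarrow> real"
  assumes meas: "g \<in> borel_measurable borel"
    and bd: "\<And>x. \<bar>g x\<bar> \<le> C" "\<And>x. \<bar>g' x\<bar> \<le> C"
    and supp: "\<And>x. norm x > R \<Longrightarrow> g x = 0" "\<And>x. norm x > R \<Longrightarrow> g' x = 0"
    and der: "\<And>x. ((\<lambda>t. g (x + t *\<^sub>R e)) has_real_derivative g' x) (at 0)"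
  shows "(\<integral>x. g' x \<partial>lborel) = 0"
proof -
  have derx: "((\<lambda>s. g (x + s *\<^sub>R e)) has_real_derivative g' (x + t *\<^sub>R e)) (at t)" for t x
    using DERIV_shift[of "\<lambda>s. g (x + s *\<^sub>R e)" _ 0 t] der[of "x + t *\<^sub>R e"]
    by (simp add: algebra_simps)
  have ib: "integrable lborel (\<lambda>x::'a. C * indicator (cball 0 (R + norm e)) x)"
    using emeasure_lborel_cball_finite[of 0 "R + norm e"]
    by (intro integrable_mult_right integrable_real_indicator) auto
  have C0: "0 \<le> C" using bd(1)[of 0] by linarith
  \<comment> \<open>For \<open>|t| < 1\<close> every translate vanishes outside the ball of radius
    \<open>R + norm e\<close>, so one majorant serves all \<open>t\<close>.\<close>
  have far: "norm (x + t *\<^sub>R e) > R" if "\<bar>t\<bar> < 1" "norm x > R + norm e" for t x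
  proof -
    have "norm x \<le> norm (x + t *\<^sub>R e) + norm (t *\<^sub>R e)"
      using norm_triangle_ineq[of "x + t *\<^sub>R e" "- (t *\<^sub>R e)"] by simp
    moreover have "norm (t *\<^sub>R e) \<le> norm e"
      using that by (simp add: mult_left_le_one_le)
    ultimately show ?thesis using that by linarith
  qed
  have bd': "\<bar>h (x + t *\<^sub>R e)\<bar> \<le> C * indicator (cball 0 (R + norm e)) x"
    if "\<bar>t\<bar> < 1" "\<And>x. \<bar>h x\<bar> \<le> C" "\<And>x. norm x > R \<Longrightarrow> h x = 0" for h :: "'a \<Rightarrow> real" and x t
  proof (cases "x \<in> cball 0 (R + norm e)")
    case True
    then show ?thesis using that by simp
  next
    case False
    then have "norm (x + t *\<^sub>R e) > R" by (intro far that) auto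
    then show ?thesis using that C0 by simp
  qed
  have int: "integrable lborel (\<lambda>x. g (x + t *\<^sub>R e))" if "\<bar>t\<bar> < 1" for t
  proof (rule Bochner_Integration.integrable_bound[OF ib])
    show "(\<lambda>x. g (x + t *\<^sub>R e)) \<in> borel_measurable lborel" using meas by measurable
    show "AE x in lborel. norm (g (x + t *\<^sub>R e)) \<le> norm (C * indicator (cball 0 (R + norm e)) x)"
      using bd'[of t g] that bd(1) supp(1) by (auto intro!: AE_I2 intro: order_trans[OF _ abs_ge_self])
  qed
  have "((\<lambda>t. \<integral>x. g (x + t *\<^sub>R e) \<partial>lborel) has_real_derivative (\<integral>x. g' (x + 0 *\<^sub>R e) \<partial>lborel)) (at 0)"
    by (rule has_real_derivative_integral(2)[where e = 1 and c = 0 and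
        f = "\<lambda>t x. g (x + t *\<^sub>R e)" and f' = "\<lambda>t x. g' (x + t *\<^sub>R e)", OF _ _ _ _ ib])
      (auto intro!: int derx bd'[OF _ bd(2) supp(2)])
  moreover have "(\<lambda>t. \<integral>x. g (x + t *\<^sub>R e) \<partial>lborel) = (\<lambda>t. \<integral>x. g x \<partial>lborel)"
    using lborel_integral_translate[OF meas] by simp
  ultimately show ?thesis
    using DERIV_unique[OF _ DERIV_const] by fastforce
qed

lemma integrable_bounded_nn:
  fixes f :: "'a \<Rightarrow> real"
  assumes [measurable]: "f \<in> borel_measurable M" and nn: "\<And>x. 0 \<le> f x"
    and le: "(\<integral>\<^sup>+x. ennreal (f x) \<partial>M) \<le> ennreal c" and c: "0 \<le> c"
  shows "integrable M f" "(\<integral>x. f x \<partial>M) \<le> c"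
proof -
  show i: "integrable M f"
    using le nn by (auto simp: integrable_iff_bounded intro: le_less_trans)
  show "(\<integral>x. f x \<partial>M) \<le> c"
    using le c nn_integral_eq_integral[OF i] nn by (simp add: ennreal_le_iff)
qed

text \<open>Dyadic shells avoid polar coordinates.\<close>

lemma inverse_square_local_integral:
  "\<exists>C>0. \<forall>(x::real^3) R. R > 0 \<longrightarrow>
     integrable lborel (\<lambda>y. indicator (cball x R) y / (norm (x - y))\<^sup>2) \<and>
     (\<integral>y. indicator (cball x R) y / (norm (x - y))\<^sup>2 \<partial>lborel) \<le> C * R"
proof -
  define b where "b = unit_ball_vol (real DIM(real^3))"
  have b0: "b > 0" unfolding b_def by (rule unit_ball_vol_pos) simp
  have main: "integrable lborel (\<lambda>y. indicator (cball x R) y / (norm (x - y))\<^sup>2) \<and>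
     (\<integral>y. indicator (cball x R) y / (norm (x - y))\<^sup>2 \<partial>lborel) \<le> 8 * b * R" if R: "R > 0"
    for x :: "real^3" and R :: real
  proof -
    \<comment> \<open>The kernel is at most \<open>4 ^ Suc n / R^2\<close> on the shell between the
      radii \<open>R / 2 ^ Suc n\<close> and \<open>R / 2 ^ n\<close>. Replacing the shell by its
      ball is harmless: volumes fall by 8 while kernels grow by 4, so the series is geometric. At
      \<open>y = x\<close> the integrand is 0, being a division by 0.\<close>
    define g where "g = (\<lambda>n y. ennreal (4 ^ Suc n / R\<^sup>2) * indicator (cball x (R / 2 ^ n)) y)"
    have pw: "ennreal (indicator (cball x R) y / (norm (x - y))\<^sup>2) \<le> (\<Sum>n. g n y)" for y
    proof (cases "y \<in> cball x R \<and> y \<noteq> x")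
      case True
      define r where "r = norm (x - y)"
      have r: "r > 0" "r \<le> R" using True by (auto simp: r_def dist_norm)
      obtain n0 where "(1/2) ^ n0 < r / R"
        using real_arch_pow_inv[of "r / R" "1/2"] r R by auto
      then have ex: "R / 2 ^ n0 < r" using R by (simp add: field_simps)
      define m where "m = (LEAST n. R / 2 ^ n < r)"
      have m: "R / 2 ^ m < r" unfolding m_def by (rule LeastI[of _ n0]) (rule ex)
      have "m \<noteq> 0" using m r by (intro notI) simp
      then obtain n where n: "m = Suc n" using not0_implies_Suc by blast
      have n2: "r \<le> R / 2 ^ n"
        using not_less_Least[of n "\<lambda>n. R / 2 ^ n < r"] n by (simp add: m_def)
      have "R < r * 2 ^ Suc n" using m n R by (simp add: field_simps)
      then have "R\<^sup>2 \<le> (r * 2 ^ Suc n)\<^sup>2" using R by (intro power_mono) auto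
      also have "\<dots> = r\<^sup>2 * 4 ^ Suc n"
        by (simp add: power_mult_distrib power2_eq_square flip: power_mult_distrib)
      finally have "1 / r\<^sup>2 \<le> 4 ^ Suc n / R\<^sup>2"
        using r R by (simp add: field_simps)
      then have "ennreal (indicator (cball x R) y / (norm (x - y))\<^sup>2) \<le> g n y"
        using True n2 by (auto simp: g_def r_def dist_norm intro!: ennreal_leI)
      also have "\<dots> \<le> (\<Sum>n. g n y)"
        using sum_le_suminf[of "\<lambda>n. g n y" "{n}"] by simp
      finally show ?thesis .
    qed auto
    have [measurable]: "g n \<in> borel_measurable borel" for n
      unfolding g_def by (intro borel_measurable_times_ennreal borel_measurable_indicator) auto
    have "(\<integral>\<^sup>+y. ennreal (indicator (cball x R) y / (norm (x - y))\<^sup>2) \<partial>lborel)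
      \<le> (\<integral>\<^sup>+y. (\<Sum>n. g n y) \<partial>lborel)"
      by (intro nn_integral_mono pw)
    also have "\<dots> = (\<Sum>n. \<integral>\<^sup>+y. g n y \<partial>lborel)"
        by (intro nn_integral_suminf) simp
    also have "\<dots> = (\<Sum>n. ennreal (4 * b * R * (1/2) ^ n))"
    proof (intro arg_cong[where f = suminf] ext)
      fix n
      have "(\<integral>\<^sup>+y. g n y \<partial>lborel) = ennreal (4 ^ Suc n / R\<^sup>2) * ennreal (b * (R / 2 ^ n) ^ 3)"
        unfolding g_def b_def using R
        by (subst nn_integral_cmult_indicator) (auto simp: emeasure_cball)
      also have "\<dots> = ennreal (4 ^ Suc n / R\<^sup>2 * (b * (R / 2 ^ n) ^ 3))"
        using R b0 by (subst ennreal_mult) auto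
      also have "4 ^ Suc n / R\<^sup>2 * (b * (R / 2 ^ n) ^ 3) = 4 * b * R * (1/2) ^ n"
      proof -
        have "(2::real) ^ n * 2 ^ n = 4 ^ n" by (simp flip: power_mult_distrib)
        then have "(4::real) ^ n = 2 ^ n * 2 ^ n" by simp
        then show ?thesis using R by (simp add: power_divide field_simps eval_nat_numeral)
      qed
      finally show "(\<integral>\<^sup>+y. g n y \<partial>lborel) = ennreal (4 * b * R * (1/2) ^ n)" .
    qed
    also have "\<dots> = ennreal (8 * b * R)"
    proof (rule suminf_ennreal_eq)
      show "(\<lambda>n. 4 * b * R * (1 / 2) ^ n) sums (8 * b * R)"
        using sums_mult[OF geometric_sums[of "1/2::real"], of "4 * b * R"] by (simp add: mult_ac)
    qed (use b0 R in auto)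
    finally have *: "(\<integral>\<^sup>+y. ennreal (indicator (cball x R) y / (norm (x - y))\<^sup>2) \<partial>lborel) \<le> ennreal (8 * b * R)" .
    have m: "(\<lambda>y. indicator (cball x R) y / (norm (x - y))\<^sup>2) \<in> borel_measurable lborel"
      by (intro borel_measurable_divide borel_measurable_indicator) auto
    show ?thesis
      using integrable_bounded_nn[OF m _ *] b0 R by simp
  qed
  show ?thesis
    by (rule exI[of _ "8 * b"]) (use main b0 in auto)
qed

section \<open>One-dimensional integrals with the weight \<open>t\<^bsup>-1/2\<^esup>\<close>\<close>

text \<open>Extension by 0 turns integrals over a half line, and convolutions over a bounded
  interval, into integrals over the whole line, to which translation and Fubini apply
  directly.\<close>

definition inv_sqrt :: "real \<Rightarrow> real" where
  "inv_sqrt t = (if t > 0 then 1 / sqrt t else 0)"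

lemma inv_sqrt_nonneg [simp]: "0 \<le> inv_sqrt t"
  by (simp add: inv_sqrt_def)

lemma inv_sqrt_measurable [measurable]: "inv_sqrt \<in> borel_measurable borel"
  unfolding inv_sqrt_def[abs_def] by measurable

lemma FTC_nonneg_atLeast_0:
  fixes f F :: "real \<Rightarrow> real"
  assumes F: "\<And>x. x > 0 \<Longrightarrow> DERIV F x :> f x"
    and f: "\<And>x. x > 0 \<Longrightarrow> isCont f x"
    and nn: "\<And>x. x > 0 \<Longrightarrow> 0 \<le> f x"
    and z: "\<And>x. x \<le> 0 \<Longrightarrow> f x = 0"
    and A: "(F \<longlongrightarrow> A) (at_right 0)" and B: "(F \<longlongrightarrow> B) at_top"
  shows "integrable lborel f" "(\<integral>x. f x \<partial>lborel) = B - A"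
proof -
  have A': "((F \<circ> real_of_ereal) \<longlongrightarrow> A) (at_right 0)"
    using A by (simp add: zero_ereal_def at_right_ereal filterlim_filtermap comp_def)
  have B': "((F \<circ> real_of_ereal) \<longlongrightarrow> B) (at_left \<infinity>)"
    using B by (simp add: ereal_tendsto_simps1)
  note FTC = interval_integral_FTC_nonneg[of 0 \<infinity> F f A B, OF _ _ _ _ A' B']
  have eq: "indicator (einterval 0 \<infinity>) x * f x = f x" for x
    using z[of x] by (auto simp: indicator_def einterval_def)
  show "integrable lborel f"
    using FTC(1) F f nn by (auto simp: set_integrable_def eq)
  show "(\<integral>x. f x \<partial>lborel) = B - A"
    using FTC(2) F f nn by (auto simp: interval_lebesgue_integral_def set_lebesgue_integral_def eq)
qed

text \<open>The basic subordination integral: kernels at time \<open>s + t\<close> are estimated by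
  multiples of \<open>(s + t)^(-3/2)\<close>, and the weighted integral over \<open>t\<close> turns
  this into a multiple of \<open>1 / s\<close>. The primitive rises from 0 to
  \<open>2 / s\<close>.\<close>

lemma inv_sqrt_three_halves:
  assumes s: "s > 0"
  shows "integrable lborel (\<lambda>t. inv_sqrt t * (1 / ((s + t) * sqrt (s + t))))"
    and "(\<integral>t. inv_sqrt t * (1 / ((s + t) * sqrt (s + t))) \<partial>lborel) = 2 / s"
proof -
  have d: "((\<lambda>t. 2 / s * sqrt (t / (s + t))) has_real_derivative
      inv_sqrt x * (1 / ((s + x) * sqrt (s + x)))) (at x)" if x: "x > 0" for x
  proof -
    have "((\<lambda>t. 2 / s * sqrt (t / (s + t))) has_real_derivative
       2 / s * (s / (s + x)\<^sup>2 * (inverse (sqrt (x / (s + x))) / 2))) (at x)"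
      using x s by (auto intro!: derivative_eq_intros simp: power2_eq_square divide_simps)
    moreover have "2 / s * (s / (s + x)\<^sup>2 * (inverse (sqrt (x / (s + x))) / 2)) =
        inv_sqrt x * (1 / ((s + x) * sqrt (s + x)))"
    proof -
      have "sqrt (s + x) * sqrt (s + x) = s + x" using x s by simp
      then have "1 / (s + x)\<^sup>2 * (sqrt (s + x) / sqrt x) = 1 / sqrt x * (1 / ((s + x) * sqrt (s + x)))"
        using x s by (simp add: divide_simps power2_eq_square)
      then show ?thesis using x s by (simp add: inv_sqrt_def real_sqrt_divide)
    qed
    ultimately show ?thesis by simp
  qed
  have c: "isCont (\<lambda>t. inv_sqrt t * (1 / ((s + t) * sqrt (s + t)))) x" if x: "x > 0" for x
  proof -
    have "isCont (\<lambda>t. 1 / sqrt t * (1 / ((s + t) * sqrt (s + t)))) x"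
      using x s by (auto intro!: continuous_intros)
    moreover have "\<forall>\<^sub>F t in nhds x. 1 / sqrt t * (1 / ((s + t) * sqrt (s + t))) = inv_sqrt t * (1 / ((s + t) * sqrt (s + t)))"
      using eventually_nhds_in_open[of "{0<..}" x] x by (auto simp: inv_sqrt_def elim!: eventually_mono)
    ultimately show ?thesis by (subst (asm) isCont_cong) auto
  qed
  have A: "((\<lambda>t. 2 / s * sqrt (t / (s + t))) \<longlongrightarrow> 0) (at_right 0)"
    using s by real_asymp
  have B: "((\<lambda>t. 2 / s * sqrt (t / (s + t))) \<longlongrightarrow> 2 / s) at_top"
    using s by real_asymp
  note * = FTC_nonneg_atLeast_0[OF d c _ _ A B]
  show "integrable lborel (\<lambda>t. inv_sqrt t * (1 / ((s + t) * sqrt (s + t))))"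
    by (rule *(1)) (use s in \<open>auto simp: inv_sqrt_def\<close>)
  show "(\<integral>t. inv_sqrt t * (1 / ((s + t) * sqrt (s + t))) \<partial>lborel) = 2 / s"
    by (subst *(2)) (use s in \<open>auto simp: inv_sqrt_def\<close>)
qed

text \<open>\<open>Gamma (1/2) = sqrt pi\<close> after a scaling. For \<open>a = |\<xi>|^2\<close>
  this is the formula that expresses \<open>1 / |\<xi>|\<close> through Gaussians.\<close>

lemma inv_sqrt_exp:
  assumes a: "a > 0"
  shows "integrable lborel (\<lambda>t. inv_sqrt t * exp (- (a * t)))"
    and "(\<integral>t. inv_sqrt t * exp (- (a * t)) \<partial>lborel) = sqrt (pi / a)"
proof -
  have eq: "ennreal (inv_sqrt t * exp (- t)) = ennreal (indicator {0..} t * t powr (1/2 - 1) / exp t)" for t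
    by (cases "t > 0") (auto simp: inv_sqrt_def powr_minus powr_half_sqrt exp_minus field_simps indicator_def)
  have "(\<integral>\<^sup>+t. ennreal (inv_sqrt t * exp (- t)) \<partial>lborel) = ennreal (sqrt pi)"
    unfolding eq using Gamma_conv_nn_integral_real[of "1/2"] by (simp add: Gamma_one_half_real)
  then have h: "has_bochner_integral lborel (\<lambda>t. inv_sqrt t * exp (- t)) (sqrt pi)"
    by (intro has_bochner_integral_nn_integral) auto
  have "has_bochner_integral lborel (\<lambda>t. inv_sqrt (0 + a * t) * exp (- (0 + a * t))) (sqrt pi /\<^sub>R \<bar>a\<bar>)"
    using lborel_has_bochner_integral_real_affine_iff[of a "\<lambda>t. inv_sqrt t * exp (- t)" "sqrt pi" 0] h a by auto
  then have "has_bochner_integral lborel (\<lambda>t. sqrt a * (inv_sqrt (0 + a * t) * exp (- (0 + a * t)))) (sqrt a * (sqrt pi /\<^sub>R \<bar>a\<bar>))"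
    by (rule has_bochner_integral_mult_right)
  moreover have "sqrt a * (inv_sqrt (0 + a * t) * exp (- (0 + a * t))) = inv_sqrt t * exp (- (a * t))" for t
    using a by (auto simp: inv_sqrt_def real_sqrt_mult zero_less_mult_iff)
  moreover have "sqrt a * (sqrt pi /\<^sub>R \<bar>a\<bar>) = sqrt (pi / a)"
  proof -
    have "sqrt a * sqrt a = a" using a by simp
    then show ?thesis using a by (simp add: real_sqrt_divide field_simps)
  qed
  ultimately have "has_bochner_integral lborel (\<lambda>t. inv_sqrt t * exp (- (a * t))) (sqrt (pi / a))"
    by (simp only:)
  then show "integrable lborel (\<lambda>t. inv_sqrt t * exp (- (a * t)))"
    "(\<integral>t. inv_sqrt t * exp (- (a * t)) \<partial>lborel) = sqrt (pi / a)"
    by (auto simp: has_bochner_integral_iff)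
qed

text \<open>This is the value \<open>B(1/2, 1/2) = \<pi>\<close> of the Beta function.\<close>

lemma inv_sqrt_convolution:
  assumes r: "r > 0"
  shows "integrable lborel (\<lambda>t. inv_sqrt t * inv_sqrt (r - t))"
    and "(\<integral>t. inv_sqrt t * inv_sqrt (r - t) \<partial>lborel) = pi"
proof -
  let ?f = "\<lambda>t. inv_sqrt t * inv_sqrt (r - t)"
  let ?F = "\<lambda>t. 2 * arctan (sqrt (t / (r - t)))"
  have d: "(?F has_real_derivative ?f x) (at x)" if x: "0 < x" "x < r" for x
  proof -
    have "(?F has_real_derivative 2 * (r / (r - x)\<^sup>2 * (inverse (sqrt (x / (r - x))) / 2) * inverse (1 + (sqrt (x / (r - x)))\<^sup>2))) (at x)"
      using x by (auto intro!: derivative_eq_intros simp: power2_eq_square divide_simps)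
    moreover have "2 * (r / (r - x)\<^sup>2 * (inverse (sqrt (x / (r - x))) / 2) * inverse (1 + (sqrt (x / (r - x)))\<^sup>2)) = ?f x"
    proof -
      have s: "(sqrt (x / (r - x)))\<^sup>2 = x / (r - x)" using x by simp
      have "sqrt (r - x) * sqrt (r - x) = r - x" using x by simp
      moreover have "inverse (1 + x / (r - x)) = (r - x) / r" using x by (simp add: field_simps)
      ultimately show ?thesis
        unfolding s using x by (simp add: inv_sqrt_def real_sqrt_divide divide_simps power2_eq_square)

    qed
    ultimately show ?thesis by simp
  qed
  have c: "isCont ?f x" if x: "0 < x" "x < r" for x
  proof -
    have "isCont (\<lambda>t. 1 / sqrt t * (1 / sqrt (r - t))) x"
      using x by (auto intro!: continuous_intros)
    moreover have "\<forall>\<^sub>F t in nhds x. 1 / sqrt t * (1 / sqrt (r - t)) = ?f t"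
      using eventually_nhds_in_open[of "{0<..<r}" x] x by (auto simp: inv_sqrt_def elim!: eventually_mono)
    ultimately show ?thesis by (subst (asm) isCont_cong) auto
  qed
  have "(?F \<longlongrightarrow> 0) (at_right 0)" using r by real_asymp
  then have A: "((?F \<circ> real_of_ereal) \<longlongrightarrow> 0) (at_right 0)"
    by (simp add: zero_ereal_def at_right_ereal filterlim_filtermap comp_def)
  have "(?F \<longlongrightarrow> pi) (at_left r)"
  proof -
    have "filterlim (\<lambda>t. sqrt (t / (r - t))) at_top (at_left r)" using r by real_asymp
    then have "((\<lambda>t. arctan (sqrt (t / (r - t)))) \<longlongrightarrow> pi / 2) (at_left r)"
      by (rule filterlim_compose[OF tendsto_arctan_at_top])
    from tendsto_mult[OF tendsto_const[of 2] this] show ?thesis by simp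
  qed
  then have B: "((?F \<circ> real_of_ereal) \<longlongrightarrow> pi) (at_left (ereal r))"
    by (simp add: ereal_tendsto_simps1)
  note FTC = interval_integral_FTC_nonneg[of 0 "ereal r" ?F ?f 0 pi, OF _ _ _ _ A B]
  have eq: "indicator (einterval 0 (ereal r)) x * ?f x = ?f x" for x
    by (auto simp: indicator_def einterval_def inv_sqrt_def)
  show "integrable lborel ?f"
    using FTC(1) d c r by (auto simp: set_integrable_def eq)
  show "(\<integral>x. ?f x \<partial>lborel) = pi"
    using FTC(2) d c r by (auto simp: interval_lebesgue_integral_def set_lebesgue_integral_def eq)
qed

section \<open>The heat kernel\<close>

lemma integrable_dominated:
  fixes f :: "'a \<Rightarrow> 'b::{banach, second_countable_topology}" and g :: "'a \<Rightarrow> real"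
  assumes "integrable M g" "f \<in> borel_measurable M" "\<And>x. x \<in> space M \<Longrightarrow> norm (f x) \<le> g x"
  shows "integrable M f"
  by (rule Bochner_Integration.integrable_bound[OF assms(1,2)])
    (use assms(3) in \<open>auto intro!: AE_I2 intro: order_trans[OF _ abs_ge_self]\<close>)

lemma norm_sq_Basis: "(norm z)\<^sup>2 = (\<Sum>b\<in>Basis. (z \<bullet> b)\<^sup>2)" for z :: "'a::euclidean_space"
  by (subst power2_norm_eq_inner, subst euclidean_inner) (simp add: power2_eq_square)

definition heat :: "real \<Rightarrow> real^3 \<Rightarrow> real" where
  "heat s z = (1 / sqrt (4 * pi * s)) ^ 3 * exp (- (norm z)\<^sup>2 / (4 * s))"

text \<open>\<open>heat1\<close> and \<open>heat2\<close> are the first two time derivatives of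
  \<open>heat\<close> in closed form, see \<open>heat_deriv\<close>. As \<open>heat\<close> times a
  polynomial in \<open>|z|^2\<close> they fall under the same estimates as
  \<open>heat\<close>.\<close>

definition heat1 :: "real \<Rightarrow> real^3 \<Rightarrow> real" where
  "heat1 s z = heat s z * ((norm z)\<^sup>2 / (4 * s\<^sup>2) - 3 / (2 * s))"

definition heat2 :: "real \<Rightarrow> real^3 \<Rightarrow> real" where
  "heat2 s z = heat s z * (((norm z)\<^sup>2 / (4 * s\<^sup>2) - 3 / (2 * s))\<^sup>2
     + (3 / (2 * s\<^sup>2) - (norm z)\<^sup>2 / (2 * s ^ 3)))"

lemma heat_nonneg: "s > 0 \<Longrightarrow> 0 \<le> heat s z"
  by (simp add: heat_def)

lemma heat_minus [simp]: "heat s (- z) = heat s z" "heat1 s (- z) = heat1 s z" "heat2 s (- z) = heat2 s z"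
  by (simp_all add: heat_def heat1_def heat2_def)

lemma heat_measurable_pair [measurable]:
  "(\<lambda>p. heat (fst p) (snd p)) \<in> borel_measurable (borel \<Otimes>\<^sub>M borel)"
  "(\<lambda>p. heat1 (fst p) (snd p)) \<in> borel_measurable (borel \<Otimes>\<^sub>M borel)"
  "(\<lambda>p. heat2 (fst p) (snd p)) \<in> borel_measurable (borel \<Otimes>\<^sub>M borel)"
  unfolding heat_def heat1_def heat2_def by measurable

lemma heat_measurable [measurable (raw)]:
  assumes [measurable]: "f \<in> borel_measurable M" "g \<in> borel_measurable M"
  shows "(\<lambda>x. heat (f x) (g x)) \<in> borel_measurable M"
    "(\<lambda>x. heat1 (f x) (g x)) \<in> borel_measurable M"
    "(\<lambda>x. heat2 (f x) (g x)) \<in> borel_measurable M"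
  unfolding heat_def heat1_def heat2_def by measurable

lemma heat_deriv:
  assumes s: "s > 0"
  shows "((\<lambda>s. heat s z) has_real_derivative heat1 s z) (at s)"
    and "((\<lambda>s. heat1 s z) has_real_derivative heat2 s z) (at s)"
proof -
  define N where "N = (norm z)\<^sup>2"
  have pos: "4 * pi * s > 0" using s by (intro mult_pos_pos) auto
  have sq: "sqrt (4 * pi * s) * sqrt (4 * pi * s) = 4 * pi * s"
    by (simp only: real_sqrt_mult_self abs_of_pos[OF pos])
  have e: "((\<lambda>s. exp (- N / (4 * s))) has_real_derivative exp (- N / (4 * s)) * (N / (4 * s\<^sup>2))) (at s)"
    using s by (auto intro!: derivative_eq_intros simp: power2_eq_square field_simps)
  have r: "((\<lambda>s. (1 / sqrt (4 * pi * s)) ^ 3) has_real_derivative (1 / sqrt (4 * pi * s)) ^ 3 * (- 3 / (2 * s))) (at s)"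
  proof -
    have d: "((\<lambda>s. (1 / sqrt (4 * pi * s)) ^ 3) has_real_derivative
        3 * (1 / sqrt (4 * pi * s))\<^sup>2 * (- (4 * pi * (inverse (sqrt (4 * pi * s)) / 2)) / (sqrt (4 * pi * s) * sqrt (4 * pi * s)))) (at s)"
      using s pos by (auto intro!: derivative_eq_intros simp: power2_eq_square mult_less_0_iff)
    have "3 * (1 / sqrt (4 * pi * s))\<^sup>2 * (- (4 * pi * (inverse (sqrt (4 * pi * s)) / 2)) / (sqrt (4 * pi * s) * sqrt (4 * pi * s)))
      = (1 / sqrt (4 * pi * s)) ^ 3 * (- 3 / (2 * s))"
      unfolding sq using s by (simp add: power2_eq_square power3_eq_cube divide_simps)
    with d show ?thesis by simp
  qed
  show 1: "((\<lambda>s. heat s z) has_real_derivative heat1 s z) (at s)"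
    using DERIV_mult[OF r e] unfolding heat_def heat1_def N_def by (simp add: algebra_simps)
  have "((\<lambda>s. N / (4 * s\<^sup>2) - 3 / (2 * s)) has_real_derivative (3 / (2 * s\<^sup>2) - N / (2 * s ^ 3))) (at s)"
    using s by (auto intro!: derivative_eq_intros simp: field_simps eval_nat_numeral)
  from DERIV_mult[OF 1 this] show "((\<lambda>s. heat1 s z) has_real_derivative heat2 s z) (at s)"
    unfolding heat1_def heat2_def N_def by (simp add: algebra_simps power2_eq_square)
qed

lemma continuous_heat:
  assumes "s > 0"
  shows "continuous_on S (heat s)" "continuous_on S (heat1 s)" "continuous_on S (heat2 s)"
  unfolding heat_def heat1_def heat2_def using assms by (auto intro!: continuous_intros)

lemma lborel_integral_prod_Basis:
  fixes F :: "'a::euclidean_space \<Rightarrow> real \<Rightarrow> 'c::{real_normed_field,banach,second_countable_topology}"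
  assumes F: "\<And>b. b \<in> Basis \<Longrightarrow> integrable lborel (F b)"
  shows "integrable lborel (\<lambda>z::'a. \<Prod>b\<in>Basis. F b (z \<bullet> b))"
    and "(\<integral>z. (\<Prod>b\<in>Basis. F b (z \<bullet> b)) \<partial>lborel) = (\<Prod>b\<in>Basis. \<integral>t. F b t \<partial>lborel)"
proof -
  interpret product_sigma_finite "\<lambda>_::'a. lborel :: real measure"
    by (simp add: product_sigma_finite_def sigma_finite_lborel)
  \<comment> \<open>Outside \<open>Basis\<close> the factors are replaced by 0, since the product
    measure is indexed by the whole type and measurability is wanted for every index.\<close>
  define Fm where "Fm = (\<lambda>b. if b \<in> Basis then F b else (\<lambda>_. 0))"
  have m[measurable]: "Fm b \<in> borel_measurable borel" for b
    using borel_measurable_integrable[OF F, of b] by (auto simp: Fm_def)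
  have ip: "integrable (Pi\<^sub>M Basis (\<lambda>_::'a. lborel)) (\<lambda>x. \<Prod>b\<in>Basis. Fm b (x b))"
    by (intro product_integrable_prod) (auto simp: Fm_def F)
  have M: "(\<lambda>z::'a. \<Prod>b\<in>Basis. Fm b (z \<bullet> b)) \<in> borel_measurable borel"
    by (intro borel_measurable_prod) measurable
  have T: "(\<lambda>f. \<Sum>b\<in>Basis. f b *\<^sub>R b) \<in> Pi\<^sub>M Basis (\<lambda>_::'a. lborel) \<rightarrow>\<^sub>M (borel :: 'a measure)"
    by measurable
  have eq: "(\<Prod>b\<in>Basis. Fm b ((\<Sum>b\<in>Basis. f b *\<^sub>R b) \<bullet> b)) = (\<Prod>b\<in>Basis. Fm b (f b))" for f :: "'a \<Rightarrow> real"
    by (intro prod.cong refl arg_cong2[where f = Fm]) simp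
  have Fm: "(\<Prod>b\<in>Basis. Fm b (z \<bullet> b)) = (\<Prod>b\<in>Basis. F b (z \<bullet> b))" for z
    by (intro prod.cong) (auto simp: Fm_def)
  have "integrable lborel (\<lambda>z::'a. \<Prod>b\<in>Basis. Fm b (z \<bullet> b))"
    by (subst lborel_eq, subst integrable_distr_eq[OF T M]) (simp only: eq ip)
  then show "integrable lborel (\<lambda>z::'a. \<Prod>b\<in>Basis. F b (z \<bullet> b))"
    by (simp only: Fm)
  have "(\<integral>z. (\<Prod>b\<in>Basis. Fm b (z \<bullet> b)) \<partial>lborel) = (\<integral>f. (\<Prod>b\<in>Basis. Fm b (f b)) \<partial>(Pi\<^sub>M Basis (\<lambda>_::'a. lborel)))"
    by (subst lborel_eq, subst integral_distr[OF T M]) (simp only: eq)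
  also have "\<dots> = (\<Prod>b\<in>Basis. \<integral>t. Fm b t \<partial>lborel)"
    by (intro product_integral_prod) (auto simp: Fm_def F)
  also have "\<dots> = (\<Prod>b\<in>Basis. \<integral>t. F b t \<partial>lborel)"
    by (intro prod.cong) (auto simp: Fm_def)
  finally show "(\<integral>z. (\<Prod>b\<in>Basis. F b (z \<bullet> b)) \<partial>lborel) = (\<Prod>b\<in>Basis. \<integral>t. F b t \<partial>lborel)"
    by (simp only: Fm)
qed

text \<open>The heat kernel at time \<open>s\<close> is Gaussian with variance \<open>2 * s\<close>,
  so scaling by \<open>sqrt (2 * s)\<close> reduces the transform to the characteristic function of
  the standard normal law.\<close>

lemma normal_density_fourier:
  assumes s: "s > 0"
  shows "integrable lborel (\<lambda>t. complex_of_real (normal_density 0 (sqrt (2 * s)) t) * cis (x * t))"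
    and "(\<integral>t. complex_of_real (normal_density 0 (sqrt (2 * s)) t) * cis (x * t) \<partial>lborel) =
      complex_of_real (exp (- s * x\<^sup>2))"
proof -
  let ?r = "sqrt (2 * s)"
  have r: "?r > 0" using s by simp
  show "integrable lborel (\<lambda>t. complex_of_real (normal_density 0 ?r t) * cis (x * t))"
  proof (rule Bochner_Integration.integrable_bound[of _ "normal_density 0 ?r"])
    show "(\<lambda>t. complex_of_real (normal_density 0 ?r t) * cis (x * t)) \<in> borel_measurable lborel"
      by (simp add: cis_conv_exp)
  qed (use r in \<open>auto simp: norm_mult\<close>)
  have "(\<integral>t. complex_of_real (normal_density 0 ?r t) * cis (x * t) \<partial>lborel) =
    \<bar>?r\<bar> *\<^sub>R (\<integral>t. complex_of_real (normal_density 0 ?r (0 + ?r * t)) * cis (x * (0 + ?r * t)) \<partial>lborel)"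
    using r by (intro lborel_integral_real_affine) auto
  also have "\<dots> = (\<integral>t. ?r *\<^sub>R (complex_of_real (normal_density 0 ?r (0 + ?r * t)) * cis (x * (0 + ?r * t))) \<partial>lborel)"
    using r by simp
  also have "\<dots> = (\<integral>t. std_normal_density t *\<^sub>R iexp ((x * ?r) * t) \<partial>lborel)"
  proof (intro Bochner_Integration.integral_cong refl)
    fix t
    have "?r * normal_density 0 ?r (?r * t) = std_normal_density t"
      using s by (simp add: normal_density_def real_sqrt_mult power_mult_distrib field_simps)
    then show "?r *\<^sub>R (complex_of_real (normal_density 0 ?r (0 + ?r * t)) * cis (x * (0 + ?r * t))) =
        std_normal_density t *\<^sub>R iexp ((x * ?r) * t)"
      by (simp add: scaleR_conv_of_real cis_conv_exp mult_ac flip: of_real_mult)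
  qed
  also have "\<dots> = char std_normal_distribution (x * ?r)"
    unfolding char_def by (subst integral_density) (auto simp: normal_density_nonneg)
  also have "\<dots> = complex_of_real (exp (- s * x\<^sup>2))"
    using s by (simp add: char_std_normal_distribution power_mult_distrib mult_ac)
  finally show "(\<integral>t. complex_of_real (normal_density 0 ?r t) * cis (x * t) \<partial>lborel) =
      complex_of_real (exp (- s * x\<^sup>2))" .
qed

text \<open>Both the Gaussian and the character are products over the coordinates, so the
  one-dimensional transform suffices.\<close>

lemma heat_fourier_cis:
  assumes s: "s > 0"
  shows "integrable lborel (\<lambda>z. complex_of_real (heat s z) * cis (x \<bullet> z))"
    and "(\<integral>z. complex_of_real (heat s z) * cis (x \<bullet> z) \<partial>lborel) = complex_of_real (exp (- s * (norm x)\<^sup>2))"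
proof -
  have eq: "complex_of_real (heat s z) * cis (x \<bullet> z) =
    (\<Prod>b\<in>Basis. complex_of_real (normal_density 0 (sqrt (2 * s)) (z \<bullet> b)) * cis ((x \<bullet> b) * (z \<bullet> b)))" for z
  proof -
    have nd: "normal_density 0 (sqrt (2 * s)) t = 1 / sqrt (4 * pi * s) * exp (- t\<^sup>2 / (4 * s))" for t
      using s by (simp add: normal_density_def)
    have "heat s z = (1 / sqrt (4 * pi * s)) ^ 3 * exp (\<Sum>b\<in>Basis. - (z \<bullet> b)\<^sup>2 / (4 * s))"
      by (simp add: heat_def norm_sq_Basis sum_negf sum_divide_distrib)
    also have "\<dots> = (\<Prod>b\<in>Basis. normal_density 0 (sqrt (2 * s)) (z \<bullet> b))"
      unfolding nd prod.distrib by (subst exp_sum) simp_all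
    finally have "heat s z = (\<Prod>b\<in>Basis. normal_density 0 (sqrt (2 * s)) (z \<bullet> b))" .
    moreover have "cis (x \<bullet> z) = (\<Prod>b\<in>Basis. cis ((x \<bullet> b) * (z \<bullet> b)))"
      by (simp add: cis_conv_exp exp_sum[symmetric] euclidean_inner[of x z] sum_distrib_left)
    ultimately show ?thesis by (simp add: prod.distrib)
  qed
  show "integrable lborel (\<lambda>z. complex_of_real (heat s z) * cis (x \<bullet> z))"
    unfolding eq by (rule lborel_integral_prod_Basis(1)) (rule normal_density_fourier(1)[OF s])
  have "(\<integral>z. complex_of_real (heat s z) * cis (x \<bullet> z) \<partial>lborel) =
      (\<Prod>b\<in>Basis. complex_of_real (exp (- s * (x \<bullet> b)\<^sup>2)))"
    unfolding eq by (subst lborel_integral_prod_Basis(2))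
      (auto intro!: normal_density_fourier(1)[OF s] simp: normal_density_fourier(2)[OF s])
  also have "\<dots> = complex_of_real (exp (- s * (norm x)\<^sup>2))"
    by (simp add: norm_sq_Basis exp_sum[symmetric] sum_distrib_left sum_negf
        flip: of_real_prod)
  finally show "(\<integral>z. complex_of_real (heat s z) * cis (x \<bullet> z) \<partial>lborel) = complex_of_real (exp (- s * (norm x)\<^sup>2))" .
qed

lemma heat_cos:
  assumes s: "s > 0"
  shows "(\<integral>z. heat s z * cos (x \<bullet> z) \<partial>lborel) = exp (- s * (norm x)\<^sup>2)"
  using integral_Re[OF heat_fourier_cis(1)[OF s, of x]] heat_fourier_cis(2)[OF s, of x] by simp

lemma heat_integrable: "s > 0 \<Longrightarrow> integrable lborel (heat s)"
  using integrable_Re[OF heat_fourier_cis(1)[of s 0]] by simp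

lemma heat_integral: "s > 0 \<Longrightarrow> (\<integral>z. heat s z \<partial>lborel) = 1"
  using heat_cos[of s 0] by simp

subsection \<open>Gaussian and algebraic bounds\<close>

lemma one_plus_pow4_le_exp: "(1 + x) ^ 4 \<le> 256 * exp (x::real)" if "x \<ge> 0"
proof -
  have "(1 + x) / 4 \<le> exp (x / 4)" using exp_ge_add_one_self[of "x/4"] that by (simp add: field_simps)
  then have "((1 + x) / 4) ^ 4 \<le> exp (x / 4) ^ 4" using that by (intro power_mono) auto
  also have "\<dots> = exp x" by (simp flip: exp_of_nat_mult)
  finally show ?thesis by (simp add: power_divide)
qed

lemma heat_prefactor_le: "s > 0 \<Longrightarrow> (1 / sqrt (4 * pi * s)) ^ 3 \<le> 1 / (s * sqrt s)"
proof -
  assume s: "s > 0"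
  have "sqrt s \<le> sqrt (4 * pi * s)" using s pi_gt3 by simp
  then have "(1 / sqrt (4 * pi * s)) ^ 3 \<le> (1 / sqrt s) ^ 3"
    using s by (intro power_mono divide_left_mono) auto
  also have "\<dots> = 1 / (s * sqrt s)" using s by (simp add: power3_eq_cube)
  finally show ?thesis .
qed

text \<open>With \<open>X = |z|^2 / (4 * s)\<close> the kernel is \<open>exp (- X)\<close> up to its
  prefactor, and this absorbs any factor up to \<open>(X + 3)^2\<close>. Spending all of the
  exponential gives decay \<open>|z|^(-4)\<close>, as needed against functions in
  \<open>L_half\<close>; keeping half of it gives the kernel at time \<open>2 * s\<close>, as needed
  in \<open>L^1\<close>.\<close>

lemma heat_poly_bound:
  assumes s: "s > 0" and c: "0 \<le> c" "c \<le> ((norm z)\<^sup>2 / (4 * s) + 3)\<^sup>2"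
  shows "heat s z * c \<le> 40000 * sqrt s / (s + (norm z)\<^sup>2)\<^sup>2"
    and "heat s z * c \<le> 500 * heat (2 * s) z"
proof -
  define X where "X = (norm z)\<^sup>2 / (4 * s)"
  have X0: "X \<ge> 0" using s by (simp add: X_def)
  have z: "(norm z)\<^sup>2 = 4 * s * X" using s by (simp add: X_def)
  have h: "heat s z = (1 / sqrt (4 * pi * s)) ^ 3 * exp (- X)" by (simp add: heat_def X_def)
  have a: "(X + 3) * (1 + 4 * X) \<le> 12 * (1 + X)\<^sup>2" using X0 by (simp add: power2_eq_square algebra_simps)
  have "((X + 3) * (1 + 4 * X))\<^sup>2 \<le> (12 * (1 + X)\<^sup>2)\<^sup>2" using a X0 by (intro power_mono) auto
  also have "\<dots> = 144 * (1 + X) ^ 4" by (simp add: power_mult_distrib flip: power_mult)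
  also have "\<dots> \<le> 144 * (256 * exp X)" using one_plus_pow4_le_exp[OF X0] by simp
  \<comment> \<open>Here \<open>144 * 256 = 36864\<close> is rounded up.\<close>
  also have "\<dots> \<le> 40000 * exp X" by simp
  finally have "(X + 3)\<^sup>2 * (1 + 4 * X)\<^sup>2 \<le> 40000 * exp X"
    by (simp only: power_mult_distrib)
  from mult_right_mono[OF this, of "exp (- X)"]
  have "(X + 3)\<^sup>2 * exp (- X) * (1 + 4 * X)\<^sup>2 \<le> 40000"
    by (simp add: mult.assoc exp_minus_inverse) (simp add: mult.commute)
  then have b: "(X + 3)\<^sup>2 * exp (- X) \<le> 40000 / (1 + 4 * X)\<^sup>2"
    using X0 by (subst pos_le_divide_eq) auto
  have "heat s z * c \<le> heat s z * (X + 3)\<^sup>2"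
    using c heat_nonneg[OF s] by (intro mult_left_mono) (auto simp: X_def)
  also have "\<dots> = (1 / sqrt (4 * pi * s)) ^ 3 * ((X + 3)\<^sup>2 * exp (- X))" by (simp add: h)
  also have "\<dots> \<le> 1 / (s * sqrt s) * (40000 / (1 + 4 * X)\<^sup>2)"
    using b heat_prefactor_le[OF s] s by (intro mult_mono) auto
  also have "\<dots> = 40000 * sqrt s / (s + (norm z)\<^sup>2)\<^sup>2"
  proof -
    have "s + (norm z)\<^sup>2 = s * (1 + 4 * X)" by (simp add: z algebra_simps)
    moreover have "sqrt s * sqrt s = s" using s by simp
    ultimately show ?thesis using s X0
      by (simp add: power_mult_distrib divide_simps power2_eq_square)
  qed
  finally show "heat s z * c \<le> 40000 * sqrt s / (s + (norm z)\<^sup>2)\<^sup>2" .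
  have "X + 3 \<le> 12 * exp (X / 4)"
    using exp_ge_add_one_self[of "X/4"] X0 by linarith
  then have "(X + 3)\<^sup>2 \<le> (12 * exp (X / 4))\<^sup>2" using X0 by (intro power_mono) auto
  also have "\<dots> = 144 * exp (X / 2)" by (simp add: power_mult_distrib flip: exp_of_nat_mult)
  finally have e: "(X + 3)\<^sup>2 \<le> 144 * exp (X / 2)" .
  have d: "(X + 3)\<^sup>2 * exp (- X) \<le> 144 * exp (- X / 2)"
  proof -
    have "exp (X / 2) * exp (- X) = exp (- X / 2)" by (simp flip: exp_add)
    with mult_right_mono[OF e, of "exp (- X)"] show ?thesis
      by (simp add: mult.assoc)
  qed
  \<comment> \<open>Doubling the time costs \<open>2^(3/2) < 3\<close> in the prefactor; with the
    144 this gives 432, rounded up to 500.\<close>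
  have p: "(1 / sqrt (4 * pi * s)) ^ 3 \<le> 3 * (1 / sqrt (4 * pi * (2 * s))) ^ 3"
  proof -
    have "sqrt (4 * pi * (2 * s)) = sqrt 2 * sqrt (4 * pi * s)" by (simp flip: real_sqrt_mult)
    moreover have "sqrt 2 ^ 3 \<le> (3::real)"
    proof -
      have "sqrt 2 ^ 3 = 2 * sqrt (2::real)" by (simp add: power3_eq_cube)
      moreover have "sqrt 2 \<le> (3/2::real)" by (rule real_le_lsqrt) (auto simp: power2_eq_square)
      ultimately show ?thesis by simp
    qed
    ultimately show ?thesis using s by (simp add: power_mult_distrib power_divide field_simps)
  qed
  have h2: "heat (2 * s) z = (1 / sqrt (4 * pi * (2 * s))) ^ 3 * exp (- X / 2)"
    by (simp add: heat_def X_def)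
  have "heat s z * c \<le> heat s z * (X + 3)\<^sup>2"
    using c heat_nonneg[OF s] by (intro mult_left_mono) (auto simp: X_def)
  also have "\<dots> = (1 / sqrt (4 * pi * s)) ^ 3 * ((X + 3)\<^sup>2 * exp (- X))" by (simp add: h)
  also have "\<dots> \<le> 3 * (1 / sqrt (4 * pi * (2 * s))) ^ 3 * (144 * exp (- X / 2))"
    by (rule mult_mono[OF p d]) (use s in auto)
  also have "\<dots> \<le> 500 * heat (2 * s) z" unfolding h2 using s by simp
  finally show "heat s z * c \<le> 500 * heat (2 * s) z" .
qed

text \<open>In terms of \<open>X\<close> the time derivatives multiply \<open>heat\<close> by
  \<open>(X - 3/2) / s\<close> and by \<open>((X - 3/2)^2 + 3/2 - 2 * X) / s^2\<close>: each
  derivative costs one power of \<open>1 / s\<close>, and the numerators are at most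
  \<open>(X + 3)^2\<close>.\<close>

lemma heat_factor_bounds:
  fixes z :: "real^3"
  assumes s: "s > 0"
  defines "X \<equiv> (norm z)\<^sup>2 / (4 * s)"
  shows "\<bar>heat1 s z\<bar> \<le> heat s z * (X + 3)\<^sup>2 / s" "\<bar>heat2 s z\<bar> \<le> heat s z * (X + 3)\<^sup>2 / s\<^sup>2"
proof -
  have X0: "X \<ge> 0" using s by (simp add: X_def)
  have z: "(norm z)\<^sup>2 = 4 * s * X" using s by (simp add: X_def)
  have 1: "heat1 s z = heat s z * ((X - 3/2) / s)"
    unfolding heat1_def z using s by (simp add: power2_eq_square divide_simps)
  have 2: "heat2 s z = heat s z * (((X - 3/2)\<^sup>2 + 3/2 - 2 * X) / s\<^sup>2)"
    unfolding heat2_def z using s by (simp add: divide_simps eval_nat_numeral)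
  have "\<bar>X - 3/2\<bar> \<le> X + 3" using X0 by linarith
  also have "\<dots> \<le> (X + 3)\<^sup>2" using X0 by (simp add: power2_eq_square algebra_simps)
  finally have a: "\<bar>X - 3/2\<bar> \<le> (X + 3)\<^sup>2" .
  have "\<bar>heat1 s z\<bar> = heat s z * (\<bar>X - 3/2\<bar> / s)"
    unfolding 1 using s heat_nonneg[OF s] by (simp add: abs_mult)
  also have "\<dots> \<le> heat s z * ((X + 3)\<^sup>2 / s)"
    using a s heat_nonneg[OF s] by (intro mult_left_mono divide_right_mono) auto
  finally show "\<bar>heat1 s z\<bar> \<le> heat s z * (X + 3)\<^sup>2 / s" by simp
  have b: "\<bar>(X - 3/2)\<^sup>2 + 3/2 - 2 * X\<bar> \<le> (X + 3)\<^sup>2"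
  proof -
    have "0 \<le> (X - 5/2)\<^sup>2" by simp
    then show ?thesis using X0 by (simp add: power2_eq_square abs_le_iff algebra_simps)
  qed
  have "\<bar>heat2 s z\<bar> = heat s z * (\<bar>(X - 3/2)\<^sup>2 + 3/2 - 2 * X\<bar> / s\<^sup>2)"
    unfolding 2 using s heat_nonneg[OF s] by (simp add: abs_mult)
  also have "\<dots> \<le> heat s z * ((X + 3)\<^sup>2 / s\<^sup>2)"
    using b s heat_nonneg[OF s] by (intro mult_left_mono divide_right_mono) auto
  finally show "\<bar>heat2 s z\<bar> \<le> heat s z * (X + 3)\<^sup>2 / s\<^sup>2" by simp
qed

lemma heat_bounds:
  assumes s: "s > 0"
  shows "heat s z \<le> 40000 * sqrt s / (s + (norm z)\<^sup>2)\<^sup>2"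
    and "\<bar>heat1 s z\<bar> \<le> 40000 / (sqrt s * (s + (norm z)\<^sup>2)\<^sup>2)"
    and "\<bar>heat2 s z\<bar> \<le> 40000 / (s * sqrt s * (s + (norm z)\<^sup>2)\<^sup>2)"
    and "\<bar>heat1 s z\<bar> \<le> 500 / s * heat (2 * s) z"
    and "\<bar>heat2 s z\<bar> \<le> 500 / s\<^sup>2 * heat (2 * s) z"
proof -
  define X where "X = (norm z)\<^sup>2 / (4 * s)"
  have X0: "X \<ge> 0" using s by (simp add: X_def)
  have X1: "1 \<le> (X + 3)\<^sup>2" using X0 by (simp add: power2_eq_square algebra_simps)
  note P = heat_poly_bound[OF s _ order_refl, of z, folded X_def]
  have sq: "sqrt s * sqrt s = s" using s by simp
  show "heat s z \<le> 40000 * sqrt s / (s + (norm z)\<^sup>2)\<^sup>2"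
    using heat_poly_bound(1)[OF s, of 1 z] X1 by (simp add: X_def)
  have "\<bar>heat1 s z\<bar> \<le> heat s z * (X + 3)\<^sup>2 / s" using heat_factor_bounds(1)[OF s] by (simp add: X_def)
  also have "\<dots> \<le> 40000 * sqrt s / (s + (norm z)\<^sup>2)\<^sup>2 / s"
    using P(1) s by (intro divide_right_mono) auto
  also have "\<dots> = 40000 / (sqrt s * (s + (norm z)\<^sup>2)\<^sup>2)"
    using s sq by (auto simp: divide_simps)
  finally show "\<bar>heat1 s z\<bar> \<le> 40000 / (sqrt s * (s + (norm z)\<^sup>2)\<^sup>2)" .
  have "\<bar>heat2 s z\<bar> \<le> heat s z * (X + 3)\<^sup>2 / s\<^sup>2" using heat_factor_bounds(2)[OF s] by (simp add: X_def)
  also have "\<dots> \<le> 40000 * sqrt s / (s + (norm z)\<^sup>2)\<^sup>2 / s\<^sup>2"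
    using P(1) s by (intro divide_right_mono) auto
  also have "\<dots> = 40000 / (s * sqrt s * (s + (norm z)\<^sup>2)\<^sup>2)"
    using s sq by (auto simp: divide_simps power2_eq_square)
  finally show "\<bar>heat2 s z\<bar> \<le> 40000 / (s * sqrt s * (s + (norm z)\<^sup>2)\<^sup>2)" .
  have "\<bar>heat1 s z\<bar> \<le> heat s z * (X + 3)\<^sup>2 / s" using heat_factor_bounds(1)[OF s] by (simp add: X_def)
  also have "\<dots> \<le> 500 * heat (2 * s) z / s"
    using P(2) s by (intro divide_right_mono) auto
  finally show "\<bar>heat1 s z\<bar> \<le> 500 / s * heat (2 * s) z" by simp
  have "\<bar>heat2 s z\<bar> \<le> heat s z * (X + 3)\<^sup>2 / s\<^sup>2" using heat_factor_bounds(2)[OF s] by (simp add: X_def)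
  also have "\<dots> \<le> 500 * heat (2 * s) z / s\<^sup>2"
    using P(2) s by (intro divide_right_mono) auto
  finally show "\<bar>heat2 s z\<bar> \<le> 500 / s\<^sup>2 * heat (2 * s) z" by simp
qed

lemma heat_le_heat:
  assumes "0 < a" "a \<le> s" "s \<le> b"
  shows "heat s z \<le> (sqrt (b / a)) ^ 3 * heat b z"
proof -
  have "(1 / sqrt (4 * pi * s)) ^ 3 \<le> (1 / sqrt (4 * pi * a)) ^ 3"
    using assms by (intro power_mono divide_left_mono) auto
  also have "(1 / sqrt (4 * pi * a)) ^ 3 = (sqrt (b / a) * (1 / sqrt (4 * pi * b))) ^ 3"
    using assms by (simp add: real_sqrt_mult real_sqrt_divide field_simps)
  finally have 1: "(1 / sqrt (4 * pi * s)) ^ 3 \<le> sqrt (b / a) ^ 3 * (1 / sqrt (4 * pi * b)) ^ 3"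
    by (simp only: power_mult_distrib)
  have 2: "exp (- (norm z)\<^sup>2 / (4 * s)) \<le> exp (- (norm z)\<^sup>2 / (4 * b))"
    using assms by (simp add: frac_le)
  show ?thesis
    unfolding heat_def using mult_mono[OF 1 2] assms by (simp add: mult_ac)
qed

lemma
  assumes s: "s > 0"
  shows heat1_integrable: "integrable lborel (heat1 s)"
    and heat2_integrable: "integrable lborel (heat2 s)"
    and heat2_L1: "(\<integral>z. \<bar>heat2 s z\<bar> \<partial>lborel) \<le> 500 / s\<^sup>2"
proof -
  have i: "integrable lborel (\<lambda>z. c * heat (2 * s) z)" for c
    using heat_integrable[of "2 * s"] s by simp
  show "integrable lborel (heat1 s)"
    by (rule integrable_dominated[OF i[of "500 / s"]]) (use heat_bounds(4)[OF s] in auto)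
  show *: "integrable lborel (heat2 s)"
    by (rule integrable_dominated[OF i[of "500 / s\<^sup>2"]]) (use heat_bounds(5)[OF s] in auto)
  have "(\<integral>z. \<bar>heat2 s z\<bar> \<partial>lborel) \<le> (\<integral>z. 500 / s\<^sup>2 * heat (2 * s) z \<partial>lborel)"
    using * heat_bounds(5)[OF s] by (intro integral_mono i) auto
  also have "\<dots> = 500 / s\<^sup>2" using heat_integral[of "2 * s"] s by simp
  finally show "(\<integral>z. \<bar>heat2 s z\<bar> \<partial>lborel) \<le> 500 / s\<^sup>2" .
qed

text \<open>Differentiate \<open>heat_cos\<close> once and twice in \<open>s\<close> under the
  integral sign.\<close>

lemma
  assumes s: "s > 0"
  shows heat1_cos: "(\<integral>z. heat1 s z * cos (x \<bullet> z) \<partial>lborel) = - (norm x)\<^sup>2 * exp (- s * (norm x)\<^sup>2)"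
    and heat2_cos: "(\<integral>z. heat2 s z * cos (x \<bullet> z) \<partial>lborel) = (norm x) ^ 4 * exp (- s * (norm x)\<^sup>2)"
proof -
  have icos: "integrable lborel (\<lambda>z. h z * cos (x \<bullet> z))" if "integrable lborel h" for h :: "real^3 \<Rightarrow> real"
    by (rule Bochner_Integration.integrable_bound[OF that])
      (use borel_measurable_integrable[OF that] in \<open>auto simp: abs_mult intro!: AE_I2 mult_left_le\<close>)
  have abscos: "\<bar>h * cos y\<bar> \<le> \<bar>h\<bar>" for h y :: real
    by (auto simp: abs_mult intro!: mult_left_le)
  \<comment> \<open>For \<open>t\<close> between \<open>r / 2\<close> and \<open>3 * r / 2\<close>
    the time \<open>2 * t\<close> lies between \<open>r\<close> and \<open>3 * r\<close>, so a
    multiple of the kernel at time \<open>3 * r\<close> dominates for all \<open>t\<close> near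
    \<open>r\<close>.\<close>
  have dom: "heat (2 * t) z \<le> sqrt 3 ^ 3 * heat (3 * r) z" "500 / t \<le> 1000 / r" "500 / t\<^sup>2 \<le> 2000 / r\<^sup>2"
    if r: "r > 0" and t: "\<bar>t - r\<bar> < r / 2" for r t z
  proof -
    have t': "r / 2 < t" "2 * t < 3 * r" using t by linarith+
    show "heat (2 * t) z \<le> sqrt 3 ^ 3 * heat (3 * r) z"
      using heat_le_heat[of r "2 * t" "3 * r" z] t' r by simp
    show "500 / t \<le> 1000 / r" using t' r by (simp add: field_simps)
    have "500 / t\<^sup>2 \<le> 500 / (r / 2)\<^sup>2" using t' r by (intro divide_left_mono power_mono) auto
    then show "500 / t\<^sup>2 \<le> 2000 / r\<^sup>2" by (simp add: power_divide)
  qed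
  have ih: "integrable lborel (\<lambda>z. c * heat (3 * r) z)" if "r > 0" for c r
    using heat_integrable[of "3 * r"] that by simp
  have d1: "((\<lambda>t. \<integral>z. heat t z * cos (x \<bullet> z) \<partial>lborel) has_real_derivative
      (\<integral>z. heat1 r z * cos (x \<bullet> z) \<partial>lborel)) (at r)" if r: "r > 0" for r
  proof (rule has_real_derivative_integral(2)[where e = "r / 2" and g = "\<lambda>z. 1000 / r * sqrt 3 ^ 3 * heat (3 * r) z"])
    fix t z assume t: "\<bar>t - r\<bar> < r / 2"
    then have t0: "t > 0" by linarith
    show "integrable lborel (\<lambda>z. heat t z * cos (x \<bullet> z))" by (intro icos heat_integrable t0)
    show "((\<lambda>s. heat s z * cos (x \<bullet> z)) has_real_derivative heat1 t z * cos (x \<bullet> z)) (at t)"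
      by (intro DERIV_cmult_right heat_deriv t0)
    have "\<bar>heat1 t z * cos (x \<bullet> z)\<bar> \<le> 500 / t * heat (2 * t) z"
      using heat_bounds(4)[OF t0, of z] abscos[of "heat1 t z" "x \<bullet> z"] by linarith
    also have "\<dots> \<le> 1000 / r * (sqrt 3 ^ 3 * heat (3 * r) z)"
      using dom[OF r t] t0 r heat_nonneg[of "2 * t"] by (intro mult_mono) auto
    finally show "\<bar>heat1 t z * cos (x \<bullet> z)\<bar> \<le> 1000 / r * sqrt 3 ^ 3 * heat (3 * r) z" by simp
  next
    show "integrable lborel (\<lambda>z. 1000 / r * sqrt 3 ^ 3 * heat (3 * r) z)" by (rule ih[OF r])
  qed (use r in simp)
  have ev: "\<forall>\<^sub>F t in nhds r. t > 0" if "r > 0" for r :: real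
    using eventually_nhds_in_open[of "{0<..}" r] that by auto
  have 1: "(\<integral>z. heat1 r z * cos (x \<bullet> z) \<partial>lborel) = - (norm x)\<^sup>2 * exp (- r * (norm x)\<^sup>2)" if r: "r > 0" for r
  proof -
    have "((\<lambda>t. exp (- t * (norm x)\<^sup>2)) has_real_derivative (\<integral>z. heat1 r z * cos (x \<bullet> z) \<partial>lborel)) (at r)"
      by (rule DERIV_cong_ev[THEN iffD1, OF refl _ refl d1[OF r]])
        (use ev[OF r] in \<open>auto elim!: eventually_mono simp: heat_cos\<close>)
    moreover have "((\<lambda>t. exp (- t * (norm x)\<^sup>2)) has_real_derivative - (norm x)\<^sup>2 * exp (- r * (norm x)\<^sup>2)) (at r)"
      by (auto intro!: derivative_eq_intros)
    ultimately show ?thesis by (rule DERIV_unique)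
  qed
  then show "(\<integral>z. heat1 s z * cos (x \<bullet> z) \<partial>lborel) = - (norm x)\<^sup>2 * exp (- s * (norm x)\<^sup>2)"
    using s by blast
  have d2: "((\<lambda>t. \<integral>z. heat1 t z * cos (x \<bullet> z) \<partial>lborel) has_real_derivative
      (\<integral>z. heat2 s z * cos (x \<bullet> z) \<partial>lborel)) (at s)"
  proof (rule has_real_derivative_integral(2)[where e = "s / 2" and g = "\<lambda>z. 2000 / s\<^sup>2 * sqrt 3 ^ 3 * heat (3 * s) z"])
    fix t z assume t: "\<bar>t - s\<bar> < s / 2"
    then have t0: "t > 0" by linarith
    show "integrable lborel (\<lambda>z. heat1 t z * cos (x \<bullet> z))" by (intro icos heat1_integrable t0)
    show "((\<lambda>s. heat1 s z * cos (x \<bullet> z)) has_real_derivative heat2 t z * cos (x \<bullet> z)) (at t)"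
      by (intro DERIV_cmult_right heat_deriv t0)
    have "\<bar>heat2 t z * cos (x \<bullet> z)\<bar> \<le> 500 / t\<^sup>2 * heat (2 * t) z"
      using heat_bounds(5)[OF t0, of z] abscos[of "heat2 t z" "x \<bullet> z"] by linarith
    also have "\<dots> \<le> 2000 / s\<^sup>2 * (sqrt 3 ^ 3 * heat (3 * s) z)"
      using dom[OF s t] t0 s heat_nonneg[of "2 * t"] by (intro mult_mono) auto
    finally show "\<bar>heat2 t z * cos (x \<bullet> z)\<bar> \<le> 2000 / s\<^sup>2 * sqrt 3 ^ 3 * heat (3 * s) z" by simp
  next
    show "integrable lborel (\<lambda>z. 2000 / s\<^sup>2 * sqrt 3 ^ 3 * heat (3 * s) z)" by (rule ih[OF s])
  qed (use s in simp)
  have "((\<lambda>t. - (norm x)\<^sup>2 * exp (- t * (norm x)\<^sup>2)) has_real_derivative (\<integral>z. heat2 s z * cos (x \<bullet> z) \<partial>lborel)) (at s)"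
    by (rule DERIV_cong_ev[THEN iffD1, OF refl _ refl d2])
      (use ev[OF s] in \<open>auto elim!: eventually_mono simp: 1\<close>)
  moreover have "((\<lambda>t. - (norm x)\<^sup>2 * exp (- t * (norm x)\<^sup>2)) has_real_derivative (norm x) ^ 4 * exp (- s * (norm x)\<^sup>2)) (at s)"
    by (auto intro!: derivative_eq_intros simp: eval_nat_numeral)
  ultimately show "(\<integral>z. heat2 s z * cos (x \<bullet> z) \<partial>lborel) = (norm x) ^ 4 * exp (- s * (norm x)\<^sup>2)"
    by (rule DERIV_unique)
qed

subsection \<open>Pairing with functions of moderate growth\<close>

lemma add_norm_sq_nonzero [simp]:
  "s > 0 \<Longrightarrow> s + (norm z)\<^sup>2 \<noteq> 0" "s > 0 \<Longrightarrow> 0 < s + (norm z)\<^sup>2"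
  by (auto simp: add_pos_nonneg add_pos_nonneg[THEN less_imp_neq, THEN not_sym])

lemma norm_sq_le_double: "(norm y)\<^sup>2 \<le> 2 * (norm x)\<^sup>2 + 2 * (norm (x - y))\<^sup>2" for x y :: "'a::real_normed_vector"
proof -
  have "norm y \<le> norm x + norm (x - y)"
    by (metis add.commute norm_minus_commute norm_triangle_sub)
  then have "(norm y)\<^sup>2 \<le> (norm x + norm (x - y))\<^sup>2" by (intro power_mono) auto
  also have "\<dots> \<le> 2 * (norm x)\<^sup>2 + 2 * (norm (x - y))\<^sup>2"
    using sum_squares_ge_zero[of "norm x - norm (x - y)" 0] by (simp add: power2_eq_square algebra_simps)
  finally show ?thesis .
qed

text \<open>The factor on the right comes from \<open>1 + |y|^2 \<le> c * (s + |x - y|^2)\<close>.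
  It lets every kernel with the decay \<open>(s + |z|^2)^(-2)\<close> be paired with functions that
  are integrable against the weight of \<open>L_half\<close>.\<close>

lemma weight_le:
  fixes x y :: "'a::real_normed_vector"
  assumes s: "s > 0"
  shows "1 / (s + (norm (x - y))\<^sup>2)\<^sup>2 \<le> (2 + (1 + 2 * (norm x)\<^sup>2) / s)\<^sup>2 / (1 + norm y ^ 4)"
proof -
  define c where "c = 2 + (1 + 2 * (norm x)\<^sup>2) / s"
  define d where "d = (norm (x - y))\<^sup>2"
  have d: "d \<ge> 0" by (simp add: d_def)
  have q: "(1 + 2 * (norm x)\<^sup>2) / s \<ge> 0" using s by simp
  have "1 + (norm y)\<^sup>2 \<le> 1 + 2 * (norm x)\<^sup>2 + 2 * d"
    using norm_sq_le_double[of y x] by (simp add: d_def)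
  also have "\<dots> \<le> c * s + c * d"
  proof (intro add_mono)
    have "c * s = 2 * s + (1 + 2 * (norm x)\<^sup>2)" using s by (simp add: c_def field_simps)
    then show "1 + 2 * (norm x)\<^sup>2 \<le> c * s" using s by simp
    show "2 * d \<le> c * d" using d q by (intro mult_right_mono) (auto simp: c_def)
  qed
  finally have "1 + (norm y)\<^sup>2 \<le> c * (s + d)" by (simp add: algebra_simps)
  then have "(1 + (norm y)\<^sup>2)\<^sup>2 \<le> (c * (s + d))\<^sup>2" by (intro power_mono) auto
  moreover have "1 + norm y ^ 4 \<le> (1 + (norm y)\<^sup>2)\<^sup>2" by (simp add: power2_sum flip: power_mult)
  ultimately have "1 + norm y ^ 4 \<le> c\<^sup>2 * (s + d)\<^sup>2" by (simp add: power_mult_distrib)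
  moreover have "1 + norm y ^ 4 > 0" by (simp add: add_pos_nonneg)
  moreover have "1 / M \<le> k / N" if "N \<le> k * M" "N > 0" "M > 0" for N k M :: real
    using that by (simp add: field_simps)
  ultimately show ?thesis
    using s d by (simp add: c_def[symmetric] d_def[symmetric])
qed

text \<open>The condition of \<open>L_half\<close> for Borel functions and \<open>lborel\<close>.
  Values in a Banach space are allowed so that the same mollification serves
  \<open>\<Delta>u\<close> and complex functions.\<close>

definition moderate :: "(real^3 \<Rightarrow> 'b::{banach, second_countable_topology}) \<Rightarrow> bool" where
  "moderate g \<longleftrightarrow> g \<in> borel_measurable borel \<and> integrable lborel (\<lambda>y. norm (g y) / (1 + norm y ^ 4))"

lemma moderate_integrable:
  fixes g :: "real^3 \<Rightarrow> 'b::{banach, second_countable_topology}"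
  assumes g: "integrable lborel g"
  shows "moderate g"
  unfolding moderate_def
proof
  show [measurable]: "g \<in> borel_measurable borel" using g by auto
  have i: "integrable lborel (\<lambda>y. norm (g y))" using g by simp
  show "integrable lborel (\<lambda>y. norm (g y) / (1 + norm y ^ 4))"
  proof (rule integrable_dominated[OF i])
    fix y :: "real^3"
    have "norm (g y) / (1 + norm y ^ 4) \<le> norm (g y) / 1"
      by (intro divide_left_mono) (auto simp: add_pos_nonneg)
    then show "norm (norm (g y) / (1 + norm y ^ 4)) \<le> norm (g y)" by simp
  qed measurable
qed

lemma moderate_bound:
  assumes s: "s > 0" and le: "\<bar>h\<bar> \<le> A / (s + (norm (x - y))\<^sup>2)\<^sup>2"
  shows "norm (h *\<^sub>R g y) \<le> A * (2 + (1 + 2 * (norm x)\<^sup>2) / s)\<^sup>2 * (norm (g y) / (1 + norm y ^ 4))"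
proof -
  have p: "(s + (norm (x - y))\<^sup>2)\<^sup>2 > 0"
    using s by (simp add: add_pos_nonneg)
  have "0 \<le> A / (s + (norm (x - y))\<^sup>2)\<^sup>2" using le by linarith
  then have A: "A \<ge> 0" using p by (simp add: zero_le_divide_iff)
  have "\<bar>h\<bar> \<le> A * (1 / (s + (norm (x - y))\<^sup>2)\<^sup>2)" using le by simp
  also have "\<dots> \<le> A * ((2 + (1 + 2 * (norm x)\<^sup>2) / s)\<^sup>2 / (1 + norm y ^ 4))"
    by (intro mult_left_mono weight_le s A)
  finally have "\<bar>h\<bar> * norm (g y) \<le> A * ((2 + (1 + 2 * (norm x)\<^sup>2) / s)\<^sup>2 / (1 + norm y ^ 4)) * norm (g y)"
    by (intro mult_right_mono) auto
  then show ?thesis by simp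
qed

lemma moderate_pairing:
  assumes g: "moderate g" and s: "s > 0" and h[measurable]: "h \<in> borel_measurable borel"
    and le: "\<And>z. \<bar>h z\<bar> \<le> A / (s + (norm z)\<^sup>2)\<^sup>2"
  shows "integrable lborel (\<lambda>y. h (x - y) *\<^sub>R g y)"
proof -
  have [measurable]: "g \<in> borel_measurable borel" using g by (simp add: moderate_def)
  show ?thesis
    by (rule integrable_dominated[where g = "\<lambda>y. A * (2 + (1 + 2 * (norm x)\<^sup>2) / s)\<^sup>2 * (norm (g y) / (1 + norm y ^ 4))"])
      (use g in \<open>simp_all only: moderate_def integrable_mult_right moderate_bound[OF s le] simp_thms, measurable\<close>)
qed

text \<open>Near \<open>x\<close> continuity is used. Away from \<open>x\<close> the two terms of
  \<open>g y - g x\<close> need different bounds: \<open>g y\<close> is only integrable against a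
  weight and needs algebraic decay, while the constant \<open>g x\<close> needs an integrable
  majorant, for which the kernel at time \<open>2 * s\<close> is taken.\<close>

lemma heat_approx_identity:
  fixes g :: "real^3 \<Rightarrow> 'b::{banach, second_countable_topology}"
  assumes g: "moderate g" and c: "isCont g x"
  shows "((\<lambda>s. \<integral>y. heat s (x - y) *\<^sub>R g y \<partial>lborel) \<longlongrightarrow> g x) (at_right 0)"
proof (rule tendstoI)
  fix e :: real assume e: "e > 0"
  have [measurable]: "g \<in> borel_measurable borel" using g by (simp add: moderate_def)
  define G where "G = (\<integral>y. norm (g y) / (1 + norm y ^ 4) \<partial>lborel)"
  obtain d where d: "d > 0" "\<And>y. norm (y - x) < d \<Longrightarrow> norm (g y - g x) < e / 2"
    using c e unfolding continuous_at_eps_delta dist_norm by (metis half_gt_zero)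
  define K where "K = 160000 * (2 + (1 + 2 * (norm x)\<^sup>2) / d\<^sup>2)\<^sup>2"
  have iG: "integrable lborel (\<lambda>y. norm (g y) / (1 + norm y ^ 4))" using g by (simp add: moderate_def)
  have main: "norm ((\<integral>y. heat s (x - y) *\<^sub>R g y \<partial>lborel) - g x)
      \<le> e / 2 + K * G * sqrt s + norm (g x) * 2000 / d\<^sup>2 * s" if s: "s > 0" for s
  proof -
    have i1: "integrable lborel (\<lambda>y. heat s (x - y) *\<^sub>R g y)"
      by (rule moderate_pairing[OF g s, of _ "40000 * sqrt s"])
        (use heat_bounds(1)[OF s] heat_nonneg[OF s] in auto)
    have ih: "integrable lborel (\<lambda>y. heat s (x - y))" if "s > 0" for s
      using heat_integrable[OF that] by (subst lborel_integrable_reflect) auto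
    have vh: "(\<integral>y. heat s (x - y) \<partial>lborel) = 1" if "s > 0" for s
      using heat_integral[OF that] by (subst lborel_integral_reflect) auto
    have i2: "integrable lborel (\<lambda>y. heat s (x - y) *\<^sub>R g x)"
      using ih[OF s] by simp
    have "(\<integral>y. heat s (x - y) *\<^sub>R g y \<partial>lborel) - g x = (\<integral>y. heat s (x - y) *\<^sub>R (g y - g x) \<partial>lborel)"
      using vh[OF s] i1 i2 by (simp add: scaleR_diff_right ih s)
    also have "norm \<dots> \<le> (\<integral>y. norm (heat s (x - y) *\<^sub>R (g y - g x)) \<partial>lborel)"
      by (rule integral_norm_bound)
    also have "\<dots> \<le> (\<integral>y. e / 2 * heat s (x - y) + K * sqrt s * (norm (g y) / (1 + norm y ^ 4))
        + norm (g x) * (2000 * s / d\<^sup>2) * heat (2 * s) (x - y) \<partial>lborel)"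
    proof (rule integral_mono)
      show "integrable lborel (\<lambda>y. norm (heat s (x - y) *\<^sub>R (g y - g x)))"
        using i1 i2 by (intro integrable_norm) (simp add: scaleR_diff_right)
      show "integrable lborel (\<lambda>y. e / 2 * heat s (x - y) + K * sqrt s * (norm (g y) / (1 + norm y ^ 4))
        + norm (g x) * (2000 * s / d\<^sup>2) * heat (2 * s) (x - y))"
        using s by (intro Bochner_Integration.integrable_add integrable_mult_right ih iG) auto
      fix y
      have nn: "0 \<le> K * sqrt s * (norm (g y) / (1 + norm y ^ 4))"
        using s by (auto simp: K_def intro!: mult_nonneg_nonneg divide_nonneg_nonneg)
      have nn2: "0 \<le> norm (g x) * (2000 * s / d\<^sup>2) * heat (2 * s) (x - y)"
        using s heat_nonneg[of "2 * s"] by (intro mult_nonneg_nonneg) auto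
      show "norm (heat s (x - y) *\<^sub>R (g y - g x)) \<le> e / 2 * heat s (x - y) + K * sqrt s * (norm (g y) / (1 + norm y ^ 4))
        + norm (g x) * (2000 * s / d\<^sup>2) * heat (2 * s) (x - y)"
      proof (cases "norm (y - x) < d")
        case True
        have "heat s (x - y) * norm (g y - g x) \<le> heat s (x - y) * (e / 2)"
          using d(2)[OF True] heat_nonneg[OF s] by (intro mult_left_mono) auto
        then show ?thesis using nn nn2 heat_nonneg[OF s] by (simp add: mult_ac)
      next
        case False
        define r where "r = norm (x - y)"
        have r: "d \<le> r" using False by (simp add: r_def norm_minus_commute)
        have dr: "d\<^sup>2 \<le> r\<^sup>2" using r d by (intro power_mono) auto
        \<comment> \<open>As \<open>d \<le> r\<close>, the time in the algebraic bound may be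
          replaced by \<open>d^2\<close> at the price of a factor 4. The constant \<open>K\<close>
          is then independent of \<open>s\<close>, and \<open>sqrt s\<close> makes the term
          small.\<close>
        have "(d\<^sup>2 + r\<^sup>2)\<^sup>2 \<le> (2 * r\<^sup>2)\<^sup>2" using dr by (intro power_mono) auto
        also have "\<dots> \<le> 4 * (s + r\<^sup>2)\<^sup>2"
          using s power_mono[of "r\<^sup>2" "s + r\<^sup>2" 2] by (simp add: power_mult_distrib)
        finally have "40000 * sqrt s / (s + r\<^sup>2)\<^sup>2 \<le> 160000 * sqrt s / (d\<^sup>2 + r\<^sup>2)\<^sup>2"
          using s d r by (simp add: divide_simps add_pos_nonneg)
        then have "\<bar>heat s (x - y)\<bar> \<le> 160000 * sqrt s / (d\<^sup>2 + (norm (x - y))\<^sup>2)\<^sup>2"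
          using heat_bounds(1)[OF s, of "x - y"] heat_nonneg[OF s] by (simp add: r_def)
        from moderate_bound[OF _ this, of g] d
        have 1: "heat s (x - y) * norm (g y) \<le> K * sqrt s * (norm (g y) / (1 + norm y ^ 4))"
          using heat_nonneg[OF s] by (simp add: K_def mult_ac)
        \<comment> \<open>\<open>X\<close> is at least \<open>d^2 / (4 * s)\<close>, so absorbing
          one factor \<open>X\<close> into the kernel at time \<open>2 * s\<close> gains the factor
          \<open>4 * s / d^2\<close>.\<close>
        define X where "X = r\<^sup>2 / (4 * s)"
        have X: "d\<^sup>2 / (4 * s) \<le> X" using dr s by (simp add: X_def divide_right_mono)
        have hX: "d\<^sup>2 / (4 * s) * heat s (x - y) \<le> heat s (x - y) * X"
          using mult_right_mono[OF X heat_nonneg[OF s, of "x - y"]] by (simp only: mult.commute)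
        have "X \<le> (X + 3)\<^sup>2"
        proof -
          have "X \<ge> 0" using s by (simp add: X_def)
          then show ?thesis by (simp add: power2_eq_square algebra_simps)
        qed
        then have "heat s (x - y) * X \<le> 500 * heat (2 * s) (x - y)"
          by (intro heat_poly_bound(2)[OF s]) (use s in \<open>auto simp: X_def r_def\<close>)
        with hX have "d\<^sup>2 / (4 * s) * heat s (x - y) \<le> 500 * heat (2 * s) (x - y)"
          by linarith
        then have "heat s (x - y) \<le> 2000 * s / d\<^sup>2 * heat (2 * s) (x - y)"
          using s d by (simp add: field_simps)
        from mult_left_mono[OF this, of "norm (g x)"]
        have 2: "heat s (x - y) * norm (g x) \<le> norm (g x) * (2000 * s / d\<^sup>2) * heat (2 * s) (x - y)"
          by (simp add: mult_ac)
        have "heat s (x - y) * norm (g y - g x) \<le> heat s (x - y) * (norm (g y) + norm (g x))"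
          using heat_nonneg[OF s] by (intro mult_left_mono norm_triangle_ineq4) auto
        then show ?thesis
          using 1 2 heat_nonneg[OF s] mult_nonneg_nonneg[OF less_imp_le[OF e] heat_nonneg[OF s, of "x - y"]]
          by (simp add: distrib_left abs_of_nonneg)
      qed
    qed
    also have "\<dots> = e / 2 * 1 + K * sqrt s * G + norm (g x) * (2000 * s / d\<^sup>2) * 1"
    proof (intro has_bochner_integral_integral_eq has_bochner_integral_add has_bochner_integral_mult_right)
      show "has_bochner_integral lborel (\<lambda>y. heat s (x - y)) 1"
        "has_bochner_integral lborel (\<lambda>y. heat (2 * s) (x - y)) 1"
        "has_bochner_integral lborel (\<lambda>y. norm (g y) / (1 + norm y ^ 4)) G"
        using ih[OF s] ih[of "2 * s"] iG vh[OF s] vh[of "2 * s"] s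
        by (simp_all add: has_bochner_integral_iff G_def)
    qed
    finally show ?thesis by (simp add: mult_ac)
  qed
  have "((\<lambda>s. e / 2 + K * G * sqrt s + norm (g x) * 2000 / d\<^sup>2 * s) \<longlongrightarrow> e / 2 + K * G * sqrt 0 + norm (g x) * 2000 / d\<^sup>2 * 0) (at_right 0)"
    by (intro tendsto_intros)
  then have "\<forall>\<^sub>F s in at_right 0. e / 2 + K * G * sqrt s + norm (g x) * 2000 / d\<^sup>2 * s < e"
    by (rule order_tendstoD) (use e in simp)
  then show "\<forall>\<^sub>F s in at_right 0. dist (\<integral>y. heat s (x - y) *\<^sub>R g y \<partial>lborel) (g x) < e"
    using eventually_at_right_less[of 0]
  proof eventually_elim
    case (elim s)
    then show ?case using main[of s] by (simp add: dist_norm)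
  qed
qed

section \<open>The Fourier transform\<close>

lemma integrable_pair_dominated:
  fixes h :: "'a::euclidean_space \<times> 'b::euclidean_space \<Rightarrow> 'c::{banach, second_countable_topology}"
    and f :: "'a \<Rightarrow> real" and g :: "'b \<Rightarrow> real"
  assumes f: "integrable lborel f" and g: "integrable lborel g"
    and h: "h \<in> borel_measurable (lborel \<Otimes>\<^sub>M lborel)"
    and le: "\<And>x y. norm (h (x, y)) \<le> f x * g y"
  shows "integrable (lborel \<Otimes>\<^sub>M lborel) h"
proof -
  have [measurable]: "f \<in> borel_measurable borel" "g \<in> borel_measurable borel"
    using f g by auto
  have "integrable (lborel \<Otimes>\<^sub>M lborel) (\<lambda>(x, y). f x * g y)"
  proof (rule lborel_pair.Fubini_integrable)
    show "(\<lambda>(x, y). f x * g y) \<in> borel_measurable (lborel \<Otimes>\<^sub>M lborel)" by measurable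
    have "integrable lborel (\<lambda>x. \<bar>f x\<bar> * (\<integral>y. \<bar>g y\<bar> \<partial>lborel))"
      using f by (intro integrable_mult_left) simp
    then show "integrable lborel (\<lambda>x. \<integral>y. norm (case (x, y) of (x, y) \<Rightarrow> f x * g y) \<partial>lborel)"
      by (simp add: abs_mult)
  qed (use g in simp)
  then show ?thesis
    by (rule integrable_dominated) (use h le in auto)
qed

lemma integrable_cis_mult:
  fixes \<psi> :: "real^3 \<Rightarrow> complex"
  assumes "integrable lborel \<psi>" and [measurable]: "t \<in> borel_measurable borel"
  shows "integrable lborel (\<lambda>x. cis (t x) * \<psi> x)"
proof (rule integrable_dominated)
  show "integrable lborel (\<lambda>x. norm (\<psi> x))" using assms by simp
  have [measurable]: "\<psi> \<in> borel_measurable borel" using assms by auto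
  show "(\<lambda>x. cis (t x) * \<psi> x) \<in> borel_measurable lborel"
    unfolding cis_conv_exp by measurable
qed (simp add: norm_mult)

text \<open>A Gaussian is its own Fourier transform up to scaling: time \<open>s\<close> corresponds
  to time \<open>1 / (4 * s)\<close>.\<close>

lemma heat_fourier_representation:
  assumes s: "s > 0"
  shows "complex_of_real (heat s z) = complex_of_real ((1 / sqrt (4 * pi * s)) ^ 3) *
    (\<integral>x. complex_of_real (heat (1 / (4 * s)) x) * cis (z \<bullet> x) \<partial>lborel)"
  using s by (subst heat_fourier_cis(2)) (auto simp: heat_def)

text \<open>Inserting the Fourier representation of the heat kernel, Fubini turns the mollification
  of \<open>\<psi>\<close> into an integral over \<open>fourier \<psi>\<close>, hence into 0, and
  \<open>s\<close> tends to 0. The Gaussian in \<open>\<xi>\<close> makes the double integral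
  absolutely convergent. This uniqueness is what gives meaning to the definite description in
  \<open>half_laplacian\<close>.\<close>

lemma fourier_eq_0_imp_eq_0:
  assumes c: "continuous_on UNIV \<psi>" and i: "integrable lborel \<psi>" and z: "\<And>\<xi>. fourier \<psi> \<xi> = 0"
  shows "\<psi> x = 0"
proof -
  have [measurable]: "\<psi> \<in> borel_measurable borel" using i by auto
  have "(\<integral>y. heat s (x - y) *\<^sub>R \<psi> y \<partial>lborel) = 0" if s: "s > 0" for s
  proof -
    define r where "r = 1 / (4 * s)"
    define k where "k = (1 / sqrt (4 * pi * s)) ^ 3"
    have r: "r > 0" using s by (simp add: r_def)
    have m: "(\<lambda>p. complex_of_real (heat r (snd p)) * cis ((x - fst p) \<bullet> snd p) * \<psi> (fst p))
        \<in> borel_measurable (lborel \<Otimes>\<^sub>M lborel)"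
      unfolding cis_conv_exp by measurable
    have I: "integrable (lborel \<Otimes>\<^sub>M lborel)
        (\<lambda>p. complex_of_real (heat r (snd p)) * cis ((x - fst p) \<bullet> snd p) * \<psi> (fst p))"
      by (rule integrable_pair_dominated[where f = "\<lambda>y. norm (\<psi> y)" and g = "heat r", OF _ _ m])
        (use i heat_integrable[OF r] heat_nonneg[OF r] in \<open>auto simp: norm_mult\<close>)
    have "(\<integral>y. heat s (x - y) *\<^sub>R \<psi> y \<partial>lborel) =
       (\<integral>y. complex_of_real k * (\<integral>\<xi>. complex_of_real (heat r \<xi>) * cis ((x - y) \<bullet> \<xi>) * \<psi> y \<partial>lborel) \<partial>lborel)"
      by (intro Bochner_Integration.integral_cong refl)
        (simp add: scaleR_conv_of_real heat_fourier_representation[OF s] r_def k_def mult_ac)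
    also have "\<dots> = complex_of_real k * (\<integral>y. (\<integral>\<xi>. complex_of_real (heat r \<xi>) * cis ((x - y) \<bullet> \<xi>) * \<psi> y \<partial>lborel) \<partial>lborel)"
      by simp
    also have "(\<integral>y. (\<integral>\<xi>. complex_of_real (heat r \<xi>) * cis ((x - y) \<bullet> \<xi>) * \<psi> y \<partial>lborel) \<partial>lborel)
       = (\<integral>\<xi>. (\<integral>y. complex_of_real (heat r \<xi>) * cis ((x - y) \<bullet> \<xi>) * \<psi> y \<partial>lborel) \<partial>lborel)"
      by (rule lborel_pair.Fubini_integral[symmetric]) (use I in \<open>simp only: case_prod_unfold\<close>)
    also have "\<dots> = (\<integral>\<xi>. complex_of_real (heat r \<xi>) * cis (x \<bullet> \<xi>) * fourier \<psi> \<xi> \<partial>lborel)"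
    proof (intro Bochner_Integration.integral_cong refl)
      fix \<xi> :: "real^3"
      have eq: "complex_of_real (heat r \<xi>) * cis ((x - y) \<bullet> \<xi>) * \<psi> y =
         complex_of_real (heat r \<xi>) * cis (x \<bullet> \<xi>) * (cis (- (\<xi> \<bullet> y)) * \<psi> y)" for y
      proof -
        have "cis ((x - y) \<bullet> \<xi>) = cis (x \<bullet> \<xi>) * cis (- (\<xi> \<bullet> y))"
          by (simp add: cis_mult inner_diff_left inner_commute[of y])
        then show ?thesis by simp
      qed
      then show "(\<integral>y. complex_of_real (heat r \<xi>) * cis ((x - y) \<bullet> \<xi>) * \<psi> y \<partial>lborel) =
          complex_of_real (heat r \<xi>) * cis (x \<bullet> \<xi>) * fourier \<psi> \<xi>"
        by (simp only: eq fourier_def integral_mult_right_zero)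
    qed
    also have "\<dots> = 0" by (simp add: z)
    finally show ?thesis by simp
  qed
  then have ev: "\<forall>\<^sub>F s in at_right 0. (\<integral>y. heat s (x - y) *\<^sub>R \<psi> y \<partial>lborel) = 0"
    using eventually_at_right_less[of 0] by (auto elim: eventually_mono)
  have cx: "isCont \<psi> x"
    using c by (simp add: continuous_on_eq_continuous_at)
  have "((\<lambda>s. 0) \<longlongrightarrow> \<psi> x) (at_right (0::real))"
    by (rule Lim_transform_eventually[OF heat_approx_identity[OF moderate_integrable[OF i] cx] ev])
  then show ?thesis
    using tendsto_unique[OF trivial_limit_at_right_real _ tendsto_const] by blast
qed

lemma fourier_even_translate:
  assumes g: "integrable lborel g" and ev: "\<And>z. g (- z) = g z"
  shows "fourier (\<lambda>y. complex_of_real (g (x - y))) \<xi> =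
    cis (- (\<xi> \<bullet> x)) * complex_of_real (\<integral>z. g z * cos (\<xi> \<bullet> z) \<partial>lborel)"
proof -
  have [measurable]: "g \<in> borel_measurable borel" using g by auto
  have ic: "integrable lborel (\<lambda>z. cis (\<xi> \<bullet> z) * complex_of_real (g z))"
    using g by (intro integrable_cis_mult) auto
  have "(\<integral>z. sin (\<xi> \<bullet> z) * g z \<partial>lborel) = (\<integral>z. sin (\<xi> \<bullet> (0 - z)) * g (0 - z) \<partial>lborel)"
    by (rule lborel_integral_reflect[symmetric]) measurable
  then have 0: "(\<integral>z. sin (\<xi> \<bullet> z) * g z \<partial>lborel) = 0" by (simp add: ev)
  have "fourier (\<lambda>y. complex_of_real (g (x - y))) \<xi> =
     (\<integral>y. cis (- (\<xi> \<bullet> (x - (x - y)))) * complex_of_real (g (x - y)) \<partial>lborel)"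
    by (simp add: fourier_def)
  also have "\<dots> = (\<integral>z. cis (- (\<xi> \<bullet> (x - z))) * complex_of_real (g z) \<partial>lborel)"
    by (rule lborel_integral_reflect) (simp add: cis_conv_exp)
  also have "\<dots> = (\<integral>z. cis (- (\<xi> \<bullet> x)) * (cis (\<xi> \<bullet> z) * complex_of_real (g z)) \<partial>lborel)"
    by (simp add: inner_diff_right cis_mult flip: mult.assoc)
  also have "\<dots> = cis (- (\<xi> \<bullet> x)) * (\<integral>z. cis (\<xi> \<bullet> z) * complex_of_real (g z) \<partial>lborel)"
    by simp
  also have "(\<integral>z. cis (\<xi> \<bullet> z) * complex_of_real (g z) \<partial>lborel) = complex_of_real (\<integral>z. g z * cos (\<xi> \<bullet> z) \<partial>lborel)"
    using integral_Re[OF ic] integral_Im[OF ic] 0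
    by (intro complex_eqI) (simp_all add: mult.commute)
  finally show ?thesis .
qed

section \<open>The half Laplacian of the time derivative of the heat kernel\<close>

text \<open>Candidate for the half Laplacian of \<open>heat1\<close>: its transform is to be
  \<open>- |\<xi>|^3 * exp (- s * |\<xi>|^2)\<close>. Write \<open>|\<xi>|^3\<close> as
  \<open>|\<xi>|^4 / |\<xi>|\<close>, recognise \<open>|\<xi>|^4 * exp (- s * |\<xi>|^2)\<close> as
  the transform of \<open>heat2\<close>, and expand \<open>1 / |\<xi>|\<close> by
  \<open>inv_sqrt_exp\<close>.\<close>

definition heat_half :: "real \<Rightarrow> real^3 \<Rightarrow> real" where
  "heat_half s z = - (1 / sqrt pi) * (\<integral>t. inv_sqrt t * heat2 (s + t) z \<partial>lborel)"

text \<open>The decay \<open>(s + t)^(-3/2)\<close> is left for the integral over \<open>t\<close>,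
  while the spatial factor is frozen at time \<open>s\<close>.\<close>

lemma heat2_weighted_bound:
  assumes s: "s > 0"
  shows "\<bar>inv_sqrt t * heat2 (s + t) z\<bar> \<le>
    inv_sqrt t * (1 / ((s + t) * sqrt (s + t))) * (40000 / (s + (norm z)\<^sup>2)\<^sup>2)"
proof (cases "t > 0")
  case True
  have "\<bar>heat2 (s + t) z\<bar> \<le> 40000 / ((s + t) * sqrt (s + t) * (s + t + (norm z)\<^sup>2)\<^sup>2)"
    using heat_bounds(3)[of "s + t" z] s True by simp
  also have "\<dots> = 1 / ((s + t) * sqrt (s + t)) * (40000 / (s + t + (norm z)\<^sup>2)\<^sup>2)" by simp
  also have "\<dots> \<le> 1 / ((s + t) * sqrt (s + t)) * (40000 / (s + (norm z)\<^sup>2)\<^sup>2)"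
    using s True by (intro mult_left_mono divide_left_mono power_mono mult_pos_pos zero_less_power) (auto simp: add_pos_nonneg)
  finally have "inv_sqrt t * \<bar>heat2 (s + t) z\<bar> \<le> inv_sqrt t * (1 / ((s + t) * sqrt (s + t)) * (40000 / (s + (norm z)\<^sup>2)\<^sup>2))"
    by (rule mult_left_mono) simp
  then show ?thesis by (simp add: abs_mult mult.assoc)
qed (simp add: inv_sqrt_def)

lemma heat_half_integrand:
  assumes s: "s > 0"
  shows "integrable lborel (\<lambda>t. inv_sqrt t * heat2 (s + t) z)"
proof (rule integrable_dominated)
  show "integrable lborel (\<lambda>t. inv_sqrt t * (1 / ((s + t) * sqrt (s + t))) * (40000 / (s + (norm z)\<^sup>2)\<^sup>2))"
    by (intro integrable_mult_left inv_sqrt_three_halves s)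
qed (use heat2_weighted_bound[OF s] in auto)

lemma heat_half_bound:
  assumes s: "s > 0"
  shows "\<bar>heat_half s z\<bar> \<le> 80000 / s / (s + (norm z)\<^sup>2)\<^sup>2"
proof -
  have "\<bar>\<integral>t. inv_sqrt t * heat2 (s + t) z \<partial>lborel\<bar> \<le>
    (\<integral>t. inv_sqrt t * (1 / ((s + t) * sqrt (s + t))) * (40000 / (s + (norm z)\<^sup>2)\<^sup>2) \<partial>lborel)"
    using heat2_weighted_bound[OF s] inv_sqrt_three_halves(1)[OF s] heat_half_integrand[OF s]
    by (intro order_trans[OF integral_abs_bound] integral_mono integrable_mult_left integrable_abs) auto
  also have "\<dots> = 80000 / s / (s + (norm z)\<^sup>2)\<^sup>2"
    by (simp only: integral_mult_left_zero inv_sqrt_three_halves(2)[OF s]) simp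
  finally have *: "\<bar>\<integral>t. inv_sqrt t * heat2 (s + t) z \<partial>lborel\<bar> \<le> 80000 / s / (s + (norm z)\<^sup>2)\<^sup>2" .
  have "1 \<le> sqrt pi" using pi_gt3 by simp
  then have "1 / sqrt pi \<le> 1" by simp
  then have "1 / sqrt pi * \<bar>\<integral>t. inv_sqrt t * heat2 (s + t) z \<partial>lborel\<bar> \<le> 1 * (80000 / s / (s + (norm z)\<^sup>2)\<^sup>2)"
    using * by (intro mult_mono) auto
  then show ?thesis by (simp add: heat_half_def abs_mult)
qed

lemma heat_half_continuous:
  assumes s: "s > 0"
  shows "continuous_on UNIV (heat_half s)"
proof -
  have "isCont (\<lambda>z. \<integral>t. inv_sqrt t * heat2 (s + t) z \<partial>lborel) z" for z
    unfolding continuous_at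
  proof (rule tendsto_integral_at_within)
    show "integrable lborel (\<lambda>t. inv_sqrt t * (1 / ((s + t) * sqrt (s + t))) * (40000 / s\<^sup>2))"
      by (intro integrable_mult_left inv_sqrt_three_halves s)
    have "norm (inv_sqrt t * heat2 (s + t) z) \<le> inv_sqrt t * (1 / ((s + t) * sqrt (s + t))) * (40000 / s\<^sup>2)" for t z
    proof (cases "t > 0")
      case True
      have "inv_sqrt t * (1 / ((s + t) * sqrt (s + t))) * (40000 / (s + (norm z)\<^sup>2)\<^sup>2) \<le>
          inv_sqrt t * (1 / ((s + t) * sqrt (s + t))) * (40000 / s\<^sup>2)"
        using s True by (intro mult_left_mono divide_left_mono power_mono mult_pos_pos zero_less_power) (auto simp: add_pos_nonneg)
      then show ?thesis using heat2_weighted_bound[OF s, of t z] by simp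
    qed (simp add: inv_sqrt_def)
    then show "\<forall>\<^sub>F y in at z. AE t in lborel. norm (inv_sqrt t * heat2 (s + t) y) \<le>
        inv_sqrt t * (1 / ((s + t) * sqrt (s + t))) * (40000 / s\<^sup>2)"
      by simp
    have "((\<lambda>y. inv_sqrt t * heat2 (s + t) y) \<longlongrightarrow> inv_sqrt t * heat2 (s + t) z) (at z)" for t
    proof (cases "t > 0")
      case True
      then have "isCont (heat2 (s + t)) z"
        using continuous_heat(3)[of "s + t" UNIV] s by (simp add: continuous_on_eq_continuous_at)
      then show ?thesis by (intro tendsto_mult tendsto_const) (simp add: continuous_at)
    qed (simp add: inv_sqrt_def)
    then show "AE t in lborel. ((\<lambda>y. inv_sqrt t * heat2 (s + t) y) \<longlongrightarrow> inv_sqrt t * heat2 (s + t) z) (at z)"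
      by simp
  qed auto
  then show ?thesis
    unfolding heat_half_def by (intro continuous_intros) (simp add: continuous_on_eq_continuous_at)
qed

lemma heat_half_pair_integrable:
  assumes s: "s > 0"
  shows "integrable (lborel \<Otimes>\<^sub>M lborel) (\<lambda>(t, z). inv_sqrt t * heat2 (s + t) z)"
proof (rule lborel_pair.Fubini_integrable)
  show "(\<lambda>(t, z). inv_sqrt t * heat2 (s + t) z) \<in> borel_measurable (lborel \<Otimes>\<^sub>M lborel)"
    by measurable
  show "AE t in lborel. integrable lborel (\<lambda>z. case (t, z) of (t, z) \<Rightarrow> inv_sqrt t * heat2 (s + t) z)"
  proof (rule AE_I2)
    fix t show "integrable lborel (\<lambda>z. case (t, z) of (t, z) \<Rightarrow> inv_sqrt t * heat2 (s + t) z)"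
      using heat2_integrable[of "s + t"] s by (cases "t > 0") (auto simp: inv_sqrt_def)
  qed
  show "integrable lborel (\<lambda>t. \<integral>z. norm (case (t, z) of (t, z) \<Rightarrow> inv_sqrt t * heat2 (s + t) z) \<partial>lborel)"
  proof (rule integrable_dominated)
    show "integrable lborel (\<lambda>t. inv_sqrt t * (1 / ((s + t) * sqrt (s + t))) * (500 / sqrt s))"
      by (intro integrable_mult_left inv_sqrt_three_halves s)
    fix t
    show "norm (\<integral>z. norm (case (t, z) of (t, z) \<Rightarrow> inv_sqrt t * heat2 (s + t) z) \<partial>lborel) \<le>
        inv_sqrt t * (1 / ((s + t) * sqrt (s + t))) * (500 / sqrt s)"
    proof (cases "t > 0")
      case True
      have "(\<integral>z. \<bar>heat2 (s + t) z\<bar> \<partial>lborel) \<le> 500 / (s + t)\<^sup>2" using heat2_L1[of "s + t"] s True by simp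
      also have "(s + t)\<^sup>2 = (s + t) * sqrt (s + t) * sqrt (s + t)"
        using s True by (simp add: power2_eq_square)
      then have "500 / (s + t)\<^sup>2 = 1 / ((s + t) * sqrt (s + t)) * (500 / sqrt (s + t))" by simp
      also have "\<dots> \<le> 1 / ((s + t) * sqrt (s + t)) * (500 / sqrt s)"
        using s True by (intro mult_left_mono divide_left_mono) auto
      finally have "inv_sqrt t * (\<integral>z. \<bar>heat2 (s + t) z\<bar> \<partial>lborel) \<le> inv_sqrt t * (1 / ((s + t) * sqrt (s + t)) * (500 / sqrt s))"
        by (intro mult_left_mono) auto
      then show ?thesis by (simp add: abs_mult mult.assoc)
    qed (simp add: inv_sqrt_def)
  qed measurable
qed

lemma
  assumes s: "s > 0"
  shows heat_half_integrable: "integrable lborel (heat_half s)"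
    and heat_half_cos: "(\<integral>z. heat_half s z * cos (\<xi> \<bullet> z) \<partial>lborel) = - ((norm \<xi>) ^ 3) * exp (- s * (norm \<xi>)\<^sup>2)"
proof -
  note P = heat_half_pair_integrable[OF s]
  have P': "integrable (lborel \<Otimes>\<^sub>M lborel) (\<lambda>(z, t). inv_sqrt t * heat2 (s + t) z)"
    using lborel_pair.integrable_product_swap_iff[of "\<lambda>(t, z). inv_sqrt t * heat2 (s + t) z"] P
    by (simp add: split_beta)
  show "integrable lborel (heat_half s)"
    using lborel_pair.integrable_fst'[OF P'] unfolding heat_half_def
    by (intro integrable_mult_right) simp
  have Pc: "integrable (lborel \<Otimes>\<^sub>M lborel) (\<lambda>(z, t). inv_sqrt t * heat2 (s + t) z * cos (\<xi> \<bullet> z))"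
  proof (rule Bochner_Integration.integrable_bound[OF P'])
    show "(\<lambda>(z, t). inv_sqrt t * heat2 (s + t) z * cos (\<xi> \<bullet> z)) \<in> borel_measurable (lborel \<Otimes>\<^sub>M lborel)"
      by measurable
    show "AE p in lborel \<Otimes>\<^sub>M lborel. norm (case p of (z, t) \<Rightarrow> inv_sqrt t * heat2 (s + t) z * cos (\<xi> \<bullet> z))
        \<le> norm (case p of (z, t) \<Rightarrow> inv_sqrt t * heat2 (s + t) z)"
      by (intro AE_I2) (auto simp: abs_mult intro!: mult_left_le)
  qed
  have "(\<integral>z. heat_half s z * cos (\<xi> \<bullet> z) \<partial>lborel) =
      - (1 / sqrt pi) * (\<integral>z. (\<integral>t. inv_sqrt t * heat2 (s + t) z * cos (\<xi> \<bullet> z) \<partial>lborel) \<partial>lborel)"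
    by (simp add: heat_half_def)
  also have "(\<integral>z. (\<integral>t. inv_sqrt t * heat2 (s + t) z * cos (\<xi> \<bullet> z) \<partial>lborel) \<partial>lborel) =
      (\<integral>t. (\<integral>z. inv_sqrt t * heat2 (s + t) z * cos (\<xi> \<bullet> z) \<partial>lborel) \<partial>lborel)"
    using lborel_pair.Fubini_integral[OF Pc] by simp
  also have "\<dots> = (\<integral>t. inv_sqrt t * exp (- ((norm \<xi>)\<^sup>2 * t)) * ((norm \<xi>) ^ 4 * exp (- s * (norm \<xi>)\<^sup>2)) \<partial>lborel)"
  proof (intro Bochner_Integration.integral_cong refl)
    fix t
    show "(\<integral>z. inv_sqrt t * heat2 (s + t) z * cos (\<xi> \<bullet> z) \<partial>lborel) =
        inv_sqrt t * exp (- ((norm \<xi>)\<^sup>2 * t)) * ((norm \<xi>) ^ 4 * exp (- s * (norm \<xi>)\<^sup>2))"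
    proof (cases "t > 0")
      case True
      have "(\<integral>z. inv_sqrt t * heat2 (s + t) z * cos (\<xi> \<bullet> z) \<partial>lborel) =
         inv_sqrt t * (\<integral>z. heat2 (s + t) z * cos (\<xi> \<bullet> z) \<partial>lborel)"
        by (simp add: mult.assoc)
      also have "\<dots> = inv_sqrt t * ((norm \<xi>) ^ 4 * exp (- (s + t) * (norm \<xi>)\<^sup>2))"
        using heat2_cos[of "s + t" \<xi>] s True by simp
      also have "exp (- (s + t) * (norm \<xi>)\<^sup>2) = exp (- ((norm \<xi>)\<^sup>2 * t)) * exp (- s * (norm \<xi>)\<^sup>2)"
        by (simp add: algebra_simps flip: exp_add)
      finally show ?thesis by simp
    qed (simp add: inv_sqrt_def)
  qed
  also have "\<dots> = sqrt pi * (norm \<xi>) ^ 3 * exp (- s * (norm \<xi>)\<^sup>2)"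
  \<comment> \<open>\<open>inv_sqrt_exp\<close> needs a positive exponent; at
    \<open>\<xi> = 0\<close> both sides vanish.\<close>
  proof (cases "\<xi> = 0")
    case False
    then show ?thesis
      using inv_sqrt_exp[of "(norm \<xi>)\<^sup>2"] by (simp add: real_sqrt_divide eval_nat_numeral)
  qed simp
  finally show "(\<integral>z. heat_half s z * cos (\<xi> \<bullet> z) \<partial>lborel) = - ((norm \<xi>) ^ 3) * exp (- s * (norm \<xi>)\<^sup>2)"
    by simp
qed

lemma heat_half_minus: "heat_half s (- z) = heat_half s z"
  by (simp add: heat_half_def)

text \<open>Existence follows by comparing Fourier transforms, which for even kernels are real
  multiples of the character at \<open>x\<close>; uniqueness is \<open>fourier_eq_0_imp_eq_0\<close>
  applied to the difference of two candidates.\<close>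

lemma half_laplacian_heat1:
  assumes s: "s > 0"
  shows "half_laplacian (\<lambda>y. complex_of_real (heat1 s (x - y))) = (\<lambda>y. complex_of_real (heat_half s (x - y)))"
  unfolding half_laplacian_def
proof (rule the_equality)
  have F: "fourier (\<lambda>y. complex_of_real (heat_half s (x - y))) \<xi> =
      complex_of_real (norm \<xi>) * fourier (\<lambda>y. complex_of_real (heat1 s (x - y))) \<xi>" for \<xi>
    by (subst (1 2) fourier_even_translate)
      (use s in \<open>auto simp: heat_half_integrable heat1_integrable heat_half_minus heat_half_cos heat1_cos eval_nat_numeral\<close>)
  have hm: "heat_half s \<in> borel_measurable borel" using heat_half_integrable[OF s] by auto
  have C: "continuous_on UNIV (\<lambda>y. complex_of_real (heat_half s (x - y)))"
    by (intro continuous_intros continuous_on_compose2[OF heat_half_continuous[OF s]]) auto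
  have I: "integrable lborel (\<lambda>y. complex_of_real (heat_half s (x - y)))"
    using heat_half_integrable[OF s] lborel_integrable_reflect[OF hm, of x] by simp
  show "continuous_on UNIV (\<lambda>y. complex_of_real (heat_half s (x - y))) \<and>
    integrable lborel (\<lambda>y. complex_of_real (heat_half s (x - y))) \<and>
    (\<forall>\<xi>. fourier (\<lambda>y. complex_of_real (heat_half s (x - y))) \<xi> =
      complex_of_real (norm \<xi>) * fourier (\<lambda>y. complex_of_real (heat1 s (x - y))) \<xi>)"
    using F C I by blast
  fix \<psi> :: "real^3 \<Rightarrow> complex"
  assume a: "continuous_on UNIV \<psi> \<and> integrable lborel \<psi> \<and>
    (\<forall>\<xi>. fourier \<psi> \<xi> = complex_of_real (norm \<xi>) * fourier (\<lambda>y. complex_of_real (heat1 s (x - y))) \<xi>)"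
  show "\<psi> = (\<lambda>y. complex_of_real (heat_half s (x - y)))"
  proof
    fix y
    have "\<psi> y - complex_of_real (heat_half s (x - y)) = 0"
    proof (rule fourier_eq_0_imp_eq_0[where \<psi> = "\<lambda>y. \<psi> y - complex_of_real (heat_half s (x - y))"])
      show "continuous_on UNIV (\<lambda>y. \<psi> y - complex_of_real (heat_half s (x - y)))"
        using a C by (intro continuous_intros) auto
      show "integrable lborel (\<lambda>y. \<psi> y - complex_of_real (heat_half s (x - y)))"
        using a I by (intro Bochner_Integration.integrable_diff) auto
      fix \<xi>
      have "fourier (\<lambda>y. \<psi> y - complex_of_real (heat_half s (x - y))) \<xi> =
        fourier \<psi> \<xi> - fourier (\<lambda>y. complex_of_real (heat_half s (x - y))) \<xi>"
        using a I by (simp add: fourier_def right_diff_distrib integrable_cis_mult)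
      then show "fourier (\<lambda>y. \<psi> y - complex_of_real (heat_half s (x - y))) \<xi> = 0"
        using a F by simp
    qed
    then show "\<psi> y = complex_of_real (heat_half s (x - y))" by simp
  qed
qed

section \<open>Gaussians are Schwartz functions\<close>

lemma partial_deriv_eqI:
  "((\<lambda>t. f (x + t *\<^sub>R axis i 1)) has_vector_derivative d) (at 0) \<Longrightarrow> partial_deriv i f x = d"
  unfolding partial_deriv_def by (rule vector_derivative_at)

lemma real_polynomial_function_line_deriv:
  fixes p :: "'a::real_normed_vector \<Rightarrow> real"
  assumes "real_polynomial_function p"
  shows "\<exists>q. real_polynomial_function q \<and> (\<forall>y. ((\<lambda>t. p (y + t *\<^sub>R e)) has_real_derivative q y) (at 0))"
  using assms
proof induction
  case (linear f)
  interpret bounded_linear f by fact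
  have "((\<lambda>t. f (y + t *\<^sub>R e)) has_real_derivative f e) (at 0)" for y
    by (auto simp: add scale intro!: derivative_eq_intros)
  then show ?case by (intro exI[of _ "\<lambda>_. f e"]) (auto intro: real_polynomial_function.intros(2))
next
  case (const c)
  show ?case by (intro exI[of _ "\<lambda>_. 0"]) (auto intro: real_polynomial_function.intros(2))
next
  case (add f g)
  then obtain f' g' where "real_polynomial_function f'" "real_polynomial_function g'"
    "\<And>y. ((\<lambda>t. f (y + t *\<^sub>R e)) has_real_derivative f' y) (at 0)"
    "\<And>y. ((\<lambda>t. g (y + t *\<^sub>R e)) has_real_derivative g' y) (at 0)"
    by blast
  then show ?case
    by (intro exI[of _ "\<lambda>y. f' y + g' y"]) (auto intro!: real_polynomial_function.intros(3) DERIV_add)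
next
  case (mult f g)
  then obtain f' g' where h: "real_polynomial_function f'" "real_polynomial_function g'"
    "\<And>y. ((\<lambda>t. f (y + t *\<^sub>R e)) has_real_derivative f' y) (at 0)"
    "\<And>y. ((\<lambda>t. g (y + t *\<^sub>R e)) has_real_derivative g' y) (at 0)"
    by blast
  then show ?case
    using mult.hyps DERIV_mult[OF h(3,4)]
    by (intro exI[of _ "\<lambda>y. f' y * g y + g' y * f y"])
      (auto intro!: real_polynomial_function.intros(3) real_polynomial_function.intros(4))
qed

lemma real_polynomial_function_growth:
  fixes p :: "'a::real_normed_vector \<Rightarrow> real"
  assumes "real_polynomial_function p"
  shows "\<exists>C m. 0 \<le> C \<and> (\<forall>y. \<bar>p y\<bar> \<le> C * (1 + norm y) ^ m)"
  using assms
proof induction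
  case (linear f)
  interpret bounded_linear f by fact
  obtain K where K: "K \<ge> 0" "\<And>x. norm (f x) \<le> norm x * K" using nonneg_bounded by blast
  have "\<bar>f y\<bar> \<le> K * (1 + norm y) ^ 1" for y
    using K(2)[of y] K(1) by (simp add: algebra_simps)
  then show ?case using K(1) by blast
next
  case (const c)
  show ?case by (intro exI[of _ "\<bar>c\<bar>"] exI[of _ 0]) auto
next
  case (add f g)
  then obtain C m D n where h: "0 \<le> C" "\<And>y. \<bar>f y\<bar> \<le> C * (1 + norm y) ^ m"
    "0 \<le> D" "\<And>y. \<bar>g y\<bar> \<le> D * (1 + norm y) ^ n"
    by blast
  have "\<bar>f y + g y\<bar> \<le> (C + D) * (1 + norm y) ^ (m + n)" for y
  proof -
    have "C * (1 + norm y) ^ m \<le> C * (1 + norm y) ^ (m + n)"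
      "D * (1 + norm y) ^ n \<le> D * (1 + norm y) ^ (m + n)"
      using h by (auto intro!: mult_left_mono power_increasing)
    then show ?thesis using h(2)[of y] h(4)[of y] by (simp add: distrib_right)
  qed
  then show ?case using h by (intro exI[of _ "C + D"]) auto
next
  case (mult f g)
  then obtain C m D n where h: "0 \<le> C" "\<And>y. \<bar>f y\<bar> \<le> C * (1 + norm y) ^ m"
    "0 \<le> D" "\<And>y. \<bar>g y\<bar> \<le> D * (1 + norm y) ^ n"
    by blast
  have "\<bar>f y * g y\<bar> \<le> (C * D) * (1 + norm y) ^ (m + n)" for y
    using mult_mono[OF h(2,4), of y y] h(1,3) by (simp add: abs_mult power_add mult_ac)
  then show ?case using h by (intro exI[of _ "C * D"]) auto
qed

lemma norm_sq_polynomial: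
  "real_polynomial_function (\<lambda>y::'a::euclidean_space. (norm (x - y))\<^sup>2)"
proof -
  have "real_polynomial_function (\<lambda>y::'a. \<Sum>b\<in>Basis. (x \<bullet> b - y \<bullet> b)\<^sup>2)"
    by (intro real_polynomial_function_sum real_polynomial_function_power real_polynomial_function_diff
        real_polynomial_function.intros(2) real_polynomial_function.intros(1)) (auto intro: bounded_linear_inner_left)
  then show ?thesis by (simp add: norm_sq_Basis inner_diff_left)
qed

text \<open>Polynomials times a fixed Gaussian are closed under partial derivatives: with
  \<open>p'\<close> the derivative of \<open>p\<close> along the axis \<open>e\<close>, the new
  polynomial is \<open>p' + 2 * a * ((x - y) \<bullet> e) * p\<close>. Being a Schwartz function
  thus reduces to a growth bound.\<close>

lemma poly_gauss_partial:
  assumes p: "real_polynomial_function p"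
  shows "\<exists>q. real_polynomial_function q \<and>
    partial_deriv i (\<lambda>y. complex_of_real (p y * exp (- (a * (norm (x - y))\<^sup>2)))) =
      (\<lambda>y. complex_of_real (q y * exp (- (a * (norm (x - y))\<^sup>2))))"
proof -
  let ?e = "axis i 1 :: real^3"
  obtain p' where p': "real_polynomial_function p'"
    "\<And>y. ((\<lambda>t. p (y + t *\<^sub>R ?e)) has_real_derivative p' y) (at 0)"
    using real_polynomial_function_line_deriv[OF p] by blast
  define q where "q = (\<lambda>y. p' y + p y * (2 * a * ((x - y) \<bullet> ?e)))"
  have l: "real_polynomial_function (\<lambda>y. (x - y) \<bullet> ?e)"
    unfolding inner_diff_left
    by (intro real_polynomial_function_diff real_polynomial_function.intros(2) real_polynomial_function.intros(1)
        bounded_linear_inner_left)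
  have q: "real_polynomial_function q"
    unfolding q_def by (intro real_polynomial_function.intros(3) real_polynomial_function.intros(4) p p' l real_polynomial_function.intros(2))
  have n: "(norm (x - (y + t *\<^sub>R ?e)))\<^sup>2 = (norm (x - y))\<^sup>2 - 2 * t * ((x - y) \<bullet> ?e) + t\<^sup>2" for y t
  proof -
    have "(norm ((x - y) - t *\<^sub>R ?e))\<^sup>2 = (norm (x - y))\<^sup>2 - 2 * t * ((x - y) \<bullet> ?e) + t\<^sup>2 * (norm ?e)\<^sup>2"
      using dot_norm_neg[of "x - y" "t *\<^sub>R ?e"] by (simp add: power_mult_distrib)
    then show ?thesis by (simp add: diff_diff_eq)
  qed
  have "((\<lambda>t. complex_of_real (p (y + t *\<^sub>R ?e) * exp (- (a * (norm (x - (y + t *\<^sub>R ?e)))\<^sup>2))))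
     has_vector_derivative complex_of_real (q y * exp (- (a * (norm (x - y))\<^sup>2)))) (at 0)" for y
  proof -
    have "((\<lambda>t. exp (- (a * (norm (x - (y + t *\<^sub>R ?e)))\<^sup>2))) has_real_derivative
      exp (- (a * (norm (x - y))\<^sup>2)) * (2 * a * ((x - y) \<bullet> ?e))) (at 0)"
      unfolding n by (auto intro!: derivative_eq_intros simp: algebra_simps)
    from DERIV_mult[OF p'(2)[of y] this]
    have "((\<lambda>t. p (y + t *\<^sub>R ?e) * exp (- (a * (norm (x - (y + t *\<^sub>R ?e)))\<^sup>2)))
        has_real_derivative q y * exp (- (a * (norm (x - y))\<^sup>2))) (at 0)"
      by (simp add: q_def algebra_simps)
    then show ?thesis using has_vector_derivative_of_real by (simp only: has_real_derivative_iff_has_vector_derivative)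
  qed
  then show ?thesis
    using q by (intro exI[of _ q] conjI ext partial_deriv_eqI) auto
qed

lemma poly_gauss_iter_partial:
  assumes "real_polynomial_function p"
  shows "\<exists>q. real_polynomial_function q \<and>
    iter_partial is (\<lambda>y. complex_of_real (p y * exp (- (a * (norm (x - y))\<^sup>2)))) =
      (\<lambda>y. complex_of_real (q y * exp (- (a * (norm (x - y))\<^sup>2))))"
proof (induction "is")
  case Nil
  then show ?case using assms by (auto simp: iter_partial_def)
next
  case (Cons i "is")
  then obtain q where q: "real_polynomial_function q"
    "iter_partial is (\<lambda>y. complex_of_real (p y * exp (- (a * (norm (x - y))\<^sup>2)))) =
      (\<lambda>y. complex_of_real (q y * exp (- (a * (norm (x - y))\<^sup>2))))" by blast
  then show ?case using poly_gauss_partial[OF q(1), of i a x] by (simp add: iter_partial_def)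
qed

text \<open>Since \<open>1 + r \<le> exp r\<close>, it suffices to complete the square in
  \<open>k * r - a * r^2\<close>.\<close>

lemma one_plus_power_gauss_le:
  assumes a: "a > 0" and r: "r \<ge> (0::real)"
  shows "(1 + r) ^ k * exp (- (a * r\<^sup>2)) \<le> exp (real k ^ 2 / (4 * a))"
proof -
  have "(1 + r) ^ k \<le> exp r ^ k"
    using r exp_ge_add_one_self[of r] by (intro power_mono) auto
  also have "\<dots> = exp (real k * r)" by (simp add: exp_of_nat_mult)
  finally have "(1 + r) ^ k * exp (- (a * r\<^sup>2)) \<le> exp (real k * r) * exp (- (a * r\<^sup>2))"
    by (intro mult_right_mono) auto
  also have "\<dots> = exp (real k * r - a * r\<^sup>2)" by (simp flip: exp_add)
  also have "\<dots> \<le> exp (real k ^ 2 / (4 * a))"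
  proof -
    have "0 \<le> (real k - 2 * a * r)\<^sup>2" by simp
    then have "(real k * r - a * r\<^sup>2) * (4 * a) \<le> real k ^ 2"
      by (simp add: power2_eq_square algebra_simps)
    then show ?thesis using a by (simp add: pos_le_divide_eq)
  qed
  finally show ?thesis .
qed

lemma schwartz_poly_gauss:
  assumes p: "real_polynomial_function p" and a: "a > 0"
  shows "schwartz (\<lambda>y. complex_of_real (p y * exp (- (a * (norm (x - y))\<^sup>2))))"
proof -
  have 1: "(\<lambda>y. complex_of_real (q y * exp (- (a * (norm (x - y))\<^sup>2)))) differentiable (at y)"
    if q: "real_polynomial_function q" for q y
  proof -
    have "q differentiable at y" by (rule differentiable_at_real_polynomial_function[OF q])
    moreover have "(\<lambda>y. (norm (x - y))\<^sup>2) differentiable at y"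
      by (rule differentiable_at_real_polynomial_function[OF norm_sq_polynomial])
    ultimately obtain D E where DE: "(q has_derivative D) (at y)" "((\<lambda>y. (norm (x - y))\<^sup>2) has_derivative E) (at y)"
      by (auto simp: differentiable_def)
    have "((\<lambda>y. complex_of_real (q y * exp (- (a * n y)))) has_derivative
       (\<lambda>h. complex_of_real (q y * (exp (- (a * n y)) * (- (a * E h))) + D h * exp (- (a * n y))))) (at y)"
      if "(n has_derivative E) (at y)" for n
      by (rule bounded_linear.has_derivative[OF bounded_linear_of_real])
        (auto intro!: derivative_eq_intros DE(1) that simp: mult_ac)
    from this[OF DE(2)] show ?thesis unfolding differentiable_def by blast
  qed
  have 2: "bounded (range (\<lambda>y. (1 + norm y) ^ N *\<^sub>R complex_of_real (q y * exp (- (a * (norm (x - y))\<^sup>2)))))"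
    if q: "real_polynomial_function q" for q N
  proof -
    obtain C m where C: "0 \<le> C" "\<And>y. \<bar>q y\<bar> \<le> C * (1 + norm y) ^ m"
      using real_polynomial_function_growth[OF q] by blast
    define B where "B = C * ((1 + norm x) ^ (N + m) * exp (real (N + m) ^ 2 / (4 * a)))"
    have "norm ((1 + norm y) ^ N *\<^sub>R complex_of_real (q y * exp (- (a * (norm (x - y))\<^sup>2)))) \<le> B" for y
    proof -
      define r where "r = norm (x - y)"
      have "1 + norm y \<le> 1 + norm x + r"
        using norm_triangle_ineq4[of x "x - y"] by (simp add: r_def)
      also have "\<dots> \<le> (1 + norm x) * (1 + r)" by (simp add: r_def algebra_simps)
      finally have le: "(1 + norm y) ^ (N + m) \<le> ((1 + norm x) * (1 + r)) ^ (N + m)"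
        by (intro power_mono) auto
      have "norm ((1 + norm y) ^ N *\<^sub>R complex_of_real (q y * exp (- (a * (norm (x - y))\<^sup>2)))) =
         (1 + norm y) ^ N * \<bar>q y\<bar> * exp (- (a * r\<^sup>2))"
        by (simp add: abs_mult r_def norm_mult)
      also have "\<dots> \<le> (1 + norm y) ^ N * (C * (1 + norm y) ^ m) * exp (- (a * r\<^sup>2))"
        using C by (intro mult_right_mono mult_left_mono) auto
      also have "\<dots> = C * ((1 + norm y) ^ (N + m) * exp (- (a * r\<^sup>2)))"
        by (simp add: power_add mult_ac)
      also have "\<dots> \<le> C * (((1 + norm x) * (1 + r)) ^ (N + m) * exp (- (a * r\<^sup>2)))"
        using le C(1) by (intro mult_left_mono mult_right_mono) auto
      also have "\<dots> = C * ((1 + norm x) ^ (N + m) * ((1 + r) ^ (N + m) * exp (- (a * r\<^sup>2))))"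
        by (simp add: power_mult_distrib mult_ac)
      also have "\<dots> \<le> B"
        unfolding B_def using one_plus_power_gauss_le[OF a, of r "N + m"] C(1)
        by (intro mult_left_mono) (auto simp: r_def)
      finally show ?thesis .
    qed
    then show ?thesis unfolding bounded_iff by auto
  qed
  show ?thesis
    unfolding schwartz_def smooth_def
  proof (intro conjI allI)
    fix "is" :: "3 list" and y :: "real^3" and N :: nat
    obtain q where q: "real_polynomial_function q"
      "iter_partial is (\<lambda>y. complex_of_real (p y * exp (- (a * (norm (x - y))\<^sup>2)))) =
        (\<lambda>y. complex_of_real (q y * exp (- (a * (norm (x - y))\<^sup>2))))"
      using poly_gauss_iter_partial[OF p] by blast
    show "iter_partial is (\<lambda>y. complex_of_real (p y * exp (- (a * (norm (x - y))\<^sup>2)))) differentiable (at y)"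
      unfolding q(2) by (rule 1[OF q(1)])
    show "bounded (range (\<lambda>y. (1 + norm y) ^ N *\<^sub>R
        iter_partial is (\<lambda>y. complex_of_real (p y * exp (- (a * (norm (x - y))\<^sup>2)))) y))"
      unfolding q(2) by (rule 2[OF q(1)])
  qed
qed

lemma schwartz_heat1:
  assumes s: "s > 0"
  shows "schwartz (\<lambda>y. complex_of_real (heat1 s (x - y)))"
proof -
  define p where "p = (\<lambda>y. (1 / sqrt (4 * pi * s)) ^ 3 * (1 / (4 * s\<^sup>2) * (norm (x - y))\<^sup>2 - 3 / (2 * s)))"
  have p: "real_polynomial_function p"
    unfolding p_def
    by (intro real_polynomial_function.intros(4) real_polynomial_function_diff real_polynomial_function.intros(2) norm_sq_polynomial)
  have "heat1 s (x - y) = p y * exp (- (1 / (4 * s) * (norm (x - y))\<^sup>2))" for y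
    by (simp add: heat1_def heat_def p_def)
  then show ?thesis using schwartz_poly_gauss[OF p, of "1 / (4 * s)" x] s by simp
qed

section \<open>The weak Laplacian of a smooth function\<close>

lemma smooth_partial: "smooth f \<Longrightarrow> smooth (partial_deriv i f)"
proof -
  assume f: "smooth f"
  have "iter_partial is (partial_deriv i f) = iter_partial (is @ [i]) f" for "is"
    by (simp add: iter_partial_def)
  then show "smooth (partial_deriv i f)" using f by (simp add: smooth_def)
qed

lemma smooth_differentiable: "smooth f \<Longrightarrow> f differentiable (at x)"
  unfolding smooth_def by (drule spec[of _ "[]"]) (simp add: iter_partial_def)

lemma smooth_continuous: "smooth f \<Longrightarrow> continuous_on S f"
  by (intro continuous_at_imp_continuous_on ballI differentiable_imp_continuous_within smooth_differentiable)

lemma differentiable_has_partial: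
  fixes f :: "real^3 \<Rightarrow> real"
  assumes "f differentiable (at x)"
  shows "((\<lambda>t. f (x + t *\<^sub>R axis i 1)) has_real_derivative partial_deriv i f x) (at 0)"
proof -
  obtain D where D: "(f has_derivative D) (at x)" using assms by (auto simp: differentiable_def)
  have "((\<lambda>t. x + t *\<^sub>R axis i 1) has_derivative (\<lambda>t. t *\<^sub>R axis i 1)) (at (0::real))"
    by (auto intro!: derivative_eq_intros)
  then have "((\<lambda>t. f (x + t *\<^sub>R axis i 1)) has_derivative (\<lambda>t. D (t *\<^sub>R axis i 1))) (at 0)"
    by (rule has_derivative_compose) (use D in simp)
  then have "(\<lambda>t. f (x + t *\<^sub>R axis i 1)) differentiable (at 0)" by (auto simp: differentiable_def)
  then show ?thesis
    unfolding partial_deriv_def has_real_derivative_iff_has_vector_derivative by (rule vector_derivative_works[THEN iffD1])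
qed

lemma locally_integrable_continuous:
  assumes "continuous_on UNIV f"
  shows "locally_integrable f"
  unfolding locally_integrable_def set_integrable_def
proof (intro allI impI)
  fix K :: "(real^3) set" assume K: "compact K"
  have "integrable lborel (\<lambda>x. indicator K x *\<^sub>R f x)"
    using assms K by (intro borel_integrable_compact) (auto intro: continuous_on_subset)
  then show "integrable lebesgue (\<lambda>x. indicat_real K x *\<^sub>R f x)"
    by (subst integrable_completion) auto
qed

lemma continuous_compact_support:
  fixes h :: "'a::euclidean_space \<Rightarrow> real"
  assumes c: "continuous_on UNIV h" and z: "\<And>x. norm x > R \<Longrightarrow> h x = 0"
  shows "integrable lborel h" "\<exists>C. \<forall>x. \<bar>h x\<bar> \<le> C"
proof -
  have "integrable lborel (\<lambda>x. indicator (cball 0 R) x *\<^sub>R h x)"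
    using c by (intro borel_integrable_compact) (auto intro: continuous_on_subset)
  also have "(\<lambda>x. indicator (cball 0 R) x *\<^sub>R h x) = h"
    using z by (force simp: indicator_def not_le)
  finally show "integrable lborel h" .
  have "bounded (h ` cball 0 R)"
    by (intro compact_imp_bounded compact_continuous_image) (use c in \<open>auto intro: continuous_on_subset\<close>)
  then obtain C where "\<forall>y\<in>h ` cball 0 R. norm y \<le> C"
    unfolding bounded_iff by blast
  then have C: "\<bar>h x\<bar> \<le> C" if "norm x \<le> R" for x
    using that by auto
  have "\<bar>h x\<bar> \<le> max C 0" for x
    using C[of x] z[of x] by (cases "norm x \<le> R") auto
  then show "\<exists>C. \<forall>x. \<bar>h x\<bar> \<le> C" by blast
qed

text \<open>The product rule and \<open>integral_partial_eq_0\<close>. The bounded support is that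
  of \<open>b\<close> and \<open>b'\<close>, so \<open>a\<close> may grow arbitrarily.\<close>

lemma line_ibp:
  fixes a b a' b' :: "'a::euclidean_space \<Rightarrow> real"
  assumes c: "continuous_on UNIV a" "continuous_on UNIV a'" "continuous_on UNIV b" "continuous_on UNIV b'"
    and da: "\<And>x. ((\<lambda>t. a (x + t *\<^sub>R e)) has_real_derivative a' x) (at 0)"
    and db: "\<And>x. ((\<lambda>t. b (x + t *\<^sub>R e)) has_real_derivative b' x) (at 0)"
    and z: "\<And>x. norm x > R \<Longrightarrow> b x = 0" "\<And>x. norm x > R \<Longrightarrow> b' x = 0"
  shows "integrable lborel (\<lambda>x. a' x * b x)" "integrable lborel (\<lambda>x. a x * b' x)"
    "(\<integral>x. a' x * b x \<partial>lborel) = - (\<integral>x. a x * b' x \<partial>lborel)"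
proof -
  have cont: "continuous_on UNIV (\<lambda>x. a x * b x)" "continuous_on UNIV (\<lambda>x. a' x * b x)" "continuous_on UNIV (\<lambda>x. a x * b' x)"
    "continuous_on UNIV (\<lambda>x. a' x * b x + a x * b' x)"
    using c by (auto intro!: continuous_intros)
  show i: "integrable lborel (\<lambda>x. a' x * b x)" "integrable lborel (\<lambda>x. a x * b' x)"
    using z by (auto intro!: continuous_compact_support(1)[OF cont(2), of R] continuous_compact_support(1)[OF cont(3), of R])
  obtain C where C: "\<And>x. \<bar>a x * b x\<bar> \<le> C"
    using continuous_compact_support(2)[OF cont(1), of R] z by auto
  obtain C' where C': "\<And>x. \<bar>a' x * b x + a x * b' x\<bar> \<le> C'"
    using continuous_compact_support(2)[OF cont(4), of R] z by auto
  have "(\<integral>x. a' x * b x + a x * b' x \<partial>lborel) = 0"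
  proof (rule integral_partial_eq_0[where g = "\<lambda>x. a x * b x" and C = "max C C'" and R = R and e = e])
    show "((\<lambda>t. a (x + t *\<^sub>R e) * b (x + t *\<^sub>R e)) has_real_derivative a' x * b x + a x * b' x) (at 0)" for x
      using DERIV_mult[OF da[of x] db[of x]] by (simp add: mult_ac)
    show "\<bar>a x * b x\<bar> \<le> max C C'" "\<bar>a' x * b x + a x * b' x\<bar> \<le> max C C'" for x
      using C[of x] C'[of x] by auto
  qed (use z borel_measurable_continuous_onI[OF cont(1)] in auto)
  then show "(\<integral>x. a' x * b x \<partial>lborel) = - (\<integral>x. a x * b' x \<partial>lborel)"
    using i by simp
qed

lemma smooth_weak_partial:
  assumes f: "smooth f"
  shows "weak_partial i f (partial_deriv i f)"
  unfolding weak_partial_def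
proof (intro conjI allI impI)
  let ?e = "axis i 1 :: real^3"
  have cf: "continuous_on UNIV f" and cf': "continuous_on UNIV (partial_deriv i f)"
    using f by (auto intro: smooth_continuous smooth_partial)
  show "locally_integrable f" "locally_integrable (partial_deriv i f)"
    using cf cf' by (auto intro: locally_integrable_continuous)
  fix \<phi> :: "real^3 \<Rightarrow> real" assume \<phi>: "test_function \<phi>"
  then have s\<phi>: "smooth \<phi>" and comp: "compact (closure {x. \<phi> x \<noteq> 0})" by (auto simp: test_function_def)
  have c\<phi>: "continuous_on UNIV \<phi>" and c\<phi>': "continuous_on UNIV (partial_deriv i \<phi>)"
    using s\<phi> by (auto intro: smooth_continuous smooth_partial)
  have "bounded {x. \<phi> x \<noteq> 0}" using comp by (meson bounded_closure bounded_subset closure_subset compact_imp_bounded)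
  then obtain R where R: "\<And>x. \<phi> x \<noteq> 0 \<Longrightarrow> norm x \<le> R" by (auto simp: bounded_iff)
  have z: "\<phi> x = 0" if "norm x > R" for x using R[of x] that by force
  have z': "partial_deriv i \<phi> x = 0" if x: "norm x > R" for x
  proof (rule partial_deriv_eqI)
    have "open {t. norm (x + t *\<^sub>R ?e) > R}"
      by (intro open_Collect_less continuous_intros)
    then have "\<forall>\<^sub>F t in nhds 0. norm (x + t *\<^sub>R ?e) > R"
      using eventually_nhds_in_open[of "{t. norm (x + t *\<^sub>R ?e) > R}" 0] x by auto
    then have ev: "\<forall>\<^sub>F t in nhds 0. \<phi> (x + t *\<^sub>R ?e) = 0"
      by eventually_elim (rule z)
    have "((\<lambda>t. \<phi> (x + t *\<^sub>R ?e)) has_real_derivative 0) (at 0)"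
      by (subst DERIV_cong_ev[OF refl ev refl]) simp
    then show "((\<lambda>t. \<phi> (x + t *\<^sub>R ?e)) has_vector_derivative 0) (at 0)"
      by (simp add: has_real_derivative_iff_has_vector_derivative)
  qed
  note ibp = line_ibp[OF cf cf' c\<phi> c\<phi>' differentiable_has_partial[OF smooth_differentiable[OF f], of _ i]
      differentiable_has_partial[OF smooth_differentiable[OF s\<phi>], of _ i] z z']
  have "(\<integral>x. f x * partial_deriv i \<phi> x \<partial>lborel) = - (\<integral>x. partial_deriv i f x * \<phi> x \<partial>lborel)"
    using ibp(3) by simp
  then show "(LINT x|lebesgue. f x * partial_deriv i \<phi> x) = - (LINT x|lebesgue. partial_deriv i f x * \<phi> x)"
    using ibp(1,2)[THEN borel_measurable_integrable] by (simp add: integral_completion)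
qed

definition laplacian :: "(real^3 \<Rightarrow> real) \<Rightarrow> real^3 \<Rightarrow> real" where
  "laplacian u x = (\<Sum>i\<in>UNIV. partial_deriv i (partial_deriv i u) x)"

text \<open>\<open>solution\<close> speaks about every representative of the weak Laplacian; this
  supplies the classical, continuous one, for which pointwise statements make sense.\<close>

lemma smooth_weak_laplacian: "smooth u \<Longrightarrow> weak_laplacian u (laplacian u)"
  unfolding weak_laplacian_def laplacian_def
  by (intro exI[of _ "\<lambda>i. partial_deriv i u"] exI[of _ "\<lambda>i. partial_deriv i (partial_deriv i u)"])
    (auto intro: smooth_weak_partial smooth_partial)

lemma smooth_laplacian_continuous: "smooth u \<Longrightarrow> continuous_on UNIV (laplacian u)"
  unfolding laplacian_def by (intro continuous_intros smooth_continuous smooth_partial)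

text \<open>The test function is \<open>heat1 s (x - y)\<close> as a function of \<open>y\<close>, a
  Schwartz function by \<open>schwartz_heat1\<close> whose half Laplacian is known. The rest is the
  passage from complex integrals over \<open>lebesgue\<close> to real ones over
  \<open>lborel\<close>.\<close>

lemma solution_heat_identity:
  assumes u: "smooth u" and sol: "solution (distribution_of (\<lambda>x. 2 * g x)) u"
    and g: "continuous_on UNIV g" and s: "s > 0"
  shows "(\<integral>y. heat_half s (x - y) * (- laplacian u y) \<partial>lborel) = 2 * (\<integral>y. heat1 s (x - y) * g y \<partial>lborel)"
proof -
  have cu: "continuous_on UNIV (laplacian u)" using u by (rule smooth_laplacian_continuous)
  have "continuous_on UNIV (\<lambda>y. heat_half s (x - y))"
    by (intro continuous_on_compose2[OF heat_half_continuous[OF s]] continuous_intros) auto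
  moreover have "continuous_on UNIV (\<lambda>y. heat1 s (x - y))"
    by (intro continuous_on_compose2[OF continuous_heat(2)[OF s, of UNIV]] continuous_intros) auto
  ultimately have m: "(\<lambda>y. complex_of_real (heat_half s (x - y) * (- laplacian u y))) \<in> borel_measurable lborel"
    "(\<lambda>y. complex_of_real (2 * (heat1 s (x - y) * g y))) \<in> borel_measurable lborel"
    using cu g by (auto intro!: borel_measurable_continuous_onI continuous_intros)
  have "(LINT y|lebesgue. complex_of_real (- laplacian u y) * half_laplacian (\<lambda>y. complex_of_real (heat1 s (x - y))) y) =
      distribution_of (\<lambda>x. 2 * g x) (\<lambda>y. complex_of_real (heat1 s (x - y)))"
    using sol smooth_weak_laplacian[OF u] schwartz_heat1[OF s, of x] unfolding solution_def by blast
  then have "(LINT y|lebesgue. complex_of_real (heat_half s (x - y) * (- laplacian u y))) =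
      (LINT y|lebesgue. complex_of_real (2 * (heat1 s (x - y) * g y)))"
    by (simp add: half_laplacian_heat1[OF s] distribution_of_def mult_ac)
  then have "(\<integral>y. complex_of_real (heat_half s (x - y) * (- laplacian u y)) \<partial>lborel) =
      (\<integral>y. complex_of_real (2 * (heat1 s (x - y) * g y)) \<partial>lborel)"
    by (simp only: integral_completion[OF m(1)] integral_completion[OF m(2)])
  then have "complex_of_real (\<integral>y. heat_half s (x - y) * (- laplacian u y) \<partial>lborel) =
      complex_of_real (\<integral>y. 2 * (heat1 s (x - y) * g y) \<partial>lborel)"
    by (simp only: integral_complex_of_real)
  then show ?thesis by (simp only: of_real_eq_iff integral_mult_right_zero)
qed

lemma solution_laplacian_moderate:
  assumes u: "smooth u" and sol: "solution f u"
  shows "moderate (laplacian u)"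
proof -
  have c: "continuous_on UNIV (laplacian u)" using u by (rule smooth_laplacian_continuous)
  then have m[measurable]: "laplacian u \<in> borel_measurable borel" by (rule borel_measurable_continuous_onI)
  have "laplacian u \<in> L_half"
    using sol smooth_weak_laplacian[OF u] unfolding solution_def by blast
  then have "integrable lebesgue (\<lambda>x. \<bar>laplacian u x\<bar> / (1 + norm x ^ 4))" by (simp add: L_half_def)
  then show ?thesis
    unfolding moderate_def by (subst (asm) integrable_completion) simp_all
qed

section \<open>Inverting the half Laplacian\<close>

text \<open>This integral makes the fractional integration in time converge on the side of
  \<open>\<Delta>u\<close>, where only the factor \<open>1 / (s + t)\<close> of
  \<open>heat_half_bound\<close> is available. The primitive is an arctangent.\<close>

lemma inv_sqrt_inverse:
  assumes s: "s > 0"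
  shows "integrable lborel (\<lambda>t. inv_sqrt t * (1 / (s + t)))"
proof (rule FTC_nonneg_atLeast_0(1))
  show "((\<lambda>t. 2 / sqrt s * arctan (sqrt t / sqrt s)) has_real_derivative inv_sqrt x * (1 / (s + x))) (at x)" if x: "x > 0" for x
  proof -
    have d: "((\<lambda>t. 2 / sqrt s * arctan (sqrt t / sqrt s)) has_real_derivative
        2 / sqrt s * (inverse (1 + (sqrt x / sqrt s)\<^sup>2) * (inverse (sqrt x) / 2 / sqrt s))) (at x)"
      by (intro DERIV_cmult DERIV_chain2[OF DERIV_arctan] DERIV_cdivide DERIV_real_sqrt x)
    have a: "sqrt s * sqrt s = s" using s by simp
    have b: "(sqrt x / sqrt s)\<^sup>2 = x / s" using x s by (simp add: power_divide)
    have c: "inverse (1 + x / s) = s / (s + x)" using x s by (simp add: field_simps)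
    have "2 / sqrt s * (inverse (1 + (sqrt x / sqrt s)\<^sup>2) * (inverse (sqrt x) / 2 / sqrt s)) =
        inverse (1 + (sqrt x / sqrt s)\<^sup>2) * (1 / sqrt x) * (1 / (sqrt s * sqrt s))"
      by (simp add: inverse_eq_divide)
    also have "\<dots> = s / (s + x) * (1 / sqrt x) * (1 / s)" by (simp only: a b c)
    also have "\<dots> = inv_sqrt x * (1 / (s + x))" using x s by (simp add: inv_sqrt_def)
    finally have "2 / sqrt s * (inverse (1 + (sqrt x / sqrt s)\<^sup>2) * (inverse (sqrt x) / 2 / sqrt s)) = inv_sqrt x * (1 / (s + x))" .
    with d show ?thesis by simp
  qed
  show "isCont (\<lambda>t. inv_sqrt t * (1 / (s + t))) x" if x: "x > 0" for x
  proof -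
    have "isCont (\<lambda>t. 1 / sqrt t * (1 / (s + t))) x"
      using x s by (auto intro!: continuous_intros)
    moreover have "\<forall>\<^sub>F t in nhds x. 1 / sqrt t * (1 / (s + t)) = inv_sqrt t * (1 / (s + t))"
      using eventually_nhds_in_open[of "{0<..}" x] x by (auto simp: inv_sqrt_def elim!: eventually_mono)
    ultimately show ?thesis by (subst (asm) isCont_cong) auto
  qed
  show "((\<lambda>t. 2 / sqrt s * arctan (sqrt t / sqrt s)) \<longlongrightarrow> 0) (at_right 0)" using s by real_asymp
  have "filterlim (\<lambda>t. sqrt t / sqrt s) at_top at_top" using s by real_asymp
  then have "((\<lambda>t. arctan (sqrt t / sqrt s)) \<longlongrightarrow> pi / 2) at_top"
    by (rule filterlim_compose[OF tendsto_arctan_at_top])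
  then show "((\<lambda>t. 2 / sqrt s * arctan (sqrt t / sqrt s)) \<longlongrightarrow> 2 / sqrt s * (pi / 2)) at_top"
    by (intro tendsto_intros)
qed (use s in \<open>auto simp: inv_sqrt_def\<close>)

lemma three_halves_integrable:
  assumes s: "s > 0"
  shows "integrable lborel (\<lambda>r. indicator {0<..} r * (1 / ((s + r) * sqrt (s + r))))"
proof (rule FTC_nonneg_atLeast_0(1))
  show "((\<lambda>r. - 2 / sqrt (s + r)) has_real_derivative indicator {0<..} x * (1 / ((s + x) * sqrt (s + x)))) (at x)" if x: "x > 0" for x
  proof -
    have "((\<lambda>r. - 2 / sqrt (s + r)) has_real_derivative
        - (- 2 * (inverse (sqrt (s + x)) / 2) / (sqrt (s + x) * sqrt (s + x)))) (at x)"
      using x s by (auto intro!: derivative_eq_intros)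
    moreover have "sqrt (s + x) * sqrt (s + x) = s + x" using x s by simp
    ultimately show ?thesis using x by (simp add: inverse_eq_divide mult.commute)
  qed
  show "isCont (\<lambda>r. indicator {0<..} r * (1 / ((s + r) * sqrt (s + r)))) x" if x: "x > 0" for x
  proof -
    have "isCont (\<lambda>r. 1 / ((s + r) * sqrt (s + r))) x"
      using x s by (auto intro!: continuous_intros)
    moreover have "\<forall>\<^sub>F r in nhds x. 1 / ((s + r) * sqrt (s + r)) = indicator {0<..} r * (1 / ((s + r) * sqrt (s + r)))"
      using eventually_nhds_in_open[of "{0<..}" x] x by (auto elim!: eventually_mono)
    ultimately show ?thesis by (subst (asm) isCont_cong) auto
  qed
  show "((\<lambda>r. - 2 / sqrt (s + r)) \<longlongrightarrow> - 2 / sqrt s) (at_right 0)"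
  proof -
    have "((\<lambda>r. - 2 / sqrt (s + r)) \<longlongrightarrow> - 2 / sqrt (s + 0)) (at_right 0)"
      by (intro tendsto_intros) (use s in auto)
    then show ?thesis by simp
  qed
  show "((\<lambda>r. - 2 / sqrt (s + r)) \<longlongrightarrow> 0) at_top" using s by real_asymp
qed (use s in \<open>auto\<close>)

text \<open>Integrability replaces the sign condition of \<open>FTC_nonneg_atLeast_0\<close>,
  because \<open>heat2\<close> changes sign.\<close>

lemma FTC_integrable_atLeast_0:
  fixes f F :: "real \<Rightarrow> real"
  assumes F: "\<And>x. x > 0 \<Longrightarrow> DERIV F x :> f x"
    and f: "\<And>x. x > 0 \<Longrightarrow> isCont f x"
    and i: "integrable lborel (\<lambda>x. indicator {0<..} x * f x)"
    and A: "(F \<longlongrightarrow> A) (at_right 0)" and B: "(F \<longlongrightarrow> B) at_top"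
  shows "(\<integral>x. indicator {0<..} x * f x \<partial>lborel) = B - A"
proof -
  have A': "((F \<circ> real_of_ereal) \<longlongrightarrow> A) (at_right 0)"
    using A by (simp add: zero_ereal_def at_right_ereal filterlim_filtermap comp_def)
  have B': "((F \<circ> real_of_ereal) \<longlongrightarrow> B) (at_left \<infinity>)"
    using B by (simp add: ereal_tendsto_simps1)
  have e: "einterval 0 \<infinity> = {0<..}" by (auto simp: einterval_def)
  have "(LBINT x=0..\<infinity>. f x) = B - A"
    by (rule interval_integral_FTC_integrable[OF _ _ _ _ A' B'])
      (use F f i in \<open>auto simp: set_integrable_def e has_real_derivative_iff_has_vector_derivative\<close>)
  then show ?thesis by (simp add: interval_lebesgue_integral_def set_lebesgue_integral_def e)
qed

lemma heat_crude_bounds: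
  assumes q: "q > 0"
  shows "heat q z \<le> 40000 * (1 / ((q + (norm z)\<^sup>2) * sqrt (q + (norm z)\<^sup>2)))"
    and "\<bar>heat1 q z\<bar> \<le> 40000 / q * (1 / (q * sqrt q))"
    and "\<bar>heat2 q z\<bar> \<le> 40000 / q\<^sup>2 * (1 / (q * sqrt q))"
proof -
  define R where "R = q + (norm z)\<^sup>2"
  have R: "R > 0" "q \<le> R" using q by (auto simp: R_def)
  have sR: "sqrt R * sqrt R = R" using R by simp
  have "heat q z \<le> 40000 * sqrt q / R\<^sup>2" using heat_bounds(1)[OF q] by (simp add: R_def)
  also have "\<dots> \<le> 40000 * sqrt R / R\<^sup>2" using R by (intro divide_right_mono) auto
  also have "\<dots> = 40000 * (1 / (R * sqrt R))"
  proof -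
    have "sqrt R / R\<^sup>2 = 1 / (R * sqrt R)"
      using R sR by (simp add: divide_simps power2_eq_square)
    then show ?thesis by simp
  qed
  finally show "heat q z \<le> 40000 * (1 / ((q + (norm z)\<^sup>2) * sqrt (q + (norm z)\<^sup>2)))" by (simp add: R_def)
  have q2: "q\<^sup>2 \<le> R\<^sup>2" using R q by (intro power_mono) auto
  have "\<bar>heat1 q z\<bar> \<le> 40000 / (sqrt q * R\<^sup>2)" using heat_bounds(2)[OF q] by (simp add: R_def)
  also have "\<dots> \<le> 40000 / (sqrt q * q\<^sup>2)" using q2 q R by (intro divide_left_mono mult_left_mono) auto
  also have "\<dots> = 40000 / q * (1 / (q * sqrt q))" using q by (simp add: power2_eq_square)
  finally show "\<bar>heat1 q z\<bar> \<le> 40000 / q * (1 / (q * sqrt q))" .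
  have "\<bar>heat2 q z\<bar> \<le> 40000 / (q * sqrt q * R\<^sup>2)" using heat_bounds(3)[OF q] by (simp add: R_def)
  also have "\<dots> \<le> 40000 / (q * sqrt q * q\<^sup>2)" using q2 q R by (intro divide_left_mono mult_left_mono) auto
  also have "\<dots> = 40000 / q\<^sup>2 * (1 / (q * sqrt q))" using q by (simp add: power2_eq_square)
  finally show "\<bar>heat2 q z\<bar> \<le> 40000 / q\<^sup>2 * (1 / (q * sqrt q))" .
qed

lemma isCont_heat_time:
  assumes "s > 0"
  shows "isCont (\<lambda>s. heat s z) s" "isCont (\<lambda>s. heat1 s z) s" "isCont (\<lambda>s. heat2 s z) s"
  using heat_deriv[OF assms] assms
  by (auto intro: DERIV_isCont simp: heat2_def[abs_def] intro!: continuous_intros)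

lemma heat1_at_top: "((\<lambda>s. heat1 s z) \<longlongrightarrow> 0) at_top"
proof (rule Lim_null_comparison)
  show "\<forall>\<^sub>F s in at_top. norm (heat1 s z) \<le> 40000 / s * (1 / (s * sqrt s))"
    using eventually_gt_at_top[of 0] by eventually_elim (use heat_crude_bounds(2) in auto)
  show "((\<lambda>s::real. 40000 / s * (1 / (s * sqrt s))) \<longlongrightarrow> 0) at_top" by real_asymp
qed

text \<open>Two half integrations in time make a full one. With \<open>r = \<tau> + t\<close> the
  two weights convolve to the constant \<open>pi\<close> by \<open>inv_sqrt_convolution\<close>, and
  the integral of \<open>heat2\<close> over all times after \<open>s\<close> is
  \<open>- heat1 s\<close>. The remaining factor is \<open>pi / sqrt pi = sqrt pi\<close>.\<close>

lemma heat_half_half: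
  assumes s: "s > 0"
  shows "(\<integral>\<tau>. inv_sqrt \<tau> * heat_half (s + \<tau>) z \<partial>lborel) = sqrt pi * heat1 s z"
proof -
  let ?h = "\<lambda>r. heat2 (s + r) z"
  let ?k = "\<lambda>r \<tau>. inv_sqrt \<tau> * inv_sqrt (r - \<tau>)"
  have k0: "?k r \<tau> = 0" if "\<not> r > 0" for r \<tau> using that by (auto simp: inv_sqrt_def)
  have hb: "\<bar>indicator {0<..} r * ?h r\<bar> \<le> 40000 / s\<^sup>2 * (indicator {0<..} r * (1 / ((s + r) * sqrt (s + r))))" for r
  proof (cases "r > 0")
    case True
    have "\<bar>?h r\<bar> \<le> 40000 / (s + r)\<^sup>2 * (1 / ((s + r) * sqrt (s + r)))"
      using heat_crude_bounds(3)[of "s + r" z] s True by simp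
    also have "\<dots> \<le> 40000 / s\<^sup>2 * (1 / ((s + r) * sqrt (s + r)))"
      using s True by (intro mult_right_mono divide_left_mono power_mono) auto
    finally show ?thesis using True by simp
  qed simp
  have ih: "integrable lborel (\<lambda>r. indicator {0<..} r * ?h r)"
    by (rule integrable_dominated[where g = "\<lambda>r. 40000 / s\<^sup>2 * (indicator {0<..} r * (1 / ((s + r) * sqrt (s + r))))"])
      (use hb in \<open>auto intro!: three_halves_integrable s integrable_mult_right simp del: integrable_mult_left_iff mult_1_right times_divide_eq_right\<close>)
  have P: "integrable (lborel \<Otimes>\<^sub>M lborel) (\<lambda>(r, \<tau>). ?k r \<tau> * ?h r)"
  proof (rule lborel_pair.Fubini_integrable)
    show "(\<lambda>(r, \<tau>). ?k r \<tau> * ?h r) \<in> borel_measurable (lborel \<Otimes>\<^sub>M lborel)"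
      by measurable
    show "AE r in lborel. integrable lborel (\<lambda>\<tau>. case (r, \<tau>) of (r, \<tau>) \<Rightarrow> ?k r \<tau> * ?h r)"
    proof (rule AE_I2)
      fix r :: real
      show "integrable lborel (\<lambda>\<tau>. case (r, \<tau>) of (r, \<tau>) \<Rightarrow> ?k r \<tau> * ?h r)"
      proof (cases "r > 0")
        case False
        then show ?thesis by (simp only: prod.case k0[OF False] mult_zero_left) simp
      qed (use inv_sqrt_convolution(1)[of r] in auto)
    qed
    have "(\<integral>\<tau>. norm (case (r, \<tau>) of (r, \<tau>) \<Rightarrow> ?k r \<tau> * ?h r) \<partial>lborel) = pi * \<bar>indicator {0<..} r * ?h r\<bar>" for r
    proof (cases "r > 0")
      case True
      then show ?thesis
        using inv_sqrt_convolution(2)[OF True] by (simp add: abs_mult)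
    qed (simp add: k0)
    then show "integrable lborel (\<lambda>r. \<integral>\<tau>. norm (case (r, \<tau>) of (r, \<tau>) \<Rightarrow> ?k r \<tau> * ?h r) \<partial>lborel)"
      using ih by simp
  qed
  have "(\<integral>\<tau>. inv_sqrt \<tau> * heat_half (s + \<tau>) z \<partial>lborel) =
     (\<integral>\<tau>. - (1 / sqrt pi) * (\<integral>r. ?k r \<tau> * ?h r \<partial>lborel) \<partial>lborel)"
  proof (intro Bochner_Integration.integral_cong refl)
    fix \<tau> :: real
    have "(\<integral>t. inv_sqrt t * heat2 (s + \<tau> + t) z \<partial>lborel) = (\<integral>r. inv_sqrt (r + - \<tau>) * heat2 (s + \<tau> + (r + - \<tau>)) z \<partial>lborel)"
      by (rule lborel_integral_translate[symmetric]) measurable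
    then show "inv_sqrt \<tau> * heat_half (s + \<tau>) z = - (1 / sqrt pi) * (\<integral>r. ?k r \<tau> * ?h r \<partial>lborel)"
      by (simp add: heat_half_def mult.assoc)
  qed
  also have "\<dots> = - (1 / sqrt pi) * (\<integral>\<tau>. (\<integral>r. ?k r \<tau> * ?h r \<partial>lborel) \<partial>lborel)"
    by (rule integral_mult_right_zero)
  also have "(\<integral>\<tau>. (\<integral>r. ?k r \<tau> * ?h r \<partial>lborel) \<partial>lborel) = (\<integral>r. (\<integral>\<tau>. ?k r \<tau> * ?h r \<partial>lborel) \<partial>lborel)"
    by (rule lborel_pair.Fubini_integral[OF P])
  also have "\<dots> = (\<integral>r. pi * (indicator {0<..} r * ?h r) \<partial>lborel)"
  proof (intro Bochner_Integration.integral_cong refl)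
    fix r :: real
    show "(\<integral>\<tau>. ?k r \<tau> * ?h r \<partial>lborel) = pi * (indicator {0<..} r * ?h r)"
    proof (cases "r > 0")
      case False
      then show ?thesis by (simp only: k0[OF False] mult_zero_left) simp
    qed (use inv_sqrt_convolution(2)[of r] in auto)
  qed
  also have "\<dots> = pi * (\<integral>r. indicator {0<..} r * ?h r \<partial>lborel)"
    by (rule integral_mult_right_zero)
  also have "(\<integral>r. indicator {0<..} r * ?h r \<partial>lborel) = 0 - heat1 s z"
  proof (rule FTC_integrable_atLeast_0[OF _ _ ih])
    show "((\<lambda>r. heat1 (s + r) z) has_real_derivative ?h r) (at r)" if "r > 0" for r
      using DERIV_shift[of "\<lambda>s. heat1 s z" "?h r" r s] heat_deriv(2)[of "s + r" z] s that by (simp add: add.commute)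
    show "isCont ?h r" if "r > 0" for r
      using isCont_o2[of r "\<lambda>r. s + r" "\<lambda>s. heat2 s z"] isCont_heat_time(3)[of "s + r" z] s that by simp
    have "isCont (\<lambda>r. s + r) 0" by (intro continuous_intros)
    then have "isCont (\<lambda>r. heat1 (s + r) z) 0"
      by (rule isCont_o2) (use isCont_heat_time(2)[of s z] s in simp)
    then have "((\<lambda>r. heat1 (s + r) z) \<longlongrightarrow> heat1 s z) (at 0)"
      by (simp add: isCont_def)
    then show "((\<lambda>r. heat1 (s + r) z) \<longlongrightarrow> heat1 s z) (at_right 0)"
      using filterlim_at_split by auto
    show "((\<lambda>r. heat1 (s + r) z) \<longlongrightarrow> 0) at_top"
      by (rule filterlim_compose[OF heat1_at_top]) (rule filterlim_tendsto_add_at_top[OF tendsto_const filterlim_ident])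
  qed
  also have "- (1 / sqrt pi) * (pi * (0 - heat1 s z)) = (pi / sqrt pi) * heat1 s z" by simp
  also have "\<dots> = sqrt pi * heat1 s z" by (simp add: real_div_sqrt)
  finally show ?thesis .
qed

text \<open>The kernel of \<open>(-\<Delta>)^(-1/2)\<close> smoothed by the heat flow for time
  \<open>s\<close>: formally its transform is \<open>exp (- s * |\<xi>|^2) / |\<xi>|\<close>. At
  \<open>s = 0\<close> the Riesz kernel itself appears, see \<open>heat_riesz_0\<close>;
  \<open>heat_riesz1\<close> is the time derivative.\<close>

definition heat_riesz :: "real \<Rightarrow> real^3 \<Rightarrow> real" where
  "heat_riesz s z = 1 / sqrt pi * (\<integral>t. inv_sqrt t * heat (s + t) z \<partial>lborel)"

definition heat_riesz1 :: "real \<Rightarrow> real^3 \<Rightarrow> real" where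
  "heat_riesz1 s z = 1 / sqrt pi * (\<integral>t. inv_sqrt t * heat1 (s + t) z \<partial>lborel)"

lemma heat_riesz_measurable [measurable]:
  "heat_riesz s \<in> borel_measurable borel" "heat_riesz1 s \<in> borel_measurable borel"
  unfolding heat_riesz_def[abs_def] heat_riesz1_def[abs_def] by measurable

lemma inv_sqrt_pi_le: "1 / sqrt pi \<le> 1"
  using pi_gt3 by simp

lemma heat_riesz_integrand:
  assumes s: "s \<ge> 0"
  shows "0 \<le> inv_sqrt t * heat (s + t) z"
    "inv_sqrt t * heat (s + t) z \<le> 40000 * (inv_sqrt t * (1 / ((s + (norm z)\<^sup>2 + t) * sqrt (s + (norm z)\<^sup>2 + t))))"
proof -
  have "0 \<le> inv_sqrt t * heat (s + t) z \<and> inv_sqrt t * heat (s + t) z \<le> 40000 * (inv_sqrt t * (1 / ((s + (norm z)\<^sup>2 + t) * sqrt (s + (norm z)\<^sup>2 + t))))"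
  proof (cases "t > 0")
    case True
    then have "s + t > 0" using s by simp
    then show ?thesis
      using mult_left_mono[OF heat_crude_bounds(1)[of "s + t" z], of "inv_sqrt t"] heat_nonneg[of "s + t" z]
      by (simp add: mult_ac add_ac)
  qed (simp add: inv_sqrt_def)
  then show "0 \<le> inv_sqrt t * heat (s + t) z"
    "inv_sqrt t * heat (s + t) z \<le> 40000 * (inv_sqrt t * (1 / ((s + (norm z)\<^sup>2 + t) * sqrt (s + (norm z)\<^sup>2 + t))))"
    by auto
qed

text \<open>The crude bound on \<open>heat\<close> depends on \<open>s + t + |z|^2\<close> alone, so
  \<open>inv_sqrt_three_halves\<close> applies with \<open>s + |z|^2\<close> as its parameter. This
  covers \<open>s = 0\<close> with \<open>z \<noteq> 0\<close> and gives the majorant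
  \<open>80000 / |z|^2\<close> for the limit at time 0.\<close>

lemma heat_riesz_bounds:
  assumes s: "s \<ge> 0" and p: "s + (norm z)\<^sup>2 > 0"
  shows "integrable lborel (\<lambda>t. inv_sqrt t * heat (s + t) z)"
    "0 \<le> heat_riesz s z" "heat_riesz s z \<le> 80000 / (s + (norm z)\<^sup>2)"
proof -
  note I = inv_sqrt_three_halves[OF p]
  show i: "integrable lborel (\<lambda>t. inv_sqrt t * heat (s + t) z)"
    by (rule integrable_dominated[OF integrable_mult_right[OF I(1), of 40000]])
      (use heat_riesz_integrand[OF s] in auto)
  show "0 \<le> heat_riesz s z"
    unfolding heat_riesz_def using heat_riesz_integrand(1)[OF s]
    by (intro mult_nonneg_nonneg integral_nonneg_AE) auto
  have "(\<integral>t. inv_sqrt t * heat (s + t) z \<partial>lborel) \<le>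
     (\<integral>t. 40000 * (inv_sqrt t * (1 / ((s + (norm z)\<^sup>2 + t) * sqrt (s + (norm z)\<^sup>2 + t)))) \<partial>lborel)"
    by (intro integral_mono i integrable_mult_right I heat_riesz_integrand s)
  also have "\<dots> = 80000 / (s + (norm z)\<^sup>2)"
    unfolding integral_mult_right_zero I(2) by simp
  finally have "(\<integral>t. inv_sqrt t * heat (s + t) z \<partial>lborel) \<le> 80000 / (s + (norm z)\<^sup>2)" .
  then have "1 / sqrt pi * (\<integral>t. inv_sqrt t * heat (s + t) z \<partial>lborel) \<le> 1 * (80000 / (s + (norm z)\<^sup>2))"
    using inv_sqrt_pi_le heat_riesz_integrand(1)[OF s] by (intro mult_mono integral_nonneg_AE) auto
  then show "heat_riesz s z \<le> 80000 / (s + (norm z)\<^sup>2)" by (simp add: heat_riesz_def)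
qed

text \<open>At \<open>s = 0\<close> the integrand is a multiple of
  \<open>exp (- |z|^2 / (4 * t)) / t^2\<close>, an exact derivative. The constant is
  \<open>(4 * pi)^(-3/2) * 4 / sqrt pi = 1 / (2 * pi^2)\<close>.\<close>

lemma heat_riesz_0:
  assumes z: "z \<noteq> 0"
  shows "heat_riesz 0 z = 1 / (2 * pi\<^sup>2 * (norm z)\<^sup>2)"
proof -
  define \<rho> where "\<rho> = (norm z)\<^sup>2"
  define K where "K = (1 / sqrt (4 * pi)) ^ 3"
  have \<rho>: "\<rho> > 0" using z by (simp add: \<rho>_def)
  have eq: "inv_sqrt t * heat (0 + t) z = (if t > 0 then K * (exp (- \<rho> / (4 * t)) / t\<^sup>2) else 0)" for t
  proof (cases "t > 0")
    case True
    have gen: "(1 / (a * b)) ^ 3 = (1 / a) ^ 3 * (1 / (b * b * b))" for a b :: real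
      by (simp add: power3_eq_cube)
    have "(1 / sqrt (4 * pi * t)) ^ 3 = K * (1 / (sqrt t * sqrt t * sqrt t))"
      unfolding K_def by (subst real_sqrt_mult, rule gen)
    then have "(1 / sqrt (4 * pi * t)) ^ 3 = K * (1 / (t * sqrt t))"
      using True by simp
    moreover have "sqrt t * sqrt t = t" using True by simp
    ultimately show ?thesis
      using True by (simp add: inv_sqrt_def heat_def \<rho>_def power2_eq_square)
  qed (simp add: inv_sqrt_def)
  have "(\<integral>t. (if t > 0 then K * (exp (- \<rho> / (4 * t)) / t\<^sup>2) else 0) \<partial>lborel) = K * (4 / \<rho>) - 0"
  proof (rule FTC_nonneg_atLeast_0(2)[where F = "\<lambda>t. K * (4 / \<rho> * exp (- \<rho> / (4 * t)))"])
    fix t :: real assume t: "t > 0"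
    show "((\<lambda>t. K * (4 / \<rho> * exp (- \<rho> / (4 * t)))) has_real_derivative
        (if t > 0 then K * (exp (- \<rho> / (4 * t)) / t\<^sup>2) else 0)) (at t)"
      using t \<rho> by (auto intro!: derivative_eq_intros simp: power2_eq_square)
    have "isCont (\<lambda>t. K * (exp (- \<rho> / (4 * t)) / t\<^sup>2)) t"
      using t by (auto intro!: continuous_intros)
    moreover have "\<forall>\<^sub>F r in nhds t. K * (exp (- \<rho> / (4 * r)) / r\<^sup>2) = (if r > 0 then K * (exp (- \<rho> / (4 * r)) / r\<^sup>2) else 0)"
      using eventually_nhds_in_open[of "{0<..}" t] t by (auto elim!: eventually_mono)
    ultimately show "isCont (\<lambda>t. if t > 0 then K * (exp (- \<rho> / (4 * t)) / t\<^sup>2) else 0) t"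
      by (subst (asm) isCont_cong) auto
  next
    have "((\<lambda>t. exp (- \<rho> / (4 * t))) \<longlongrightarrow> 0) (at_right 0)" "((\<lambda>t. exp (- \<rho> / (4 * t))) \<longlongrightarrow> 1) at_top"
      using \<rho> by real_asymp+
    note this[THEN tendsto_mult[OF tendsto_const[of "4 / \<rho>"]], THEN tendsto_mult[OF tendsto_const[of K]]]
    then show "((\<lambda>t. K * (4 / \<rho> * exp (- \<rho> / (4 * t)))) \<longlongrightarrow> 0) (at_right 0)"
      "((\<lambda>t. K * (4 / \<rho> * exp (- \<rho> / (4 * t)))) \<longlongrightarrow> K * (4 / \<rho>)) at_top" by simp_all
  qed (auto simp: K_def)
  then have "heat_riesz 0 z = 1 / sqrt pi * (K * (4 / \<rho>))"
    unfolding heat_riesz_def eq by simp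
  also have "K = 1 / (8 * pi * sqrt pi)"
    by (simp add: K_def real_sqrt_mult power3_eq_cube)
  also have "1 / sqrt pi * (1 / (8 * pi * sqrt pi) * (4 / \<rho>)) = 1 / (2 * pi\<^sup>2 * \<rho>)"
    using \<rho> by (simp add: power2_eq_square)
  finally show ?thesis by (simp add: \<rho>_def)
qed

lemma heat_riesz_tendsto_0:
  assumes z: "z \<noteq> 0"
  shows "((\<lambda>s. heat_riesz s z) \<longlongrightarrow> 1 / (2 * pi\<^sup>2 * (norm z)\<^sup>2)) (at_right 0)"
proof -
  have p: "0 + (norm z)\<^sup>2 > 0" using z by simp
  have "((\<lambda>s. \<integral>t. inv_sqrt t * heat (s + t) z \<partial>lborel) \<longlongrightarrow> (\<integral>t. inv_sqrt t * heat (0 + t) z \<partial>lborel)) (at_right 0)"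
  proof (rule tendsto_integral_at_within)
    show "integrable lborel (\<lambda>t. 40000 * (inv_sqrt t * (1 / ((0 + (norm z)\<^sup>2 + t) * sqrt (0 + (norm z)\<^sup>2 + t)))))"
      by (intro integrable_mult_right inv_sqrt_three_halves p)
    show "\<forall>\<^sub>F s in at_right 0. AE t in lborel. norm (inv_sqrt t * heat (s + t) z) \<le>
        40000 * (inv_sqrt t * (1 / ((0 + (norm z)\<^sup>2 + t) * sqrt (0 + (norm z)\<^sup>2 + t))))"
      using eventually_at_right_less[of 0]
    proof (eventually_elim, intro AE_I2)
      fix s t :: real assume s: "0 < s"
      show "norm (inv_sqrt t * heat (s + t) z) \<le>
        40000 * (inv_sqrt t * (1 / ((0 + (norm z)\<^sup>2 + t) * sqrt (0 + (norm z)\<^sup>2 + t))))"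
      proof (cases "t > 0")
        case True
        have "norm (inv_sqrt t * heat (s + t) z) \<le> 40000 * (inv_sqrt t * (1 / ((s + (norm z)\<^sup>2 + t) * sqrt (s + (norm z)\<^sup>2 + t))))"
          using heat_riesz_integrand[of s t z] s by simp
        also have "\<dots> \<le> 40000 * (inv_sqrt t * (1 / ((0 + (norm z)\<^sup>2 + t) * sqrt (0 + (norm z)\<^sup>2 + t))))"
          using s True p by (intro mult_left_mono divide_left_mono mult_mono mult_pos_pos real_sqrt_le_mono)
            (auto intro!: add_nonneg_pos)
        finally show ?thesis .
      qed (simp add: inv_sqrt_def)
    qed
    have "((\<lambda>s. inv_sqrt t * heat (s + t) z) \<longlongrightarrow> inv_sqrt t * heat (0 + t) z) (at_right 0)" for t
    proof (cases "t > 0")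
      case True
      have "isCont (\<lambda>s. heat (s + t) z) 0"
        using isCont_o2[of 0 "\<lambda>s. s + t" "\<lambda>s. heat s z"] isCont_heat_time(1)[OF True, of z] by simp
      then have "((\<lambda>s. heat (s + t) z) \<longlongrightarrow> heat (0 + t) z) (at_right 0)"
        by (simp add: isCont_def filterlim_at_split)
      then show ?thesis by (intro tendsto_intros)
    qed (simp add: inv_sqrt_def)
    then show "AE t in lborel. ((\<lambda>s. inv_sqrt t * heat (s + t) z) \<longlongrightarrow> inv_sqrt t * heat (0 + t) z) (at_right 0)"
      by simp
  qed auto
  then have "((\<lambda>s. heat_riesz s z) \<longlongrightarrow> heat_riesz 0 z) (at_right 0)"
    unfolding heat_riesz_def by (intro tendsto_intros)
  then show ?thesis by (simp add: heat_riesz_0[OF z])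
qed

lemma heat1_weighted_bound:
  assumes s: "s > 0"
  shows "\<bar>inv_sqrt t * heat1 (s + t) z\<bar> \<le> 40000 / s * (inv_sqrt t * (1 / ((s + t) * sqrt (s + t))))"
proof (cases "t > 0")
  case True
  have "\<bar>heat1 (s + t) z\<bar> \<le> 40000 / (s + t) * (1 / ((s + t) * sqrt (s + t)))"
    using heat_crude_bounds(2)[of "s + t" z] s True by simp
  also have "\<dots> \<le> 40000 / s * (1 / ((s + t) * sqrt (s + t)))"
    using s True by (intro mult_right_mono divide_left_mono) auto
  finally have "inv_sqrt t * \<bar>heat1 (s + t) z\<bar> \<le> inv_sqrt t * (40000 / s * (1 / ((s + t) * sqrt (s + t))))"
    by (rule mult_left_mono) simp
  then show ?thesis by (simp add: abs_mult mult_ac)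
qed (simp add: inv_sqrt_def)

lemma heat_riesz1_bound:
  assumes s: "s > 0"
  shows "integrable lborel (\<lambda>t. inv_sqrt t * heat1 (s + t) z)" "\<bar>heat_riesz1 s z\<bar> \<le> 80000 / s\<^sup>2"
proof -
  note I = inv_sqrt_three_halves[OF s]
  show i: "integrable lborel (\<lambda>t. inv_sqrt t * heat1 (s + t) z)"
    by (rule integrable_dominated[OF integrable_mult_right[OF I(1), of "40000 / s"]])
      (use heat1_weighted_bound[OF s] in auto)
  have "\<bar>\<integral>t. inv_sqrt t * heat1 (s + t) z \<partial>lborel\<bar> \<le> (\<integral>t. \<bar>inv_sqrt t * heat1 (s + t) z\<bar> \<partial>lborel)"
    by (rule integral_abs_bound)
  also have "\<dots> \<le> (\<integral>t. 40000 / s * (inv_sqrt t * (1 / ((s + t) * sqrt (s + t)))) \<partial>lborel)"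
    by (intro integral_mono i integrable_abs integrable_mult_right I heat1_weighted_bound s)
  also have "\<dots> = 80000 / s\<^sup>2"
    unfolding integral_mult_right_zero I(2) by (simp add: power2_eq_square)
  finally have "\<bar>\<integral>t. inv_sqrt t * heat1 (s + t) z \<partial>lborel\<bar> \<le> 80000 / s\<^sup>2" .
  then have "1 / sqrt pi * \<bar>\<integral>t. inv_sqrt t * heat1 (s + t) z \<partial>lborel\<bar> \<le> 1 * (80000 / s\<^sup>2)"
    using inv_sqrt_pi_le by (intro mult_mono) auto
  then show "\<bar>heat_riesz1 s z\<bar> \<le> 80000 / s\<^sup>2" by (simp add: heat_riesz1_def abs_mult)
qed

lemma heat_riesz_deriv:
  assumes s: "s > 0"
  shows "((\<lambda>s. heat_riesz s z) has_real_derivative heat_riesz1 s z) (at s)"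
  unfolding heat_riesz_def heat_riesz1_def
proof (rule DERIV_cmult, rule has_real_derivative_integral(2))
  show "s / 2 > 0" using s by simp
  show "integrable lborel (\<lambda>t. 40000 / (s / 2) * (inv_sqrt t * (1 / ((s / 2 + t) * sqrt (s / 2 + t)))))"
    using s by (intro integrable_mult_right inv_sqrt_three_halves) simp
  fix r assume r: "\<bar>r - s\<bar> < s / 2"
  then have r': "r > s / 2" "r > 0" using s by linarith+
  show "integrable lborel (\<lambda>t. inv_sqrt t * heat (r + t) z)"
    using r' by (intro heat_riesz_bounds) (auto intro: add_pos_nonneg)
  fix t :: real
  show "((\<lambda>s. inv_sqrt t * heat (s + t) z) has_real_derivative inv_sqrt t * heat1 (r + t) z) (at r)"
  proof (cases "t > 0")
    case True
    then show ?thesis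
      using DERIV_shift[of "\<lambda>s. heat s z" "heat1 (r + t) z" r t] heat_deriv(1)[of "r + t" z] r'
      by (intro DERIV_cmult) simp
  qed (simp add: inv_sqrt_def)
  show "\<bar>inv_sqrt t * heat1 (r + t) z\<bar> \<le> 40000 / (s / 2) * (inv_sqrt t * (1 / ((s / 2 + t) * sqrt (s / 2 + t))))"
  proof (cases "t > 0")
    case True
    have "\<bar>inv_sqrt t * heat1 (r + t) z\<bar> \<le> 40000 / r * (inv_sqrt t * (1 / ((r + t) * sqrt (r + t))))"
      using r' by (intro heat1_weighted_bound) simp
    also have "\<dots> \<le> 40000 / (s / 2) * (inv_sqrt t * (1 / ((s / 2 + t) * sqrt (s / 2 + t))))"
      using r' s True by (intro mult_mono mult_left_mono divide_left_mono mult_pos_pos real_sqrt_le_mono) auto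
    finally show ?thesis .
  qed (simp add: inv_sqrt_def)
qed

lemma heat_half_measurable [measurable (raw)]:
  assumes [measurable]: "f \<in> borel_measurable M" "g \<in> borel_measurable M"
  shows "(\<lambda>x. heat_half (f x) (g x)) \<in> borel_measurable M"
proof -
  have "(\<lambda>(x, t). inv_sqrt t * heat2 (f x + t) (g x)) \<in> borel_measurable (M \<Otimes>\<^sub>M lborel)"
    by measurable
  then show ?thesis
    unfolding heat_half_def by (intro borel_measurable_times borel_measurable_const lborel.borel_measurable_lebesgue_integral)
qed

text \<open>A continuous density is bounded near the singularity of the kernel \<open>\<bar>z\<bar>\<^sup>-\<^sup>2\<close> and integrable away from it.\<close>

lemma inverse_square_pairing:
  fixes x :: "real^3"
  assumes f: "integrable lborel f" and nn: "\<And>y. 0 \<le> f y" and c: "continuous_on UNIV f"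
  shows "integrable lborel (\<lambda>y. f y / (norm (x - y))\<^sup>2)"
proof -
  obtain C where C: "\<And>(x::real^3) R. R > 0 \<Longrightarrow> integrable lborel (\<lambda>y. indicator (cball x R) y / (norm (x - y))\<^sup>2)"
    using inverse_square_local_integral by blast
  have "bounded (f ` cball x 1)"
    by (intro compact_imp_bounded compact_continuous_image) (use c in \<open>auto intro: continuous_on_subset\<close>)
  then obtain S where "\<forall>y\<in>f ` cball x 1. norm y \<le> S" unfolding bounded_iff by blast
  then have S: "f y \<le> S" if "y \<in> cball x 1" for y
  proof -
    have "norm (f y) \<le> S" using \<open>\<forall>y\<in>f ` cball x 1. norm y \<le> S\<close> that by blast
    then show ?thesis by simp
  qed
  have [measurable]: "f \<in> borel_measurable borel" using f by auto
  show ?thesis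
  proof (rule integrable_dominated)
    show "integrable lborel (\<lambda>y. S * (indicator (cball x 1) y / (norm (x - y))\<^sup>2) + f y)"
      using C[of 1 x] f by (intro Bochner_Integration.integrable_add integrable_mult_right) auto
    fix y
    show "norm (f y / (norm (x - y))\<^sup>2) \<le> S * (indicator (cball x 1) y / (norm (x - y))\<^sup>2) + f y"
    proof (cases "y \<in> cball x 1")
      case True
      have "f y / (norm (x - y))\<^sup>2 \<le> S / (norm (x - y))\<^sup>2" using S[OF True] by (intro divide_right_mono) auto
      then show ?thesis using True nn[of y] by simp
    next
      case False
      then have "1 \<le> (norm (x - y))\<^sup>2" by (intro one_le_power) (simp add: dist_norm)
      then have "f y / (norm (x - y))\<^sup>2 \<le> f y / 1" using nn[of y] by (intro divide_left_mono) auto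
      then show ?thesis using False nn[of y] by simp
    qed
  qed measurable
qed

text \<open>All that is kept of the equation: \<open>w\<close> is \<open>- \<Delta>u\<close>,
  \<open>f\<close> is \<open>e^(3u)\<close>, and \<open>eq\<close> is the equation tested at every
  time and every centre.\<close>

locale half_laplace_equation =
  fixes w f :: "real^3 \<Rightarrow> real"
  assumes w: "moderate w" and cw: "continuous_on UNIV w"
    and f: "integrable lborel f" and nn: "\<And>y. 0 \<le> f y" and cf: "continuous_on UNIV f"
    and eq: "\<And>s x. s > 0 \<Longrightarrow>
      (\<integral>y. heat_half s (x - y) * w y \<partial>lborel) = 2 * (\<integral>y. heat1 s (x - y) * f y \<partial>lborel)"
begin

lemma meas [measurable]: "w \<in> borel_measurable borel" "f \<in> borel_measurable borel"
  using w borel_measurable_integrable[OF f] by (simp_all add: moderate_def)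

text \<open>Write the equation at time \<open>s + \<tau>\<close> and integrate it against
  \<open>\<tau>^(-1/2)\<close>. On the left \<open>heat_half_half\<close> removes the half
  Laplacian, on the right the definition of \<open>heat_riesz1\<close> appears, and the common
  factor \<open>sqrt pi\<close> cancels.\<close>

lemma heat1_identity:
  assumes s: "s > 0"
  shows "(\<integral>y. heat1 s (x - y) * w y \<partial>lborel) = 2 * (\<integral>y. heat_riesz1 s (x - y) * f y \<partial>lborel)"
proof -
  define c where "c = 2 + (1 + 2 * (norm x)\<^sup>2) / s"
  have PF: "integrable (lborel \<Otimes>\<^sub>M lborel) (\<lambda>(y, \<tau>). inv_sqrt \<tau> * heat_half (s + \<tau>) (x - y) * w y)"
  proof (rule integrable_pair_dominated[where g = "\<lambda>\<tau>. inv_sqrt \<tau> * (1 / (s + \<tau>))"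
        and f = "\<lambda>y. 80000 * c\<^sup>2 * (norm (w y) / (1 + norm y ^ 4))"])
    show "integrable lborel (\<lambda>y. 80000 * c\<^sup>2 * (norm (w y) / (1 + norm y ^ 4)))"
      using w by (intro integrable_mult_right) (simp add: moderate_def)
    show "integrable lborel (\<lambda>\<tau>. inv_sqrt \<tau> * (1 / (s + \<tau>)))" by (rule inv_sqrt_inverse[OF s])
    show "(\<lambda>(y, \<tau>). inv_sqrt \<tau> * heat_half (s + \<tau>) (x - y) * w y) \<in> borel_measurable (lborel \<Otimes>\<^sub>M lborel)"
      by measurable
    fix y \<tau>
    show "norm (case (y, \<tau>) of (y, \<tau>) \<Rightarrow> inv_sqrt \<tau> * heat_half (s + \<tau>) (x - y) * w y) \<le>
       80000 * c\<^sup>2 * (norm (w y) / (1 + norm y ^ 4)) * (inv_sqrt \<tau> * (1 / (s + \<tau>)))"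
    proof (cases "\<tau> > 0")
      case True
      have "\<bar>heat_half (s + \<tau>) (x - y)\<bar> \<le> 80000 / (s + \<tau>) / (s + \<tau> + (norm (x - y))\<^sup>2)\<^sup>2"
        using True s by (intro heat_half_bound) auto
      \<comment> \<open>Dropping \<open>\<tau>\<close> from the spatial factor keeps the constant
        \<open>c\<close> of \<open>weight_le\<close> independent of \<open>\<tau>\<close>; the
        factor \<open>1 / (s + \<tau>)\<close> remains for the time integral.\<close>
      also have "\<dots> \<le> 80000 / (s + \<tau>) / (s + (norm (x - y))\<^sup>2)\<^sup>2"
        using True s by (intro divide_left_mono power_mono mult_pos_pos zero_less_power) (auto simp: add_pos_nonneg)
      finally have "norm (heat_half (s + \<tau>) (x - y) *\<^sub>R w y) \<le> 80000 / (s + \<tau>) * c\<^sup>2 * (norm (w y) / (1 + norm y ^ 4))"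
        unfolding c_def by (rule moderate_bound[OF s])
      then have "inv_sqrt \<tau> * norm (heat_half (s + \<tau>) (x - y) *\<^sub>R w y) \<le>
          inv_sqrt \<tau> * (80000 / (s + \<tau>) * c\<^sup>2 * (norm (w y) / (1 + norm y ^ 4)))"
        by (rule mult_left_mono) simp
      then show ?thesis by (simp add: abs_mult mult_ac)
    qed (simp add: inv_sqrt_def)
  qed
  have PG: "integrable (lborel \<Otimes>\<^sub>M lborel) (\<lambda>(y, \<tau>). inv_sqrt \<tau> * heat1 (s + \<tau>) (x - y) * f y)"
  proof (rule integrable_pair_dominated[where f = f
        and g = "\<lambda>\<tau>. 40000 / s * (inv_sqrt \<tau> * (1 / ((s + \<tau>) * sqrt (s + \<tau>))))"])
    show "integrable lborel (\<lambda>\<tau>. 40000 / s * (inv_sqrt \<tau> * (1 / ((s + \<tau>) * sqrt (s + \<tau>)))))"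
      by (intro integrable_mult_right inv_sqrt_three_halves s)
    show "(\<lambda>(y, \<tau>). inv_sqrt \<tau> * heat1 (s + \<tau>) (x - y) * f y) \<in> borel_measurable (lborel \<Otimes>\<^sub>M lborel)"
      by measurable
    fix y \<tau>
    have "\<bar>inv_sqrt \<tau> * heat1 (s + \<tau>) (x - y)\<bar> * f y \<le> 40000 / s * (inv_sqrt \<tau> * (1 / ((s + \<tau>) * sqrt (s + \<tau>)))) * f y"
      by (intro mult_right_mono heat1_weighted_bound s nn)
    then show "norm (case (y, \<tau>) of (y, \<tau>) \<Rightarrow> inv_sqrt \<tau> * heat1 (s + \<tau>) (x - y) * f y) \<le>
       f y * (40000 / s * (inv_sqrt \<tau> * (1 / ((s + \<tau>) * sqrt (s + \<tau>)))))"
      using nn[of y] by (simp add: abs_mult mult_ac)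
  qed (rule f)
  have "sqrt pi * (\<integral>y. heat1 s (x - y) * w y \<partial>lborel) = (\<integral>y. (sqrt pi * heat1 s (x - y)) * w y \<partial>lborel)"
    by (simp add: mult.assoc)
  also have "\<dots> = (\<integral>y. (\<integral>\<tau>. inv_sqrt \<tau> * heat_half (s + \<tau>) (x - y) * w y \<partial>lborel) \<partial>lborel)"
    by (simp only: integral_mult_left_zero heat_half_half[OF s])
  also have "\<dots> = (\<integral>\<tau>. (\<integral>y. inv_sqrt \<tau> * heat_half (s + \<tau>) (x - y) * w y \<partial>lborel) \<partial>lborel)"
    by (rule lborel_pair.Fubini_integral[OF PF, symmetric])
  also have "\<dots> = (\<integral>\<tau>. 2 * (\<integral>y. inv_sqrt \<tau> * heat1 (s + \<tau>) (x - y) * f y \<partial>lborel) \<partial>lborel)"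
  proof (intro Bochner_Integration.integral_cong refl)
    fix \<tau> :: real
    show "(\<integral>y. inv_sqrt \<tau> * heat_half (s + \<tau>) (x - y) * w y \<partial>lborel) =
        2 * (\<integral>y. inv_sqrt \<tau> * heat1 (s + \<tau>) (x - y) * f y \<partial>lborel)"
    proof (cases "\<tau> > 0")
      case True
      then show ?thesis using eq[of "s + \<tau>" x] s by (simp add: mult.assoc)
    qed (simp add: inv_sqrt_def)
  qed
  also have "\<dots> = 2 * (\<integral>\<tau>. (\<integral>y. inv_sqrt \<tau> * heat1 (s + \<tau>) (x - y) * f y \<partial>lborel) \<partial>lborel)"
    by (rule integral_mult_right_zero)
  also have "(\<integral>\<tau>. (\<integral>y. inv_sqrt \<tau> * heat1 (s + \<tau>) (x - y) * f y \<partial>lborel) \<partial>lborel) =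
      (\<integral>y. (\<integral>\<tau>. inv_sqrt \<tau> * heat1 (s + \<tau>) (x - y) * f y \<partial>lborel) \<partial>lborel)"
    by (rule lborel_pair.Fubini_integral[OF PG])
  also have "\<dots> = (\<integral>y. sqrt pi * (heat_riesz1 s (x - y) * f y) \<partial>lborel)"
    by (intro Bochner_Integration.integral_cong refl) (simp add: heat_riesz1_def)
  also have "\<dots> = sqrt pi * (\<integral>y. heat_riesz1 s (x - y) * f y \<partial>lborel)"
    by (rule integral_mult_right_zero)
  finally show ?thesis by simp
qed

lemma heat_w_deriv:
  assumes s: "s > 0"
  shows "((\<lambda>s. \<integral>y. heat s (x - y) * w y \<partial>lborel) has_real_derivative (\<integral>y. heat1 s (x - y) * w y \<partial>lborel)) (at s)"
proof (rule has_real_derivative_integral(2))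
  define c where "c = 2 + (1 + 2 * (norm x)\<^sup>2) / (s / 2)"
  show "s / 2 > 0" using s by simp
  show "integrable lborel (\<lambda>y. 40000 / sqrt (s / 2) * c\<^sup>2 * (norm (w y) / (1 + norm y ^ 4)))"
    using w by (intro integrable_mult_right) (simp add: moderate_def)
  fix r assume r: "\<bar>r - s\<bar> < s / 2"
  then have r': "r > s / 2" "r > 0" using s by linarith+
  show "integrable lborel (\<lambda>y. heat r (x - y) * w y)"
    using moderate_pairing[OF w r'(2), of "heat r" "40000 * sqrt r" x] heat_bounds(1)[OF r'(2)] heat_nonneg[OF r'(2)] by simp
  fix y
  show "((\<lambda>s. heat s (x - y) * w y) has_real_derivative heat1 r (x - y) * w y) (at r)"
    by (intro DERIV_cmult_right heat_deriv r')
  have "\<bar>heat1 r (x - y)\<bar> \<le> 40000 / (sqrt r * (r + (norm (x - y))\<^sup>2)\<^sup>2)"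
    by (rule heat_bounds(2)[OF r'(2)])
  also have "\<dots> \<le> 40000 / (sqrt (s / 2) * (s / 2 + (norm (x - y))\<^sup>2)\<^sup>2)"
    using r' s by (intro divide_left_mono mult_mono power_mono mult_pos_pos zero_less_power) (auto simp: add_pos_nonneg)
  also have "\<dots> = 40000 / sqrt (s / 2) / (s / 2 + (norm (x - y))\<^sup>2)\<^sup>2" by simp
  finally have "norm (heat1 r (x - y) *\<^sub>R w y) \<le> 40000 / sqrt (s / 2) * c\<^sup>2 * (norm (w y) / (1 + norm y ^ 4))"
    unfolding c_def by (rule moderate_bound[rotated]) (use s in simp)
  then show "\<bar>heat1 r (x - y) * w y\<bar> \<le> 40000 / sqrt (s / 2) * c\<^sup>2 * (norm (w y) / (1 + norm y ^ 4))"
    by simp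
qed

lemma heat_riesz_f_integrable:
  assumes s: "s > 0"
  shows "integrable lborel (\<lambda>y. heat_riesz s (x - y) * f y)"
    and "\<bar>\<integral>y. heat_riesz s (x - y) * f y \<partial>lborel\<bar> \<le> 80000 / s * (\<integral>y. f y \<partial>lborel)"
proof -
  have b: "\<bar>heat_riesz s (x - y) * f y\<bar> \<le> 80000 / s * f y" for y
  proof -
    have "heat_riesz s (x - y) \<le> 80000 / (s + (norm (x - y))\<^sup>2)" "0 \<le> heat_riesz s (x - y)"
      using s by (auto intro!: heat_riesz_bounds)
    moreover have "80000 / (s + (norm (x - y))\<^sup>2) \<le> 80000 / s"
      using s by (intro divide_left_mono) (auto simp: add_pos_nonneg)
    ultimately have "\<bar>heat_riesz s (x - y)\<bar> \<le> 80000 / s" by simp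
    then show ?thesis using nn[of y] mult_right_mono by (fastforce simp: abs_mult)
  qed
  show i: "integrable lborel (\<lambda>y. heat_riesz s (x - y) * f y)"
    by (rule integrable_dominated[OF integrable_mult_right[OF f, of "80000 / s"]]) (use b in auto)
  have "\<bar>\<integral>y. heat_riesz s (x - y) * f y \<partial>lborel\<bar> \<le> (\<integral>y. \<bar>heat_riesz s (x - y) * f y\<bar> \<partial>lborel)"
    by (rule integral_abs_bound)
  also have "\<dots> \<le> (\<integral>y. 80000 / s * f y \<partial>lborel)"
    by (intro integral_mono integrable_abs i integrable_mult_right f b)
  finally show "\<bar>\<integral>y. heat_riesz s (x - y) * f y \<partial>lborel\<bar> \<le> 80000 / s * (\<integral>y. f y \<partial>lborel)"
    by simp
qed

lemma heat_riesz_f_deriv: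
  assumes s: "s > 0"
  shows "((\<lambda>s. \<integral>y. heat_riesz s (x - y) * f y \<partial>lborel) has_real_derivative
    (\<integral>y. heat_riesz1 s (x - y) * f y \<partial>lborel)) (at s)"
proof (rule has_real_derivative_integral(2))
  show "s / 2 > 0" using s by simp
  show "integrable lborel (\<lambda>y. 80000 / (s / 2)\<^sup>2 * f y)"
    by (intro integrable_mult_right f)
  fix r assume r: "\<bar>r - s\<bar> < s / 2"
  then have r': "r > s / 2" "r > 0" using s by linarith+
  show "integrable lborel (\<lambda>y. heat_riesz r (x - y) * f y)" by (rule heat_riesz_f_integrable[OF r'(2)])
  fix y
  show "((\<lambda>s. heat_riesz s (x - y) * f y) has_real_derivative heat_riesz1 r (x - y) * f y) (at r)"
    by (intro DERIV_cmult_right heat_riesz_deriv r')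
  have "\<bar>heat_riesz1 r (x - y)\<bar> \<le> 80000 / r\<^sup>2" by (rule heat_riesz1_bound[OF r'(2)])
  also have "\<dots> \<le> 80000 / (s / 2)\<^sup>2"
    using r' s by (intro divide_left_mono power_mono mult_pos_pos zero_less_power) auto
  finally have "\<bar>heat_riesz1 r (x - y)\<bar> * f y \<le> 80000 / (s / 2)\<^sup>2 * f y" by (rule mult_right_mono) (rule nn)
  then show "\<bar>heat_riesz1 r (x - y) * f y\<bar> \<le> 80000 / (s / 2)\<^sup>2 * f y"
    using nn[of y] by (simp add: abs_mult)
qed

text \<open>\<open>heat1_identity\<close> says that the derivative in \<open>s\<close> vanishes. As
  time tends to 0 the value becomes \<open>w x\<close> minus the potential, and for large times the
  dependence on \<open>x\<close> disappears.\<close>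

definition defect :: "real^3 \<Rightarrow> real \<Rightarrow> real" where
  "defect x s = (\<integral>y. heat s (x - y) * w y \<partial>lborel) - 2 * (\<integral>y. heat_riesz s (x - y) * f y \<partial>lborel)"

lemma defect_constant:
  assumes "a > 0" "b > 0"
  shows "defect x a = defect x b"
proof -
  have d: "(defect x has_real_derivative 0) (at s)" if "s > 0" for s
    using DERIV_diff[OF heat_w_deriv[OF that, of x] DERIV_cmult[OF heat_riesz_f_deriv[OF that, of x], of 2]]
    by (simp add: defect_def[abs_def] heat1_identity[OF that])
  have *: "defect x a = defect x b" if "0 < a" "a < b" for a b
  proof -
    have "\<exists>z>a. z < b \<and> defect x b - defect x a = (b - a) * 0"
      by (rule MVT2[OF that(2)]) (rule d, use that in linarith)
    then show ?thesis by auto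
  qed
  consider "a < b" | "b < a" | "a = b" by linarith
  then show ?thesis
  proof cases
    case 1
    then show ?thesis by (rule *[OF assms(1)])
  next
    case 2
    then show ?thesis by (rule *[OF assms(2), symmetric])
  qed simp
qed

lemma defect_at_0:
  "(defect x \<longlongrightarrow> w x - 1 / pi\<^sup>2 * (\<integral>y. f y / (norm (x - y))\<^sup>2 \<partial>lborel)) (at_right 0)"
proof -
  have 1: "((\<lambda>s. \<integral>y. heat s (x - y) * w y \<partial>lborel) \<longlongrightarrow> w x) (at_right 0)"
    using heat_approx_identity[OF w, of x] cw by (simp add: continuous_on_eq_continuous_at)
  have "((\<lambda>s. \<integral>y. heat_riesz s (x - y) * f y \<partial>lborel) \<longlongrightarrow> (\<integral>y. 1 / (2 * pi\<^sup>2 * (norm (x - y))\<^sup>2) * f y \<partial>lborel)) (at_right 0)"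
  proof (rule tendsto_integral_at_within)
    show "integrable lborel (\<lambda>y. 80000 * (f y / (norm (x - y))\<^sup>2))"
      by (intro integrable_mult_right inverse_square_pairing f nn cf)
    show "\<forall>\<^sub>F s in at_right 0. AE y in lborel. norm (heat_riesz s (x - y) * f y) \<le> 80000 * (f y / (norm (x - y))\<^sup>2)"
      using eventually_at_right_less[of 0]
    proof eventually_elim
      fix s :: real assume s: "0 < s"
      show "AE y in lborel. norm (heat_riesz s (x - y) * f y) \<le> 80000 * (f y / (norm (x - y))\<^sup>2)"
        using AE_lborel_singleton[of x]
      proof eventually_elim
        case (elim y)
        then have p: "(norm (x - y))\<^sup>2 > 0" by simp
        have "heat_riesz s (x - y) \<le> 80000 / (s + (norm (x - y))\<^sup>2)" "0 \<le> heat_riesz s (x - y)"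
          using s by (auto intro!: heat_riesz_bounds)
        moreover have "80000 / (s + (norm (x - y))\<^sup>2) \<le> 80000 / (norm (x - y))\<^sup>2"
          using s p by (intro divide_left_mono mult_pos_pos add_pos_pos) auto
        ultimately have "\<bar>heat_riesz s (x - y)\<bar> \<le> 80000 / (norm (x - y))\<^sup>2" by linarith
        then have "\<bar>heat_riesz s (x - y)\<bar> * f y \<le> 80000 / (norm (x - y))\<^sup>2 * f y"
          by (rule mult_right_mono) (rule nn)
        then show ?case using nn[of y] by (simp add: abs_mult)
      qed
    qed
    show "AE y in lborel. ((\<lambda>s. heat_riesz s (x - y) * f y) \<longlongrightarrow> 1 / (2 * pi\<^sup>2 * (norm (x - y))\<^sup>2) * f y) (at_right 0)"
      using AE_lborel_singleton[of x] by eventually_elim (intro tendsto_intros heat_riesz_tendsto_0, simp)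
  qed measurable
  from tendsto_diff[OF 1 tendsto_mult[OF tendsto_const[of 2] this]]
  have "(defect x \<longlongrightarrow> w x - 2 * (\<integral>y. 1 / (2 * pi\<^sup>2 * (norm (x - y))\<^sup>2) * f y \<partial>lborel)) (at_right 0)"
    by (simp add: defect_def[abs_def])
  also have "(\<integral>y. 1 / (2 * pi\<^sup>2 * (norm (x - y))\<^sup>2) * f y \<partial>lborel) = (\<integral>y. 1 / (2 * pi\<^sup>2) * (f y / (norm (x - y))\<^sup>2) \<partial>lborel)"
    by (intro Bochner_Integration.integral_cong refl) simp
  finally show ?thesis by (simp only: integral_mult_right_zero) simp
qed

text \<open>A single kernel does not suffice: the supremum of \<open>heat s z\<close> over
  \<open>s \<ge> 1\<close> decays only like \<open>|z|^(-3)\<close>, too slowly for the weight of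
  \<open>w\<close>. The mean value theorem along the segment from 0 to \<open>x\<close> gains
  \<open>|x| / sqrt s\<close>, which cancels the \<open>sqrt s\<close> in the algebraic bound and
  leaves \<open>|z|^(-4)\<close> uniformly in \<open>s\<close>.\<close>

lemma heat_translate_bound:
  assumes s: "s \<ge> 1"
  shows "\<bar>heat s (x - y) - heat s (0 - y)\<bar> * norm (w y) \<le>
    40000 * norm x * (3 + 2 * (norm x)\<^sup>2)\<^sup>2 * (norm (w y) / (1 + norm y ^ 4))"
proof -
  have s0: "s > 0" using s by simp
  define g where "g = (\<lambda>\<theta>. heat s (\<theta> *\<^sub>R x - y))"
  define g' where "g' = (\<lambda>\<theta>. heat s (\<theta> *\<^sub>R x - y) * (- ((\<theta> *\<^sub>R x - y) \<bullet> x) / (2 * s)))"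
  have n: "(norm (\<theta> *\<^sub>R x - y))\<^sup>2 = \<theta>\<^sup>2 * (norm x)\<^sup>2 - 2 * \<theta> * (x \<bullet> y) + (norm y)\<^sup>2" for \<theta>
    using dot_norm_neg[of "\<theta> *\<^sub>R x" y] by (simp add: power_mult_distrib)
  have i: "(\<theta> *\<^sub>R x - y) \<bullet> x = \<theta> * (norm x)\<^sup>2 - x \<bullet> y" for \<theta>
    by (simp add: inner_diff_left power2_norm_eq_inner inner_commute[of y x])
  have d: "(g has_real_derivative g' \<theta>) (at \<theta>)" for \<theta>
    unfolding g_def g'_def heat_def n i using s0
    by (auto intro!: derivative_eq_intros simp: field_simps)
  obtain \<theta> where \<theta>: "0 < \<theta>" "\<theta> < 1" "g 1 - g 0 = (1 - 0) * g' \<theta>"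
    using MVT2[of 0 1 g g'] d by auto
  define z where "z = \<theta> *\<^sub>R x - y"
  define X where "X = (norm z)\<^sup>2 / (4 * s)"
  define c where "c = norm z / (2 * sqrt s)"
  have c2: "c\<^sup>2 = X" using s0 by (simp add: c_def X_def power_divide power_mult_distrib)
  have c0: "c \<ge> 0" "X \<ge> 0" using s0 by (auto simp: c_def X_def)
  have "c \<le> 1 + c\<^sup>2" using c0 zero_le_power2[of "c - 1"] by (simp add: power2_eq_square algebra_simps)
  also have "\<dots> \<le> (X + 3)\<^sup>2" unfolding c2 using c0 by (simp add: power2_eq_square algebra_simps)
  finally have h: "heat s z * c \<le> 40000 * sqrt s / (s + (norm z)\<^sup>2)\<^sup>2"
    by (intro heat_poly_bound(1)[OF s0] c0) (simp add: X_def)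
  have "\<bar>g' \<theta>\<bar> = heat s z * (\<bar>z \<bullet> x\<bar> / (2 * s))"
    using heat_nonneg[OF s0] s0 by (simp add: g'_def z_def abs_mult)
  also have "\<dots> \<le> heat s z * (norm z * norm x / (2 * s))"
    using heat_nonneg[OF s0] s0 Cauchy_Schwarz_ineq2[of z x] by (intro mult_left_mono divide_right_mono) auto
  also have "\<dots> = heat s z * c * (norm x / sqrt s)"
  proof -
    have "sqrt s * sqrt s = s" using s0 by simp
    then have "norm z * norm x / (2 * s) = c * (norm x / sqrt s)"
      unfolding c_def by (metis (no_types, lifting) mult.assoc times_divide_times_eq)
    then show ?thesis by simp
  qed
  also have "\<dots> \<le> 40000 * sqrt s / (s + (norm z)\<^sup>2)\<^sup>2 * (norm x / sqrt s)"
    by (intro mult_right_mono h) (use s0 in auto)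
  also have "\<dots> = 40000 * norm x / (s + (norm z)\<^sup>2)\<^sup>2"
    using s0 by simp
  also have "\<dots> \<le> 40000 * norm x / (1 + (norm z)\<^sup>2)\<^sup>2"
    using s by (intro divide_left_mono power_mono mult_pos_pos zero_less_power) (auto simp: add_pos_nonneg)
  finally have "\<bar>g' \<theta>\<bar> \<le> 40000 * norm x / (1 + (norm (\<theta> *\<^sub>R x - y))\<^sup>2)\<^sup>2" by (simp add: z_def)
  then have "\<bar>heat s (x - y) - heat s (0 - y)\<bar> \<le> 40000 * norm x / (1 + (norm (\<theta> *\<^sub>R x - y))\<^sup>2)\<^sup>2"
    using \<theta>(3) by (simp add: g_def)
  from moderate_bound[OF _ this, of w]
  have "\<bar>heat s (x - y) - heat s (0 - y)\<bar> * norm (w y) \<le>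
     40000 * norm x * (2 + (1 + 2 * (norm (\<theta> *\<^sub>R x))\<^sup>2) / 1)\<^sup>2 * (norm (w y) / (1 + norm y ^ 4))"
    by simp
  also have "\<dots> \<le> 40000 * norm x * (3 + 2 * (norm x)\<^sup>2)\<^sup>2 * (norm (w y) / (1 + norm y ^ 4))"
  proof (intro mult_right_mono mult_left_mono power_mono)
    have "norm (\<theta> *\<^sub>R x) \<le> norm x" using \<theta> by (simp add: mult_left_le_one_le)
    then have "(norm (\<theta> *\<^sub>R x))\<^sup>2 \<le> (norm x)\<^sup>2" by (intro power_mono) auto
    then show "2 + (1 + 2 * (norm (\<theta> *\<^sub>R x))\<^sup>2) / 1 \<le> 3 + 2 * (norm x)\<^sup>2" by simp
  qed (auto intro!: divide_nonneg_nonneg add_nonneg_nonneg)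
  finally show ?thesis .
qed

text \<open>The Liouville step: for large times the heat average of \<open>w\<close> forgets its
  centre. The kernels tend to 0 pointwise, and \<open>heat_translate_bound\<close> dominates their
  difference.\<close>

lemma heat_translate_limit:
  "((\<lambda>s. (\<integral>y. heat s (x - y) * w y \<partial>lborel) - (\<integral>y. heat s (0 - y) * w y \<partial>lborel)) \<longlongrightarrow> 0) at_top"
proof -
  have ih: "integrable lborel (\<lambda>y. heat r (x - y) * w y)" if r: "r > 0" for r x
    using moderate_pairing[OF w r, of "heat r" "40000 * sqrt r" x] heat_bounds(1)[OF r] heat_nonneg[OF r] by simp
  have "((\<lambda>s. \<integral>y. (heat s (x - y) - heat s (0 - y)) * w y \<partial>lborel) \<longlongrightarrow> (\<integral>y. 0 \<partial>(lborel :: (real^3) measure))) at_top"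
  proof (rule integral_dominated_convergence_at_top)
    show "integrable lborel (\<lambda>y. 40000 * norm x * (3 + 2 * (norm x)\<^sup>2)\<^sup>2 * (norm (w y) / (1 + norm y ^ 4)))"
      using w by (intro integrable_mult_right) (simp add: moderate_def)
    show "\<forall>\<^sub>F s in at_top. AE y in lborel. norm ((heat s (x - y) - heat s (0 - y)) * w y) \<le>
        40000 * norm x * (3 + 2 * (norm x)\<^sup>2)\<^sup>2 * (norm (w y) / (1 + norm y ^ 4))"
      using eventually_ge_at_top[of 1]
    proof (eventually_elim, intro AE_I2)
      fix s y assume "(1::real) \<le> s"
      then show "norm ((heat s (x - y) - heat s (0 - y)) * w y) \<le>
        40000 * norm x * (3 + 2 * (norm x)\<^sup>2)\<^sup>2 * (norm (w y) / (1 + norm y ^ 4))"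
        using heat_translate_bound[of s x y] by (simp add: abs_mult)
    qed
    have h0: "((\<lambda>s. heat s z) \<longlongrightarrow> 0) at_top" for z
    proof (rule Lim_null_comparison)
      show "\<forall>\<^sub>F s in at_top. norm (heat s z) \<le> 1 / (s * sqrt s)"
        using eventually_gt_at_top[of 0]
      proof eventually_elim
        case (elim s)
        have "heat s z \<le> 1 / (s * sqrt s) * 1"
          unfolding heat_def using elim by (intro mult_mono heat_prefactor_le) auto
        then show ?case using heat_nonneg[OF elim] by simp
      qed
      show "((\<lambda>s::real. 1 / (s * sqrt s)) \<longlongrightarrow> 0) at_top" by real_asymp
    qed
    show "AE y in lborel. ((\<lambda>s. (heat s (x - y) - heat s (0 - y)) * w y) \<longlongrightarrow> 0) at_top"
      by (intro AE_I2 tendsto_mult_left_zero) (use tendsto_diff[OF h0 h0] in simp)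
  qed measurable
  then have "((\<lambda>s. \<integral>y. (heat s (x - y) - heat s (0 - y)) * w y \<partial>lborel) \<longlongrightarrow> 0) at_top" by simp
  then show ?thesis
  proof (rule Lim_transform_eventually)
    show "\<forall>\<^sub>F s in at_top. (\<integral>y. (heat s (x - y) - heat s (0 - y)) * w y \<partial>lborel) =
       (\<integral>y. heat s (x - y) * w y \<partial>lborel) - (\<integral>y. heat s (0 - y) * w y \<partial>lborel)"
      using eventually_gt_at_top[of 0]
    proof eventually_elim
      case (elim s)
      then show ?case
        by (subst Bochner_Integration.integral_diff[symmetric]) (rule ih[OF elim], rule ih[OF elim], simp only: left_diff_distrib)
    qed
  qed
qed

text \<open>\<open>defect x 1\<close> is computed as the limit at time 0. The difference
  \<open>defect x s - defect 0 s\<close> is independent of \<open>s\<close> and tends to 0 as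
  \<open>s\<close> grows, so the constant is the one at the origin.\<close>

lemma representation:
  "w x = w 0 - 1 / pi\<^sup>2 * (\<integral>y. f y / (norm (0 - y))\<^sup>2 \<partial>lborel) + 1 / pi\<^sup>2 * (\<integral>y. f y / (norm (x - y))\<^sup>2 \<partial>lborel)"
proof -
  have e: "defect x 1 = w x - 1 / pi\<^sup>2 * (\<integral>y. f y / (norm (x - y))\<^sup>2 \<partial>lborel)" for x
  proof (rule tendsto_unique[OF trivial_limit_at_right_real _ defect_at_0])
    have "\<forall>\<^sub>F s in at_right 0. defect x 1 = defect x s"
      using eventually_at_right_less[of 0] by eventually_elim (auto intro: defect_constant)
    then show "(defect x \<longlongrightarrow> defect x 1) (at_right 0)"
      by (rule Lim_transform_eventually[OF tendsto_const])
  qed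
  have r: "((\<lambda>s. \<integral>y. heat_riesz s (x - y) * f y \<partial>lborel) \<longlongrightarrow> 0) at_top" for x
  proof (rule Lim_null_comparison)
    show "\<forall>\<^sub>F s in at_top. norm (\<integral>y. heat_riesz s (x - y) * f y \<partial>lborel) \<le> 80000 / s * (\<integral>y. f y \<partial>lborel)"
      using eventually_gt_at_top[of 0] by eventually_elim (use heat_riesz_f_integrable(2) in simp)
    have "((\<lambda>s::real. 80000 / s) \<longlongrightarrow> 0) at_top" by real_asymp
    then show "((\<lambda>s. 80000 / s * (\<integral>y. f y \<partial>lborel)) \<longlongrightarrow> 0) at_top"
      by (rule tendsto_mult_left_zero)
  qed
  have l: "((\<lambda>s. defect x s - defect 0 s) \<longlongrightarrow> 0 - 2 * 0 + 2 * 0) at_top"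
    using tendsto_add[OF tendsto_diff[OF heat_translate_limit[of x] tendsto_mult[OF tendsto_const[of 2] r[of x]]]
        tendsto_mult[OF tendsto_const[of 2] r[of 0]]]
    by (simp add: defect_def algebra_simps)
  have c: "\<forall>\<^sub>F s in at_top. defect x s - defect 0 s = defect x 1 - defect 0 1"
    using eventually_gt_at_top[of 0]
  proof eventually_elim
    case (elim s)
    then show ?case using defect_constant[of s 1 x] defect_constant[of s 1 0] by simp
  qed
  have "((\<lambda>s::real. defect x 1 - defect 0 1) \<longlongrightarrow> 0) at_top"
    using Lim_transform_eventually[OF l c] by simp
  then have "defect x 1 - defect 0 1 = 0"
    by (simp add: tendsto_const_iff)
  then show ?thesis by (simp add: e)
qed

end

lemma solution_laplacian:
  assumes u: "smooth u" and sol: "solution (distribution_of (\<lambda>x. 2 * f x)) u"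
    and f: "integrable lborel f" "\<And>y. 0 \<le> f y" "continuous_on UNIV f"
  shows "\<exists>c. \<forall>x. - laplacian u x = c + 1 / pi\<^sup>2 * (\<integral>y. f y / (norm (x - y))\<^sup>2 \<partial>lborel)"
proof -
  interpret half_laplace_equation "\<lambda>x. - laplacian u x" f
  proof
    show "moderate (\<lambda>x. - laplacian u x)"
      using solution_laplacian_moderate[OF u sol] by (simp add: moderate_def)
    show "continuous_on UNIV (\<lambda>x. - laplacian u x)"
      by (intro continuous_intros smooth_laplacian_continuous u)
    show "(\<integral>y. heat_half s (x - y) * - laplacian u y \<partial>lborel) = 2 * (\<integral>y. heat1 s (x - y) * f y \<partial>lborel)"
      if "s > 0" for s x
      by (rule solution_heat_identity[OF u sol f(3) that])
  qed (fact f)+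
  show ?thesis using representation by blast
qed

section \<open>The logarithmic potential\<close>

definition log_potential :: "(real^3 \<Rightarrow> real) \<Rightarrow> real^3 \<Rightarrow> real" where
  "log_potential f x = 1 / pi\<^sup>2 * (\<integral>y. ln (norm y / norm (x - y)) * f y \<partial>lborel)"

text \<open>Second derivatives of the potential cannot be taken directly under the integral: the
  supremum of \<open>|z + t *\<^sub>R e|^(-2)\<close> over a segment is not locally integrable in
  three dimensions. Regularised kernels are differentiated instead, and uniform convergence of the
  derivatives on unit balls passes the result to the limit.\<close>

lemma line_deriv_of_uniform_limit:
  fixes F :: "nat \<Rightarrow> 'a::real_normed_vector \<Rightarrow> real"
  assumes der: "\<And>n x. ((\<lambda>t. F n (x + t *\<^sub>R e)) has_real_derivative F' n x) (at 0)"
    and lim: "\<And>x. (\<lambda>n. F n x) \<longlonglongrightarrow> G x"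
    and uni: "\<And>x \<eta>. \<eta> > 0 \<Longrightarrow> \<forall>\<^sub>F n in sequentially. \<forall>z\<in>ball x 1. \<bar>F' n z - G' z\<bar> \<le> \<eta>"
  shows "((\<lambda>t. G (x + t *\<^sub>R e)) has_real_derivative G' x) (at 0)"
proof -
  \<comment> \<open>For \<open>|t| < r\<close> the points \<open>x + t *\<^sub>R e\<close> stay in
    the unit ball about \<open>x\<close>; the added 1 in the denominator covers
    \<open>e = 0\<close>.\<close>
  define r where "r = 1 / (norm e + 1)"
  have r: "r > 0" by (simp add: r_def add_nonneg_pos)
  define S where "S = {-r<..<r}"
  have S: "x + t *\<^sub>R e \<in> ball x 1" if "t \<in> S" for t
  proof -
    have "\<bar>t\<bar> < r" using that by (auto simp: S_def)
    then have "\<bar>t\<bar> * norm e \<le> r * norm e" by (intro mult_right_mono) auto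
    also have "\<dots> < 1" by (simp add: r_def add_nonneg_pos)
    finally show ?thesis by (simp add: dist_norm)
  qed
  have derx: "((\<lambda>t. F n (x + t *\<^sub>R e)) has_real_derivative F' n (x + t *\<^sub>R e)) (at t)" for n t
    using DERIV_shift[of "\<lambda>s. F n (x + s *\<^sub>R e)" _ 0 t] der[of n "x + t *\<^sub>R e"]
    by (simp add: algebra_simps)
  have "\<exists>g. \<forall>t\<in>S. (\<lambda>n. F n (x + t *\<^sub>R e)) \<longlonglongrightarrow> g t \<and>
      (g has_derivative (\<lambda>h. G' (x + t *\<^sub>R e) * h)) (at t within S)"
  proof (rule has_derivative_sequence[where f' = "\<lambda>n t h. F' n (x + t *\<^sub>R e) * h" and ?x0.0 = 0 and l = "G x"])
    show "convex S" by (simp add: S_def)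
    show "((\<lambda>t. F n (x + t *\<^sub>R e)) has_derivative (\<lambda>h. F' n (x + t *\<^sub>R e) * h)) (at t within S)" for n t
      using derx[of n t] by (simp add: has_field_derivative_def has_derivative_at_withinI)
    show "0 \<in> S" using r by (simp add: S_def)
    show "(\<lambda>n. F n (x + 0 *\<^sub>R e)) \<longlonglongrightarrow> G x" using lim by simp
    fix \<eta> :: real assume "\<eta> > 0"
    from uni[OF this, of x]
    show "\<forall>\<^sub>F n in sequentially. \<forall>t\<in>S. \<forall>h. norm (F' n (x + t *\<^sub>R e) * h - G' (x + t *\<^sub>R e) * h) \<le> \<eta> * norm h"
    proof (eventually_elim, intro ballI allI)
      fix n t h assume a: "\<forall>z\<in>ball x 1. \<bar>F' n z - G' z\<bar> \<le> \<eta>" and "t \<in> S"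
      then have "\<bar>F' n (x + t *\<^sub>R e) - G' (x + t *\<^sub>R e)\<bar> * \<bar>h\<bar> \<le> \<eta> * \<bar>h\<bar>"
        using S by (intro mult_right_mono) auto
      then show "norm (F' n (x + t *\<^sub>R e) * h - G' (x + t *\<^sub>R e) * h) \<le> \<eta> * norm h"
        by (simp add: abs_mult flip: left_diff_distrib)
    qed
  qed
  then obtain g where g: "\<And>t. t \<in> S \<Longrightarrow> (\<lambda>n. F n (x + t *\<^sub>R e)) \<longlonglongrightarrow> g t"
    "\<And>t. t \<in> S \<Longrightarrow> (g has_derivative (\<lambda>h. G' (x + t *\<^sub>R e) * h)) (at t within S)" by blast
  have gG: "g t = G (x + t *\<^sub>R e)" if "t \<in> S" for t
    using g(1)[OF that] lim by (rule LIMSEQ_unique)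
  have S0: "open S" "0 \<in> S" using r by (auto simp: S_def)
  have "(g has_real_derivative G' x) (at 0)"
    using g(2)[OF S0(2)] at_within_open[OF S0(2,1)] by (simp add: has_field_derivative_def)
  moreover have "\<forall>\<^sub>F t in nhds 0. g t = G (x + t *\<^sub>R e)"
    using eventually_nhds_in_open[OF S0] by eventually_elim (rule gG)
  ultimately show ?thesis by (subst (asm) DERIV_cong_ev[OF refl _ refl])
qed

lemma continuous_of_uniform_limit:
  fixes F :: "nat \<Rightarrow> 'a::metric_space \<Rightarrow> real"
  assumes c: "\<And>n. continuous_on UNIV (F n)"
    and uni: "\<And>x \<eta>. \<eta> > 0 \<Longrightarrow> \<forall>\<^sub>F n in sequentially. \<forall>z\<in>ball x 1. \<bar>F n z - G z\<bar> \<le> \<eta>"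
  shows "continuous_on UNIV G"
proof -
  have "continuous_on (ball x 1) G" for x
  proof (rule uniform_limit_theorem)
    show "\<forall>\<^sub>F n in sequentially. continuous_on (ball x 1) (F n)"
      by (intro always_eventually allI continuous_on_subset[OF c]) auto
    show "uniform_limit (ball x 1) F G sequentially"
      unfolding uniform_limit_iff
    proof (intro allI impI)
      fix e :: real assume e: "e > 0"
      then have "\<forall>\<^sub>F n in sequentially. \<forall>z\<in>ball x 1. \<bar>F n z - G z\<bar> \<le> e / 2" by (intro uni) simp
      then show "\<forall>\<^sub>F n in sequentially. \<forall>z\<in>ball x 1. dist (F n z) (G z) < e"
        by eventually_elim (use e in \<open>force simp: dist_real_def\<close>)
    qed
  qed simp
  then have "isCont G x" for x
    using continuous_on_eq_continuous_at[OF open_ball, of x 1 G] by simp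
  then show ?thesis by (simp add: continuous_on_eq_continuous_at)
qed

section \<open>Regularised logarithmic kernels and their errors\<close>

definition reg :: "nat \<Rightarrow> real" where
  "reg n = 1 / real (Suc n)"

lemma reg_nonzero [simp]: "reg n \<noteq> 0"
  by (simp add: reg_def)

lemma reg: "0 < reg n" "reg n \<le> 1" "reg \<longlonglongrightarrow> 0"
  using LIMSEQ_Suc[OF lim_1_over_n] by (auto simp: reg_def[abs_def])

text \<open>A smooth version of \<open>ln |z|\<close>. Its first and second partial derivatives are
  \<open>log_ker1\<close> and \<open>log_ker2\<close>, while \<open>ker1\<close> and
  \<open>ker2\<close> are those of \<open>ln |z|\<close> away from 0; at 0 the latter two have the
  value 0, being divisions by 0.\<close>

definition log_ker :: "nat \<Rightarrow> real^3 \<Rightarrow> real" where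
  "log_ker n z = ln ((norm z)\<^sup>2 + (reg n)\<^sup>2) / 2"

definition log_ker1 :: "3 \<Rightarrow> nat \<Rightarrow> real^3 \<Rightarrow> real" where
  "log_ker1 i n z = z $ i / ((norm z)\<^sup>2 + (reg n)\<^sup>2)"

definition log_ker2 :: "3 \<Rightarrow> 3 \<Rightarrow> nat \<Rightarrow> real^3 \<Rightarrow> real" where
  "log_ker2 i j n z = of_bool (i = j) / ((norm z)\<^sup>2 + (reg n)\<^sup>2) - 2 * (z $ i) * (z $ j) / ((norm z)\<^sup>2 + (reg n)\<^sup>2)\<^sup>2"

definition ker1 :: "3 \<Rightarrow> real^3 \<Rightarrow> real" where
  "ker1 i z = z $ i / (norm z)\<^sup>2"

definition ker2 :: "3 \<Rightarrow> 3 \<Rightarrow> real^3 \<Rightarrow> real" where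
  "ker2 i j z = of_bool (i = j) / (norm z)\<^sup>2 - 2 * (z $ i) * (z $ j) / ((norm z)\<^sup>2)\<^sup>2"

lemma reg_pos: "0 < (norm z)\<^sup>2 + (reg n)\<^sup>2" "(norm z)\<^sup>2 + (reg n)\<^sup>2 \<noteq> 0"
proof -
  show "0 < (norm z)\<^sup>2 + (reg n)\<^sup>2" using reg(1)[of n] by (intro add_nonneg_pos) auto
  then show "(norm z)\<^sup>2 + (reg n)\<^sup>2 \<noteq> 0" by (rule less_imp_neq[THEN not_sym])
qed

lemma norm_mult_reg_le: "norm z * reg n \<le> (norm z)\<^sup>2 + (reg n)\<^sup>2"
  using sum_squares_bound[of "norm z" "reg n"] mult_nonneg_nonneg[OF norm_ge_zero[of z] less_imp_le[OF reg(1)[of n]]]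
  by linarith

lemma norm_sq_line: "(norm (z + t *\<^sub>R axis j (1::real)))\<^sup>2 = (norm z)\<^sup>2 + 2 * t * (z $ j) + t\<^sup>2"
  using dot_norm[of z "t *\<^sub>R axis j 1"] by (simp add: power_mult_distrib inner_axis)

lemma log_ker_deriv:
  "((\<lambda>t. log_ker n (z + t *\<^sub>R axis j 1)) has_real_derivative log_ker1 j n z) (at 0)"
  "((\<lambda>t. log_ker1 i n (z + t *\<^sub>R axis j 1)) has_real_derivative log_ker2 i j n z) (at 0)"
proof -
  let ?r = "(norm z)\<^sup>2 + (reg n)\<^sup>2"
  have p: "?r > 0" by (rule reg_pos)
  have gen: "1 / a * (2 * b) / 2 = b / a" for a b :: real by simp
  have q: "((\<lambda>t. (norm z)\<^sup>2 + 2 * t * (z $ j) + t\<^sup>2 + (reg n)\<^sup>2) has_real_derivative 2 * (z $ j)) (at 0)"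
    by (auto intro!: derivative_eq_intros)
  have "((\<lambda>t. ln ((norm z)\<^sup>2 + 2 * t * (z $ j) + t\<^sup>2 + (reg n)\<^sup>2) / 2) has_real_derivative
      1 / ((norm z)\<^sup>2 + 2 * 0 * (z $ j) + 0\<^sup>2 + (reg n)\<^sup>2) * (2 * (z $ j)) / 2) (at 0)"
    by (rule DERIV_cdivide[OF DERIV_chain2[OF DERIV_ln_divide q]]) (use p in simp)
  then show "((\<lambda>t. log_ker n (z + t *\<^sub>R axis j 1)) has_real_derivative log_ker1 j n z) (at 0)"
    unfolding log_ker_def log_ker1_def norm_sq_line gen by simp
  have a: "((\<lambda>t. z $ i + t * of_bool (i = j)) has_real_derivative of_bool (i = j)) (at 0)"
    by (auto intro!: derivative_eq_intros)
  have "((\<lambda>t. (z $ i + t * of_bool (i = j)) / ((norm z)\<^sup>2 + 2 * t * (z $ j) + t\<^sup>2 + (reg n)\<^sup>2)) has_real_derivative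
     (of_bool (i = j) * ?r - z $ i * (2 * (z $ j))) / (?r * ?r)) (at 0)"
    using DERIV_divide[OF a q] p by simp
  moreover have "(of_bool (i = j) * ?r - z $ i * (2 * (z $ j))) / (?r * ?r) = log_ker2 i j n z"
    using reg_pos(2)[of z n] by (simp add: log_ker2_def diff_divide_distrib power2_eq_square mult_ac)
  moreover have comp: "(z + t *\<^sub>R axis j 1) $ i = z $ i + t * of_bool (i = j)" for t
    by (simp add: axis_def)
  ultimately show "((\<lambda>t. log_ker1 i n (z + t *\<^sub>R axis j 1)) has_real_derivative log_ker2 i j n z) (at 0)"
    unfolding log_ker1_def norm_sq_line comp by (simp only:)
qed

lemma log_ker_continuous:
  "continuous_on S (log_ker n)" "continuous_on S (log_ker1 i n)" "continuous_on S (log_ker2 i j n)"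
  unfolding log_ker_def log_ker1_def log_ker2_def using reg_pos
  by (auto intro!: continuous_intros)

lemma component_products:
  fixes z :: "real^3"
  shows "\<bar>z $ i\<bar> \<le> norm z" "\<bar>z $ i * z $ j\<bar> \<le> (norm z)\<^sup>2"
proof -
  show *: "\<bar>z $ i\<bar> \<le> norm z" for i by (rule component_le_norm_cart)
  show "\<bar>z $ i * z $ j\<bar> \<le> (norm z)\<^sup>2"
    unfolding abs_mult power2_eq_square by (intro mult_mono *) auto
qed

lemma log_ker_bounds:
  "\<bar>log_ker1 i n z\<bar> \<le> 1 / reg n" "\<bar>log_ker2 i j n z\<bar> \<le> 3 / (reg n)\<^sup>2"
proof -
  let ?r = "(norm z)\<^sup>2 + (reg n)\<^sup>2"
  have p: "?r > 0" by (rule reg_pos)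
  have e: "reg n > 0" by (rule reg)
  have "norm z * reg n \<le> ?r" by (rule norm_mult_reg_le)
  then have "\<bar>z $ i\<bar> * reg n \<le> ?r"
    using component_products(1)[of z i] e by (meson mult_right_mono less_imp_le order_trans)
  then show "\<bar>log_ker1 i n z\<bar> \<le> 1 / reg n"
    using p e by (simp add: log_ker1_def abs_divide field_simps)
  have "\<bar>2 * (z $ i) * (z $ j) / ?r\<^sup>2\<bar> = 2 * (\<bar>z $ i * z $ j\<bar> / ?r\<^sup>2)" by (simp add: abs_mult)
  also have "\<dots> \<le> 2 * (?r / ?r\<^sup>2)"
    using component_products(2)[of z i j] by (intro mult_left_mono divide_right_mono) (auto intro: order_trans)
  also have "\<dots> = 2 / ?r" using p by (simp add: power2_eq_square)
  finally have "\<bar>log_ker2 i j n z\<bar> \<le> 1 / ?r + 2 / ?r"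
    unfolding log_ker2_def using p by (intro order_trans[OF abs_triangle_ineq4] add_mono) (auto simp: abs_divide)
  also have "\<dots> = 3 / ?r" by simp
  also have "\<dots> \<le> 3 / (reg n)\<^sup>2" using e p by (intro divide_left_mono) auto
  finally show "\<bar>log_ker2 i j n z\<bar> \<le> 3 / (reg n)\<^sup>2" .
qed

lemma ker_bounds:
  assumes z: "z \<noteq> 0"
  shows "\<bar>ker1 i z\<bar> \<le> 1 / norm z" "\<bar>ker2 i j z\<bar> \<le> 3 / (norm z)\<^sup>2"
proof -
  have n: "norm z > 0" using z by simp
  have "\<bar>ker1 i z\<bar> \<le> norm z / (norm z)\<^sup>2"
    unfolding ker1_def abs_divide using component_products(1) by (simp add: divide_right_mono)
  then show "\<bar>ker1 i z\<bar> \<le> 1 / norm z" using n by (simp add: power2_eq_square)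
  have "\<bar>2 * (z $ i) * (z $ j) / ((norm z)\<^sup>2)\<^sup>2\<bar> = 2 * (\<bar>z $ i * z $ j\<bar> / ((norm z)\<^sup>2)\<^sup>2)" by (simp add: abs_mult)
  also have "\<dots> \<le> 2 * ((norm z)\<^sup>2 / ((norm z)\<^sup>2)\<^sup>2)"
    using component_products(2)[of z i j] by (intro mult_left_mono divide_right_mono) auto
  also have "\<dots> = 2 / (norm z)\<^sup>2" using n by (simp add: power2_eq_square)
  finally have "\<bar>ker2 i j z\<bar> \<le> 1 / (norm z)\<^sup>2 + 2 / (norm z)\<^sup>2"
    unfolding ker2_def by (intro order_trans[OF abs_triangle_ineq4] add_mono) (auto simp: abs_divide)
  then show "\<bar>ker2 i j z\<bar> \<le> 3 / (norm z)\<^sup>2" by simp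
qed

lemma ker_measurable [measurable]:
  "log_ker n \<in> borel_measurable borel" "log_ker1 i n \<in> borel_measurable borel" "log_ker2 i j n \<in> borel_measurable borel"
  "ker1 i \<in> borel_measurable borel" "ker2 i j \<in> borel_measurable borel"
proof -
  show "log_ker n \<in> borel_measurable borel" "log_ker1 i n \<in> borel_measurable borel" "log_ker2 i j n \<in> borel_measurable borel"
    by (auto intro!: borel_measurable_continuous_onI log_ker_continuous)
  have [measurable]: "(\<lambda>z::real^3. z $ i) \<in> borel_measurable borel" for i
    by (intro borel_measurable_continuous_onI continuous_intros)
  show "ker1 i \<in> borel_measurable borel" "ker2 i j \<in> borel_measurable borel"
    unfolding ker1_def ker2_def by measurable
qed

text \<open>The two bounds serve the two regions of \<open>ker_error_uniform\<close>: the first is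
  an integrable singularity uniformly in \<open>n\<close>, the second tends to 0 with
  \<open>reg n\<close> away from the origin. The 5 is what the second derivatives require.\<close>

definition ker_error :: "(nat \<Rightarrow> real^3 \<Rightarrow> real) \<Rightarrow> bool" where
  "ker_error d \<longleftrightarrow> (\<forall>n. d n \<in> borel_measurable borel) \<and>
    (\<forall>n z. z \<noteq> 0 \<longrightarrow> \<bar>d n z\<bar> \<le> 5 / (norm z)\<^sup>2 \<and> \<bar>d n z\<bar> \<le> 5 * reg n * (1 / (norm z)\<^sup>2 + 1 / (norm z) ^ 4))"

lemma log_ker_error:
  "ker_error (\<lambda>n z. log_ker n z - ln (norm z))"
  "ker_error (\<lambda>n z. log_ker1 i n z - ker1 i z)"
  "ker_error (\<lambda>n z. log_ker2 i j n z - ker2 i j z)"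
proof -
  \<comment> \<open>For the logarithm and its first derivatives the error is at most
    \<open>reg n / |z|^2\<close>, which implies both bounds. Second derivatives are treated
    separately: where \<open>|z|\<close> is of the size of \<open>reg n\<close>, their error can be
    of order \<open>1 / |z|^2\<close>.\<close>
  have *: "\<bar>a\<bar> \<le> 5 / (norm z)\<^sup>2 \<and> \<bar>a\<bar> \<le> 5 * reg n * (1 / (norm z)\<^sup>2 + 1 / (norm z) ^ 4)"
    if "z \<noteq> 0" "\<bar>a\<bar> \<le> reg n / (norm z)\<^sup>2" for a n and z :: "real^3"
  proof -
    have 1: "reg n / (norm z)\<^sup>2 \<le> 5 / (norm z)\<^sup>2"
      using reg(2)[of n] by (intro divide_right_mono) auto
    have "reg n / (norm z)\<^sup>2 \<le> 5 * reg n * (1 / (norm z)\<^sup>2)"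
      using reg(1)[of n] by (simp add: divide_right_mono)
    also have "\<dots> \<le> 5 * reg n * (1 / (norm z)\<^sup>2 + 1 / (norm z) ^ 4)"
      using reg(1)[of n] by (intro mult_left_mono) auto
    finally show ?thesis using 1 that(2) by linarith
  qed
  show "ker_error (\<lambda>n z. log_ker n z - ln (norm z))"
    unfolding ker_error_def
  proof (intro conjI allI impI)
    fix n and z :: "real^3" assume z: "z \<noteq> 0"
    define \<rho> where "\<rho> = (norm z)\<^sup>2"
    have \<rho>: "\<rho> > 0" using z by (simp add: \<rho>_def)
    have "ln (norm z) = ln \<rho> / 2" using z by (simp add: \<rho>_def ln_realpow)
    then have "log_ker n z - ln (norm z) = (ln (\<rho> + (reg n)\<^sup>2) - ln \<rho>) / 2"
      by (simp add: log_ker_def \<rho>_def diff_divide_distrib)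
    also have "ln (\<rho> + (reg n)\<^sup>2) - ln \<rho> = ln (1 + (reg n)\<^sup>2 / \<rho>)"
    proof -
      have "1 + (reg n)\<^sup>2 / \<rho> = (\<rho> + (reg n)\<^sup>2) / \<rho>" using \<rho> by (simp add: field_simps)
      then show ?thesis using \<rho> add_pos_pos[OF \<rho>, of "(reg n)\<^sup>2"] by (simp add: ln_div)
    qed
    finally have e: "log_ker n z - ln (norm z) = ln (1 + (reg n)\<^sup>2 / \<rho>) / 2" .
    have "0 \<le> ln (1 + (reg n)\<^sup>2 / \<rho>)" using \<rho> by simp
    moreover have "ln (1 + (reg n)\<^sup>2 / \<rho>) \<le> (reg n)\<^sup>2 / \<rho>"
      using \<rho> by (intro ln_add_one_self_le_self) simp
    moreover have "(reg n)\<^sup>2 / \<rho> \<le> reg n / \<rho>"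
      using \<rho> reg(1,2)[of n] by (intro divide_right_mono) (auto simp: power2_eq_square mult_left_le)
    ultimately have "\<bar>log_ker n z - ln (norm z)\<bar> \<le> reg n / \<rho>" unfolding e by linarith
    from *[OF z this[unfolded \<rho>_def]]
    show "\<bar>log_ker n z - ln (norm z)\<bar> \<le> 5 / (norm z)\<^sup>2"
      "\<bar>log_ker n z - ln (norm z)\<bar> \<le> 5 * reg n * (1 / (norm z)\<^sup>2 + 1 / (norm z) ^ 4)" by auto
  qed measurable
  show "ker_error (\<lambda>n z. log_ker1 i n z - ker1 i z)"
    unfolding ker_error_def
  proof (intro conjI allI impI)
    fix n and z :: "real^3" assume z: "z \<noteq> 0"
    define \<rho> where "\<rho> = (norm z)\<^sup>2"
    define \<epsilon> where "\<epsilon> = reg n"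
    have \<rho>: "\<rho> > 0" and \<epsilon>: "\<epsilon> > 0" using z reg by (auto simp: \<rho>_def \<epsilon>_def)
    have "log_ker1 i n z - ker1 i z = - (z $ i * \<epsilon>\<^sup>2) / (\<rho> * (\<rho> + \<epsilon>\<^sup>2))"
      using \<rho> \<epsilon> add_pos_pos[OF \<rho>, of "\<epsilon>\<^sup>2"]
      by (simp add: log_ker1_def ker1_def flip: \<rho>_def \<epsilon>_def) (simp add: divide_simps algebra_simps)
    then have "\<bar>log_ker1 i n z - ker1 i z\<bar> = \<bar>z $ i\<bar> * \<epsilon> * (\<epsilon> / (\<rho> * (\<rho> + \<epsilon>\<^sup>2)))"
      using \<rho> \<epsilon> by (simp add: abs_mult power2_eq_square)
    also have "\<dots> \<le> (\<rho> + \<epsilon>\<^sup>2) * (\<epsilon> / (\<rho> * (\<rho> + \<epsilon>\<^sup>2)))"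
    proof (rule mult_right_mono)
      have "norm z * \<epsilon> \<le> \<rho> + \<epsilon>\<^sup>2"
        unfolding \<rho>_def \<epsilon>_def by (rule norm_mult_reg_le)
      then show "\<bar>z $ i\<bar> * \<epsilon> \<le> \<rho> + \<epsilon>\<^sup>2"
        using component_products(1)[of z i] \<epsilon> by (meson mult_right_mono less_imp_le order_trans)
    qed (use \<rho> \<epsilon> in auto)
    also have "\<dots> = \<epsilon> / \<rho>" using \<rho> \<epsilon> add_pos_pos[OF \<rho>, of "\<epsilon>\<^sup>2"] by simp
    finally have "\<bar>log_ker1 i n z - ker1 i z\<bar> \<le> reg n / (norm z)\<^sup>2" by (simp add: \<epsilon>_def \<rho>_def)
    from *[OF z this]
    show "\<bar>log_ker1 i n z - ker1 i z\<bar> \<le> 5 / (norm z)\<^sup>2"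
      "\<bar>log_ker1 i n z - ker1 i z\<bar> \<le> 5 * reg n * (1 / (norm z)\<^sup>2 + 1 / (norm z) ^ 4)" by auto
  qed measurable
  show "ker_error (\<lambda>n z. log_ker2 i j n z - ker2 i j z)"
    unfolding ker_error_def
  proof (intro conjI allI impI)
    fix n and z :: "real^3" assume z: "z \<noteq> 0"
    define \<rho> where "\<rho> = (norm z)\<^sup>2"
    \<comment> \<open>Unlike in the previous case, \<open>\<epsilon>\<close> is the square of
      \<open>reg n\<close>.\<close>
    define \<epsilon> where "\<epsilon> = (reg n)\<^sup>2"
    define R where "R = \<rho> + \<epsilon>"
    have \<rho>: "\<rho> > 0" and \<epsilon>: "\<epsilon> > 0" using z reg(1)[of n] by (auto simp: \<rho>_def \<epsilon>_def)
    have R: "R > 0" "\<rho> \<le> R" "\<epsilon> \<le> R" "R - \<rho> = \<epsilon>" using \<rho> \<epsilon> by (auto simp: R_def)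
    have "log_ker2 i j n z - ker2 i j z = of_bool (i = j) * (1 / R - 1 / \<rho>) - 2 * (z $ i * z $ j) * (1 / R\<^sup>2 - 1 / \<rho>\<^sup>2)"
      by (simp add: log_ker2_def ker2_def R_def \<rho>_def \<epsilon>_def algebra_simps)
    \<comment> \<open>The diagonal term contributes 1 and the product term \<open>2 * 2\<close>,
      which is where 5 comes from.\<close>
    also have "\<bar>\<dots>\<bar> \<le> \<epsilon> / (\<rho> * R) + 2 * \<rho> * (2 * \<epsilon> / (\<rho>\<^sup>2 * R))"
    proof (intro order_trans[OF abs_triangle_ineq4] add_mono)
      have "\<bar>1 / R - 1 / \<rho>\<bar> = \<epsilon> / (\<rho> * R)"
      proof -
        have "1 / R - 1 / \<rho> = - (\<epsilon> / (\<rho> * R))" using R \<rho> by (simp add: field_simps)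
        then show ?thesis using R \<rho> \<epsilon> by simp
      qed
      then show "\<bar>of_bool (i = j) * (1 / R - 1 / \<rho>)\<bar> \<le> \<epsilon> / (\<rho> * R)"
        using R \<rho> \<epsilon> by (simp add: abs_mult)
      have "\<bar>1 / R\<^sup>2 - 1 / \<rho>\<^sup>2\<bar> \<le> 2 * \<epsilon> / (\<rho>\<^sup>2 * R)"
      proof -
        have "1 / R\<^sup>2 - 1 / \<rho>\<^sup>2 = - ((R - \<rho>) * (R + \<rho>) / (\<rho>\<^sup>2 * R\<^sup>2))"
          using R(1) \<rho> by (simp add: field_simps power2_eq_square)
        then have "\<bar>1 / R\<^sup>2 - 1 / \<rho>\<^sup>2\<bar> = \<epsilon> * (R + \<rho>) / (\<rho>\<^sup>2 * R\<^sup>2)"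
          using R \<rho> \<epsilon> by (simp add: abs_mult)
        also have "\<dots> \<le> \<epsilon> * (2 * R) / (\<rho>\<^sup>2 * R\<^sup>2)"
          using R \<rho> \<epsilon> by (intro divide_right_mono mult_left_mono) auto
        also have "\<dots> = 2 * \<epsilon> / (\<rho>\<^sup>2 * R)" using R by (simp add: power2_eq_square mult_ac)
        finally show ?thesis .
      qed
      then have "2 * \<bar>z $ i * z $ j\<bar> * \<bar>1 / R\<^sup>2 - 1 / \<rho>\<^sup>2\<bar> \<le> 2 * \<rho> * (2 * \<epsilon> / (\<rho>\<^sup>2 * R))"
        using component_products(2)[of z i j] \<rho> by (intro mult_mono) (auto simp: \<rho>_def)
      then show "\<bar>2 * (z $ i * z $ j) * (1 / R\<^sup>2 - 1 / \<rho>\<^sup>2)\<bar> \<le> 2 * \<rho> * (2 * \<epsilon> / (\<rho>\<^sup>2 * R))"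
        by (simp add: abs_mult)
    qed
    also have "\<dots> = 5 * (\<epsilon> / (\<rho> * R))" using \<rho> by (simp add: power2_eq_square)
    finally have le: "\<bar>log_ker2 i j n z - ker2 i j z\<bar> \<le> 5 * (\<epsilon> / (\<rho> * R))" .
    have "\<epsilon> / (\<rho> * R) \<le> R / (\<rho> * R)" using R \<rho> by (intro divide_right_mono) auto
    also have "\<dots> = 1 / \<rho>" using R by simp
    finally show "\<bar>log_ker2 i j n z - ker2 i j z\<bar> \<le> 5 / (norm z)\<^sup>2" using le by (simp add: \<rho>_def)
    have "\<epsilon> / (\<rho> * R) \<le> reg n / (\<rho> * \<rho>)"
    proof (intro frac_le mult_left_mono)
      show "\<epsilon> \<le> reg n" using reg(1,2)[of n] by (simp add: \<epsilon>_def power2_eq_square mult_left_le)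
    qed (use R \<rho> reg(1)[of n] in auto)
    also have "\<dots> = reg n * (1 / (norm z) ^ 4)" by (simp add: \<rho>_def flip: power_add)
    also have "\<dots> \<le> reg n * (1 / (norm z)\<^sup>2 + 1 / (norm z) ^ 4)"
      using reg(1)[of n] by (intro mult_left_mono) auto
    finally show "\<bar>log_ker2 i j n z - ker2 i j z\<bar> \<le> 5 * reg n * (1 / (norm z)\<^sup>2 + 1 / (norm z) ^ 4)"
      using le by linarith
  qed measurable
qed

section \<open>Potentials of a nonnegative, integrable and continuous density\<close>

locale density =
  fixes f :: "real^3 \<Rightarrow> real"
  assumes f: "integrable lborel f" and nn: "\<And>y. 0 \<le> f y" and cf: "continuous_on UNIV f"
begin

lemma meas [measurable]: "f \<in> borel_measurable borel"
  by (rule borel_measurable_integrable[OF f, simplified])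

lemma int_inv_sq: "integrable lborel (\<lambda>y. f y / (norm (x - y))\<^sup>2)"
  by (rule inverse_square_pairing[OF f nn cf])

lemma AE_ne: "AE y in lborel. y \<noteq> (0::real^3) \<and> y \<noteq> x \<and> x \<noteq> y"
  using AE_lborel_singleton[of 0] AE_lborel_singleton[of x] by eventually_elim auto

lemma pairing_integrable:
  assumes [measurable]: "k \<in> borel_measurable borel" and b: "\<And>z. z \<noteq> 0 \<Longrightarrow> \<bar>k z\<bar> \<le> C + D / (norm z)\<^sup>2"
  shows "integrable lborel (\<lambda>y. k (x - y) * f y)"
proof (rule Bochner_Integration.integrable_bound)
  show "integrable lborel (\<lambda>y. C * f y + D * (f y / (norm (x - y))\<^sup>2))"
    by (intro Bochner_Integration.integrable_add integrable_mult_right f int_inv_sq)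
  show "AE y in lborel. norm (k (x - y) * f y) \<le> norm (C * f y + D * (f y / (norm (x - y))\<^sup>2))"
    using AE_ne[of x]
  proof eventually_elim
    case (elim y)
    then have "\<bar>k (x - y)\<bar> * f y \<le> (C + D / (norm (x - y))\<^sup>2) * f y" by (intro mult_right_mono b nn) auto
    also have "\<dots> = C * f y + D * (f y / (norm (x - y))\<^sup>2)" by (simp add: distrib_right)
    finally show ?case using nn[of y] by (simp add: abs_mult)
  qed
qed measurable

lemma ker_error_integrable:
  assumes d: "ker_error d"
  shows "integrable lborel (\<lambda>y. d n (x - y) * f y)"
proof (rule pairing_integrable)
  show "d n \<in> borel_measurable borel" using d by (simp add: ker_error_def)
  show "\<bar>d n z\<bar> \<le> 0 + 5 / (norm z)\<^sup>2" if "z \<noteq> 0" for z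
    using d that by (simp add: ker_error_def)
qed

text \<open>Split at distance \<open>\<delta>\<close> from \<open>x\<close>: inside,
  \<open>f\<close> is bounded and the singularity has integral of order \<open>\<delta>\<close>;
  outside, the error is a multiple of \<open>reg n\<close> and only the total mass of
  \<open>f\<close> enters.\<close>

lemma ker_error_uniform:
  assumes d: "ker_error d" and \<eta>: "\<eta> > 0"
  shows "\<forall>\<^sub>F n in sequentially. \<forall>x\<in>ball x0 1. \<bar>\<integral>y. d n (x - y) * f y \<partial>lborel\<bar> \<le> \<eta>"
proof -
  obtain K where K: "K > 0" "\<And>(x::real^3) R. R > 0 \<Longrightarrow> integrable lborel (\<lambda>y. indicator (cball x R) y / (norm (x - y))\<^sup>2)"
    "\<And>(x::real^3) R. R > 0 \<Longrightarrow> (\<integral>y. indicator (cball x R) y / (norm (x - y))\<^sup>2 \<partial>lborel) \<le> K * R"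
    using inverse_square_local_integral by blast
  have "bounded (f ` cball x0 2)"
    by (intro compact_imp_bounded compact_continuous_image) (use cf in \<open>auto intro: continuous_on_subset\<close>)
  then obtain S where S0: "\<forall>y\<in>f ` cball x0 2. norm y \<le> S" unfolding bounded_iff by blast
  have S: "f y \<le> S" if "y \<in> cball x0 2" for y
  proof -
    have "norm (f y) \<le> S" using S0 that by blast
    then show ?thesis by simp
  qed
  have S1: "S \<ge> 0" using S[of x0] nn[of x0] by simp
  define V where "V = (\<integral>y. f y \<partial>lborel)"
  have V: "V \<ge> 0" unfolding V_def by (intro integral_nonneg_AE) (auto simp: nn)
  \<comment> \<open>\<open>\<delta>\<close> is fixed before \<open>n\<close>. The minimum with 1
    keeps the ball of radius \<open>\<delta>\<close> about \<open>x\<close> inside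
    \<open>cball x0 2\<close>, where \<open>f\<close> is at most \<open>S\<close>; the added 1 in
    the denominator covers \<open>S = 0\<close>.\<close>
  define \<delta> where "\<delta> = min 1 (\<eta> / 2 / (5 * S * K + 1))"
  have den: "5 * S * K + 1 > 0" using S1 K(1) by (intro add_nonneg_pos mult_nonneg_nonneg) auto
  have \<delta>: "0 < \<delta>" "\<delta> \<le> 1" using den \<eta> by (auto simp: \<delta>_def)
  have \<delta>2: "5 * S * (K * \<delta>) \<le> \<eta> / 2"
  proof -
    have "\<delta> \<le> \<eta> / 2 / (5 * S * K + 1)" by (simp add: \<delta>_def)
    then have "\<delta> * (5 * S * K + 1) \<le> \<eta> / 2" by (rule pos_le_divide_eq[OF den, THEN iffD1])
    moreover have "\<delta> * (5 * S * K + 1) = 5 * S * (K * \<delta>) + \<delta>" by (simp add: algebra_simps)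
    ultimately show ?thesis using \<delta>(1) by linarith
  qed
  define M where "M = 5 * (1 / \<delta>\<^sup>2 + 1 / \<delta> ^ 4)"
  have M: "M \<ge> 0" using \<delta> by (auto simp: M_def)
  have main: "\<bar>\<integral>y. d n (x - y) * f y \<partial>lborel\<bar> \<le> 5 * S * (K * \<delta>) + M * V * reg n" if x: "x \<in> ball x0 1" for n x
  proof -
    have dm[measurable]: "d n \<in> borel_measurable borel" using d by (simp add: ker_error_def)
    have "\<bar>\<integral>y. d n (x - y) * f y \<partial>lborel\<bar> \<le> (\<integral>y. \<bar>d n (x - y) * f y\<bar> \<partial>lborel)"
      by (rule integral_abs_bound)
    also have "\<dots> \<le> (\<integral>y. 5 * S * (indicator (cball x \<delta>) y / (norm (x - y))\<^sup>2) + M * reg n * f y \<partial>lborel)"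
    proof (rule integral_mono_AE)
      show "integrable lborel (\<lambda>y. \<bar>d n (x - y) * f y\<bar>)" by (intro integrable_abs ker_error_integrable d)
      show "integrable lborel (\<lambda>y. 5 * S * (indicator (cball x \<delta>) y / (norm (x - y))\<^sup>2) + M * reg n * f y)"
        by (intro Bochner_Integration.integrable_add integrable_mult_right f K \<delta>)
      show "AE y in lborel. \<bar>d n (x - y) * f y\<bar> \<le> 5 * S * (indicator (cball x \<delta>) y / (norm (x - y))\<^sup>2) + M * reg n * f y"
        using AE_ne[of x]
      proof eventually_elim
        case (elim y)
        define z where "z = x - y"
        have z: "z \<noteq> 0" using elim by (auto simp: z_def)
        have d1: "\<bar>d n z\<bar> \<le> 5 / (norm z)\<^sup>2" and d2: "\<bar>d n z\<bar> \<le> 5 * reg n * (1 / (norm z)\<^sup>2 + 1 / (norm z) ^ 4)"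
          using d z by (auto simp: ker_error_def)
        show ?case
        proof (cases "y \<in> cball x \<delta>")
          case True
          have "dist x0 y \<le> dist x0 x + dist x y" by (rule dist_triangle)
          then have "y \<in> cball x0 2" using True x \<delta> by simp
          then have "\<bar>d n z\<bar> * f y \<le> 5 / (norm z)\<^sup>2 * S" using d1 S nn[of y] by (intro mult_mono) auto
          moreover have "0 \<le> M * reg n * f y" using M reg(1)[of n] nn[of y] by simp
          ultimately show ?thesis using True nn[of y] by (simp add: z_def abs_mult mult_ac)
        next
          case False
          then have \<delta>z: "\<delta> \<le> norm z" by (simp add: z_def dist_norm)
          have "1 / (norm z)\<^sup>2 + 1 / (norm z) ^ 4 \<le> 1 / \<delta>\<^sup>2 + 1 / \<delta> ^ 4"
            using \<delta>z \<delta> z by (intro add_mono divide_left_mono power_mono mult_pos_pos zero_less_power) auto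
          then have "5 * reg n * (1 / (norm z)\<^sup>2 + 1 / (norm z) ^ 4) \<le> 5 * reg n * (1 / \<delta>\<^sup>2 + 1 / \<delta> ^ 4)"
            using reg(1)[of n] by (intro mult_left_mono) auto
          then have "\<bar>d n z\<bar> \<le> M * reg n" using d2 by (simp add: M_def mult_ac)
          then have "\<bar>d n z\<bar> * f y \<le> M * reg n * f y" by (rule mult_right_mono) (rule nn)
          then show ?thesis using False nn[of y] by (simp add: z_def abs_mult)
        qed
      qed
    qed
    also have "\<dots> = 5 * S * (\<integral>y. indicator (cball x \<delta>) y / (norm (x - y))\<^sup>2 \<partial>lborel) + M * reg n * V"
      unfolding V_def
      by (subst Bochner_Integration.integral_add) (simp_all only: integrable_mult_right f K(2)[OF \<delta>(1)] integral_mult_right_zero)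
    also have "\<dots> \<le> 5 * S * (K * \<delta>) + M * reg n * V"
      using K(3)[OF \<delta>(1)] S1 by (intro add_right_mono mult_left_mono) auto
    finally show ?thesis by (simp add: mult_ac)
  qed
  have "(\<lambda>n. M * V * reg n) \<longlonglongrightarrow> M * V * 0" by (intro tendsto_intros reg)
  then have "\<forall>\<^sub>F n in sequentially. M * V * reg n < \<eta> / 2"
    by (rule order_tendstoD) (use \<eta> in simp)
  then show ?thesis
  proof (eventually_elim, intro ballI)
    fix n x assume "M * V * reg n < \<eta> / 2" "x \<in> ball x0 1"
    then show "\<bar>\<integral>y. d n (x - y) * f y \<partial>lborel\<bar> \<le> \<eta>" using main[of x n] \<delta>2 by linarith
  qed
qed

end

section \<open>Derivatives, Laplacian and lower bound of the logarithmic potential\<close>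

lemma abs_half_ln_quotient_le:
  assumes "a > 0" "b > (0::real)"
  shows "\<bar>ln b / 2 - ln a / 2\<bar> \<le> b / a + a / b"
proof -
  have "ln (b / a) \<le> b / a" "ln (a / b) \<le> a / b"
    using assms by (auto intro!: ln_bound)
  moreover have "0 < b / a" "0 < a / b" using assms by auto
  ultimately have "ln b - ln a \<le> b / a" "ln a - ln b \<le> a / b" using assms by (auto simp: ln_div)
  then show ?thesis using \<open>0 < b / a\<close> \<open>0 < a / b\<close> by linarith
qed

lemma isCont_compose_diff:
  fixes k :: "'a::real_normed_vector \<Rightarrow> 'b::topological_space"
  assumes c: "continuous_on UNIV k"
  shows "isCont (\<lambda>x. k (x - y)) x"
proof -
  have "continuous_on UNIV (\<lambda>x. k (x - y))"
    by (rule continuous_on_compose2[OF c]) (auto intro!: continuous_intros)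
  then show ?thesis by (simp add: continuous_on_eq_continuous_at)
qed

context density
begin

text \<open>The two logarithms need not be integrable against \<open>f\<close> separately; only
  their difference stays bounded at infinity. It is half the logarithm of \<open>b / a\<close>, and
  both \<open>b / a\<close> and \<open>a / b\<close> are at most a constant plus a multiple of
  \<open>1 / |y|^2\<close>. The bound \<open>X\<close> on \<open>norm x\<close> gives one majorant
  for a whole neighbourhood.\<close>

lemma log_ker_dominated:
  assumes X: "norm x \<le> X" and y: "y \<noteq> 0"
  shows "\<bar>(log_ker n (x - y) - ln (norm y)) * f y\<bar> \<le>
    (4 + (2 * X\<^sup>2 / (reg n)\<^sup>2)) * f y + (2 * X\<^sup>2 + 1) * (f y / (norm (0 - y))\<^sup>2)"
proof -
  define a where "a = (norm y)\<^sup>2"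
  define b where "b = (norm (x - y))\<^sup>2 + (reg n)\<^sup>2"
  have a: "a > 0" using y by (simp add: a_def)
  have b: "b > 0" "(reg n)\<^sup>2 \<le> b" using reg_pos(1)[of "x - y" n] by (auto simp: b_def)
  have rp: "(reg n)\<^sup>2 > 0" by simp
  have X2: "(norm x)\<^sup>2 \<le> X\<^sup>2" using X by (intro power_mono) auto
  have r1: "(reg n)\<^sup>2 \<le> 1" using reg(1,2)[of n] by (simp add: power_le_one)
  have "b \<le> 2 * a + (2 * X\<^sup>2 + 1)"
    using norm_sq_le_double[of "x - y" x] X2 r1 by (simp add: a_def b_def)
  then have "b / a \<le> (2 * a + (2 * X\<^sup>2 + 1)) / a" using a by (intro divide_right_mono) auto
  also have "\<dots> = 2 + (2 * X\<^sup>2 + 1) / a" using a by (simp add: add_divide_distrib)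
  finally have 1: "b / a \<le> 2 + (2 * X\<^sup>2 + 1) / a" .
  have "p \<le> 2 * (d + r) + 2 * m" if "p \<le> 2 * k + 2 * d" "k \<le> m" "0 \<le> r" for p k d m r :: real
    using that by simp
  from this[OF norm_sq_le_double X2 zero_le_power2] have "a \<le> 2 * b + 2 * X\<^sup>2"
    unfolding a_def b_def .
  then have "a / b \<le> (2 * b + 2 * X\<^sup>2) / b" using b by (intro divide_right_mono) auto
  also have "\<dots> = 2 + 2 * X\<^sup>2 / b" using b by (simp add: add_divide_distrib)
  also have "\<dots> \<le> 2 + 2 * X\<^sup>2 / (reg n)\<^sup>2" by (intro add_left_mono divide_left_mono mult_pos_pos b rp) simp
  finally have 2: "a / b \<le> 2 + 2 * X\<^sup>2 / (reg n)\<^sup>2" .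
  have "log_ker n (x - y) - ln (norm y) = ln b / 2 - ln a / 2"
    using y by (simp add: log_ker_def a_def b_def ln_realpow)
  then have "\<bar>log_ker n (x - y) - ln (norm y)\<bar> \<le> (4 + 2 * X\<^sup>2 / (reg n)\<^sup>2) + (2 * X\<^sup>2 + 1) / a"
    using abs_half_ln_quotient_le[OF a b(1)] 1 2 by simp
  then have "\<bar>log_ker n (x - y) - ln (norm y)\<bar> * f y \<le> ((4 + 2 * X\<^sup>2 / (reg n)\<^sup>2) + (2 * X\<^sup>2 + 1) / a) * f y"
    by (rule mult_right_mono) (rule nn)
  then show ?thesis using nn[of y] by (simp add: abs_mult a_def distrib_right)
qed

lemma dominant_integrable:
  "integrable lborel (\<lambda>y. C * f y + D * (f y / (norm (x - y))\<^sup>2))"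
  by (intro Bochner_Integration.integrable_add integrable_mult_right f int_inv_sq)

lemma log_ker_integrable: "integrable lborel (\<lambda>y. (log_ker n (x - y) - ln (norm y)) * f y)"
proof (rule Bochner_Integration.integrable_bound[OF dominant_integrable])
  show "AE y in lborel. norm ((log_ker n (x - y) - ln (norm y)) * f y) \<le>
     norm ((4 + (2 * (norm x)\<^sup>2 / (reg n)\<^sup>2)) * f y + (2 * (norm x)\<^sup>2 + 1) * (f y / (norm (0 - y))\<^sup>2))"
    using AE_ne[of x]
  proof eventually_elim
    case (elim y)
    then show ?case using order_trans[OF log_ker_dominated[OF order_refl] abs_ge_self] by simp
  qed
qed measurable

lemma log_integrable: "integrable lborel (\<lambda>y. (ln (norm (x - y)) - ln (norm y)) * f y)"
proof -
  have "integrable lborel (\<lambda>y. (log_ker 0 (x - y) - ln (norm y)) * f y - (log_ker 0 (x - y) - ln (norm (x - y))) * f y)"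
    by (intro Bochner_Integration.integrable_diff log_ker_integrable ker_error_integrable[OF log_ker_error(1)])
  then show ?thesis by (simp add: algebra_simps)
qed

lemma log_potential_eq:
  "log_potential f x = - (1 / pi\<^sup>2) * (\<integral>y. (ln (norm (x - y)) - ln (norm y)) * f y \<partial>lborel)"
proof -
  have "(\<integral>y. ln (norm y / norm (x - y)) * f y \<partial>lborel) = (\<integral>y. - ((ln (norm (x - y)) - ln (norm y)) * f y) \<partial>lborel)"
  proof (rule integral_cong_AE)
    show "AE y in lborel. ln (norm y / norm (x - y)) * f y = - ((ln (norm (x - y)) - ln (norm y)) * f y)"
      using AE_ne[of x]
    proof eventually_elim
      case (elim y)
      then show ?case by (simp add: ln_div algebra_simps)
    qed
  qed measurable
  then show ?thesis by (simp add: log_potential_def)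
qed

definition reg_potential :: "nat \<Rightarrow> real^3 \<Rightarrow> real" where
  "reg_potential n x = (\<integral>y. (log_ker n (x - y) - ln (norm y)) * f y \<partial>lborel)"

definition reg_grad :: "3 \<Rightarrow> nat \<Rightarrow> real^3 \<Rightarrow> real" where
  "reg_grad i n x = (\<integral>y. log_ker1 i n (x - y) * f y \<partial>lborel)"

definition reg_hess :: "3 \<Rightarrow> 3 \<Rightarrow> nat \<Rightarrow> real^3 \<Rightarrow> real" where
  "reg_hess i j n x = (\<integral>y. log_ker2 i j n (x - y) * f y \<partial>lborel)"

definition grad_potential :: "3 \<Rightarrow> real^3 \<Rightarrow> real" where
  "grad_potential i x = (\<integral>y. ker1 i (x - y) * f y \<partial>lborel)"

definition hess_potential :: "3 \<Rightarrow> 3 \<Rightarrow> real^3 \<Rightarrow> real" where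
  "hess_potential i j x = (\<integral>y. ker2 i j (x - y) * f y \<partial>lborel)"

lemma bounded_ker_integrable:
  assumes "k \<in> borel_measurable borel" "\<And>z. \<bar>k z\<bar> \<le> B"
  shows "integrable lborel (\<lambda>y. k (x - y) * f y)"
  by (rule pairing_integrable[where C = B and D = 0]) (use assms in auto)

lemma ker_integrable:
  "integrable lborel (\<lambda>y. log_ker1 i n (x - y) * f y)"
  "integrable lborel (\<lambda>y. log_ker2 i j n (x - y) * f y)"
  "integrable lborel (\<lambda>y. ker1 i (x - y) * f y)"
  "integrable lborel (\<lambda>y. ker2 i j (x - y) * f y)"
proof -
  show "integrable lborel (\<lambda>y. log_ker1 i n (x - y) * f y)" "integrable lborel (\<lambda>y. log_ker2 i j n (x - y) * f y)"
    by (rule bounded_ker_integrable, measurable, rule log_ker_bounds)+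
  show "integrable lborel (\<lambda>y. ker1 i (x - y) * f y)"
  proof (rule pairing_integrable)
    fix z :: "real^3" assume z: "z \<noteq> 0"
    have "t \<le> 1 + t\<^sup>2" if "t \<ge> 0" for t :: real
      using sum_squares_bound[of t 1] that by simp
    from this[of "1 / norm z"] show "\<bar>ker1 i z\<bar> \<le> 1 + 1 / (norm z)\<^sup>2"
      using ker_bounds(1)[OF z, of i] by (simp add: power_divide)
  qed measurable
  show "integrable lborel (\<lambda>y. ker2 i j (x - y) * f y)"
    by (rule pairing_integrable[where C = 0 and D = 3]) (use ker_bounds(2) in auto)
qed

lemma reg_limits:
  assumes \<eta>: "\<eta> > 0"
  shows "\<forall>\<^sub>F n in sequentially. \<forall>x\<in>ball x0 1. \<bar>reg_potential n x - (\<integral>y. (ln (norm (x - y)) - ln (norm y)) * f y \<partial>lborel)\<bar> \<le> \<eta>"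
    and "\<forall>\<^sub>F n in sequentially. \<forall>x\<in>ball x0 1. \<bar>reg_grad i n x - grad_potential i x\<bar> \<le> \<eta>"
    and "\<forall>\<^sub>F n in sequentially. \<forall>x\<in>ball x0 1. \<bar>reg_hess i j n x - hess_potential i j x\<bar> \<le> \<eta>"
proof -
  have "reg_potential n x - (\<integral>y. (ln (norm (x - y)) - ln (norm y)) * f y \<partial>lborel) = (\<integral>y. (log_ker n (x - y) - ln (norm (x - y))) * f y \<partial>lborel)" for n x
    unfolding reg_potential_def by (subst Bochner_Integration.integral_diff[OF log_ker_integrable log_integrable, symmetric]) (simp add: algebra_simps)
  then show "\<forall>\<^sub>F n in sequentially. \<forall>x\<in>ball x0 1. \<bar>reg_potential n x - (\<integral>y. (ln (norm (x - y)) - ln (norm y)) * f y \<partial>lborel)\<bar> \<le> \<eta>"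
    using ker_error_uniform[OF log_ker_error(1) \<eta>, of x0] by simp
  have "reg_grad i n x - grad_potential i x = (\<integral>y. (log_ker1 i n (x - y) - ker1 i (x - y)) * f y \<partial>lborel)" for n x
    unfolding reg_grad_def grad_potential_def
    by (subst Bochner_Integration.integral_diff[OF ker_integrable(1,3), symmetric]) (simp add: algebra_simps)
  then show "\<forall>\<^sub>F n in sequentially. \<forall>x\<in>ball x0 1. \<bar>reg_grad i n x - grad_potential i x\<bar> \<le> \<eta>"
    using ker_error_uniform[OF log_ker_error(2) \<eta>, of x0] by simp
  have "reg_hess i j n x - hess_potential i j x = (\<integral>y. (log_ker2 i j n (x - y) - ker2 i j (x - y)) * f y \<partial>lborel)" for n x
    unfolding reg_hess_def hess_potential_def
    by (subst Bochner_Integration.integral_diff[OF ker_integrable(2,4), symmetric]) (simp add: algebra_simps)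
  then show "\<forall>\<^sub>F n in sequentially. \<forall>x\<in>ball x0 1. \<bar>reg_hess i j n x - hess_potential i j x\<bar> \<le> \<eta>"
    using ker_error_uniform[OF log_ker_error(3) \<eta>, of x0] by simp
qed

lemma uniform_imp_pointwise:
  assumes "\<And>\<eta>. \<eta> > 0 \<Longrightarrow> \<forall>\<^sub>F n in sequentially. \<forall>z\<in>ball x 1. \<bar>F n z - G z\<bar> \<le> (\<eta>::real)"
  shows "(\<lambda>n. F n x) \<longlonglongrightarrow> G (x::real^3)"
proof (rule tendstoI)
  fix e :: real assume "e > 0"
  then have "\<forall>\<^sub>F n in sequentially. \<forall>z\<in>ball x 1. \<bar>F n z - G z\<bar> \<le> e / 2" by (intro assms) simp
  then show "\<forall>\<^sub>F n in sequentially. dist (F n x) (G x) < e"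
  proof eventually_elim
    case (elim n)
    then have "\<bar>F n x - G x\<bar> \<le> e / 2" by simp
    then show ?case using \<open>e > 0\<close> by (simp add: dist_real_def)
  qed
qed

lemma line_shift:
  fixes e :: "real^3"
  assumes "\<And>z. ((\<lambda>t. k (z + t *\<^sub>R e)) has_real_derivative k' z) (at 0)"
  shows "((\<lambda>t. k (x + t *\<^sub>R e - y)) has_real_derivative k' (x + s *\<^sub>R e - y)) (at s)"
  using DERIV_shift[of "\<lambda>t. k (x - y + t *\<^sub>R e)" _ 0 s] assms[of "x - y + s *\<^sub>R e"]
  by (simp add: algebra_simps)

lemma reg_deriv:
  "((\<lambda>t. reg_potential n (x + t *\<^sub>R axis j 1)) has_real_derivative reg_grad j n x) (at 0)"
  "((\<lambda>t. reg_grad i n (x + t *\<^sub>R axis j 1)) has_real_derivative reg_hess i j n x) (at 0)"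
proof -
  have "((\<lambda>t. reg_potential n (x + t *\<^sub>R axis j 1)) has_real_derivative (\<integral>y. log_ker1 j n (x + 0 *\<^sub>R axis j 1 - y) * f y \<partial>lborel)) (at 0)"
    unfolding reg_potential_def
  proof (rule has_real_derivative_integral(2)[where e = 1 and g = "\<lambda>y. 1 / reg n * f y" and f' = "\<lambda>t y. log_ker1 j n (x + t *\<^sub>R axis j 1 - y) * f y"])
    show "integrable lborel (\<lambda>y. 1 / reg n * f y)" by (intro integrable_mult_right f)
    fix t :: real and y
    show "((\<lambda>s. (log_ker n (x + s *\<^sub>R axis j 1 - y) - ln (norm y)) * f y) has_real_derivative
        log_ker1 j n (x + t *\<^sub>R axis j 1 - y) * f y) (at t)"
      using DERIV_diff[OF line_shift[OF log_ker_deriv(1)] DERIV_const] by (intro DERIV_cmult_right) simp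
    have "\<bar>log_ker1 j n (x + t *\<^sub>R axis j 1 - y)\<bar> * f y \<le> 1 / reg n * f y" by (intro mult_right_mono log_ker_bounds nn)
    then show "\<bar>log_ker1 j n (x + t *\<^sub>R axis j 1 - y) * f y\<bar> \<le> 1 / reg n * f y" using nn[of y] by (simp add: abs_mult)
  qed (auto intro: log_ker_integrable)
  then show "((\<lambda>t. reg_potential n (x + t *\<^sub>R axis j 1)) has_real_derivative reg_grad j n x) (at 0)" by (simp add: reg_grad_def)
  have "((\<lambda>t. reg_grad i n (x + t *\<^sub>R axis j 1)) has_real_derivative (\<integral>y. log_ker2 i j n (x + 0 *\<^sub>R axis j 1 - y) * f y \<partial>lborel)) (at 0)"
    unfolding reg_grad_def
  proof (rule has_real_derivative_integral(2)[where e = 1 and g = "\<lambda>y. 3 / (reg n)\<^sup>2 * f y" and f' = "\<lambda>t y. log_ker2 i j n (x + t *\<^sub>R axis j 1 - y) * f y"])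
    show "integrable lborel (\<lambda>y. 3 / (reg n)\<^sup>2 * f y)" by (intro integrable_mult_right f)
    fix t :: real and y
    show "((\<lambda>s. log_ker1 i n (x + s *\<^sub>R axis j 1 - y) * f y) has_real_derivative
        log_ker2 i j n (x + t *\<^sub>R axis j 1 - y) * f y) (at t)"
      by (intro DERIV_cmult_right line_shift log_ker_deriv)
    have "\<bar>log_ker2 i j n (x + t *\<^sub>R axis j 1 - y)\<bar> * f y \<le> 3 / (reg n)\<^sup>2 * f y" by (intro mult_right_mono log_ker_bounds nn)
    then show "\<bar>log_ker2 i j n (x + t *\<^sub>R axis j 1 - y) * f y\<bar> \<le> 3 / (reg n)\<^sup>2 * f y" using nn[of y] by (simp add: abs_mult)
  qed (auto intro: ker_integrable)
  then show "((\<lambda>t. reg_grad i n (x + t *\<^sub>R axis j 1)) has_real_derivative reg_hess i j n x) (at 0)" by (simp add: reg_hess_def)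
qed

lemma bounded_conv_continuous:
  assumes m[measurable]: "k \<in> borel_measurable borel" and b: "\<And>z. \<bar>k z\<bar> \<le> B" and c: "continuous_on UNIV k"
  shows "continuous_on UNIV (\<lambda>x. \<integral>y. k (x - y) * f y \<partial>lborel)"
proof -
  have "((\<lambda>x. \<integral>y. k (x - y) * f y \<partial>lborel) \<longlongrightarrow> (\<integral>y. k (x - y) * f y \<partial>lborel)) (at x)" for x
  proof (rule tendsto_integral_at_within)
    show "integrable lborel (\<lambda>y. B * f y)" by (intro integrable_mult_right f)
    have "\<bar>k (x - y)\<bar> * f y \<le> B * f y" for x y by (intro mult_right_mono b nn)
    then show "\<forall>\<^sub>F x in at x. AE y in lborel. norm (k (x - y) * f y) \<le> B * f y"
      using nn by (simp add: abs_mult)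
    show "AE y in lborel. ((\<lambda>x. k (x - y) * f y) \<longlongrightarrow> k (x - y) * f y) (at x)"
      using isCont_compose_diff[OF c] by (intro AE_I2 tendsto_mult tendsto_const) (simp add: isCont_def)
  qed measurable
  then show ?thesis by (simp add: continuous_on_eq_continuous_at isCont_def)
qed

lemma reg_continuous: "continuous_on UNIV (reg_potential n)" "continuous_on UNIV (reg_grad i n)" "continuous_on UNIV (reg_hess i j n)"
proof -
  show "continuous_on UNIV (reg_grad i n)" "continuous_on UNIV (reg_hess i j n)"
    unfolding reg_grad_def[abs_def] reg_hess_def[abs_def]
    by (rule bounded_conv_continuous[OF _ log_ker_bounds(1)], measurable, rule log_ker_continuous)
       (rule bounded_conv_continuous[OF _ log_ker_bounds(2)], measurable, rule log_ker_continuous)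
  have "((\<lambda>x. \<integral>y. (log_ker n (x - y) - ln (norm y)) * f y \<partial>lborel) \<longlongrightarrow> (\<integral>y. (log_ker n (x - y) - ln (norm y)) * f y \<partial>lborel)) (at x)" for x
  proof (rule tendsto_integral_at_within[OF _ _ dominant_integrable])
    have "\<forall>\<^sub>F z in at x. z \<in> ball x 1" by (intro eventually_at_in_open') auto
    then show "\<forall>\<^sub>F z in at x. AE y in lborel. norm ((log_ker n (z - y) - ln (norm y)) * f y) \<le>
        (4 + (2 * (norm x + 1)\<^sup>2 / (reg n)\<^sup>2)) * f y + (2 * (norm x + 1)\<^sup>2 + 1) * (f y / (norm (0 - y))\<^sup>2)"
    proof eventually_elim
      case (elim z)
      then have "norm z \<le> norm x + 1" using norm_triangle_sub[of z x] by (simp add: dist_norm norm_minus_commute)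
      then show ?case
        using AE_ne[of x] log_ker_dominated by (auto elim!: eventually_mono)
    qed
    show "AE y in lborel. ((\<lambda>z. (log_ker n (z - y) - ln (norm y)) * f y) \<longlongrightarrow> (log_ker n (x - y) - ln (norm y)) * f y) (at x)"
      using isCont_compose_diff[OF log_ker_continuous(1)[of UNIV n]]
      by (intro AE_I2 tendsto_mult tendsto_diff tendsto_const) (simp add: isCont_def)
  qed measurable
  then show "continuous_on UNIV (reg_potential n)"
    unfolding reg_potential_def[abs_def] by (simp add: continuous_on_eq_continuous_at isCont_def)
qed

lemma log_potential_continuous: "continuous_on UNIV (log_potential f)"
  and grad_potential_continuous: "continuous_on UNIV (grad_potential i)"
  and hess_potential_continuous: "continuous_on UNIV (hess_potential i j)"
proof -
  have "continuous_on UNIV (\<lambda>x. \<integral>y. (ln (norm (x - y)) - ln (norm y)) * f y \<partial>lborel)"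
    by (rule continuous_of_uniform_limit[OF reg_continuous(1) reg_limits(1)])
  then show "continuous_on UNIV (log_potential f)"
    unfolding log_potential_eq[abs_def] by (intro continuous_intros)
  show "continuous_on UNIV (grad_potential i)"
    by (rule continuous_of_uniform_limit[OF reg_continuous(2) reg_limits(2)])
  show "continuous_on UNIV (hess_potential i j)"
    by (rule continuous_of_uniform_limit[OF reg_continuous(3) reg_limits(3)])
qed

lemma log_potential_deriv:
  "((\<lambda>t. log_potential f (x + t *\<^sub>R axis j 1)) has_real_derivative - (1 / pi\<^sup>2) * grad_potential j x) (at 0)"
  unfolding log_potential_eq
  by (intro DERIV_cmult line_deriv_of_uniform_limit[OF reg_deriv(1) uniform_imp_pointwise[OF reg_limits(1)] reg_limits(2)])

lemma grad_potential_deriv: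
  "((\<lambda>t. grad_potential i (x + t *\<^sub>R axis j 1)) has_real_derivative hess_potential i j x) (at 0)"
  by (rule line_deriv_of_uniform_limit[OF reg_deriv(2) uniform_imp_pointwise[OF reg_limits(2)] reg_limits(3)])

lemma partial_log_potential: "partial_deriv i (log_potential f) = (\<lambda>x. - (1 / pi\<^sup>2) * grad_potential i x)"
  using log_potential_deriv by (intro ext partial_deriv_eqI) (simp add: has_real_derivative_iff_has_vector_derivative)

lemma partial2_log_potential:
  "partial_deriv j (partial_deriv i (log_potential f)) = (\<lambda>x. - (1 / pi\<^sup>2) * hess_potential i j x)"
  unfolding partial_log_potential
  by (intro ext partial_deriv_eqI)
    (simp only: DERIV_cmult[OF grad_potential_deriv] flip: has_real_derivative_iff_has_vector_derivative)

text \<open>The trace of the Hessian of \<open>ln |z|\<close> in dimension 3 is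
  \<open>(3 - 2) / |z|^2\<close>; at \<open>z = 0\<close> both sides are 0 by the convention for
  division.\<close>

lemma laplacian_log_potential:
  "laplacian (log_potential f) x = - (1 / pi\<^sup>2) * (\<integral>y. f y / (norm (x - y))\<^sup>2 \<partial>lborel)"
proof -
  have k: "(\<Sum>i\<in>UNIV. ker2 i i z) = 1 / (norm z)\<^sup>2" for z
  proof -
    have "(norm z)\<^sup>2 = z$1 * z$1 + z$2 * z$2 + z$3 * z$3"
      by (simp add: power2_norm_eq_inner inner_vec_def sum_3)
    then have "(\<Sum>i\<in>UNIV. ker2 i i z) = 3 / (norm z)\<^sup>2 - 2 * ((norm z)\<^sup>2 / ((norm z)\<^sup>2)\<^sup>2)"
      by (simp add: ker2_def sum_3 add_divide_distrib distrib_left)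
    also have "\<dots> = 1 / (norm z)\<^sup>2" by (cases "z = 0") (simp_all add: power2_eq_square)
    finally show ?thesis .
  qed
  have "laplacian (log_potential f) x = - (1 / pi\<^sup>2) * (\<Sum>i\<in>UNIV. hess_potential i i x)"
    unfolding laplacian_def partial2_log_potential by (simp only: sum_distrib_left)
  also have "(\<Sum>i\<in>UNIV. hess_potential i i x) = (\<integral>y. (\<Sum>i\<in>UNIV. ker2 i i (x - y) * f y) \<partial>lborel)"
    unfolding hess_potential_def by (rule Bochner_Integration.integral_sum[symmetric]) (rule ker_integrable)
  also have "\<dots> = (\<integral>y. f y / (norm (x - y))\<^sup>2 \<partial>lborel)"
    by (simp only: sum_distrib_right[symmetric] k) (simp add: mult.commute)
  finally show ?thesis .
qed

text \<open>For \<open>|y| \<ge> 1\<close> use \<open>|x - y| \<le> (1 + |x|) * |y|\<close>; for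
  \<open>|y| < 1\<close> use \<open>|x - y| \<le> 1 + |x|\<close> and bound \<open>- ln |y|\<close>
  by \<open>1 / |y|^2\<close>. The coefficient of the logarithm is already the sharp one that
  \<open>potential_asymptotics\<close> needs.\<close>

lemma log_potential_lower: "log_potential f x \<ge> - (1 / pi\<^sup>2) * ((\<integral>y. f y \<partial>lborel) * ln (1 + norm x) + (\<integral>y. f y / (norm (0 - y))\<^sup>2 \<partial>lborel))"
proof -
  have "(\<integral>y. (ln (norm (x - y)) - ln (norm y)) * f y \<partial>lborel) \<le> (\<integral>y. ln (1 + norm x) * f y + 1 * (f y / (norm (0 - y))\<^sup>2) \<partial>lborel)"
  proof (rule integral_mono_AE[OF log_integrable dominant_integrable])
    show "AE y in lborel. (ln (norm (x - y)) - ln (norm y)) * f y \<le> ln (1 + norm x) * f y + 1 * (f y / (norm (0 - y))\<^sup>2)"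
      using AE_ne[of x]
    proof eventually_elim
      case (elim y)
      define r where "r = norm y"
      have r: "r > 0" using elim by (simp add: r_def)
      have xy: "norm (x - y) > 0" "norm (x - y) \<le> norm x + r"
        using elim norm_triangle_ineq4[of x y] by (auto simp: r_def)
      have "ln (norm (x - y)) - ln r \<le> ln (1 + norm x) + 1 / r\<^sup>2"
      proof (cases "r \<ge> 1")
        case True
        have "norm x * 1 \<le> norm x * r" using True by (intro mult_left_mono) auto
        then have "norm (x - y) \<le> (1 + norm x) * r" using xy by (simp add: distrib_right)
        then have "ln (norm (x - y)) \<le> ln ((1 + norm x) * r)" using xy by (intro ln_mono) auto
        also have "\<dots> = ln (1 + norm x) + ln r" using r add_pos_nonneg[OF zero_less_one norm_ge_zero[of x]] by (simp add: ln_mult)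
        finally show ?thesis using r by (simp add: add_increasing2)
      next
        case False
        have "ln (norm (x - y)) \<le> ln (1 + norm x)" using xy False by (intro ln_mono) (auto intro: order_trans)
        moreover have "- ln r \<le> 1 / r\<^sup>2"
        proof -
          have "- ln r = ln (1 / r)" using r by (simp add: ln_div)
          also have "\<dots> \<le> 1 / r" using r by (intro ln_bound) auto
          also have "\<dots> \<le> 1 / r\<^sup>2" using r False by (intro divide_left_mono) (auto simp: power2_eq_square mult_left_le)
          finally show ?thesis .
        qed
        ultimately show ?thesis by linarith
      qed
      then have "(ln (norm (x - y)) - ln (norm y)) * f y \<le> (ln (1 + norm x) + 1 / r\<^sup>2) * f y"
        unfolding r_def by (rule mult_right_mono) (rule nn)
      then show ?case by (simp add: r_def distrib_right)
    qed
  qed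
  also have "\<dots> = (\<integral>y. f y \<partial>lborel) * ln (1 + norm x) + (\<integral>y. f y / (norm (0 - y))\<^sup>2 \<partial>lborel)"
    by (subst Bochner_Integration.integral_add[OF integrable_mult_right[OF f] integrable_mult_right[OF int_inv_sq]])
      (simp only: integral_mult_right_zero mult_1, simp only: mult.commute)
  finally show ?thesis
    unfolding log_potential_eq by (intro mult_left_mono_neg) auto
qed

end

section \<open>Functions with constant Laplacian and polynomial growth from above\<close>

lemma line_derivs_0_imp_constant:
  fixes q :: "real^3 \<Rightarrow> real"
  assumes d: "\<And>x i. ((\<lambda>t. q (x + t *\<^sub>R axis i 1)) has_real_derivative 0) (at 0)"
  shows "q x = q 0"
proof -
  have step: "q (x + s *\<^sub>R axis i 1) = q x" for x s i
  proof -
    have "((\<lambda>t. q (x + t *\<^sub>R axis i 1)) has_real_derivative 0) (at t)" for t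
      using DERIV_shift[of "\<lambda>t. q (x + t *\<^sub>R axis i 1)" 0 0 t] d[of "x + t *\<^sub>R axis i 1" i] by (simp add: algebra_simps)
    then have "(\<lambda>t. q (x + t *\<^sub>R axis i 1)) s = (\<lambda>t. q (x + t *\<^sub>R axis i 1)) 0"
      by (intro DERIV_isconst_all allI)
    then show ?thesis by simp
  qed
  have "x = 0 + (x$1) *\<^sub>R axis 1 1 + (x$2) *\<^sub>R axis 2 1 + (x$3) *\<^sub>R axis 3 1"
    by (simp add: vec_eq_iff forall_3 axis_def)
  then have "q x = q (0 + (x$1) *\<^sub>R axis 1 1 + (x$2) *\<^sub>R axis 2 1 + (x$3) *\<^sub>R axis 3 1)" by (rule arg_cong)
  also have "\<dots> = q 0" by (simp only: step)
  finally show ?thesis .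
qed

section \<open>Radial bumps and their derivatives in position and in radius\<close>

lemma pos_part_power_deriv:
  assumes n: "n \<ge> 1"
  shows "((\<lambda>s. max 0 s ^ Suc n) has_real_derivative real (Suc n) * max 0 s ^ n) (at (s::real))"
proof -
  consider "s > 0" | "s < 0" | "s = 0" by linarith
  then show ?thesis
  proof cases
    case 1
    have "((\<lambda>s. s ^ Suc n) has_real_derivative real (Suc n) * s ^ n) (at s)"
      using DERIV_pow[of "Suc n" s] by simp
    moreover have "\<forall>\<^sub>F t in nhds s. t ^ Suc n = max 0 t ^ Suc n"
      using eventually_nhds_in_open[of "{0<..}" s] 1 by (auto elim!: eventually_mono)
    ultimately show ?thesis using 1 by (subst (asm) DERIV_cong_ev[OF refl _ refl]) auto
  next
    case 2
    have "((\<lambda>s. 0) has_real_derivative 0) (at s)" by simp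
    moreover have "\<forall>\<^sub>F t in nhds s. 0 = max 0 t ^ Suc n"
      using eventually_nhds_in_open[of "{..<0}" s] 2 by (auto elim!: eventually_mono)
    ultimately have "((\<lambda>t. max 0 t ^ Suc n) has_real_derivative 0) (at s)"
      by (subst (asm) DERIV_cong_ev[OF refl _ refl])
    moreover have "real (Suc n) * max 0 s ^ n = 0" using 2 n by simp
    ultimately show ?thesis by (simp only:)
  next
    case 3
    \<comment> \<open>At the kink the difference quotient is at most \<open>|h| ^ n\<close>, so
      \<open>n \<ge> 1\<close> is what makes it tend to 0.\<close>
    have "((\<lambda>h. (max 0 (0 + h) ^ Suc n - max 0 0 ^ Suc n) / h) \<longlongrightarrow> 0) (at (0::real))"
    proof (rule Lim_null_comparison)
      have "norm ((max 0 (0 + h) ^ Suc n - max 0 0 ^ Suc n) / h) \<le> \<bar>h\<bar> ^ n" for h :: real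
      proof (cases "h > 0")
        case True
        then have "(max 0 (0 + h) ^ Suc n - max 0 0 ^ Suc n) / h = h ^ n" by simp
        then show ?thesis using True by simp
      next
        case False
        then have "max 0 (0 + h) = 0" by simp
        then show ?thesis by simp
      qed
      then show "\<forall>\<^sub>F h in at 0. norm ((max 0 (0 + h) ^ Suc n - max 0 0 ^ Suc n) / h) \<le> \<bar>h\<bar> ^ n" by simp
      have "((\<lambda>h::real. \<bar>h\<bar> ^ n) \<longlongrightarrow> \<bar>0\<bar> ^ n) (at 0)" by (intro tendsto_intros)
      moreover have "\<bar>0::real\<bar> ^ n = 0" using n by simp
      ultimately show "((\<lambda>h::real. \<bar>h\<bar> ^ n) \<longlongrightarrow> 0) (at 0)" by (simp only:)
    qed
    moreover have "real (Suc n) * max 0 (0::real) ^ n = 0" using n by simp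
    ultimately show ?thesis unfolding 3 DERIV_def by (simp only:)
  qed
qed

text \<open>A radial weight whose derivatives in position and in radius are multiples of the same
  weight with a lower exponent. Averages against it replace spherical means, so that no surface
  measure is needed.\<close>

definition bump :: "nat \<Rightarrow> real \<Rightarrow> real^3 \<Rightarrow> real" where
  "bump n R z = max 0 (R\<^sup>2 - (norm z)\<^sup>2) ^ n"

lemma bump_nonneg: "0 \<le> bump n R z"
  by (simp add: bump_def)

lemma bump_le: "bump n R z \<le> (R\<^sup>2) ^ n"
  unfolding bump_def by (intro power_mono) auto

lemma bump_outside: "n \<ge> 1 \<Longrightarrow> 0 \<le> R \<Longrightarrow> norm z > R \<Longrightarrow> bump n R z = 0"
  using power_mono[of R "norm z" 2] by (simp add: bump_def max_def)

lemma bump_continuous [continuous_intros]: "continuous_on S (bump n R)"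
  unfolding bump_def by (intro continuous_intros)

lemma bump_measurable [measurable]: "bump n R \<in> borel_measurable borel"
  by (rule borel_measurable_continuous_onI) (rule bump_continuous)

lemma bump_scale: "R > 0 \<Longrightarrow> bump n R (R *\<^sub>R z) = (R\<^sup>2) ^ n * bump n 1 z"
proof -
  assume R: "R > 0"
  have "R\<^sup>2 - (norm (R *\<^sub>R z))\<^sup>2 = R\<^sup>2 * (1 - (norm z)\<^sup>2)" by (simp add: power_mult_distrib algebra_simps)
  moreover have "max 0 (R\<^sup>2 * c) = R\<^sup>2 * max 0 c" for c
    using R by (auto simp: max_def zero_le_mult_iff)
  ultimately show ?thesis by (simp add: bump_def power_mult_distrib)
qed

lemma bump_line_deriv:
  assumes n: "n \<ge> 1"
  shows "((\<lambda>t. bump (Suc n) R (z + t *\<^sub>R axis j 1)) has_real_derivative - (2 * real (Suc n)) * (z $ j) * bump n R z) (at 0)"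
proof -
  have q: "((\<lambda>t. R\<^sup>2 - ((norm z)\<^sup>2 + 2 * t * (z $ j) + t\<^sup>2)) has_real_derivative - (2 * (z $ j))) (at 0)"
    by (auto intro!: derivative_eq_intros)
  show ?thesis
    unfolding bump_def norm_sq_line
    by (rule DERIV_cong[OF DERIV_chain2[OF pos_part_power_deriv[OF n] q]]) (simp add: algebra_simps)
qed

lemma bump_radius_deriv:
  assumes n: "n \<ge> 1"
  shows "((\<lambda>R. bump (Suc n) R z) has_real_derivative 2 * real (Suc n) * R * bump n R z) (at R)"
proof -
  have q: "((\<lambda>R. R\<^sup>2 - (norm z)\<^sup>2) has_real_derivative 2 * R) (at R)"
    by (auto intro!: derivative_eq_intros)
  show ?thesis
    unfolding bump_def
    by (rule DERIV_cong[OF DERIV_chain2[OF pos_part_power_deriv[OF n] q]]) (simp add: algebra_simps)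
qed

text \<open>\<open>bump1\<close>, \<open>bump2\<close> and \<open>bump3\<close> are the partial
  derivatives of \<open>bump 4\<close> of the orders one to three, as \<open>bump_derivs\<close>
  shows.\<close>

definition bump1 :: "3 \<Rightarrow> real \<Rightarrow> real^3 \<Rightarrow> real" where
  "bump1 i R z = - 8 * (z $ i) * bump 3 R z"

definition bump2 :: "3 \<Rightarrow> 3 \<Rightarrow> real \<Rightarrow> real^3 \<Rightarrow> real" where
  "bump2 i j R z = - 8 * of_bool (i = j) * bump 3 R z + 48 * (z $ i) * (z $ j) * bump 2 R z"

definition bump3 :: "3 \<Rightarrow> 3 \<Rightarrow> 3 \<Rightarrow> real \<Rightarrow> real^3 \<Rightarrow> real" where
  "bump3 i j l R z = 48 * (of_bool (i = j) * (z $ l) + of_bool (i = l) * (z $ j) + of_bool (j = l) * (z $ i)) * bump 2 R z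
     - 192 * (z $ i) * (z $ j) * (z $ l) * bump 1 R z"

lemma coord_line_deriv: "((\<lambda>t. (z + t *\<^sub>R axis j 1) $ i) has_real_derivative of_bool (i = j)) (at 0)" for z :: "real^3"
  by (auto intro!: derivative_eq_intros simp: axis_def)

lemma bump_derivs:
  "((\<lambda>t. bump 4 R (z + t *\<^sub>R axis i 1)) has_real_derivative bump1 i R z) (at 0)"
  "((\<lambda>t. bump1 i R (z + t *\<^sub>R axis j 1)) has_real_derivative bump2 i j R z) (at 0)"
  "((\<lambda>t. bump2 i j R (z + t *\<^sub>R axis l 1)) has_real_derivative bump3 i j l R z) (at 0)"
proof -
  have b: "((\<lambda>t. bump 4 R (z + t *\<^sub>R axis i 1)) has_real_derivative - 8 * (z $ i) * bump 3 R z) (at 0)"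
    "((\<lambda>t. bump 3 R (z + t *\<^sub>R axis i 1)) has_real_derivative - 6 * (z $ i) * bump 2 R z) (at 0)"
    "((\<lambda>t. bump 2 R (z + t *\<^sub>R axis i 1)) has_real_derivative - 4 * (z $ i) * bump 1 R z) (at 0)" for i
    using bump_line_deriv[of 3 R z i] bump_line_deriv[of 2 R z i] bump_line_deriv[of 1 R z i]
    by (simp_all add: eval_nat_numeral)
  show "((\<lambda>t. bump 4 R (z + t *\<^sub>R axis i 1)) has_real_derivative bump1 i R z) (at 0)"
    using b(1) by (simp add: bump1_def)
  show "((\<lambda>t. bump1 i R (z + t *\<^sub>R axis j 1)) has_real_derivative bump2 i j R z) (at 0)"
    using DERIV_mult[OF DERIV_cmult[OF coord_line_deriv[of z j i], of "-8"] b(2)[of j]]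
    unfolding bump1_def bump2_def by (simp add: algebra_simps)
  show "((\<lambda>t. bump2 i j R (z + t *\<^sub>R axis l 1)) has_real_derivative bump3 i j l R z) (at 0)"
    using DERIV_add[OF DERIV_cmult[OF b(2)[of l], of "- 8 * of_bool (i = j)"]
        DERIV_mult[OF DERIV_mult[OF DERIV_cmult[OF coord_line_deriv[of z l i], of 48] coord_line_deriv[of z l j]] b(3)[of l]]]
    unfolding bump2_def bump3_def by (simp add: algebra_simps)
qed

lemma bumps_continuous:
  "continuous_on S (bump1 i R)" "continuous_on S (bump2 i j R)" "continuous_on S (bump3 i j l R)"
  unfolding bump1_def bump2_def bump3_def by (intro continuous_intros)+

lemma bumps_outside:
  assumes "0 \<le> R" "norm z > R"
  shows "bump1 i R z = 0" "bump2 i j R z = 0" "bump3 i j l R z = 0"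
  using assms by (simp_all add: bump1_def bump2_def bump3_def bump_outside)

text \<open>\<open>336 = 3 * 48 + 192\<close>. What matters is the order \<open>R^5\<close>, against
  the order \<open>R^11\<close> of the integral of \<open>bump 4\<close>.\<close>

lemma bump3_bound:
  assumes R: "R \<ge> 0"
  shows "\<bar>bump3 i j l R z\<bar> \<le> 336 * R ^ 5"
proof (cases "norm z > R")
  case True
  then show ?thesis using R by (simp add: bumps_outside)
next
  case False
  have c: "\<bar>z $ i\<bar> \<le> R" for i using component_products(1)[of z i] False by linarith
  have o: "\<bar>of_bool P * (z $ i)\<bar> \<le> R" for P i using c[of i] R by auto
  have 1: "\<bar>of_bool (i = j) * (z $ l) + of_bool (i = l) * (z $ j) + of_bool (j = l) * (z $ i)\<bar> \<le> 3 * R"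
    using o[of "i = j" l] o[of "i = l" j] o[of "j = l" i] by linarith
  have "\<bar>48 * (of_bool (i = j) * (z $ l) + of_bool (i = l) * (z $ j) + of_bool (j = l) * (z $ i)) * bump 2 R z\<bar>
     = 48 * (\<bar>of_bool (i = j) * (z $ l) + of_bool (i = l) * (z $ j) + of_bool (j = l) * (z $ i)\<bar> * bump 2 R z)"
    using bump_nonneg[of 2 R z] by (simp add: abs_mult)
  also have "\<dots> \<le> 48 * (3 * R * (R\<^sup>2) ^ 2)"
    by (intro mult_left_mono mult_mono 1 bump_le) (use R bump_nonneg in auto)
  finally have A: "\<bar>48 * (of_bool (i = j) * (z $ l) + of_bool (i = l) * (z $ j) + of_bool (j = l) * (z $ i)) * bump 2 R z\<bar> \<le> 144 * R ^ 5"
    by (simp add: eval_nat_numeral)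
  have "\<bar>192 * (z $ i) * (z $ j) * (z $ l) * bump 1 R z\<bar> = 192 * (\<bar>z $ i\<bar> * \<bar>z $ j\<bar> * \<bar>z $ l\<bar> * bump 1 R z)"
    using bump_nonneg[of 1 R z] by (simp add: abs_mult)
  also have "\<dots> \<le> 192 * (R * R * R * (R\<^sup>2) ^ 1)"
    by (intro mult_left_mono mult_mono c bump_le) (use R bump_nonneg in auto)
  finally have B: "\<bar>192 * (z $ i) * (z $ j) * (z $ l) * bump 1 R z\<bar> \<le> 192 * R ^ 5"
    by (simp add: eval_nat_numeral)
  show ?thesis unfolding bump3_def using A B by linarith
qed

lemma bump_integral_scale:
  assumes R: "R > 0"
  shows "(\<integral>z. bump n R z \<partial>lborel) = R ^ (2 * n + 3) * (\<integral>z. bump n 1 z \<partial>lborel)"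
proof -
  have "(\<integral>z. bump n R z \<partial>lborel) = \<bar>R\<bar> ^ DIM(real^3) *\<^sub>R (\<integral>z. bump n R (0 + R *\<^sub>R z) \<partial>lborel)"
    by (rule lborel_integral_affine) (use R in auto)
  also have "\<dots> = R ^ 3 * ((R\<^sup>2) ^ n * (\<integral>z. bump n 1 z \<partial>lborel))"
    using R by (simp add: bump_scale)
  finally show ?thesis by (simp add: power_add mult_ac flip: power_mult)
qed

lemma bump_integrable: "n \<ge> 1 \<Longrightarrow> R \<ge> 0 \<Longrightarrow> integrable lborel (bump n R)"
  by (rule continuous_compact_support(1)[OF bump_continuous, of R]) (rule bump_outside)

lemma bump_mass_pos: "0 < (\<integral>z. bump 4 1 z \<partial>lborel)"
proof -
  have "0 < (3/4) ^ 4 * measure lborel (cball (0::real^3) (1/2))"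
    by (simp add: content_cball unit_ball_vol_pos)
  also have "\<dots> = (\<integral>z. (3/4) ^ 4 * indicator (cball (0::real^3) (1/2)) z \<partial>lborel)"
    by simp
  also have "\<dots> \<le> (\<integral>z. bump 4 1 z \<partial>lborel)"
  proof (rule integral_mono)
    show "integrable lborel (\<lambda>z::real^3. (3/4) ^ 4 * indicat_real (cball 0 (1/2)) z)"
      using emeasure_lborel_cball_finite[of "0::real^3" "1/2"]
      by (intro integrable_mult_right integrable_real_indicator) auto
    show "integrable lborel (bump 4 1)" by (rule bump_integrable) auto
    fix z :: "real^3"
    show "(3/4) ^ 4 * indicator (cball 0 (1/2)) z \<le> bump 4 1 z"
    proof (cases "z \<in> cball 0 (1/2)")
      case True
      then have "(norm z)\<^sup>2 \<le> (1/2)\<^sup>2" by (intro power_mono) auto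
      then have "3/4 \<le> max 0 (1\<^sup>2 - (norm z)\<^sup>2)" by (simp add: power2_eq_square)
      then have "(3/4) ^ 4 \<le> bump 4 1 z" unfolding bump_def by (rule power_mono) simp
      then show ?thesis using True by simp
    qed (simp add: bump_nonneg)
  qed
  finally show ?thesis .
qed

lemma compact_support_product_integrable:
  fixes a k :: "real^3 \<Rightarrow> real" and x :: "real^3"
  assumes a: "continuous_on UNIV a" and k: "continuous_on UNIV k" and z: "\<And>z. norm z > R \<Longrightarrow> k z = 0"
  shows "integrable lborel (\<lambda>y. a y * k (x - y))"
proof (rule continuous_compact_support(1)[where R = "norm x + R"])
  show "continuous_on UNIV (\<lambda>y. a y * k (x - y))"
    by (intro continuous_intros a continuous_on_compose2[OF k]) auto
  fix y :: "real^3" assume "norm x + R < norm y"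
  then have "norm (x - y) > R" using norm_triangle_sub[of y x] by (simp add: norm_minus_commute)
  then show "a y * k (x - y) = 0" using z by simp
qed

text \<open>The derivative falls on the kernel, so derivatives of an average of \<open>p\<close> are
  again averages of \<open>p\<close>.\<close>

lemma conv_line_deriv:
  fixes a k k' :: "real^3 \<Rightarrow> real" and e :: "real^3"
  assumes a: "continuous_on UNIV a" and k: "continuous_on UNIV k" "continuous_on UNIV k'"
    and z: "\<And>z. norm z > R \<Longrightarrow> k z = 0" "\<And>z. norm z > R \<Longrightarrow> k' z = 0"
    and d: "\<And>z. ((\<lambda>t. k (z + t *\<^sub>R e)) has_real_derivative k' z) (at 0)"
  shows "((\<lambda>t. \<integral>y. a y * k (x + t *\<^sub>R e - y) \<partial>lborel) has_real_derivative (\<integral>y. a y * k' (x - y) \<partial>lborel)) (at 0)"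
proof -
  obtain C where C: "\<And>z. \<bar>k' z\<bar> \<le> C" using continuous_compact_support(2)[OF k(2), of R] z by auto
  have C0: "C \<ge> 0" using C[of 0] by linarith
  have dx: "((\<lambda>t. k (x + t *\<^sub>R e - y)) has_real_derivative k' (x + s *\<^sub>R e - y)) (at s)" for y s
    using DERIV_shift[of "\<lambda>t. k (x - y + t *\<^sub>R e)" _ 0 s] d[of "x - y + s *\<^sub>R e"] by (simp add: algebra_simps)
  define S where "S = cball x (R + norm e)"
  have iS: "integrable lborel (\<lambda>y. C * (indicator S y *\<^sub>R \<bar>a y\<bar>))"
    unfolding S_def
    by (intro integrable_mult_right borel_integrable_compact continuous_on_rabs continuous_on_subset[OF a]) auto
  have "((\<lambda>t. \<integral>y. a y * k (x + t *\<^sub>R e - y) \<partial>lborel) has_real_derivative (\<integral>y. a y * k' (x + 0 *\<^sub>R e - y) \<partial>lborel)) (at 0)"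
  proof (rule has_real_derivative_integral(2)[where e = 1 and f' = "\<lambda>t y. a y * k' (x + t *\<^sub>R e - y)", OF _ _ _ _ iS])
    show "integrable lborel (\<lambda>y. a y * k (x + t *\<^sub>R e - y))" for t
      by (rule compact_support_product_integrable[OF a k(1) z(1)])
    fix t :: real and y assume t: "\<bar>t - 0\<bar> < 1"
    show "((\<lambda>s. a y * k (x + s *\<^sub>R e - y)) has_real_derivative a y * k' (x + t *\<^sub>R e - y)) (at t)"
      by (intro DERIV_cmult dx)
    show "\<bar>a y * k' (x + t *\<^sub>R e - y)\<bar> \<le> C * (indicator S y *\<^sub>R \<bar>a y\<bar>)"
    proof (cases "y \<in> S")
      case True
      then show ?thesis using mult_left_mono[OF C, of "\<bar>a y\<bar>"] by (simp add: abs_mult mult.commute)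
    next
      case False
      have "norm (x - y) \<le> norm (x + t *\<^sub>R e - y) + norm (t *\<^sub>R e)"
        using norm_triangle_ineq4[of "x + t *\<^sub>R e - y" "t *\<^sub>R e"] by (simp add: algebra_simps)
      moreover have "norm (t *\<^sub>R e) \<le> norm e" using t by (simp add: mult_left_le_one_le)
      ultimately have "norm (x + t *\<^sub>R e - y) > R" using False by (simp add: S_def dist_norm)
      then show ?thesis using z False by simp
    qed
  qed simp
  then show ?thesis by simp
qed

text \<open>In the application \<open>p\<close> is \<open>u - v\<close> and \<open>\<phi>\<close> is
  \<open>e^(3u)\<close>. The control of \<open>p\<close> is one-sided and, since
  \<open>\<phi>\<close> is merely integrable, effective only on average. The functions
  \<open>g i\<close> and \<open>h i\<close> are the first and the pure second partial derivatives of
  \<open>p\<close>.\<close>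

locale constant_laplacian =
  fixes p :: "real^3 \<Rightarrow> real" and g h :: "3 \<Rightarrow> real^3 \<Rightarrow> real" and L A :: real and \<phi> :: "real^3 \<Rightarrow> real"
  assumes cp: "continuous_on UNIV p" and cg: "\<And>i. continuous_on UNIV (g i)" and ch: "\<And>i. continuous_on UNIV (h i)"
    and dp: "\<And>i x. ((\<lambda>t. p (x + t *\<^sub>R axis i 1)) has_real_derivative g i x) (at 0)"
    and dg: "\<And>i x. ((\<lambda>t. g i (x + t *\<^sub>R axis i 1)) has_real_derivative h i x) (at 0)"
    and lap: "\<And>x. (\<Sum>i\<in>UNIV. h i x) = L"
    and \<phi>: "integrable lborel \<phi>" "\<And>y. 0 \<le> \<phi> y" and A: "A \<ge> 0"
    and up: "\<And>y. p y \<le> \<phi> y + A * (1 + norm y)"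
begin

section \<open>Weighted averages and the mean value property\<close>

definition mean :: "nat \<Rightarrow> real \<Rightarrow> real^3 \<Rightarrow> real" where
  "mean n R x = (\<integral>y. p y * bump n R (x - y) \<partial>lborel)"

definition mass :: "nat \<Rightarrow> real" where
  "mass n = (\<integral>z. bump n 1 z \<partial>lborel)"

lemma mean_integrable: "n \<ge> 1 \<Longrightarrow> R \<ge> 0 \<Longrightarrow> integrable lborel (\<lambda>y. p y * bump n R (x - y))"
  by (rule compact_support_product_integrable[OF cp bump_continuous]) (rule bump_outside)

lemma reflected_deriv:
  fixes x e :: "real^3"
  assumes "\<And>z. ((\<lambda>t. k (z + t *\<^sub>R e)) has_real_derivative k' z) (at 0)"
  shows "((\<lambda>t. k (x - (y + t *\<^sub>R e))) has_real_derivative - k' (x - y)) (at 0)"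
proof -
  have "((\<lambda>t. k ((x - y) + (- t) *\<^sub>R e)) has_real_derivative k' (x - y) * - 1) (at 0)"
    by (rule DERIV_chain2[where f = "\<lambda>t. k ((x - y) + t *\<^sub>R e)"]) (use assms[of "x - y"] in \<open>auto intro!: derivative_eq_intros\<close>)
  then show ?thesis by (simp add: algebra_simps)
qed

lemma cont_reflect: "continuous_on UNIV k \<Longrightarrow> continuous_on UNIV (\<lambda>y. k (x - y))" for k :: "real^3 \<Rightarrow> real" and x :: "real^3"
  by (rule continuous_on_compose2[of UNIV k]) (auto intro!: continuous_intros)

lemma outside_reflect: "norm x + R < norm y \<Longrightarrow> norm (x - y) > R" for x y :: "real^3"
  using norm_triangle_sub[of y x] by (simp add: norm_minus_commute)

text \<open>Both derivatives are moved onto \<open>bump 5\<close>, whose second derivative is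
  \<open>80 * (z $ i)^2 * bump 3 R z - 10 * bump 4 R z\<close>. The exponent 5 is chosen so that the
  average against \<open>bump 4\<close> appears.\<close>

lemma second_ibp:
  assumes R: "R \<ge> 0"
  shows "(\<integral>y. h i y * bump 5 R (x - y) \<partial>lborel) = 80 * (\<integral>y. p y * ((x - y) $ i)\<^sup>2 * bump 3 R (x - y) \<partial>lborel) - 10 * mean 4 R x"
    and "integrable lborel (\<lambda>y. h i y * bump 5 R (x - y))"
    and "integrable lborel (\<lambda>y. p y * ((x - y) $ i)\<^sup>2 * bump 3 R (x - y))"
proof -
  define k1 where "k1 = (\<lambda>z::real^3. - 10 * (z $ i) * bump 4 R z)"
  define k2 where "k2 = (\<lambda>z::real^3. - 10 * bump 4 R z + 80 * (z $ i)\<^sup>2 * bump 3 R z)"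
  have d0: "((\<lambda>t. bump 5 R (z + t *\<^sub>R axis i 1)) has_real_derivative k1 z) (at 0)" for z
    using bump_line_deriv[of 4 R z i] by (simp add: k1_def eval_nat_numeral)
  have d1: "((\<lambda>t. k1 (z + t *\<^sub>R axis i 1)) has_real_derivative k2 z) (at 0)" for z
    using DERIV_mult[OF DERIV_cmult[OF coord_line_deriv[of z i i], of "-10"] bump_derivs(1)[of R z i]]
    unfolding k1_def k2_def by (simp add: bump1_def algebra_simps power2_eq_square)
  have c: "continuous_on UNIV (bump 5 R)" "continuous_on UNIV k1" "continuous_on UNIV k2"
    unfolding k1_def k2_def by (intro continuous_intros)+
  have z: "bump 5 R z = 0" "k1 z = 0" "k2 z = 0" if "norm z > R" for z
    using that R by (auto simp: k1_def k2_def bump_outside)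
  note I1 = line_ibp[where R = "norm x + R", OF cg[of i] ch[of i] cont_reflect[OF c(1), of x] continuous_on_minus[OF cont_reflect[OF c(2), of x]] dg[of i] reflected_deriv[OF d0]]
  have z': "norm x + R < norm y \<Longrightarrow> bump 5 R (x - y) = 0" "norm x + R < norm y \<Longrightarrow> - k1 (x - y) = 0"
    "norm x + R < norm y \<Longrightarrow> k1 (x - y) = 0" "norm x + R < norm y \<Longrightarrow> - k2 (x - y) = 0" for y
    using z[OF outside_reflect[of x R y]] by auto
  note J1 = I1[OF z'(1,2)]
  note I2 = line_ibp[where R = "norm x + R", OF cp cg[of i] cont_reflect[OF c(2), of x] continuous_on_minus[OF cont_reflect[OF c(3), of x]] dp[of _ i] reflected_deriv[OF d1]]
  note J2 = I2[OF z'(3,4)]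
  show "integrable lborel (\<lambda>y. h i y * bump 5 R (x - y))" by (rule J1(1))
  have i2: "integrable lborel (\<lambda>y. p y * (80 * ((x - y) $ i)\<^sup>2 * bump 3 R (x - y)))"
    by (rule compact_support_product_integrable[OF cp, where R = R and k = "\<lambda>z. 80 * (z $ i)\<^sup>2 * bump 3 R z"])
      (use R in \<open>auto intro!: continuous_intros simp: bump_outside\<close>)
  then show i3: "integrable lborel (\<lambda>y. p y * ((x - y) $ i)\<^sup>2 * bump 3 R (x - y))"
    using integrable_mult_right[of "1/80" lborel "\<lambda>y. p y * (80 * ((x - y) $ i)\<^sup>2 * bump 3 R (x - y))"] by (simp add: mult_ac)
  have "(\<integral>y. h i y * bump 5 R (x - y) \<partial>lborel) = (\<integral>y. g i y * k1 (x - y) \<partial>lborel)"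
    using J1(3) by simp
  also have "\<dots> = (\<integral>y. p y * k2 (x - y) \<partial>lborel)" using J2(3) by simp
  also have "\<dots> = (\<integral>y. 80 * (p y * ((x - y) $ i)\<^sup>2 * bump 3 R (x - y)) - 10 * (p y * bump 4 R (x - y)) \<partial>lborel)"
    by (intro Bochner_Integration.integral_cong refl) (simp add: k2_def algebra_simps)
  also have "\<dots> = 80 * (\<integral>y. p y * ((x - y) $ i)\<^sup>2 * bump 3 R (x - y) \<partial>lborel) - 10 * mean 4 R x"
    using i3 mean_integrable[of 4 R x] R unfolding mean_def
    by (subst Bochner_Integration.integral_diff) (auto simp del: integral_mult_right_zero simp: integral_mult_right_zero)
  finally show "(\<integral>y. h i y * bump 5 R (x - y) \<partial>lborel) = 80 * (\<integral>y. p y * ((x - y) $ i)\<^sup>2 * bump 3 R (x - y) \<partial>lborel) - 10 * mean 4 R x" .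
qed

text \<open>Together with \<open>mean_deriv\<close> this is the ordinary differential equation
  \<open>R m' = 11 m + c R\<^sup>1\<^sup>3\<close> for \<open>m(R) = mean 4 R x\<close>, which yields the mean value property. The fourth
  power of \<open>R\<^sup>2 - \<bar>z\<bar>\<^sup>2\<close> leaves three derivatives for the estimate of the third derivatives of \<open>p\<close>.\<close>
lemma mean_identity:
  assumes R: "R > 0"
  shows "80 * R\<^sup>2 * mean 3 R x - 110 * mean 4 R x = L * (R ^ 13 * mass 5)"
proof -
  have R0: "R \<ge> 0" using R by simp
  \<comment> \<open>From \<open>|z|^2 = R^2 - (R^2 - |z|^2)\<close>: summed over \<open>i\<close>,
    the quadratic factors turn \<open>bump 3\<close> into a combination of \<open>bump 3\<close> and
    \<open>bump 4\<close>.\<close>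
  have sq: "(\<Sum>i\<in>UNIV. (z $ i)\<^sup>2) * bump 3 R z = R\<^sup>2 * bump 3 R z - bump 4 R z" for z
  proof -
    have n: "(\<Sum>i\<in>UNIV. (z $ i)\<^sup>2) = (norm z)\<^sup>2"
      unfolding power2_norm_eq_inner inner_vec_def by (simp add: power2_eq_square)
    show ?thesis
      unfolding n bump_def by (cases "(norm z)\<^sup>2 \<le> R\<^sup>2") (simp_all add: eval_nat_numeral max_def algebra_simps)
  qed
  have "(\<Sum>i\<in>UNIV. \<integral>y. h i y * bump 5 R (x - y) \<partial>lborel) = (\<integral>y. (\<Sum>i\<in>UNIV. h i y * bump 5 R (x - y)) \<partial>lborel)"
    by (rule Bochner_Integration.integral_sum[symmetric]) (rule second_ibp(2)[OF R0])
  also have "\<dots> = (\<integral>y. L * bump 5 R (x - y) \<partial>lborel)"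
    by (simp only: sum_distrib_right[symmetric] lap)
  also have "\<dots> = L * (\<integral>y. bump 5 R (x - y) \<partial>lborel)" by (rule integral_mult_right_zero)
  also have "(\<integral>y. bump 5 R (x - y) \<partial>lborel) = R ^ 13 * mass 5"
    using bump_integral_scale[OF R, of 5] lborel_integral_reflect[OF bump_measurable, of 5 R x] by (simp add: mass_def)
  finally have a: "(\<Sum>i\<in>UNIV. \<integral>y. h i y * bump 5 R (x - y) \<partial>lborel) = L * (R ^ 13 * mass 5)" .
  have "(\<Sum>i\<in>UNIV. \<integral>y. p y * ((x - y) $ i)\<^sup>2 * bump 3 R (x - y) \<partial>lborel) = (\<integral>y. (\<Sum>i\<in>UNIV. p y * ((x - y) $ i)\<^sup>2 * bump 3 R (x - y)) \<partial>lborel)"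
    by (rule Bochner_Integration.integral_sum[symmetric]) (rule second_ibp(3)[OF R0])
  also have "\<dots> = (\<integral>y. R\<^sup>2 * (p y * bump 3 R (x - y)) - p y * bump 4 R (x - y) \<partial>lborel)"
  proof (intro Bochner_Integration.integral_cong refl)
    fix y
    have "(\<Sum>i\<in>UNIV. p y * ((x - y) $ i)\<^sup>2 * bump 3 R (x - y)) = p y * ((\<Sum>i\<in>UNIV. ((x - y) $ i)\<^sup>2) * bump 3 R (x - y))"
      by (simp only: sum_distrib_left sum_distrib_right mult.assoc)
    also have "\<dots> = R\<^sup>2 * (p y * bump 3 R (x - y)) - p y * bump 4 R (x - y)" unfolding sq by (simp add: algebra_simps)
    finally show "(\<Sum>i\<in>UNIV. p y * ((x - y) $ i)\<^sup>2 * bump 3 R (x - y)) = R\<^sup>2 * (p y * bump 3 R (x - y)) - p y * bump 4 R (x - y)" .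
  qed
  also have "\<dots> = R\<^sup>2 * mean 3 R x - mean 4 R x"
    unfolding mean_def using mean_integrable[of 3 R x] mean_integrable[of 4 R x] R0
    by (subst Bochner_Integration.integral_diff) auto
  finally have b: "(\<Sum>i\<in>UNIV. \<integral>y. p y * ((x - y) $ i)\<^sup>2 * bump 3 R (x - y) \<partial>lborel) = R\<^sup>2 * mean 3 R x - mean 4 R x" .
  \<comment> \<open>The three coordinates contribute \<open>3 * 10 = 30\<close>, whence
    \<open>80 + 30 = 110\<close>.\<close>
  have "(\<Sum>i\<in>UNIV. \<integral>y. h i y * bump 5 R (x - y) \<partial>lborel) = 80 * (R\<^sup>2 * mean 3 R x - mean 4 R x) - 30 * mean 4 R x"
    unfolding second_ibp(1)[OF R0] sum_subtractf by (simp only: sum_distrib_left[symmetric] b) simp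
  then show ?thesis using a by (simp add: algebra_simps)
qed

lemma mean_deriv:
  assumes R: "R > 0"
  shows "((\<lambda>R. mean 4 R x) has_real_derivative 8 * R * mean 3 R x) (at R)"
proof -
  have "integrable lborel (\<lambda>y. 16 * R * ((2 * R)\<^sup>2) ^ 3 * (indicator (cball x (2 * R)) y *\<^sub>R \<bar>p y\<bar>))"
    by (intro integrable_mult_right borel_integrable_compact continuous_on_rabs continuous_on_subset[OF cp]) auto
  then have "((\<lambda>R. \<integral>y. p y * bump 4 R (x - y) \<partial>lborel) has_real_derivative (\<integral>y. p y * (8 * R * bump 3 R (x - y)) \<partial>lborel)) (at R)"
  proof (rule has_real_derivative_integral(2)[where e = R and f' = "\<lambda>R y. p y * (8 * R * bump 3 R (x - y))", rotated 4])
    fix r assume "\<bar>r - R\<bar> < R"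
    then have r: "0 < r" "r < 2 * R" by linarith+
    show "integrable lborel (\<lambda>y. p y * bump 4 r (x - y))" using r by (intro mean_integrable) auto
    fix y
    show "((\<lambda>s. p y * bump 4 s (x - y)) has_real_derivative p y * (8 * r * bump 3 r (x - y))) (at r)"
      using DERIV_cmult[OF bump_radius_deriv[of 3 "x - y" r], of "p y"] by (simp add: eval_nat_numeral)
    show "\<bar>p y * (8 * r * bump 3 r (x - y))\<bar> \<le> 16 * R * ((2 * R)\<^sup>2) ^ 3 * (indicator (cball x (2 * R)) y *\<^sub>R \<bar>p y\<bar>)"
    proof (cases "y \<in> cball x (2 * R)")
      case True
      have "bump 3 r (x - y) \<le> (r\<^sup>2) ^ 3" by (rule bump_le)
      also have "\<dots> \<le> ((2 * R)\<^sup>2) ^ 3" using r by (intro power_mono) auto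
      finally have b3: "bump 3 r (x - y) \<le> ((2 * R)\<^sup>2) ^ 3" .
      have "8 * r * bump 3 r (x - y) \<le> 16 * R * ((2 * R)\<^sup>2) ^ 3"
        by (rule mult_mono[OF _ b3]) (use r bump_nonneg in auto)
      then have "\<bar>p y\<bar> * (8 * r * bump 3 r (x - y)) \<le> \<bar>p y\<bar> * (16 * R * ((2 * R)\<^sup>2) ^ 3)"
        by (intro mult_left_mono) auto
      then show ?thesis using True r bump_nonneg[of 3 r "x - y"] by (simp add: abs_mult mult_ac)
    next
      case False
      then have "bump 3 r (x - y) = 0" using r by (intro bump_outside) (auto simp: dist_norm)
      then show ?thesis using False by simp
    qed
  qed (use R in simp)
  moreover have "(\<integral>y. p y * (8 * R * bump 3 R (x - y)) \<partial>lborel) = 8 * R * mean 3 R x"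
    unfolding mean_def by (subst integral_mult_right_zero[symmetric]) (intro Bochner_Integration.integral_cong refl, simp)
  ultimately show ?thesis by (simp add: mean_def[abs_def])
qed

text \<open>Integration of the differential equation with the factor \<open>R^(-11)\<close>; the
  exponent \<open>11 = 2 * 4 + 3\<close> is the scaling of \<open>bump 4\<close>.\<close>

lemma mean_over_power_constant:
  assumes "0 < a" "a < b"
  shows "mean 4 a x / a ^ 11 - L * mass 5 / 20 * a\<^sup>2 = mean 4 b x / b ^ 11 - L * mass 5 / 20 * b\<^sup>2"
proof -
  let ?F = "\<lambda>R. mean 4 R x / R ^ 11 - L * mass 5 / 20 * R\<^sup>2"
  have d: "(?F has_real_derivative 0) (at R)" if R: "R > 0" for R
  proof -
    have D: "(?F has_real_derivative (8 * R * mean 3 R x * R ^ 11 - mean 4 R x * (11 * R ^ 10)) / (R ^ 11 * R ^ 11) - L * mass 5 / 20 * (2 * R)) (at R)"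
      using R by (intro DERIV_diff DERIV_divide mean_deriv DERIV_cmult) (auto intro!: derivative_eq_intros)
    have "(8 * R * mean 3 R x * R ^ 11 - mean 4 R x * (11 * R ^ 10)) / (R ^ 11 * R ^ 11) - L * mass 5 / 20 * (2 * R) = 0"
    proof -
      have "(8 * R * mean 3 R x * R ^ 11 - mean 4 R x * (11 * R ^ 10)) = R ^ 10 / 10 * (80 * R\<^sup>2 * mean 3 R x - 110 * mean 4 R x)"
        by (simp add: eval_nat_numeral algebra_simps)
      also have "\<dots> = L * mass 5 / 10 * R * (R ^ 11 * R ^ 11)"
        unfolding mean_identity[OF R] by (simp add: eval_nat_numeral)
      finally show ?thesis using R by simp
    qed
    then show ?thesis by (rule DERIV_cong[OF D])
  qed
  have "\<exists>z>a. z < b \<and> ?F b - ?F a = (b - a) * 0"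
    by (rule MVT2[OF assms(2)]) (rule d, use assms in linarith)
  then show ?thesis by auto
qed

lemma mean_limit: "((\<lambda>R. mean 4 R x / R ^ 11) \<longlongrightarrow> p x * mass 4) (at_right 0)"
proof (rule tendstoI)
  fix e :: real assume e: "e > 0"
  have m0: "mass 4 > 0" unfolding mass_def by (rule bump_mass_pos)
  define \<eta> where "\<eta> = e / (2 * mass 4)"
  have \<eta>: "\<eta> > 0" using e m0 by (simp add: \<eta>_def)
  obtain d where d: "d > 0" "\<And>y. norm (y - x) < d \<Longrightarrow> \<bar>p y - p x\<bar> < \<eta>"
    using cp \<eta> unfolding continuous_on_eq_continuous_at[OF open_UNIV] continuous_at_eps_delta dist_norm real_norm_def
    by (metis UNIV_I)
  have "\<bar>mean 4 R x / R ^ 11 - p x * mass 4\<bar> < e" if R: "0 < R" "R < d" for R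
  proof -
    have ib: "integrable lborel (\<lambda>y. bump 4 R (x - y))"
      using bump_integrable[of 4 R] R by (subst lborel_integrable_reflect) auto
    have vb: "(\<integral>y. bump 4 R (x - y) \<partial>lborel) = R ^ 11 * mass 4"
      using bump_integral_scale[of R 4] R lborel_integral_reflect[OF bump_measurable, of 4 R x] by (simp add: mass_def)
    have im: "integrable lborel (\<lambda>y. p y * bump 4 R (x - y))" using R by (intro mean_integrable) auto
    have "mean 4 R x - p x * (R ^ 11 * mass 4) = (\<integral>y. p y * bump 4 R (x - y) - p x * bump 4 R (x - y) \<partial>lborel)"
      unfolding mean_def vb[symmetric] by (subst Bochner_Integration.integral_diff[OF im integrable_mult_right[OF ib]]) simp
    also have "\<bar>\<dots>\<bar> \<le> (\<integral>y. \<bar>p y * bump 4 R (x - y) - p x * bump 4 R (x - y)\<bar> \<partial>lborel)" by (rule integral_abs_bound)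
    also have "\<dots> \<le> (\<integral>y. \<eta> * bump 4 R (x - y) \<partial>lborel)"
    proof (rule integral_mono)
      show "integrable lborel (\<lambda>y. \<bar>p y * bump 4 R (x - y) - p x * bump 4 R (x - y)\<bar>)"
        by (intro integrable_abs Bochner_Integration.integrable_diff im integrable_mult_right ib)
      show "integrable lborel (\<lambda>y. \<eta> * bump 4 R (x - y))" by (intro integrable_mult_right ib)
      fix y
      have e: "\<bar>p y * bump 4 R (x - y) - p x * bump 4 R (x - y)\<bar> = \<bar>p y - p x\<bar> * bump 4 R (x - y)"
        using bump_nonneg[of 4 R "x - y"] by (simp add: abs_mult flip: left_diff_distrib)
      show "\<bar>p y * bump 4 R (x - y) - p x * bump 4 R (x - y)\<bar> \<le> \<eta> * bump 4 R (x - y)"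
      proof (cases "norm (x - y) > R")
        case True
        then show ?thesis using R by (simp add: bump_outside)
      next
        case False
        then have "norm (y - x) < d" using R by (simp add: norm_minus_commute)
        then show ?thesis unfolding e using d(2)[of y] bump_nonneg by (intro mult_right_mono) auto
      qed
    qed
    also have "\<dots> = \<eta> * (R ^ 11 * mass 4)" by (simp only: integral_mult_right_zero vb)
    also have "\<dots> = e / 2 * R ^ 11" using m0 by (simp add: \<eta>_def)
    finally have *: "\<bar>mean 4 R x - p x * (R ^ 11 * mass 4)\<bar> \<le> e / 2 * R ^ 11" .
    have R11: "R ^ 11 > 0" using R by simp
    have "mean 4 R x / R ^ 11 - p x * mass 4 = (mean 4 R x - p x * (R ^ 11 * mass 4)) / R ^ 11"
      using R11 by (simp add: diff_divide_distrib)
    also have "\<bar>\<dots>\<bar> \<le> e / 2" using * R11 by (simp add: pos_divide_le_eq)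
    finally show ?thesis using e by simp
  qed
  then show "\<forall>\<^sub>F R in at_right 0. dist (mean 4 R x / R ^ 11) (p x * mass 4) < e"
    unfolding eventually_at_right_field dist_real_def using d(1) by blast
qed

lemma mean_value:
  assumes R: "R > 0"
  shows "mean 4 R x = R ^ 11 * (p x * mass 4 + L * mass 5 / 20 * R\<^sup>2)"
proof -
  let ?K = "mean 4 R x / R ^ 11 - L * mass 5 / 20 * R\<^sup>2"
  have "\<forall>\<^sub>F r in at_right 0. mean 4 r x / r ^ 11 = ?K + L * mass 5 / 20 * r\<^sup>2"
    unfolding eventually_at_right_field
  proof (intro exI[of _ R] conjI allI impI)
    fix r assume "0 < r" "r < R"
    from mean_over_power_constant[OF this, of x] show "mean 4 r x / r ^ 11 = ?K + L * mass 5 / 20 * r\<^sup>2" by linarith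
  qed (rule R)
  from Lim_transform_eventually[OF mean_limit this]
  have "((\<lambda>r. ?K + L * mass 5 / 20 * r\<^sup>2) \<longlongrightarrow> p x * mass 4) (at_right 0)" .
  moreover have "((\<lambda>r. ?K + L * mass 5 / 20 * r\<^sup>2) \<longlongrightarrow> ?K + L * mass 5 / 20 * 0\<^sup>2) (at_right 0)"
    by (intro tendsto_intros)
  ultimately have "p x * mass 4 = ?K + L * mass 5 / 20 * 0\<^sup>2"
    using tendsto_unique[OF trivial_limit_at_right_real] by blast
  then have "mean 4 R x / R ^ 11 = p x * mass 4 + L * mass 5 / 20 * R\<^sup>2" by simp
  then show ?thesis using R by (simp add: field_simps)
qed

text \<open>Since \<open>|p| + p\<close> is twice the positive part, the upper bound controls the
  average of \<open>|p| + p\<close>, and the average of \<open>p\<close> itself is known exactly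
  from \<open>mean_value\<close>. The order \<open>R^5\<close> is the volume \<open>R^3\<close>
  times \<open>R^2\<close>, the growth of the term with \<open>L\<close>.\<close>

lemma abs_integral_growth:
  "\<exists>C. \<forall>R\<ge>1. (\<integral>y. indicator (cball x R) y *\<^sub>R \<bar>p y\<bar> \<partial>lborel) \<le> C * R ^ 5"
proof -
  define b where "b = measure lborel (cball (0::real^3) 1)"
  define V where "V = (\<integral>y. \<phi> y \<partial>lborel)"
  have V: "V \<ge> 0" unfolding V_def by (intro integral_nonneg_AE) (auto simp: \<phi>)
  define C where "C = 2 * (V + A * (2 + norm x) * b) + \<bar>p x\<bar> * mass 4 + \<bar>L * mass 5 / 20\<bar>"
  have m0: "mass 4 > 0" unfolding mass_def by (rule bump_mass_pos)
  have meas_p[measurable]: "p \<in> borel_measurable borel" using cp by (rule borel_measurable_continuous_onI)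
  have bR: "measure lborel (cball x R) = b * R ^ 3" if "R \<ge> 0" for R
    using that by (simp add: b_def content_cball)
  have main: "(\<integral>y. \<bar>p y\<bar> * bump 4 R (x - y) \<partial>lborel) \<le> C * R ^ 13" if R: "R \<ge> 1" for R
  proof -
    have R0: "R > 0" using R by simp
    have i1: "integrable lborel (\<lambda>y. p y * bump 4 R (x - y))" using R by (intro mean_integrable) auto
    have i2: "integrable lborel (\<lambda>y. \<bar>p y\<bar> * bump 4 R (x - y))"
      using integrable_abs[OF i1] bump_nonneg[of 4 R] by (simp add: abs_mult)
    have i3: "integrable lborel (\<lambda>y. R ^ 8 * (\<phi> y + A * (1 + norm x + R) * indicator (cball x R) y))"
      using emeasure_lborel_cball_finite[of x R]
      by (intro integrable_mult_right Bochner_Integration.integrable_add \<phi> integrable_real_indicator) auto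
    have "(\<integral>y. \<bar>p y\<bar> * bump 4 R (x - y) \<partial>lborel) + mean 4 R x = (\<integral>y. \<bar>p y\<bar> * bump 4 R (x - y) + p y * bump 4 R (x - y) \<partial>lborel)"
      unfolding mean_def by (rule Bochner_Integration.integral_add[OF i2 i1, symmetric])
    also have "\<dots> \<le> (\<integral>y. 2 * (R ^ 8 * (\<phi> y + A * (1 + norm x + R) * indicator (cball x R) y)) \<partial>lborel)"
    proof (rule integral_mono[OF Bochner_Integration.integrable_add[OF i2 i1] integrable_mult_right[OF i3]])
      fix y
      have nn: "0 \<le> A * (1 + norm x + R) * indicator (cball x R) y" using A R by simp
      show "\<bar>p y\<bar> * bump 4 R (x - y) + p y * bump 4 R (x - y) \<le> 2 * (R ^ 8 * (\<phi> y + A * (1 + norm x + R) * indicator (cball x R) y))"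
      proof (cases "y \<in> cball x R \<and> p y \<ge> 0")
        case True
        have "norm y \<le> norm x + R" using True norm_triangle_sub[of y x] by (simp add: dist_norm norm_minus_commute)
        then have "A * (1 + norm y) \<le> A * (1 + norm x + R)" using A by (intro mult_left_mono) auto
        then have "p y \<le> \<phi> y + A * (1 + norm x + R) * indicator (cball x R) y" using up[of y] True by simp
        then have "p y * bump 4 R (x - y) \<le> (\<phi> y + A * (1 + norm x + R) * indicator (cball x R) y) * (R\<^sup>2) ^ 4"
          by (rule mult_mono[OF _ bump_le]) (use \<phi>(2)[of y] nn bump_nonneg in \<open>simp_all only: add_nonneg_nonneg\<close>)
        then show ?thesis using True by (simp add: mult.commute)
      next
        case False
        have "\<bar>p y\<bar> * bump 4 R (x - y) + p y * bump 4 R (x - y) \<le> 0"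
        proof (cases "y \<in> cball x R")
          case True
          then show ?thesis using False by simp
        next
          case False
          then show ?thesis using R by (simp add: bump_outside dist_norm)
        qed
        moreover have "0 \<le> 2 * (R ^ 8 * (\<phi> y + A * (1 + norm x + R) * indicator (cball x R) y))"
          using R by (intro mult_nonneg_nonneg add_nonneg_nonneg nn \<phi>(2)) auto
        ultimately show ?thesis by linarith
      qed
    qed
    also have "\<dots> = 2 * (R ^ 8 * (V + A * (1 + norm x + R) * (b * R ^ 3)))"
    proof -
      have "(\<integral>y. \<phi> y + A * (1 + norm x + R) * indicator (cball x R) y \<partial>lborel) = V + A * (1 + norm x + R) * (b * R ^ 3)"
      proof (subst Bochner_Integration.integral_add[OF \<phi>(1)])
        show "integrable lborel (\<lambda>y. A * (1 + norm x + R) * indicat_real (cball x R) y)"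
          using emeasure_lborel_cball_finite[of x R] by (intro integrable_mult_right integrable_real_indicator) auto
        show "integral\<^sup>L lborel \<phi> + (\<integral>y. A * (1 + norm x + R) * indicator (cball x R) y \<partial>lborel) = V + A * (1 + norm x + R) * (b * R ^ 3)"
          unfolding V_def integral_mult_right_zero bR[symmetric, OF R0[THEN less_imp_le]] by simp
      qed
      then show ?thesis by (simp only: integral_mult_right_zero)
    qed
    \<comment> \<open>All terms are rounded up to the order \<open>R^13\<close>, that of the
      contribution of \<open>L\<close> to \<open>mean 4 R x\<close>.\<close>
    also have "\<dots> \<le> 2 * (R ^ 8 * (V * R ^ 5 + A * ((2 + norm x) * R\<^sup>2) * (b * R ^ 3)))"
    proof (intro mult_left_mono add_mono mult_right_mono)
      show "V \<le> V * R ^ 5" using V R by (simp add: mult_le_cancel_left1 one_le_power)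
      have s: "R \<le> R\<^sup>2" "1 \<le> R\<^sup>2" using R self_le_power[of R 2] one_le_power[of R 2] by auto
      have "norm x * 1 \<le> norm x * R\<^sup>2" by (rule mult_left_mono[OF s(2)]) simp
      with s show "1 + norm x + R \<le> (2 + norm x) * R\<^sup>2" unfolding distrib_right by linarith
    qed (use A R in \<open>auto simp: b_def\<close>)
    also have "\<dots> = 2 * (V + A * (2 + norm x) * b) * R ^ 13" by (simp add: eval_nat_numeral algebra_simps)
    finally have 1: "(\<integral>y. \<bar>p y\<bar> * bump 4 R (x - y) \<partial>lborel) + mean 4 R x \<le> 2 * (V + A * (2 + norm x) * b) * R ^ 13" .
    have "- mean 4 R x = R ^ 11 * (- p x * mass 4 - L * mass 5 / 20 * R\<^sup>2)"
      unfolding mean_value[OF R0] by (simp add: algebra_simps)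
    also have "\<dots> \<le> R ^ 11 * (\<bar>p x\<bar> * mass 4 * R\<^sup>2 + \<bar>L * mass 5 / 20\<bar> * R\<^sup>2)"
    proof (intro mult_left_mono)
      have "- p x * mass 4 \<le> \<bar>p x\<bar> * mass 4" using m0 by (intro mult_right_mono) auto
      also have "\<dots> \<le> \<bar>p x\<bar> * mass 4 * R\<^sup>2"
        using mult_left_mono[OF one_le_power[OF R, of 2], of "\<bar>p x\<bar> * mass 4"] m0 by simp
      finally have a: "- p x * mass 4 \<le> \<bar>p x\<bar> * mass 4 * R\<^sup>2" .
      have "- (L * mass 5 / 20) * R\<^sup>2 \<le> \<bar>L * mass 5 / 20\<bar> * R\<^sup>2" by (intro mult_right_mono) auto
      then show "- p x * mass 4 - L * mass 5 / 20 * R\<^sup>2 \<le> \<bar>p x\<bar> * mass 4 * R\<^sup>2 + \<bar>L * mass 5 / 20\<bar> * R\<^sup>2" using a by simp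
    qed (use R in auto)
    also have "\<dots> = (\<bar>p x\<bar> * mass 4 + \<bar>L * mass 5 / 20\<bar>) * R ^ 13" by (simp add: eval_nat_numeral algebra_simps)
    finally have 2: "- mean 4 R x \<le> (\<bar>p x\<bar> * mass 4 + \<bar>L * mass 5 / 20\<bar>) * R ^ 13" .
    show ?thesis using add_mono[OF 1 2] unfolding C_def by (simp only: distrib_right)
  qed
  \<comment> \<open>On \<open>cball x R\<close> the weight \<open>bump 4 (2 * R)\<close> is at least
    \<open>R^8\<close>, so doubling the radius passes from the weighted average to the ball.\<close>
  have "(\<integral>y. indicator (cball x R) y *\<^sub>R \<bar>p y\<bar> \<partial>lborel) \<le> (2 ^ 13 * C) * R ^ 5" if R: "R \<ge> 1" for R
  proof -
    have ic: "integrable lborel (\<lambda>y. R ^ 8 * (indicator (cball x R) y *\<^sub>R \<bar>p y\<bar>))"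
      by (intro integrable_mult_right borel_integrable_compact continuous_on_rabs continuous_on_subset[OF cp]) auto
    have i1: "integrable lborel (\<lambda>y. p y * bump 4 (2 * R) (x - y))" using R by (intro mean_integrable) auto
    have i2: "integrable lborel (\<lambda>y. \<bar>p y\<bar> * bump 4 (2 * R) (x - y))"
      using integrable_abs[OF i1] bump_nonneg[of 4 "2 * R"] by (simp add: abs_mult)
    have "R ^ 8 * (\<integral>y. indicator (cball x R) y *\<^sub>R \<bar>p y\<bar> \<partial>lborel) = (\<integral>y. R ^ 8 * (indicator (cball x R) y *\<^sub>R \<bar>p y\<bar>) \<partial>lborel)"
      by (rule integral_mult_right_zero[symmetric])
    also have "\<dots> \<le> (\<integral>y. \<bar>p y\<bar> * bump 4 (2 * R) (x - y) \<partial>lborel)"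
    proof (rule integral_mono[OF ic i2])
      fix y
      show "R ^ 8 * (indicator (cball x R) y *\<^sub>R \<bar>p y\<bar>) \<le> \<bar>p y\<bar> * bump 4 (2 * R) (x - y)"
      proof (cases "y \<in> cball x R")
        case True
        then have "(norm (x - y))\<^sup>2 \<le> R\<^sup>2" by (intro power_mono) (auto simp: dist_norm)
        then have "R\<^sup>2 \<le> max 0 ((2 * R)\<^sup>2 - (norm (x - y))\<^sup>2)" by (simp add: power_mult_distrib)
        then have "(R\<^sup>2) ^ 4 \<le> bump 4 (2 * R) (x - y)" unfolding bump_def by (rule power_mono) simp
        then have "\<bar>p y\<bar> * (R\<^sup>2) ^ 4 \<le> \<bar>p y\<bar> * bump 4 (2 * R) (x - y)" by (rule mult_left_mono) simp
        then show ?thesis using True by (simp add: mult.commute)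
      qed (simp add: bump_nonneg)
    qed
    also have "\<dots> \<le> C * (2 * R) ^ 13" using R by (intro main) simp
    also have "\<dots> = R ^ 8 * ((2 ^ 13 * C) * R ^ 5)" by (simp add: power_mult_distrib eval_nat_numeral)
    finally show ?thesis using R by (simp add: mult_le_cancel_left)
  qed
  then show ?thesis by blast
qed

text \<open>Partial derivatives of \<open>p\<close>, written as averages of \<open>p\<close> at
  scale \<open>R\<close>. Their values do not depend on \<open>R\<close>, see \<open>D_eq\<close>,
  so a large \<open>R\<close> may be used to estimate them.\<close>

definition D1 :: "real \<Rightarrow> 3 \<Rightarrow> real^3 \<Rightarrow> real" where
  "D1 R i x = (\<integral>y. p y * bump1 i R (x - y) \<partial>lborel) / (R ^ 11 * mass 4)"

definition D2 :: "real \<Rightarrow> 3 \<Rightarrow> 3 \<Rightarrow> real^3 \<Rightarrow> real" where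
  "D2 R i j x = (\<integral>y. p y * bump2 i j R (x - y) \<partial>lborel) / (R ^ 11 * mass 4)"

definition D3 :: "real \<Rightarrow> 3 \<Rightarrow> 3 \<Rightarrow> 3 \<Rightarrow> real^3 \<Rightarrow> real" where
  "D3 R i j l x = (\<integral>y. p y * bump3 i j l R (x - y) \<partial>lborel) / (R ^ 11 * mass 4)"

lemma D_deriv:
  assumes R: "R > 0"
  shows "((\<lambda>t. p (x + t *\<^sub>R axis i 1)) has_real_derivative D1 R i x) (at 0)"
    "((\<lambda>t. D1 R i (x + t *\<^sub>R axis j 1)) has_real_derivative D2 R i j x) (at 0)"
    "((\<lambda>t. D2 R i j (x + t *\<^sub>R axis l 1)) has_real_derivative D3 R i j l x) (at 0)"
proof -
  have m0: "mass 4 > 0" unfolding mass_def by (rule bump_mass_pos)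
  have p_eq: "p z = mean 4 R z / (R ^ 11 * mass 4) - L * mass 5 / 20 * R\<^sup>2 / mass 4" for z
    unfolding mean_value[OF R] using R m0 by (simp add: field_simps)
  have z: "bump 4 R z = 0" "bump1 i R z = 0" "bump2 i j R z = 0" "bump3 i j l R z = 0" if "norm z > R" for z
    using R that by (auto simp: bump_outside bumps_outside)
  note d0 = conv_line_deriv[OF cp bump_continuous bumps_continuous(1) z(1,2) bump_derivs(1)]
  note d1 = conv_line_deriv[OF cp bumps_continuous(1,2) z(2,3) bump_derivs(2)]
  note d2 = conv_line_deriv[OF cp bumps_continuous(2,3) z(3,4) bump_derivs(3)]
  show "((\<lambda>t. p (x + t *\<^sub>R axis i 1)) has_real_derivative D1 R i x) (at 0)"
    using DERIV_diff[OF DERIV_cdivide[OF d0, where c = "R ^ 11 * mass 4"] DERIV_const[of "L * mass 5 / 20 * R\<^sup>2 / mass 4"]]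
    unfolding p_eq[symmetric] mean_def[symmetric] D1_def[symmetric] by (simp only: diff_0_right)
  show "((\<lambda>t. D1 R i (x + t *\<^sub>R axis j 1)) has_real_derivative D2 R i j x) (at 0)"
    unfolding D1_def D2_def by (rule DERIV_cdivide[OF d1])
  show "((\<lambda>t. D2 R i j (x + t *\<^sub>R axis l 1)) has_real_derivative D3 R i j l x) (at 0)"
    unfolding D2_def D3_def by (rule DERIV_cdivide[OF d2])
qed

lemma D_eq:
  assumes R: "R > 0"
  shows "D1 R i x = D1 1 i x" "D2 R i j x = D2 1 i j x" "D3 R i j l x = D3 1 i j l x"
proof -
  show 1: "D1 R i x = D1 1 i x" for x
    by (rule DERIV_unique[OF D_deriv(1)[OF R] D_deriv(1)]) simp
  show 2: "D2 R i j x = D2 1 i j x" for x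
    using D_deriv(2)[OF R, of i x j] D_deriv(2)[OF zero_less_one, of i x j] unfolding 1 by (rule DERIV_unique)
  show "D3 R i j l x = D3 1 i j l x"
    using D_deriv(3)[OF R, of i j x l] D_deriv(3)[OF zero_less_one, of i j x l] unfolding 2 by (rule DERIV_unique)
qed

text \<open>At scale \<open>R\<close> the kernel contributes \<open>R^5\<close>, the integral of
  \<open>|p|\<close> another \<open>R^5\<close>, and the normalisation is \<open>R^11\<close>. What
  is left is \<open>1 / R\<close>, which tends to 0.\<close>

lemma D3_zero: "D3 1 i j l x = 0"
proof -
  have m0: "mass 4 > 0" unfolding mass_def by (rule bump_mass_pos)
  obtain C where C: "\<And>R. R \<ge> 1 \<Longrightarrow> (\<integral>y. indicator (cball x R) y *\<^sub>R \<bar>p y\<bar> \<partial>lborel) \<le> C * R ^ 5"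
    using abs_integral_growth by blast
  have b: "\<bar>D3 1 i j l x\<bar> \<le> 336 * C / mass 4 * (1 / R)" if R: "R \<ge> 1" for R
  proof -
    have z: "bump3 i j l R z = 0" if "norm z > R" for z using R that by (auto simp: bumps_outside)
    have ic: "integrable lborel (\<lambda>y. 336 * R ^ 5 * (indicator (cball x R) y *\<^sub>R \<bar>p y\<bar>))"
      by (intro integrable_mult_right borel_integrable_compact continuous_on_rabs continuous_on_subset[OF cp]) auto
    have "\<bar>\<integral>y. p y * bump3 i j l R (x - y) \<partial>lborel\<bar> \<le> (\<integral>y. \<bar>p y * bump3 i j l R (x - y)\<bar> \<partial>lborel)"
      by (rule integral_abs_bound)
    also have "\<dots> \<le> (\<integral>y. 336 * R ^ 5 * (indicator (cball x R) y *\<^sub>R \<bar>p y\<bar>) \<partial>lborel)"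
    proof (rule integral_mono[OF integrable_abs ic])
      show "integrable lborel (\<lambda>y. p y * bump3 i j l R (x - y))"
        by (rule compact_support_product_integrable[OF cp bumps_continuous(3) z])
      fix y
      show "\<bar>p y * bump3 i j l R (x - y)\<bar> \<le> 336 * R ^ 5 * (indicator (cball x R) y *\<^sub>R \<bar>p y\<bar>)"
      proof (cases "y \<in> cball x R")
        case True
        have "\<bar>p y\<bar> * \<bar>bump3 i j l R (x - y)\<bar> \<le> \<bar>p y\<bar> * (336 * R ^ 5)"
          using R by (intro mult_left_mono bump3_bound) auto
        then show ?thesis using True by (simp add: abs_mult mult_ac)
      next
        case False
        then show ?thesis using z[of "x - y"] by (simp add: dist_norm)
      qed
    qed
    also have "\<dots> = 336 * R ^ 5 * (\<integral>y. indicator (cball x R) y *\<^sub>R \<bar>p y\<bar> \<partial>lborel)"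
      by (rule integral_mult_right_zero)
    also have "\<dots> \<le> 336 * R ^ 5 * (C * R ^ 5)" using R by (intro mult_left_mono C) auto
    finally have "\<bar>\<integral>y. p y * bump3 i j l R (x - y) \<partial>lborel\<bar> / (R ^ 11 * mass 4) \<le> 336 * R ^ 5 * (C * R ^ 5) / (R ^ 11 * mass 4)"
      using R m0 by (intro divide_right_mono) auto
    also have "\<bar>\<integral>y. p y * bump3 i j l R (x - y) \<partial>lborel\<bar> / (R ^ 11 * mass 4) = \<bar>D3 R i j l x\<bar>"
      unfolding D3_def abs_divide using R m0 by simp
    also have "D3 R i j l x = D3 1 i j l x" by (rule D_eq(3)) (use R in simp)
    also have "336 * R ^ 5 * (C * R ^ 5) / (R ^ 11 * mass 4) = 336 * C / mass 4 * (1 / R)"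
      using R by (simp add: eval_nat_numeral)
    finally show ?thesis .
  qed
  have "((\<lambda>R::real. 1 / R) \<longlongrightarrow> 0) at_top" by real_asymp
  from tendsto_mult_right_zero[OF this] have "((\<lambda>R. 336 * C / mass 4 * (1 / R)) \<longlongrightarrow> 0) at_top" .
  then have "\<bar>D3 1 i j l x\<bar> \<le> 0"
  proof (rule tendsto_lowerbound)
    show "\<forall>\<^sub>F R in at_top. \<bar>D3 1 i j l x\<bar> \<le> 336 * C / mass 4 * (1 / R)"
      using eventually_ge_at_top[of 1] by eventually_elim (rule b)
  qed simp
  then show ?thesis by simp
qed

text \<open>As third derivatives vanish, \<open>D2\<close> is constant and \<open>D1\<close> is
  affine, and subtracting the quadratic Taylor polynomial from \<open>p\<close> leaves a function
  with zero partial derivatives.\<close>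

lemma quadratic:
  "p x = p 0 + (\<Sum>i\<in>UNIV. D1 1 i 0 * (x $ i)) + (\<Sum>i\<in>UNIV. \<Sum>j\<in>UNIV. D2 1 i j 0 / 2 * (x $ i) * (x $ j))"
  and hess_symmetric: "D2 1 i j 0 = D2 1 j i 0"
proof -
  \<comment> \<open>Symmetry is read off from the kernel \<open>bump2\<close>, so mixed derivatives
    of \<open>p\<close> call for no separate argument.\<close>
  have sym: "D2 1 i j z = D2 1 j i z" for i j z
  proof -
    have "bump2 i j 1 w = bump2 j i 1 w" for w by (simp add: bump2_def mult_ac eq_commute)
    then show ?thesis by (simp add: D2_def)
  qed
  then show "D2 1 i j 0 = D2 1 j i 0" .
  have 2: "D2 1 i j z = D2 1 i j 0" for i j z
    by (rule line_derivs_0_imp_constant) (use D_deriv(3)[OF zero_less_one] D3_zero in metis)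
  have sumd: "((\<lambda>t. \<Sum>j\<in>UNIV. c j * ((z + t *\<^sub>R axis l 1) $ j)) has_real_derivative c l) (at 0)"
    for c :: "3 \<Rightarrow> real" and l and z :: "real^3"
  proof -
    have "((\<lambda>t. \<Sum>j\<in>UNIV. c j * ((z + t *\<^sub>R axis l 1) $ j)) has_real_derivative (\<Sum>j\<in>UNIV. c j * of_bool (j = l))) (at 0)"
      by (intro DERIV_sum DERIV_cmult coord_line_deriv)
    moreover have "(\<Sum>j\<in>UNIV. c j * of_bool (j = l)) = c l"
      by (simp add: of_bool_def if_distrib[of "\<lambda>d. _ * d"] cong: if_cong)
    ultimately show ?thesis by (simp only:)
  qed
  have 1: "D1 1 i z - (\<Sum>j\<in>UNIV. D2 1 i j 0 * (z $ j)) = D1 1 i 0" for i z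
  proof -
    have "D1 1 i z - (\<Sum>j\<in>UNIV. D2 1 i j 0 * (z $ j)) = D1 1 i 0 - (\<Sum>j\<in>UNIV. D2 1 i j 0 * ((0::real^3) $ j))"
    proof (rule line_derivs_0_imp_constant[where q = "\<lambda>z. D1 1 i z - (\<Sum>j\<in>UNIV. D2 1 i j 0 * (z $ j))"])
      fix z l
      show "((\<lambda>t. D1 1 i (z + t *\<^sub>R axis l 1) - (\<Sum>j\<in>UNIV. D2 1 i j 0 * ((z + t *\<^sub>R axis l 1) $ j))) has_real_derivative 0) (at 0)"
        by (rule DERIV_cong[OF DERIV_diff[OF D_deriv(2)[OF zero_less_one] sumd]]) (simp add: 2[of i l z])
    qed
    then show ?thesis by simp
  qed
  let ?Q = "\<lambda>z::real^3. \<Sum>i\<in>UNIV. \<Sum>j\<in>UNIV. D2 1 i j 0 / 2 * (z $ i) * (z $ j)"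
  let ?q = "\<lambda>z. p z - (\<Sum>i\<in>UNIV. D1 1 i 0 * (z $ i)) - ?Q z"
  have "?q x = ?q 0"
  proof (rule line_derivs_0_imp_constant[where q = ?q])
    fix z :: "real^3" and l :: 3
    have "((\<lambda>t. ?Q (z + t *\<^sub>R axis l 1)) has_real_derivative
       (\<Sum>i\<in>UNIV. \<Sum>j\<in>UNIV. D2 1 i j 0 / 2 * of_bool (i = l) * (z $ j) + of_bool (j = l) * (D2 1 i j 0 / 2 * (z $ i)))) (at 0)"
    proof (intro DERIV_sum)
      fix i j :: 3
      show "((\<lambda>t. D2 1 i j 0 / 2 * ((z + t *\<^sub>R axis l 1) $ i) * ((z + t *\<^sub>R axis l 1) $ j)) has_real_derivative
         D2 1 i j 0 / 2 * of_bool (i = l) * (z $ j) + of_bool (j = l) * (D2 1 i j 0 / 2 * (z $ i))) (at 0)"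
        by (rule DERIV_cong[OF DERIV_mult[OF DERIV_cmult[OF coord_line_deriv] coord_line_deriv]]) simp
    qed
    moreover have "(\<Sum>i\<in>UNIV. \<Sum>j\<in>UNIV. D2 1 i j 0 / 2 * of_bool (i = l) * (z $ j) + of_bool (j = l) * (D2 1 i j 0 / 2 * (z $ i)))
        = (\<Sum>j\<in>UNIV. D2 1 l j 0 * (z $ j))"
    proof -
      have "(\<Sum>i\<in>UNIV. \<Sum>j\<in>UNIV. D2 1 i j 0 / 2 * of_bool (i = l) * (z $ j)) = (\<Sum>i\<in>UNIV. if i = l then (\<Sum>j\<in>UNIV. D2 1 l j 0 / 2 * (z $ j)) else 0)"
        by (intro sum.cong refl) auto
      then have "(\<Sum>i\<in>UNIV. \<Sum>j\<in>UNIV. D2 1 i j 0 / 2 * of_bool (i = l) * (z $ j)) = (\<Sum>j\<in>UNIV. D2 1 l j 0 / 2 * (z $ j))"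
        by simp
      moreover have "(\<Sum>i\<in>UNIV. \<Sum>j\<in>UNIV. of_bool (j = l) * (D2 1 i j 0 / 2 * (z $ i))) = (\<Sum>j\<in>UNIV. D2 1 l j 0 / 2 * (z $ j))"
      proof (rule sum.cong[OF refl])
        fix i :: 3
        have "(\<Sum>j\<in>UNIV. of_bool (j = l) * (D2 1 i j 0 / 2 * (z $ i))) = (\<Sum>j\<in>UNIV. if j = l then D2 1 l i 0 / 2 * (z $ i) else 0)"
          by (intro sum.cong refl) (auto simp: sym[of l i])
        then show "(\<Sum>j\<in>UNIV. of_bool (j = l) * (D2 1 i j 0 / 2 * (z $ i))) = D2 1 l i 0 / 2 * (z $ i)" by simp
      qed
      ultimately show ?thesis by (simp only: sum.distrib) (simp add: mult.commute flip: sum.distrib)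
    qed
    ultimately have Q: "((\<lambda>t. ?Q (z + t *\<^sub>R axis l 1)) has_real_derivative (\<Sum>j\<in>UNIV. D2 1 l j 0 * (z $ j))) (at 0)" by simp
    show "((\<lambda>t. ?q (z + t *\<^sub>R axis l 1)) has_real_derivative 0) (at 0)"
      by (rule DERIV_cong[OF DERIV_diff[OF DERIV_diff[OF D_deriv(1)[OF zero_less_one] sumd] Q]]) (use 1[of l z] in simp)
  qed
  then show "p x = p 0 + (\<Sum>i\<in>UNIV. D1 1 i 0 * (x $ i)) + (\<Sum>i\<in>UNIV. \<Sum>j\<in>UNIV. D2 1 i j 0 / 2 * (x $ i) * (x $ j))"
    by simp
qed

end

section \<open>Quadratic polynomials bounded from above\<close>

lemma le_exp_3: "r \<le> exp (3 * r)" for r :: real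
proof (cases "r \<ge> 0")
  case True
  then show ?thesis using exp_ge_add_one_self[of "3 * r"] by linarith
next
  case False
  then show ?thesis using exp_gt_zero[of "3 * r"] by linarith
qed

text \<open>The unit balls about the points \<open>t *\<^sub>R e\<close> carry at least the mass
  \<open>b * exp (3 * (c * t - C))\<close>, and already \<open>b * (c * t - C)\<close> is unbounded.
  Uniformity in \<open>z\<close> is essential, since the ray alone has measure 0.\<close>

lemma sup_linear_exp_not_integrable:
  fixes u :: "real^3 \<Rightarrow> real" and e :: "real^3"
  assumes c: "c > 0" and lower: "\<And>t z. t \<ge> 0 \<Longrightarrow> norm z \<le> 1 \<Longrightarrow> c * t - C \<le> u (t *\<^sub>R e + z)"
  shows "\<not> integrable lborel (\<lambda>x. exp (3 * u x))"
proof
  assume int: "integrable lborel (\<lambda>x. exp (3 * u x))"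
  define V where "V = (\<integral>x. exp (3 * u x) \<partial>lborel)"
  define b where "b = measure lborel (cball (0::real^3) 1)"
  have b: "b > 0" by (simp add: b_def content_cball unit_ball_vol_pos)
  have le: "b * (c * t - C) \<le> V" if t: "t \<ge> 0" for t
  proof -
    have "b * (c * t - C) \<le> b * exp (3 * (c * t - C))"
      by (rule mult_left_mono[OF le_exp_3]) (use b in simp)
    also have "\<dots> = (\<integral>x. exp (3 * (c * t - C)) * indicator (cball (t *\<^sub>R e) 1) x \<partial>lborel)"
      by (simp add: b_def content_cball)
    also have "\<dots> \<le> V"
      unfolding V_def
    proof (rule integral_mono[OF _ int])
      show "integrable lborel (\<lambda>x. exp (3 * (c * t - C)) * indicat_real (cball (t *\<^sub>R e) 1) x)"
        using emeasure_lborel_cball_finite[of "t *\<^sub>R e" 1] by (intro integrable_mult_right integrable_real_indicator) auto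
      fix x
      show "exp (3 * (c * t - C)) * indicator (cball (t *\<^sub>R e) 1) x \<le> exp (3 * u x)"
        using lower[of t "x - t *\<^sub>R e"] t by (auto simp: indicator_def dist_norm norm_minus_commute)
    qed
    finally show ?thesis .
  qed
  define t where "t = max 0 ((V / b + C + 1) / c)"
  have "V / b + C + 1 \<le> c * t" unfolding t_def using c by (simp add: max_def field_simps)
  then have "V / b < c * t - C" by linarith
  then have "V < b * (c * t - C)" using b by (simp add: field_simps)
  then show False using le[of t] by (simp add: t_def)
qed

text \<open>Use \<open>ln (\<delta> * r) \<le> \<delta> * r - 1\<close> with \<open>\<delta>\<close>
  so small that \<open>K * norm e * \<delta>\<close> is at most \<open>c\<close>.\<close>

lemma log_le_linear:
  fixes e :: "real^3"
  assumes K: "K \<ge> 0" and c: "c > 0"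
  shows "\<exists>C. \<forall>t\<ge>0. \<forall>z. norm z \<le> 1 \<longrightarrow> K * ln (1 + norm (t *\<^sub>R e + z)) \<le> c * t + C"
proof -
  define \<delta> where "\<delta> = c / (K * norm e + 1)"
  have p: "K * norm e + 1 > 0" using K by (smt (verit) mult_nonneg_nonneg norm_ge_zero)
  have \<delta>: "\<delta> > 0" using c p by (simp add: \<delta>_def)
  show ?thesis
  proof (intro exI[of _ "K * (2 * \<delta> - ln \<delta>)"] allI impI)
    fix t z assume t: "t \<ge> (0::real)" and z: "norm (z::real^3) \<le> 1"
    have n: "norm (t *\<^sub>R e + z) \<le> t * norm e + 1" using norm_triangle_ineq[of "t *\<^sub>R e" z] t z by simp
    have pos: "1 + norm (t *\<^sub>R e + z) > 0" by (smt (verit) norm_ge_zero)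
    have "ln (\<delta> * (1 + norm (t *\<^sub>R e + z))) \<le> \<delta> * (1 + norm (t *\<^sub>R e + z)) - 1"
      using \<delta> pos by (intro ln_le_minus_one) simp
    moreover have "\<delta> * (1 + norm (t *\<^sub>R e + z)) \<le> \<delta> * (t * norm e + 2)"
      using n \<delta> by (intro mult_left_mono) auto
    moreover have "ln (\<delta> * (1 + norm (t *\<^sub>R e + z))) = ln \<delta> + ln (1 + norm (t *\<^sub>R e + z))"
      using \<delta> pos by (intro ln_mult_pos)
    ultimately have "ln (1 + norm (t *\<^sub>R e + z)) \<le> \<delta> * (t * norm e + 2) - ln \<delta>" by linarith
    then have "K * ln (1 + norm (t *\<^sub>R e + z)) \<le> K * (\<delta> * (t * norm e + 2) - ln \<delta>)"
      using K by (rule mult_left_mono)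
    also have "\<dots> = (K * norm e) * \<delta> * t + K * (2 * \<delta> - ln \<delta>)" by (simp add: algebra_simps)
    also have "(K * norm e) * \<delta> \<le> (K * norm e + 1) * \<delta>" using \<delta> by (intro mult_right_mono) auto
    also have "\<dots> = c" using p by (simp add: \<delta>_def)
    finally show "K * ln (1 + norm (t *\<^sub>R e + z)) \<le> c * t + K * (2 * \<delta> - ln \<delta>)"
      using t by (simp add: mult_right_mono)
  qed
qed

text \<open>Linear growth along a ray is impossible, the logarithm being absorbed by half the slope.
  Hence the quadratic form is nonpositive, and \<open>b\<close> has no component in the kernel of
  \<open>A\<close>, which for symmetric \<open>A\<close> is the orthogonal complement of the range.
  With \<open>b = A y0\<close> the square can be completed, and the constant left over is an upper
  bound.\<close>

lemma quadratic_bounded_above: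
  fixes u :: "real^3 \<Rightarrow> real" and A :: "real^3 \<Rightarrow> real^3" and b :: "real^3"
  assumes lin: "linear A" and self: "\<And>x y. A x \<bullet> y = x \<bullet> A y" and K: "K \<ge> 0"
    and int: "integrable lborel (\<lambda>x. exp (3 * u x))"
    and lower: "\<And>x. u x \<ge> a + b \<bullet> x + x \<bullet> A x - K * ln (1 + norm x) - C0"
  shows "bdd_above (range (\<lambda>x. a + b \<bullet> x + x \<bullet> A x))"
proof -
  let ?p = "\<lambda>x. a + b \<bullet> x + x \<bullet> A x"
  have A_add: "A (x + y) = A x + A y" "A (t *\<^sub>R x) = t *\<^sub>R A x" for x y t
    using lin by (simp_all add: linear_add linear_scale)
  have expand: "?p (x + y) = ?p x + b \<bullet> y + 2 * (y \<bullet> A x) + y \<bullet> A y" for x y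
    using self[of x y] by (simp add: A_add inner_add_left inner_add_right inner_commute)
  obtain M where M: "\<And>z. norm (A z) \<le> M * norm z" "M > 0"
    using linear_bounded_pos[OF lin] by blast
  have no_growth: False if c: "c > 0" and g: "\<And>t z. t \<ge> 0 \<Longrightarrow> norm z \<le> 1 \<Longrightarrow> c * t - C \<le> ?p (t *\<^sub>R e + z)" for c C and e :: "real^3"
  proof -
    obtain C' where C': "\<And>t z. t \<ge> 0 \<Longrightarrow> norm z \<le> 1 \<Longrightarrow> K * ln (1 + norm (t *\<^sub>R e + z)) \<le> c / 2 * t + C'"
      using log_le_linear[OF K, of "c / 2" e] c by auto
    have "\<not> integrable lborel (\<lambda>x. exp (3 * u x))"
    proof (rule sup_linear_exp_not_integrable[where c = "c / 2" and e = e and C = "C + C' + C0"])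
      fix t z assume *: "t \<ge> (0::real)" "norm (z::real^3) \<le> 1"
      show "c / 2 * t - (C + C' + C0) \<le> u (t *\<^sub>R e + z)"
        using g[OF *] C'[OF *] lower[of "t *\<^sub>R e + z"] by (simp add: field_simps)
    qed (use c in simp)
    then show False using int by contradiction
  qed
  have small: "\<bar>z \<bullet> A z\<bar> \<le> M" "\<bar>b \<bullet> z\<bar> \<le> norm b" if "norm z \<le> 1" for z
  proof -
    have "\<bar>z \<bullet> A z\<bar> \<le> norm z * norm (A z)" by (rule Cauchy_Schwarz_ineq2)
    also have "\<dots> \<le> 1 * (M * 1)" using that M order_trans[OF M(1)[of z], of "M * 1"] by (intro mult_mono) auto
    finally show "\<bar>z \<bullet> A z\<bar> \<le> M" by simp
    have "\<bar>b \<bullet> z\<bar> \<le> norm b * norm z" by (rule Cauchy_Schwarz_ineq2)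
    also have "\<dots> \<le> norm b * 1" by (rule mult_left_mono) (use that in auto)
    finally show "\<bar>b \<bullet> z\<bar> \<le> norm b" by simp
  qed
  have neg: "e \<bullet> A e \<le> 0" for e
  proof (rule ccontr)
    assume "\<not> e \<bullet> A e \<le> 0"
    then have q: "e \<bullet> A e > 0" by simp
    \<comment> \<open>\<open>m\<close> bounds the coefficients of all terms linear in
      \<open>t\<close>, with 1 to spare for the slope. For \<open>q = e \<bullet> A e\<close> the
      quadratic term satisfies \<open>t^2 * q \<ge> t * m - m^2 / q\<close>, which compensates
      them.\<close>
    define m where "m = norm b * norm e + 2 * (M * norm e) + 1"
    have m: "\<bar>b \<bullet> e\<bar> + 2 * (M * norm e) + 1 \<le> m" using Cauchy_Schwarz_ineq2[of b e] by (simp add: m_def)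
    show False
    proof (rule no_growth[of 1 "m\<^sup>2 / (e \<bullet> A e) - a + norm b + M" e])
      fix t z assume t: "t \<ge> (0::real)" and z: "norm (z::real^3) \<le> 1"
      have "\<bar>z \<bullet> A e\<bar> \<le> norm z * norm (A e)" by (rule Cauchy_Schwarz_ineq2)
      also have "\<dots> \<le> 1 * (M * norm e)" using z M(1)[of e] by (intro mult_mono) auto
      finally have ze: "\<bar>z \<bullet> A e\<bar> \<le> M * norm e" by simp
      have "?p (t *\<^sub>R e + z) = a + t * (b \<bullet> e + 2 * (z \<bullet> A e)) + t\<^sup>2 * (e \<bullet> A e) + b \<bullet> z + z \<bullet> A z"
        unfolding expand by (simp add: A_add power2_eq_square algebra_simps)
      moreover have "t * (b \<bullet> e + 2 * (z \<bullet> A e)) \<ge> t * (1 - m)"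
        using t m ze by (intro mult_left_mono) auto
      moreover have "t\<^sup>2 * (e \<bullet> A e) \<ge> t * m - m\<^sup>2 / (e \<bullet> A e)"
      proof -
        have "0 \<le> (t * (e \<bullet> A e) - m)\<^sup>2 + t * m * (e \<bullet> A e)"
          using t q m M by (intro add_nonneg_nonneg mult_nonneg_nonneg) (auto simp: m_def)
        moreover have "(t * m - m\<^sup>2 / (e \<bullet> A e)) * (e \<bullet> A e) = t * m * (e \<bullet> A e) - m\<^sup>2"
          using q by (simp add: left_diff_distrib)
        ultimately have "(t * m - m\<^sup>2 / (e \<bullet> A e)) * (e \<bullet> A e) \<le> (t\<^sup>2 * (e \<bullet> A e)) * (e \<bullet> A e)"
          by (simp add: power2_eq_square algebra_simps)
        then show ?thesis using q by (simp add: mult_le_cancel_right)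
      qed
      moreover have "t * (1 - m) = t - t * m" by (simp add: algebra_simps)
      ultimately show "1 * t - (m\<^sup>2 / (e \<bullet> A e) - a + norm b + M) \<le> ?p (t *\<^sub>R e + z)"
        using small[OF z] by linarith
    qed simp
  qed
  \<comment> \<open>\<open>w\<close> is the part of \<open>b\<close> orthogonal to the range of
    \<open>A\<close>. By symmetry \<open>A w = 0\<close>, so along \<open>w\<close> the polynomial
    is affine with slope \<open>w \<bullet> w\<close>.\<close>
  obtain y w where y: "y \<in> span (range A)" and w: "\<And>v. v \<in> span (range A) \<Longrightarrow> orthogonal w v" and b: "b = y + w"
    using orthogonal_subspace_decomp_exists[of "range A" b] by blast
  have "A w \<bullet> v = 0" for v
    using w[of "A v"] self[of w v] by (simp add: orthogonal_def span_base)
  then have Aw: "A w = 0" using inner_eq_zero_iff by blast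
  have "w = 0"
  proof (rule ccontr)
    assume "w \<noteq> 0"
    then have c: "w \<bullet> w > 0" by simp
    have yw: "b \<bullet> w = w \<bullet> w" using w[OF y] by (simp add: b inner_add_left inner_add_right orthogonal_def inner_commute)
    show False
    proof (rule no_growth[OF c, of "norm b + M - a" w])
      fix t z assume t: "t \<ge> (0::real)" and z: "norm (z::real^3) \<le> 1"
      have "?p (t *\<^sub>R w + z) = a + t * (w \<bullet> w) + b \<bullet> z + z \<bullet> A z"
        unfolding expand by (simp add: A_add Aw yw)
      then show "w \<bullet> w * t - (norm b + M - a) \<le> ?p (t *\<^sub>R w + z)"
        using small[OF z] by (simp add: mult.commute)
    qed
  qed
  moreover have "span (range A) = range A"
    by (simp add: linear_subspace_image[OF lin] subspace_UNIV)
  ultimately have "b \<in> range A" using y b by (simp only: add_0_right)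
  then obtain y0 where y0: "b = A y0" by blast
  have "?p x \<le> a - (y0 \<bullet> A y0) / 4" for x
  proof -
    have "?p x = a - (y0 \<bullet> A y0) / 4 + (x + (1/2) *\<^sub>R y0) \<bullet> A (x + (1/2) *\<^sub>R y0)"
      unfolding y0 by (simp add: A_add inner_add_left inner_add_right self[of y0 x] inner_commute[of x "A y0"]) (simp add: field_simps)
    then show ?thesis using neg[of "x + (1/2) *\<^sub>R y0"] by linarith
  qed
  then show ?thesis by (auto intro!: bdd_aboveI[of _ "a - (y0 \<bullet> A y0) / 4"])
qed

section \<open>Degrees of polynomials in multi-index form\<close>

lemma poly_degree_le_monomial:
  assumes "sum \<kappa> UNIV \<le> d"
  shows "poly_degree_le d (\<lambda>x. k * (\<Prod>i\<in>UNIV. (x $ i) ^ \<kappa> i))"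
  unfolding poly_degree_le_def
proof (intro exI[of _ "\<lambda>a. if a = \<kappa> then k else 0"] allI)
  fix x :: "real^3"
  have "(\<Sum>a | sum a UNIV \<le> d. (if a = \<kappa> then k else 0) * (\<Prod>i\<in>UNIV. (x $ i) ^ a i))
     = (\<Sum>a | sum a UNIV \<le> d. if a = \<kappa> then k * (\<Prod>i\<in>UNIV. (x $ i) ^ \<kappa> i) else 0)"
    by (intro sum.cong refl) auto
  then show "k * (\<Prod>i\<in>UNIV. (x $ i) ^ \<kappa> i) = (\<Sum>a | sum a UNIV \<le> d. (if a = \<kappa> then k else 0) * (\<Prod>i\<in>UNIV. (x $ i) ^ a i))"
    using assms finite_multi_indices[of d] by simp
qed

lemma poly_degree_le_add:
  assumes "poly_degree_le d p" "poly_degree_le d q"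
  shows "poly_degree_le d (\<lambda>x. p x + q x)"
proof -
  obtain c c' where "\<And>x. p x = (\<Sum>a | sum a UNIV \<le> d. c a * (\<Prod>i\<in>UNIV. (x $ i) ^ a i))"
    "\<And>x. q x = (\<Sum>a | sum a UNIV \<le> d. c' a * (\<Prod>i\<in>UNIV. (x $ i) ^ a i))"
    using assms unfolding poly_degree_le_def by blast
  then show ?thesis unfolding poly_degree_le_def
    by (intro exI[of _ "\<lambda>a. c a + c' a"]) (simp add: sum.distrib distrib_right)
qed

lemma poly_degree_le_const: "poly_degree_le d (\<lambda>x. k)"
  using poly_degree_le_monomial[of "\<lambda>_. 0" d k] by simp

lemma poly_degree_le_sum: "finite I \<Longrightarrow> (\<And>i. i \<in> I \<Longrightarrow> poly_degree_le d (p i)) \<Longrightarrow> poly_degree_le d (\<lambda>x. \<Sum>i\<in>I. p i x)"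
  by (induction I rule: finite_induct) (auto intro: poly_degree_le_const poly_degree_le_add)

lemma poly_degree_le_quadratic:
  "poly_degree_le 2 (\<lambda>x. a + (\<Sum>i\<in>UNIV. b i * (x $ i)) + (\<Sum>i\<in>UNIV. \<Sum>j\<in>UNIV. c i j * (x $ i) * (x $ j)))"
proof (intro poly_degree_le_add poly_degree_le_const poly_degree_le_sum finite)
  have pr: "(\<Prod>k\<in>UNIV. (x $ k) ^ of_bool (k = i)) = x $ i" for x :: "real^3" and i
  proof -
    have "(\<Prod>k\<in>UNIV. (x $ k) ^ of_bool (k = i)) = (\<Prod>k\<in>UNIV. if k = i then x $ k else 1)"
      by (intro prod.cong refl) auto
    then show ?thesis by simp
  qed
  have s: "(\<Sum>k\<in>UNIV. of_bool (k = i)) = (1::nat)" for i :: 3 by (simp add: of_bool_def)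
  fix i j :: 3
  show "poly_degree_le 2 (\<lambda>x. b i * (x $ i))"
    using poly_degree_le_monomial[of "\<lambda>k. of_bool (k = i)" 2 "b i"] by (simp add: pr s del: of_bool_eq_1_iff sum_of_bool_eq)
  show "poly_degree_le 2 (\<lambda>x. c i j * (x $ i) * (x $ j))"
    using poly_degree_le_monomial[of "\<lambda>k. of_bool (k = i) + of_bool (k = j)" 2 "c i j"]
    by (simp add: power_add prod.distrib sum.distrib pr s mult.assoc del: sum_of_bool_eq)
qed

text \<open>The left-hand side is a second difference at 0, which kills monomials of degree 0 and 1.
  On \<open>x \<bullet> A x\<close> it gives \<open>2 * (x \<bullet> A x)\<close>, and this detects
  degree 2.\<close>

lemma affine_if_poly_degree_le_1:
  assumes p: "poly_degree_le m p" and m: "m < 2"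
  shows "p (2 *\<^sub>R x) - 2 * p x + p 0 = 0"
proof -
  obtain c where c: "\<And>x. p x = (\<Sum>a | sum a UNIV \<le> m. c a * (\<Prod>i\<in>UNIV. (x $ i) ^ a i))"
    using p unfolding poly_degree_le_def by blast
  have "p (2 *\<^sub>R x) - 2 * p x + p 0 = (\<Sum>a | sum a UNIV \<le> m. c a *
     ((\<Prod>i\<in>UNIV. ((2 *\<^sub>R x) $ i) ^ a i) - 2 * (\<Prod>i\<in>UNIV. (x $ i) ^ a i) + (\<Prod>i\<in>UNIV. ((0::real^3) $ i) ^ a i)))"
    unfolding c by (simp add: sum_distrib_left sum_subtractf sum.distrib algebra_simps)
  also have "\<dots> = 0"
  proof (rule sum.neutral, rule ballI)
    fix a :: "3 \<Rightarrow> nat" assume "a \<in> {a. sum a UNIV \<le> m}"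
    then have "sum a UNIV \<le> m" by simp
    then have s: "sum a UNIV = 0 \<or> sum a UNIV = 1" using m by linarith
    have 2: "(\<Prod>i\<in>UNIV. ((2 *\<^sub>R x) $ i) ^ a i) = 2 ^ sum a UNIV * (\<Prod>i\<in>UNIV. (x $ i) ^ a i)"
      by (simp add: power_mult_distrib prod.distrib power_sum)
    show "c a * ((\<Prod>i\<in>UNIV. ((2 *\<^sub>R x) $ i) ^ a i) - 2 * (\<Prod>i\<in>UNIV. (x $ i) ^ a i) + (\<Prod>i\<in>UNIV. ((0::real^3) $ i) ^ a i)) = 0"
      using s
    proof
      assume z: "sum a UNIV = 0"
      then have "a i = 0" for i by simp
      then show ?thesis by simp
    next
      assume o: "sum a UNIV = 1"
      then obtain i where "a i \<noteq> 0" by (metis sum.neutral zero_neq_one)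
      then have "(\<Prod>i\<in>UNIV. ((0::real^3) $ i) ^ a i) = 0" by (intro prod_zero) (auto intro!: bexI[of _ i])
      then show ?thesis unfolding 2 o by simp
    qed
  qed
  finally show ?thesis .
qed

text \<open>If the quadratic form vanishes, what remains is an affine function bounded above, hence
  a constant; this is why degree 1 cannot occur. Otherwise a point with
  \<open>x0 \<bullet> A x0 \<noteq> 0\<close> excludes every lower degree.\<close>

lemma bounded_quadratic_degree:
  fixes A :: "real^3 \<Rightarrow> real^3" and b :: "real^3"
  assumes eq: "\<And>x. p x = a + b \<bullet> x + x \<bullet> A x" and lin: "linear A" and bdd: "bdd_above (range p)"
  shows "poly_of_degree 0 p \<or> poly_of_degree 2 p"
proof (cases "\<forall>x. x \<bullet> A x = 0")
  case True
  have "b = 0"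
  proof (rule ccontr)
    assume "b \<noteq> 0"
    then have bb: "b \<bullet> b > 0" by simp
    obtain B where B: "\<And>x. p x \<le> B" using bdd unfolding bdd_above_def by auto
    \<comment> \<open>At this multiple of \<open>b\<close> the affine function has the value
      \<open>B + 1\<close>.\<close>
    from B[of "((B - a + 1) / (b \<bullet> b)) *\<^sub>R b"] show False using True bb unfolding eq by simp
  qed
  then have "p = (\<lambda>x. a)" using eq True by auto
  then show ?thesis by (simp add: poly_of_degree_def poly_degree_le_const)
next
  case False
  then obtain x0 where x0: "x0 \<bullet> A x0 \<noteq> 0" by blast
  have Ax: "A x = (\<Sum>j\<in>UNIV. (x $ j) *\<^sub>R A (axis j 1))" for x
    by (subst (1) basis_expansion[of x, symmetric]) (simp add: linear_sum[OF lin] linear_scale[OF lin] scalar_mult_eq_scaleR)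
  have "p = (\<lambda>x. a + (\<Sum>i\<in>UNIV. b $ i * (x $ i)) + (\<Sum>i\<in>UNIV. \<Sum>j\<in>UNIV. A (axis j 1) $ i * (x $ i) * (x $ j)))"
  proof
    fix x
    have "x \<bullet> A x = (\<Sum>i\<in>UNIV. \<Sum>j\<in>UNIV. A (axis j 1) $ i * (x $ i) * (x $ j))"
      unfolding Ax[of x] inner_vec_def by (simp add: sum_distrib_left mult_ac)
    then show "p x = a + (\<Sum>i\<in>UNIV. b $ i * (x $ i)) + (\<Sum>i\<in>UNIV. \<Sum>j\<in>UNIV. A (axis j 1) $ i * (x $ i) * (x $ j))"
      unfolding eq by (simp add: inner_vec_def)
  qed
  then have "poly_degree_le 2 p" using poly_degree_le_quadratic by simp
  moreover have "\<not> poly_degree_le m p" if "m < 2" for m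
  proof
    assume "poly_degree_le m p"
    from affine_if_poly_degree_le_1[OF this that, of x0] show False
      using x0 linear_0[OF lin] unfolding eq by (simp add: linear_scale[OF lin])
  qed
  ultimately show ?thesis by (simp add: poly_of_degree_def)
qed

theorem solution_minus_potential:
  assumes u: "smooth u" and sol: "solution (distribution_of (\<lambda>x. 2 * exp (3 * u x))) u"
    and int: "integrable lborel (\<lambda>x. exp (3 * u x))"
  defines "p \<equiv> \<lambda>x. u x - log_potential (\<lambda>x. exp (3 * u x)) x"
  shows "bdd_above (range p)" "poly_of_degree 0 p \<or> poly_of_degree 2 p"
proof -
  let ?f = "\<lambda>x. exp (3 * u x)"
  have cu: "continuous_on UNIV u" by (rule smooth_continuous[OF u])
  interpret density ?f
    by unfold_locales (use int in \<open>auto intro!: continuous_intros cu\<close>)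
  define g where "g = (\<lambda>i x. partial_deriv i u x - (- (1 / pi\<^sup>2) * grad_potential i x))"
  define h where "h = (\<lambda>i x. partial_deriv i (partial_deriv i u) x - (- (1 / pi\<^sup>2) * hess_potential i i x))"
  obtain c where c: "\<And>x. - laplacian u x = c + 1 / pi\<^sup>2 * (\<integral>y. ?f y / (norm (x - y))\<^sup>2 \<partial>lborel)"
    using solution_laplacian[OF u sol int _ cf] by auto
  define K where "K = 1 / pi\<^sup>2 * (\<integral>y. ?f y \<partial>lborel)"
  define C0 where "C0 = 1 / pi\<^sup>2 * (\<integral>y. ?f y / (norm (0 - y))\<^sup>2 \<partial>lborel)"
  have K: "K \<ge> 0" unfolding K_def by (intro mult_nonneg_nonneg integral_nonneg_AE) auto
  have C0: "C0 \<ge> 0" unfolding C0_def by (intro mult_nonneg_nonneg integral_nonneg_AE) auto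
  have low: "log_potential ?f x \<ge> - K * ln (1 + norm x) - C0" for x
    using log_potential_lower[of x] by (simp add: K_def C0_def algebra_simps)
  \<comment> \<open>The bound from above combines \<open>u \<le> e^(3u)\<close> with the lower bound
    of the potential, whose logarithm is replaced by the norm. The Laplacians of \<open>u\<close>
    and of the potential differ by the constant \<open>- c\<close>.\<close>
  interpret constant_laplacian p g h "- c" "K + C0" ?f
  proof
    show "continuous_on UNIV p" unfolding p_def by (intro continuous_intros cu log_potential_continuous)
    show "continuous_on UNIV (g i)" "continuous_on UNIV (h i)" for i
      unfolding g_def h_def
      by (intro continuous_intros smooth_continuous smooth_partial u grad_potential_continuous hess_potential_continuous)+
    show "((\<lambda>t. p (x + t *\<^sub>R axis i 1)) has_real_derivative g i x) (at 0)" for i x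
      unfolding p_def g_def
      by (intro DERIV_diff differentiable_has_partial smooth_differentiable u log_potential_deriv)
    show "((\<lambda>t. g i (x + t *\<^sub>R axis i 1)) has_real_derivative h i x) (at 0)" for i x
      unfolding g_def h_def
      by (intro DERIV_diff DERIV_cmult differentiable_has_partial smooth_differentiable smooth_partial u grad_potential_deriv)
    show "(\<Sum>i\<in>UNIV. h i x) = - c" for x
    proof -
      have "(\<Sum>i\<in>UNIV. h i x) = laplacian u x - laplacian (log_potential ?f) x"
        unfolding h_def laplacian_def by (simp add: sum_subtractf sum.distrib partial2_log_potential sum_negf)
      also have "\<dots> = - c" using c[of x] unfolding laplacian_log_potential by simp
      finally show ?thesis .
    qed
    show "integrable lborel ?f" by (rule int)
    show "0 \<le> ?f y" for y by simp
    show "0 \<le> K + C0" using K C0 by simp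
    show "p y \<le> ?f y + (K + C0) * (1 + norm y)" for y
    proof -
      have "u y \<le> ?f y" by (rule le_exp_3)
      moreover have "K * ln (1 + norm y) \<le> K * norm y"
        by (rule mult_left_mono[OF ln_add_one_self_le_self K]) simp
      moreover have "0 \<le> C0 * norm y" using C0 by simp
      ultimately show ?thesis using low[of y] K unfolding p_def by (simp add: algebra_simps)
    qed
  qed
  define b where "b = (\<chi> i. D1 1 i 0)"
  define A where "A = (\<lambda>x::real^3. \<chi> i. \<Sum>j\<in>UNIV. D2 1 i j 0 / 2 * (x $ j))"
  have lin: "linear A"
    unfolding A_def by (rule linearI) (simp_all add: vec_eq_iff distrib_left add_divide_distrib sum.distrib sum_distrib_left mult_ac)
  have self: "A x \<bullet> y = x \<bullet> A y" for x y
  proof -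
    have "A x \<bullet> y = (\<Sum>i\<in>UNIV. \<Sum>j\<in>UNIV. D2 1 i j 0 / 2 * (x $ j) * (y $ i))"
      by (simp add: A_def inner_vec_def sum_distrib_right)
    also have "\<dots> = (\<Sum>j\<in>UNIV. \<Sum>i\<in>UNIV. D2 1 i j 0 / 2 * (x $ j) * (y $ i))" by (rule sum.swap)
    also have "\<dots> = x \<bullet> A y"
      unfolding A_def inner_vec_def by (simp add: sum_distrib_left mult_ac) (simp add: hess_symmetric[of _ "_"] mult_ac)
    finally show ?thesis .
  qed
  have eq: "p x = p 0 + b \<bullet> x + x \<bullet> A x" for x
    unfolding A_def b_def inner_vec_def using quadratic[of x] by (simp add: sum_distrib_left mult_ac)
  have "bdd_above (range (\<lambda>x. p 0 + b \<bullet> x + x \<bullet> A x))"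
  proof (rule quadratic_bounded_above[OF lin self K int])
    fix x
    show "p 0 + b \<bullet> x + x \<bullet> A x - K * ln (1 + norm x) - C0 \<le> u x"
      using eq[of x] low[of x] by (simp add: p_def)
  qed
  then show bdd: "bdd_above (range p)" unfolding eq[symmetric] .
  show "poly_of_degree 0 p \<or> poly_of_degree 2 p"
    by (rule bounded_quadratic_degree[OF eq lin bdd])
qed

section \<open>Asymptotics of the logarithmic potential\<close>

definition neg_log :: "real^3 \<Rightarrow> real" where
  "neg_log z = max 0 (- ln (norm z))"

text \<open>The threshold \<open>\<delta>\<close> trades the singularity against a constant: the
  first term has an integral of order \<open>\<delta>\<close>, the second costs only
  \<open>ln (1 / \<delta>)\<close>. A large density near the pole can thus be paid for by a small
  \<open>\<delta>\<close> at logarithmic cost.\<close>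

lemma neg_log_le:
  assumes z: "z \<noteq> 0" and \<delta>: "0 < \<delta>" "\<delta> \<le> 1"
  shows "neg_log z \<le> indicator (cball 0 \<delta>) z / (norm z)\<^sup>2 + ln (1 / \<delta>) * indicator (ball 0 1) z"
proof -
  have n: "norm z > 0" using z by simp
  have l: "ln (1 / \<delta>) \<ge> 0" using \<delta> by (simp add: ln_div)
  consider "norm z \<ge> 1" | "norm z < 1" "norm z \<le> \<delta>" | "norm z < 1" "norm z > \<delta>" by linarith
  then show ?thesis
  proof cases
    case 1
    then have "neg_log z = 0" by (simp add: neg_log_def)
    then show ?thesis using l by simp
  next
    case 2
    have "- ln (norm z) = ln (1 / norm z)" using n by (simp add: ln_div)
    also have "\<dots> \<le> 1 / norm z - 1" using n by (intro ln_le_minus_one) simp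
    also have "\<dots> \<le> 1 / (norm z)\<^sup>2"
    proof -
      have "(norm z)\<^sup>2 \<le> norm z * 1" unfolding power2_eq_square using 2 n by (intro mult_left_mono) auto
      then have "1 / norm z \<le> 1 / (norm z)\<^sup>2" using n by (intro divide_left_mono) auto
      then show ?thesis by linarith
    qed
    finally have "neg_log z \<le> 1 / (norm z)\<^sup>2" by (simp add: neg_log_def)
    then show ?thesis using 2 l by simp
  next
    case 3
    have "ln \<delta> \<le> ln (norm z)" using 3 \<delta> n by (intro ln_mono) auto
    then have "neg_log z \<le> ln (1 / \<delta>)" using \<delta> l by (simp add: neg_log_def ln_div)
    then show ?thesis using 3 by simp
  qed
qed

context density
begin

definition total where "total = (\<integral>y. f y \<partial>lborel)"

definition tail where "tail R = (\<integral>y. indicator {y. norm y > R} y * f y \<partial>lborel)"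

definition local_log where "local_log x = (\<integral>y. neg_log (x - y) * f y \<partial>lborel)"

lemma total_nonneg: "total \<ge> 0"
  unfolding total_def using nn by (intro integral_nonneg_AE) auto

lemma tail_integrable: "integrable lborel (\<lambda>y. indicator {y. norm y > R} y * f y)"
  using f by (rule Bochner_Integration.integrable_bound) (auto simp: indicator_def)

lemma tail_limit: "(tail \<longlongrightarrow> 0) at_top"
proof -
  have "((\<lambda>R. \<integral>y. indicator {y. norm y > R} y * f y \<partial>lborel) \<longlongrightarrow> integral\<^sup>L lborel (\<lambda>y::real^3. 0)) at_top"
  proof (rule integral_dominated_convergence_at_top[where w = f])
    show "AE y in lborel. ((\<lambda>R. indicator {y. norm y > R} y * f y) \<longlongrightarrow> 0) at_top"
    proof (rule AE_I2)
      fix y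
      have "\<forall>\<^sub>F R in at_top. indicator {y. norm y > R} y * f y = 0"
        using eventually_ge_at_top[of "norm y"] by eventually_elim (simp add: indicator_def)
      then show "((\<lambda>R. indicator {y. norm y > R} y * f y) \<longlongrightarrow> 0) at_top" by (rule tendsto_eventually)
    qed
    show "\<forall>\<^sub>F R in at_top. AE y in lborel. norm (indicator {y. norm y > R} y * f y) \<le> f y"
      using nn by (intro always_eventually allI AE_I2) (auto simp: indicator_def)
  qed (use f in \<open>auto\<close>)
  then show ?thesis by (simp add: tail_def[abs_def])
qed

lemma tail_small: "\<epsilon> > 0 \<Longrightarrow> \<exists>R\<ge>1. tail R \<le> \<epsilon>"
proof -
  assume "\<epsilon> > 0"
  then have "\<forall>\<^sub>F R in at_top. tail R < \<epsilon>" using order_tendstoD(2)[OF tail_limit] by blast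
  then have "\<forall>\<^sub>F R in at_top. R \<ge> 1 \<and> tail R < \<epsilon>" using eventually_ge_at_top[of 1] by eventually_elim auto
  then show ?thesis unfolding eventually_at_top_linorder by (meson less_imp_le order_refl)
qed

lemma neg_log_measurable [measurable]: "neg_log \<in> borel_measurable borel"
  unfolding neg_log_def[abs_def] by measurable

lemma local_log_integrable: "integrable lborel (\<lambda>y. neg_log (x - y) * f y)"
proof (rule pairing_integrable[where C = 0 and D = 1])
  fix z :: "real^3" assume "z \<noteq> 0"
  from neg_log_le[OF this, of 1] have "neg_log z \<le> indicator (cball 0 1) z / (norm z)\<^sup>2" by simp
  also have "\<dots> \<le> 1 / (norm z)\<^sup>2" by (intro divide_right_mono) (auto simp: indicator_def)
  finally show "\<bar>neg_log z\<bar> \<le> 0 + 1 / (norm z)\<^sup>2" by (simp add: neg_log_def)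
qed measurable

text \<open>Points with \<open>|y| \<le> R\<close> have \<open>|x - y| \<ge> |x| / 2\<close>, which
  gives the main term \<open>- total * ln |x|\<close>. For the remaining mass \<open>tail R\<close>
  the kernel is only at most \<open>ln (2 * |x|)\<close> plus the local singularity, a loss of
  \<open>2 * ln |x|\<close> against the main term.\<close>

lemma potential_far_bound:
  assumes R: "R \<ge> 1" and x: "norm x \<ge> 2 * R"
  shows "pi\<^sup>2 * log_potential f x \<le> total * ln (2 * R) - total * ln (norm x) + 2 * tail R * ln (norm x) + local_log x"
proof -
  have lx: "ln (norm x) \<ge> 0" using R x by simp
  let ?k = "\<lambda>y. (ln (norm (x - y)) - ln (norm y)) * f y"
  let ?g = "\<lambda>y. (ln (2 * R) - ln (norm x)) * f y + 2 * ln (norm x) * (indicator {y. norm y > R} y * f y) + neg_log (x - y) * f y"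
  have "pi\<^sup>2 * log_potential f x = - (\<integral>y. ?k y \<partial>lborel)" unfolding log_potential_eq by simp
  also have "\<dots> = (\<integral>y. - ?k y \<partial>lborel)" by simp
  also have "\<dots> \<le> (\<integral>y. ?g y \<partial>lborel)"
  proof (rule integral_mono_AE)
    show "integrable lborel (\<lambda>y. - ?k y)" by (intro integrable_minus log_integrable)
    show "integrable lborel ?g"
      by (intro Bochner_Integration.integrable_add integrable_mult_right f tail_integrable local_log_integrable)
    show "AE y in lborel. - ?k y \<le> ?g y"
      using AE_ne[of x]
    proof eventually_elim
      case (elim y)
      have ny: "norm y > 0" and nxy: "norm (x - y) > 0" using elim by auto
      have tri: "norm y \<le> norm x + norm (x - y)" "norm x \<le> norm (x - y) + norm y"
        using norm_triangle_sub[of y x] norm_triangle_sub[of x y] by (auto simp: norm_minus_commute)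
      have nl: "neg_log (x - y) \<ge> 0" "neg_log (x - y) \<ge> - ln (norm (x - y))" by (auto simp: neg_log_def)
      have "ln (norm y) - ln (norm (x - y)) \<le> ln (2 * R) - ln (norm x) + 2 * ln (norm x) * indicator {y. norm y > R} y + neg_log (x - y)"
      proof (cases "norm y > R")
        case False
        then have h: "norm x / 2 \<le> norm (x - y)" using tri x by linarith
        have "ln (norm x / 2) \<le> ln (norm (x - y))" using h R x by (intro ln_mono) auto
        moreover have "ln (norm y) \<le> ln R" using False ny by (intro ln_mono) auto
        moreover have "ln (norm x / 2) = ln (norm x) - ln 2" using R x by (intro ln_divide_pos) auto
        moreover have "ln (2 * R) = ln 2 + ln R" using R by (intro ln_mult_pos) auto
        ultimately show ?thesis using False nl by simp
      next
        case True
        have l2: "ln (2 * norm x) = ln 2 + ln (norm x)" using R x by (intro ln_mult_pos) auto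
        have lR: "ln 2 \<le> ln (2 * R)" using R by (intro ln_mono) auto
        have "ln (norm y) - ln (norm (x - y)) \<le> ln (2 * norm x) + neg_log (x - y)"
        proof (cases "norm (x - y) \<ge> 1")
          case far: True
          have "0 \<le> (norm x - 1) * (norm (x - y) - 1)" using far R x by (intro mult_nonneg_nonneg) auto
          moreover have "norm x * 1 \<le> norm x * norm (x - y)" by (rule mult_left_mono[OF far]) simp
          moreover have "1 * norm (x - y) \<le> norm x * norm (x - y)" using R x by (intro mult_right_mono) auto
          ultimately have "norm y \<le> 2 * norm x * norm (x - y)" using tri(1) by (simp add: algebra_simps)
          then have "ln (norm y) \<le> ln (2 * norm x * norm (x - y))" using ny by (intro ln_mono) auto
          also have "\<dots> = ln (2 * norm x) + ln (norm (x - y))" using nxy R x by (intro ln_mult_pos) auto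
          finally show ?thesis using nl by linarith
        next
          case False
          then have "norm y \<le> 2 * norm x" using tri R x by linarith
          then have "ln (norm y) \<le> ln (2 * norm x)" using ny by (intro ln_mono) auto
          then show ?thesis using nl by linarith
        qed
        then show ?thesis using True l2 lR by simp
      qed
      from mult_right_mono[OF this nn[of y]] show ?case by (simp add: algebra_simps)
    qed
  qed
  also have "\<dots> = (ln (2 * R) - ln (norm x)) * total + 2 * ln (norm x) * tail R + local_log x"
    unfolding total_def tail_def local_log_def
    by (simp only: Bochner_Integration.integral_add integral_mult_right_zero Bochner_Integration.integrable_add integrable_mult_right f tail_integrable local_log_integrable)
  finally show ?thesis by (simp add: algebra_simps)
qed

text \<open>Because \<open>norm x \<ge> R + 1\<close>, the unit ball about \<open>x\<close> sees
  only mass outside radius \<open>R\<close>. The bound \<open>S\<close> on \<open>f\<close> is asked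
  only on the ball of radius \<open>\<delta>\<close>, which is what the maximum argument can
  provide.\<close>

lemma local_log_bound:
  fixes C :: real
  assumes C: "\<And>(x::real^3) R. R > 0 \<Longrightarrow> integrable lborel (\<lambda>y. indicator (cball x R) y / (norm (x - y))\<^sup>2) \<and>
     (\<integral>y. indicator (cball x R) y / (norm (x - y))\<^sup>2 \<partial>lborel) \<le> C * R"
    and \<delta>: "0 < \<delta>" "\<delta> \<le> 1" and S: "S \<ge> 0" "\<And>y. y \<in> cball x \<delta> \<Longrightarrow> f y \<le> S" and x: "norm x \<ge> R + 1"
  shows "local_log x \<le> S * (C * \<delta>) + ln (1 / \<delta>) * tail R"
proof -
  let ?g = "\<lambda>y. S * (indicator (cball x \<delta>) y / (norm (x - y))\<^sup>2) + ln (1 / \<delta>) * (indicator {y. norm y > R} y * f y)"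
  have l: "ln (1 / \<delta>) \<ge> 0" using \<delta> by (simp add: ln_div)
  have "local_log x \<le> (\<integral>y. ?g y \<partial>lborel)"
    unfolding local_log_def
  proof (rule integral_mono_AE[OF local_log_integrable])
    show "integrable lborel ?g"
      using C[OF \<delta>(1), of x] by (intro Bochner_Integration.integrable_add integrable_mult_right tail_integrable) auto
    show "AE y in lborel. neg_log (x - y) * f y \<le> ?g y"
      using AE_ne[of x]
    proof eventually_elim
      case (elim y)
      then have z: "x - y \<noteq> 0" by simp
      have i: "indicator (cball 0 \<delta>) (x - y) = (indicator (cball x \<delta>) y :: real)" by (simp add: indicator_def dist_norm norm_minus_commute)
      have "indicator (ball 0 1) (x - y) \<le> (indicator {y. norm y > R} y :: real)"
        using x norm_triangle_sub[of x y] by (auto simp: indicator_def)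
      then have "neg_log (x - y) \<le> indicator (cball x \<delta>) y / (norm (x - y))\<^sup>2 + ln (1 / \<delta>) * indicator {y. norm y > R} y"
        using neg_log_le[OF z \<delta>] mult_left_mono[OF _ l, of "indicator (ball 0 1) (x - y)" "indicator {y. norm y > R} y"]
        unfolding i by linarith
      from mult_right_mono[OF this nn[of y]]
      have "neg_log (x - y) * f y \<le> f y * (indicator (cball x \<delta>) y / (norm (x - y))\<^sup>2) + ln (1 / \<delta>) * (indicator {y. norm y > R} y * f y)"
        by (simp add: algebra_simps)
      also have "f y * (indicator (cball x \<delta>) y / (norm (x - y))\<^sup>2) \<le> S * (indicator (cball x \<delta>) y / (norm (x - y))\<^sup>2)"
        using S(2)[of y] by (cases "y \<in> cball x \<delta>") (auto intro: divide_right_mono)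
      finally show ?case by simp
    qed
  qed
  also have "\<dots> = S * (\<integral>y. indicator (cball x \<delta>) y / (norm (x - y))\<^sup>2 \<partial>lborel) + ln (1 / \<delta>) * tail R"
    unfolding tail_def using C[OF \<delta>(1), of x]
    by (simp only: Bochner_Integration.integral_add integral_mult_right_zero integrable_mult_right tail_integrable)
  also have "\<dots> \<le> S * (C * \<delta>) + ln (1 / \<delta>) * tail R"
    using C[OF \<delta>(1), of x] S(1) by (intro add_right_mono mult_left_mono) auto
  finally show ?thesis .
qed

text \<open>Split at distance \<open>\<rho>\<close> from \<open>x\<close>: far points are controlled
  by the decay of the kernel and the total mass, near points by the smallness of \<open>f\<close>,
  since they are far from the origin.\<close>

lemma kernel_potential_limit:
  assumes [measurable]: "k \<in> borel_measurable borel"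
    and k: "\<And>z. z \<noteq> 0 \<Longrightarrow> \<bar>k z\<bar> \<le> 3 / norm z \<or> \<bar>k z\<bar> \<le> 3 / (norm z)\<^sup>2"
    and int: "\<And>x. integrable lborel (\<lambda>y. k (x - y) * f y)"
    and lim: "(f \<longlongrightarrow> 0) at_infinity"
  shows "((\<lambda>x. \<integral>y. k (x - y) * f y \<partial>lborel) \<longlongrightarrow> 0) at_infinity"
proof (rule tendstoI)
  fix e :: real assume e: "e > 0"
  obtain C where C: "C > 0" "\<And>(x::real^3) R. R > 0 \<Longrightarrow> integrable lborel (\<lambda>y. indicator (cball x R) y / (norm (x - y))\<^sup>2) \<and>
     (\<integral>y. indicator (cball x R) y / (norm (x - y))\<^sup>2 \<partial>lborel) \<le> C * R"
    using inverse_square_local_integral by blast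
  \<comment> \<open>\<open>\<rho>\<close> makes the far part at most \<open>e / 2\<close>, and then
    \<open>\<eta>\<close> makes the near part at most \<open>3 / 8 * e\<close>.\<close>
  define \<rho> where "\<rho> = 1 + 6 * total / e"
  have \<rho>: "\<rho> \<ge> 1" using e total_nonneg by (simp add: \<rho>_def)
  define \<eta> where "\<eta> = e / (8 * \<rho> * (C * \<rho>))"
  have \<eta>: "\<eta> > 0" using e \<rho> C by (simp add: \<eta>_def)
  have "\<forall>\<^sub>F y in at_infinity. f y < \<eta>" using order_tendstoD(2)[OF lim \<eta>] .
  then obtain B where B: "\<And>y. norm y \<ge> B \<Longrightarrow> f y < \<eta>" unfolding eventually_at_infinity by blast
  have kb: "\<bar>k z\<bar> \<le> 3 * \<rho> * (indicator (cball 0 \<rho>) z / (norm z)\<^sup>2) + 3 / \<rho>" if z: "z \<noteq> 0" for z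
  proof (cases "norm z \<le> \<rho>")
    case True
    have "3 / norm z \<le> 3 * \<rho> / (norm z)\<^sup>2"
      using z True by (simp add: power2_eq_square field_simps)
    moreover have "3 / (norm z)\<^sup>2 \<le> 3 * \<rho> / (norm z)\<^sup>2" using \<rho> by (intro divide_right_mono) auto
    ultimately have "\<bar>k z\<bar> \<le> 3 * \<rho> / (norm z)\<^sup>2" using k[OF z] by linarith
    moreover have "3 / \<rho> \<ge> 0" using \<rho> by simp
    ultimately have "\<bar>k z\<bar> \<le> 3 * \<rho> / (norm z)\<^sup>2 + 3 / \<rho>" by linarith
    then show ?thesis using True by simp
  next
    case False
    have "3 / norm z \<le> 3 / \<rho>" using False \<rho> z by (intro divide_left_mono) auto
    moreover have "3 / (norm z)\<^sup>2 \<le> 3 / \<rho>"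
    proof (rule divide_left_mono)
      have "\<rho> * 1 \<le> norm z * norm z" using False \<rho> by (intro mult_mono) auto
      then show "\<rho> \<le> (norm z)\<^sup>2" by (simp add: power2_eq_square)
    qed (use \<rho> z in auto)
    ultimately show ?thesis using k[OF z] False by auto
  qed
  have main: "\<bar>\<integral>y. k (x - y) * f y \<partial>lborel\<bar> < e" if x: "norm x \<ge> \<bar>B\<bar> + \<rho>" for x
  proof -
    let ?g = "\<lambda>y. 3 * \<rho> * \<eta> * (indicator (cball x \<rho>) y / (norm (x - y))\<^sup>2) + 3 / \<rho> * f y"
    have Cx: "integrable lborel (\<lambda>y. indicator (cball x \<rho>) y / (norm (x - y))\<^sup>2)"
      "(\<integral>y. indicator (cball x \<rho>) y / (norm (x - y))\<^sup>2 \<partial>lborel) \<le> C * \<rho>"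
      using C(2)[of \<rho> x] \<rho> by auto
    have "\<bar>\<integral>y. k (x - y) * f y \<partial>lborel\<bar> \<le> (\<integral>y. \<bar>k (x - y) * f y\<bar> \<partial>lborel)" by (rule integral_abs_bound)
    also have "\<dots> \<le> (\<integral>y. ?g y \<partial>lborel)"
    proof (rule integral_mono_AE[OF integrable_abs[OF int]])
      show "integrable lborel ?g" by (intro Bochner_Integration.integrable_add integrable_mult_right Cx f)
      show "AE y in lborel. \<bar>k (x - y) * f y\<bar> \<le> ?g y"
        using AE_ne[of x]
      proof eventually_elim
        case (elim y)
        then have z: "x - y \<noteq> 0" by simp
        have i: "indicator (cball 0 \<rho>) (x - y) = (indicator (cball x \<rho>) y :: real)" by (simp add: indicator_def dist_norm norm_minus_commute)
        have fy: "f y * indicator (cball x \<rho>) y \<le> \<eta> * indicator (cball x \<rho>) y"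
        proof (cases "y \<in> cball x \<rho>")
          case True
          then have "norm y \<ge> B" using x norm_triangle_sub[of x y] by (simp add: dist_norm)
          then show ?thesis using B[of y] True by simp
        qed simp
        have "\<bar>k (x - y) * f y\<bar> = \<bar>k (x - y)\<bar> * f y" using nn[of y] by (simp add: abs_mult)
        also have "\<dots> \<le> (3 * \<rho> * (indicator (cball x \<rho>) y / (norm (x - y))\<^sup>2) + 3 / \<rho>) * f y"
          using kb[OF z] nn[of y] unfolding i by (rule mult_right_mono)
        also have "\<dots> = 3 * \<rho> * ((f y * indicator (cball x \<rho>) y) / (norm (x - y))\<^sup>2) + 3 / \<rho> * f y"
          by (simp add: distrib_right)
        also have "\<dots> \<le> 3 * \<rho> * ((\<eta> * indicator (cball x \<rho>) y) / (norm (x - y))\<^sup>2) + 3 / \<rho> * f y"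
          using \<rho> fy by (intro add_right_mono mult_left_mono divide_right_mono) auto
        finally show ?case by simp
      qed
    qed
    also have "\<dots> = 3 * \<rho> * \<eta> * (\<integral>y. indicator (cball x \<rho>) y / (norm (x - y))\<^sup>2 \<partial>lborel) + 3 / \<rho> * total"
      unfolding total_def by (simp only: Bochner_Integration.integral_add integral_mult_right_zero integrable_mult_right Cx f)
    also have "\<dots> \<le> 3 * \<rho> * \<eta> * (C * \<rho>) + 3 / \<rho> * total"
      using Cx(2) \<rho> \<eta> by (intro add_right_mono mult_left_mono) auto
    also have "3 * \<rho> * \<eta> * (C * \<rho>) = 3 / 8 * e"
      using \<rho> C by (simp add: \<eta>_def)
    also have "3 / \<rho> * total \<le> e / 2"
      using e \<rho> total_nonneg by (simp add: \<rho>_def field_simps)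
    finally show ?thesis using e by linarith
  qed
  then show "\<forall>\<^sub>F x in at_infinity. dist (\<integral>y. k (x - y) * f y \<partial>lborel) 0 < e"
    unfolding eventually_at_infinity by (auto intro!: exI[of _ "\<bar>B\<bar> + \<rho>"])
qed

end

text \<open>In the application \<open>f\<close> is \<open>e^(3u)\<close> with
  \<open>u = v + p\<close>, and \<open>P\<close> is an upper bound of the polynomial
  \<open>p\<close>. The density is thus controlled by its own potential, which makes a bootstrap
  possible.\<close>

locale critical_density = density +
  fixes P :: real
  assumes total_pos: "total > 0" and self_bound: "\<And>x. f x \<le> exp (3 * (log_potential f x + P))"
begin

text \<open>Maximising \<open>v + ln d\<close>, with \<open>d\<close> the distance to the boundary of a unit ball, controls \<open>f\<close>
  by its value at the maximum \<open>x\<^sub>1\<close> on the ball of radius \<open>d(x\<^sub>1)/2\<close>. The logarithmic singularity then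
  costs only a small multiple of \<open>v(x\<^sub>1) - ln d(x\<^sub>1)\<close>, since the mass near \<open>x\<^sub>1\<close> is small.\<close>
lemma potential_bounded_far: "\<exists>K R. \<forall>x. norm x \<ge> R \<longrightarrow> log_potential f x \<le> K"
proof -
  let ?v = "log_potential f"
  obtain C where C: "C > 0" "\<And>(x::real^3) R. R > 0 \<Longrightarrow> integrable lborel (\<lambda>y. indicator (cball x R) y / (norm (x - y))\<^sup>2) \<and>
     (\<integral>y. indicator (cball x R) y / (norm (x - y))\<^sup>2 \<partial>lborel) \<le> C * R"
    using inverse_square_local_integral by blast
  \<comment> \<open>\<open>tail R \<le> total / 2\<close> gives the term with
    \<open>ln (norm x1)\<close> a favourable sign, and \<open>tail R \<le> 1\<close> limits the cost
    of the singularity to \<open>ln (1 / \<delta>)\<close>.\<close>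
  obtain R where R: "R \<ge> 1" "tail R \<le> min 1 (total / 2)" using tail_small[of "min 1 (total / 2)"] total_pos by auto
  have tail0: "tail R \<ge> 0" unfolding tail_def using nn by (intro integral_nonneg_AE) auto
  define c where "c = ln 2 + \<bar>ln 8 + 3 * P\<bar>"
  have c0: "c \<ge> 0" unfolding c_def by (intro add_nonneg_nonneg) auto
  define K where "K = total * ln (2 * R) + C + c"
  have K0: "K \<ge> 0" unfolding K_def using total_pos R C c0 by (intro add_nonneg_nonneg mult_nonneg_nonneg) auto
  have "?v x0 \<le> K" if x0: "norm x0 \<ge> 2 * R + 2" for x0
  proof -
    \<comment> \<open>The weight vanishes on the boundary of the ball and equals 1 at
      \<open>x0\<close>, so a maximum point of \<open>?d x * exp (?v x)\<close> is interior and
      bounds \<open>?v x0\<close>.\<close>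
    let ?d = "\<lambda>x. 1 - norm (x - x0)"
    have "continuous_on (cball x0 1) (\<lambda>x. ?d x * exp (?v x))"
      by (intro continuous_intros continuous_on_subset[OF log_potential_continuous]) auto
    from continuous_attains_sup[OF compact_cball _ this] obtain x1
      where x1: "x1 \<in> cball x0 1" and mx: "\<And>x. x \<in> cball x0 1 \<Longrightarrow> ?d x * exp (?v x) \<le> ?d x1 * exp (?v x1)"
      by auto
    define d where "d = ?d x1"
    have F0: "exp (?v x0) \<le> d * exp (?v x1)" using mx[of x0] by (simp add: d_def)
    have "0 < d * exp (?v x1)" using F0 exp_gt_zero[of "?v x0"] by linarith
    then have d: "d > 0" "d \<le> 1" by (auto simp: zero_less_mult_iff) (simp add: d_def)
    define q where "q = ?v x1 + ln d"
    have v0: "?v x0 \<le> q"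
    proof -
      have "exp (?v x0) \<le> exp q" using F0 d by (simp add: q_def exp_add mult.commute)
      then show ?thesis by simp
    qed
    have lnd: "ln d \<le> 0" using d by simp
    have "q \<le> K"
    proof (rule ccontr)
      assume "\<not> q \<le> K"
      then have q: "q > K" by simp
      then have v1: "?v x1 > 0" using K0 lnd by (simp add: q_def)
      \<comment> \<open>On the ball of half the distance
        \<open>exp (?v y) \<le> 2 * exp (?v x1)\<close>, and the cube of 2 is the 8 in
        \<open>S\<close>. The choice of \<open>\<delta>\<close> stays inside that ball and makes
        \<open>S * \<delta> \<le> 1\<close>.\<close>
      define S where "S = exp (ln 8 + 3 * P + 3 * ?v x1)"
      define \<delta> where "\<delta> = min (d / 2) (1 / S)"
      have S0: "S > 0" by (simp add: S_def)
      have \<delta>0: "0 < \<delta>" using d S0 by (simp add: \<delta>_def)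
      have "\<delta> \<le> d / 2" "\<delta> \<le> 1 / S" unfolding \<delta>_def by (rule min.cobounded1, rule min.cobounded2)
      with \<delta>0 have \<delta>: "0 < \<delta>" "\<delta> \<le> 1" "S * \<delta> \<le> 1"
        using d S0 by (simp_all add: pos_le_divide_eq mult.commute)
      have fS: "f y \<le> S" if y: "y \<in> cball x1 \<delta>" for y
      proof -
        have n: "norm (y - x1) \<le> d / 2" using y by (simp add: \<delta>_def dist_norm norm_minus_commute)
        have "norm (y - x0) \<le> norm (y - x1) + norm (x1 - x0)" using norm_triangle_ineq[of "y - x1" "x1 - x0"] by simp
        then have dy: "?d y \<ge> d / 2" using n by (simp add: d_def)
        then have "y \<in> cball x0 1" using d by (simp add: dist_norm norm_minus_commute)
        from mx[OF this] have "?d y * exp (?v y) \<le> d * exp (?v x1)" by (simp add: d_def)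
        moreover have "d / 2 * exp (?v y) \<le> ?d y * exp (?v y)" using dy by (rule mult_right_mono) simp
        ultimately have "d / 2 * exp (?v y) \<le> d * exp (?v x1)" by linarith
        then have "exp (?v y) \<le> 2 * exp (?v x1)" using d by (simp add: field_simps)
        also have "2 * exp (?v x1) = exp (ln 2 + ?v x1)" by (simp add: exp_add)
        finally have "?v y \<le> ln 2 + ?v x1" by simp
        moreover have "ln 8 = 3 * ln (2::real)" using ln_realpow[of 2 3] by simp
        ultimately have "3 * (?v y + P) \<le> ln 8 + 3 * P + 3 * ?v x1" by simp
        then show ?thesis using self_bound[of y] by (simp add: S_def order_trans)
      qed
      have nx1: "norm x1 \<ge> 2 * R + 1" using x0 x1 norm_triangle_sub[of x0 x1] by (simp add: dist_norm)
      have "local_log x1 \<le> S * (C * \<delta>) + ln (1 / \<delta>) * tail R"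
        by (rule local_log_bound[OF C(2) \<delta>(1,2) _ fS]) (use S0 nx1 R in auto)
      also have "S * (C * \<delta>) \<le> C" using \<delta>(3) C(1) mult_left_mono[of "S * \<delta>" 1 C] by (simp add: mult_ac)
      also have "ln (1 / \<delta>) * tail R \<le> ln (1 / \<delta>) * 1" using R \<delta> by (intro mult_left_mono) (auto simp: ln_div)
      also have "ln (1 / \<delta>) \<le> c - ln d + 3 * ?v x1"
      proof (cases "d / 2 \<le> 1 / S")
        case True
        then have "ln (1 / \<delta>) = ln 2 - ln d" using d by (simp add: \<delta>_def ln_div)
        then show ?thesis using v1 by (simp add: c_def)
      next
        case False
        then have "ln (1 / \<delta>) = ln S" using S0 by (simp add: \<delta>_def)
        moreover have "ln (2::real) \<ge> 0" by simp
        ultimately show ?thesis using lnd unfolding c_def S_def ln_exp by linarith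
      qed
      finally have L: "local_log x1 \<le> C + (c - ln d + 3 * ?v x1)" by simp
      have lx: "ln (norm x1) \<ge> 0" using nx1 R by simp
      have "(total - 2 * tail R) * ln (norm x1) \<ge> 0" using R lx by (intro mult_nonneg_nonneg) auto
      then have "pi\<^sup>2 * ?v x1 \<le> total * ln (2 * R) + local_log x1"
        using potential_far_bound[OF R(1), of x1] nx1 by (simp add: algebra_simps)
      then have A: "pi\<^sup>2 * ?v x1 \<le> K - ln d + 3 * ?v x1" using L by (simp add: K_def)
      \<comment> \<open>At \<open>x1\<close> this yields
        \<open>9 * v \<le> K - ln d + 3 * v\<close>, so \<open>6 * v \<le> K - ln d\<close>, while
        \<open>q > K\<close> means \<open>v > K - ln d \<ge> 0\<close>.\<close>
      have "3\<^sup>2 \<le> pi\<^sup>2" using pi_gt3 by (intro power_mono) auto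
      then have "9 * ?v x1 \<le> pi\<^sup>2 * ?v x1" using v1 by (intro mult_right_mono) auto
      then show False using A q v1 lnd K0 unfolding q_def by linarith
    qed
    then show ?thesis using v0 by linarith
  qed
  then show ?thesis by blast
qed

lemma density_bounded: "\<exists>S\<ge>0. \<forall>x. f x \<le> S"
proof -
  obtain K R where K: "\<And>x. norm x \<ge> R \<Longrightarrow> log_potential f x \<le> K" using potential_bounded_far by blast
  have "bdd_above (f ` cball 0 R)"
    by (intro bounded_imp_bdd_above compact_imp_bounded compact_continuous_image continuous_on_subset[OF cf]) auto
  then obtain B where B: "\<And>x. norm x \<le> R \<Longrightarrow> f x \<le> B" unfolding bdd_above_def by (metis imageI mem_cball_0)
  have "f x \<le> max (max 0 B) (exp (3 * (K + P)))" for x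
  proof (cases "norm x \<le> R")
    case True
    then show ?thesis using B[of x] by simp
  next
    case False
    then have "log_potential f x \<le> K" by (intro K) simp
    then have "exp (3 * (log_potential f x + P)) \<le> exp (3 * (K + P))" by simp
    then show ?thesis using self_bound[of x] by linarith
  qed
  then show ?thesis by (intro exI[of _ "max (max 0 B) (exp (3 * (K + P)))"]) auto
qed

text \<open>Once \<open>f\<close> is bounded, \<open>local_log_bound\<close> may be used with
  \<open>\<delta> = 1\<close>, where \<open>ln (1 / \<delta>)\<close> vanishes. Only the tail then
  disturbs the coefficient \<open>total\<close>, by at most \<open>\<epsilon>\<close>.\<close>

lemma potential_upper:
  assumes \<epsilon>: "\<epsilon> > 0"
  shows "\<exists>K R. \<forall>x. norm x \<ge> R \<longrightarrow> pi\<^sup>2 * log_potential f x \<le> K - (total - \<epsilon>) * ln (norm x)"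
proof -
  obtain C where C: "C > 0" "\<And>(x::real^3) R. R > 0 \<Longrightarrow> integrable lborel (\<lambda>y. indicator (cball x R) y / (norm (x - y))\<^sup>2) \<and>
     (\<integral>y. indicator (cball x R) y / (norm (x - y))\<^sup>2 \<partial>lborel) \<le> C * R"
    using inverse_square_local_integral by blast
  obtain S where S: "S \<ge> 0" "\<And>x. f x \<le> S" using density_bounded by blast
  obtain R where R: "R \<ge> 1" "tail R \<le> \<epsilon> / 2" using tail_small[of "\<epsilon> / 2"] \<epsilon> by auto
  show ?thesis
  proof (intro exI allI impI)
    fix x :: "real^3" assume x: "norm x \<ge> 2 * R"
    have "local_log x \<le> S * (C * 1) + ln (1 / 1) * tail R"
      by (rule local_log_bound[OF C(2)]) (use S x R in auto)
    moreover have "2 * tail R * ln (norm x) \<le> \<epsilon> * ln (norm x)" using R x by (intro mult_right_mono) auto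
    ultimately show "pi\<^sup>2 * log_potential f x \<le> (total * ln (2 * R) + S * C) - (total - \<epsilon>) * ln (norm x)"
      using potential_far_bound[OF R(1) x] by (simp add: algebra_simps)
  qed
qed

text \<open>Half of the coefficient suffices: \<open>potential_upper\<close> with
  \<open>\<epsilon> = total / 2\<close> bounds \<open>f\<close>, through \<open>self_bound\<close>,
  by a multiple of a negative power of \<open>norm x\<close>.\<close>

lemma density_limit: "(f \<longlongrightarrow> 0) at_infinity"
proof -
  obtain K R where K: "\<And>x. norm x \<ge> R \<Longrightarrow> pi\<^sup>2 * log_potential f x \<le> K - (total - total / 2) * ln (norm x)"
    using potential_upper[of "total / 2"] total_pos by auto
  define a where "a = total / 2 / pi\<^sup>2"
  have a: "a > 0" using total_pos by (simp add: a_def)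
  have b: "f x \<le> exp (3 * (K / pi\<^sup>2 + P)) * exp (- (3 * a) * ln (norm x))" if x: "norm x \<ge> R" for x
  proof -
    have "log_potential f x \<le> (K - (total - total / 2) * ln (norm x)) / pi\<^sup>2"
      using K[OF x] by (simp add: pos_le_divide_eq mult.commute)
    also have "\<dots> = K / pi\<^sup>2 - a * ln (norm x)" by (simp add: a_def diff_divide_distrib)
    finally have "exp (3 * (log_potential f x + P)) \<le> exp (3 * (K / pi\<^sup>2 + P) + - (3 * a) * ln (norm x))" by simp
    then show ?thesis using self_bound[of x] unfolding exp_add by linarith
  qed
  have l: "filterlim (\<lambda>x::real^3. ln (norm x)) at_top at_infinity"
    by (rule filterlim_compose[OF ln_at_top filterlim_norm_at_top])
  have "filterlim (\<lambda>x::real^3. - (3 * a) * ln (norm x)) at_bot at_infinity"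
    by (rule filterlim_tendsto_neg_mult_at_bot[OF tendsto_const _ l]) (use a in simp)
  then have "((\<lambda>x::real^3. exp (- (3 * a) * ln (norm x))) \<longlongrightarrow> 0) at_infinity"
    by (rule filterlim_compose[OF exp_at_bot])
  from tendsto_mult_right_zero[OF this]
  have "((\<lambda>x::real^3. exp (3 * (K / pi\<^sup>2 + P)) * exp (- (3 * a) * ln (norm x))) \<longlongrightarrow> 0) at_infinity" .
  then show ?thesis
  proof (rule real_tendsto_sandwich[OF _ _ tendsto_const, rotated 2])
    show "\<forall>\<^sub>F x in at_infinity. f x \<le> exp (3 * (K / pi\<^sup>2 + P)) * exp (- (3 * a) * ln (norm x))"
      unfolding eventually_at_infinity using b by blast
    show "\<forall>\<^sub>F x in at_infinity. 0 \<le> f x" using nn by simp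
  qed
qed

lemma grad_potential_limit: "(grad_potential i \<longlongrightarrow> 0) at_infinity"
  unfolding grad_potential_def[abs_def]
proof (rule kernel_potential_limit[OF _ _ ker_integrable(3) density_limit])
  fix z :: "real^3" assume z: "z \<noteq> 0"
  have "\<bar>ker1 i z\<bar> \<le> 1 / norm z" by (rule ker_bounds(1)[OF z])
  also have "\<dots> \<le> 3 / norm z" by (intro divide_right_mono) auto
  finally show "\<bar>ker1 i z\<bar> \<le> 3 / norm z \<or> \<bar>ker1 i z\<bar> \<le> 3 / (norm z)\<^sup>2" ..
qed (simp add: ker1_def[abs_def])

lemma hess_potential_limit: "(hess_potential i j \<longlongrightarrow> 0) at_infinity"
  unfolding hess_potential_def[abs_def]
  by (rule kernel_potential_limit[OF _ disjI2[OF ker_bounds(2)] ker_integrable(4) density_limit]) (simp add: ker2_def[abs_def])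

text \<open>The lower estimate has the exact coefficient \<open>total\<close>, the upper one misses
  it by half of the allowed error. Additive constants are absorbed by the other half because
  \<open>ln (norm x)\<close> tends to infinity.\<close>

lemma potential_asymptotics:
  "(\<lambda>x. log_potential f x - (- (1 / pi\<^sup>2 * total) * ln (norm x))) \<in> o[at_infinity](\<lambda>x. ln (norm x))"
proof (rule landau_o.smallI)
  fix c :: real assume c: "c > 0"
  have p: "pi\<^sup>2 > 0" by simp
  obtain K R where K: "\<And>x. norm x \<ge> R \<Longrightarrow> pi\<^sup>2 * log_potential f x \<le> K - (total - c * pi\<^sup>2 / 2) * ln (norm x)"
    using potential_upper[of "c * pi\<^sup>2 / 2"] c by auto
  define C0 where "C0 = (\<integral>y. f y / (norm (0 - y))\<^sup>2 \<partial>lborel)"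
  obtain B where B0: "K \<le> B" "total * ln 2 + C0 \<le> B" by (rule that[of "max K (total * ln 2 + C0)"]) auto
  have l: "filterlim (\<lambda>x::real^3. ln (norm x)) at_top at_infinity"
    by (rule filterlim_compose[OF ln_at_top filterlim_norm_at_top])
  have "\<forall>\<^sub>F x::real^3 in at_infinity. ln (norm x) \<ge> 2 * B / (c * pi\<^sup>2)"
    using l unfolding filterlim_at_top by blast
  moreover have "\<forall>\<^sub>F x::real^3 in at_infinity. norm x \<ge> R" "\<forall>\<^sub>F x::real^3 in at_infinity. norm x \<ge> 1"
    unfolding eventually_at_infinity by blast+
  ultimately show "\<forall>\<^sub>F x in at_infinity. norm (log_potential f x - (- (1 / pi\<^sup>2 * total) * ln (norm x))) \<le> c * norm (ln (norm x))"
  proof eventually_elim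
    case (elim x)
    have lx: "ln (norm x) \<ge> 0" using elim by simp
    have B: "B \<le> c * pi\<^sup>2 / 2 * ln (norm x)" using elim(1) c by (simp add: field_simps)
    have e: "pi\<^sup>2 * (log_potential f x - (- (1 / pi\<^sup>2 * total) * ln (norm x))) = pi\<^sup>2 * log_potential f x + total * ln (norm x)"
      by (simp add: algebra_simps)
    have 1: "pi\<^sup>2 * log_potential f x + total * ln (norm x) \<le> c * pi\<^sup>2 * ln (norm x)"
      using K[OF elim(2)] B B0(1) by (simp add: algebra_simps)
    have "pi\<^sup>2 * (- (1 / pi\<^sup>2) * (total * ln (1 + norm x) + C0)) \<le> pi\<^sup>2 * log_potential f x"
      using log_potential_lower[of x] by (intro mult_left_mono) (simp_all add: total_def C0_def)
    then have lo: "- (total * ln (1 + norm x) + C0) \<le> pi\<^sup>2 * log_potential f x" by simp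
    have "ln (1 + norm x) \<le> ln (2 * norm x)" using elim by (intro ln_mono) auto
    also have "\<dots> = ln 2 + ln (norm x)" using elim by (intro ln_mult_pos) auto
    finally have "total * ln (1 + norm x) \<le> total * (ln 2 + ln (norm x))" using total_nonneg by (rule mult_left_mono)
    moreover have "c * pi\<^sup>2 * ln (norm x) \<ge> 0" using c lx by simp
    ultimately have 2: "- (c * pi\<^sup>2 * ln (norm x)) \<le> pi\<^sup>2 * log_potential f x + total * ln (norm x)"
      using lo B B0(2) by (simp add: algebra_simps)
    have "pi\<^sup>2 * \<bar>log_potential f x - (- (1 / pi\<^sup>2 * total) * ln (norm x))\<bar> = \<bar>pi\<^sup>2 * log_potential f x + total * ln (norm x)\<bar>"
      unfolding e[symmetric] abs_mult by simp
    also have "\<dots> \<le> pi\<^sup>2 * (c * ln (norm x))" using 1 2 by (simp add: abs_le_iff algebra_simps)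
    finally show ?case using lx p by (simp add: mult_le_cancel_left)
  qed
qed

end

theorem theorem3:
  fixes u v :: "real^3 \<Rightarrow> real" and \<alpha> :: real
  assumes "smooth u"
    and "solution (distribution_of (\<lambda>x. 2 * exp (3 * u x))) u"
    and "integrable lborel (\<lambda>x. exp (3 * u x))"
    and "\<alpha> = 1 / pi\<^sup>2 * (LINT x|lborel. exp (3 * u x))"
    and "v = (\<lambda>x. 1 / pi\<^sup>2 * (LINT y|lborel. ln (norm y / norm (x - y)) * exp (3 * u y)))"
  shows "\<alpha> > 0 \<and>
    (\<exists>p. (poly_of_degree 0 p \<or> poly_of_degree 2 p) \<and> bdd_above (range p) \<and>
         (\<forall>x. u x = v x + p x)) \<and>
    (\<forall>l\<in>{1, 2}. \<forall>is. length is = l \<longrightarrow> (iter_partial is v \<longlongrightarrow> 0) at_infinity) \<and>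
    (\<lambda>x. v x - (- \<alpha> * ln (norm x))) \<in> o[at_infinity](\<lambda>x. ln (norm x))"
proof -
  let ?f = "\<lambda>x. exp (3 * u x)"
  define p where "p = (\<lambda>x. u x - log_potential ?f x)"
  have v: "v = log_potential ?f" unfolding assms(5) by (simp add: fun_eq_iff log_potential_def)
  have p: "bdd_above (range p)" "poly_of_degree 0 p \<or> poly_of_degree 2 p"
    unfolding p_def by (rule solution_minus_potential[OF assms(1-3)])+
  then obtain P where P: "\<And>x. p x \<le> P" unfolding bdd_above_def by auto
  have pos: "0 < (\<integral>x. ?f x \<partial>lborel)"
  proof -
    \<comment> \<open>The integrand is positive everywhere, so a zero integral would make the whole
      space a null set.\<close>
    have "ae_filter (lborel :: (real^3) measure) \<noteq> bot" by (simp add: Measure_Space.ae_filter_eq_bot_iff)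
    then have "(\<integral>x. ?f x \<partial>lborel) \<noteq> 0"
      using assms(3) by (subst integral_nonneg_eq_0_iff_AE) (auto simp: trivial_limit_def)
    moreover have "0 \<le> (\<integral>x. ?f x \<partial>lborel)" by (intro integral_nonneg_AE) auto
    ultimately show ?thesis by linarith
  qed
  note cu = smooth_continuous[OF assms(1), of UNIV]
  interpret density ?f
    by unfold_locales (use assms(3) in \<open>auto intro!: continuous_intros cu\<close>)
  interpret critical_density ?f P
  proof
    show "total > 0" unfolding total_def by (rule pos)
    show "exp (3 * u x) \<le> exp (3 * (log_potential ?f x + P))" for x using P[of x] by (simp add: p_def)
  qed
  have "(iter_partial is v \<longlongrightarrow> 0) at_infinity" if l: "l \<in> {1, 2}" "length is = l" for l "is"
  proof -
    consider i where "is = [i]" | i j where "is = [i, j]"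
      using l by (auto simp: length_Suc_conv numeral_2_eq_2)
    then show ?thesis
    proof cases
      case 1
      have "((\<lambda>x. - (1 / pi\<^sup>2) * grad_potential i x) \<longlongrightarrow> 0) at_infinity"
        by (rule tendsto_mult_right_zero[OF grad_potential_limit])
      then show ?thesis unfolding 1 v by (simp only: iter_partial_def foldr.simps o_apply id_apply partial_log_potential)
    next
      case 2
      \<comment> \<open>In \<open>iter_partial [i, j]\<close> the derivative in direction
        \<open>j\<close> is taken first, hence the order of the indices.\<close>
      have "((\<lambda>x. - (1 / pi\<^sup>2) * hess_potential j i x) \<longlongrightarrow> 0) at_infinity"
        by (rule tendsto_mult_right_zero[OF hess_potential_limit])
      then show ?thesis unfolding 2 v by (simp only: iter_partial_def foldr.simps o_apply id_apply partial2_log_potential)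
    qed
  qed
  moreover have "(\<lambda>x. v x - (- \<alpha> * ln (norm x))) \<in> o[at_infinity](\<lambda>x. ln (norm x))"
    using potential_asymptotics unfolding v assms(4) total_def .
  moreover have "\<alpha> > 0" unfolding assms(4) using pos by simp
  moreover have "\<exists>p. (poly_of_degree 0 p \<or> poly_of_degree 2 p) \<and> bdd_above (range p) \<and> (\<forall>x. u x = v x + p x)"
    using p by (intro exI[of _ p]) (simp add: p_def v)
  ultimately show ?thesis by blast
qed

end
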